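(* Let $s\in(0,1)$, let $\Omega\subset\mathbb{R}^n$ be a bounded domain, and let $\alpha\in(0,1)$ be arbitrary. Suppose $u\in\mathcal{X}^{1,2}(\Omega)$ is a bounded weak solution of $$-\Delta u+(-\Delta)^su+a(x)u=f(x,u)\quad\text{in }\Omega,$$ where $a\in L^\infty(\Omega)\cap C^\alpha_{loc}(\Omega)$ and $f\in C^\alpha_{loc}(\Omega\times\mathbb{R})$. Assume $V$ is an open domain with $V\subset\subset\Omega$. Then $u\in C^{2,\alpha}(\bar V)$.
   Context: $\mathcal{X}^{1,2}(\Omega)$ is the completion of $C_0^\infty(\Omega)$ with respect to the norm $\|u\|_{\mathcal{X}^{1,2}(\Omega)}=\big(\|\nabla u\|_{L^2(\mathbb{R}^n)}^2+[u]_s^2\big)^{1/2}$, where $[u]_s^2=\int_{\mathbb{R}^n}\int_{\mathbb{R}^n}\frac{(u(x)-u(y))^2}{|x-y|^{n+2s}}dx\,dy$. Its elements are functions on $\mathbb{R}^n$ vanishing a.e. outside $\Omega$. Put $$B_s(u,v)=\int_{\mathbb{R}^n}\nabla u\cdot\nabla v\,dx+\int_{\mathbb{R}^n}\int_{\mathbb{R}^n}\frac{(u(x)-u(y))(v(x)-v(y))}{|x-y|^{n+2s}}dx\,dy.$$ A weak solution of the equation is $u\in\mathcal{X}^{1,2}(\Omega)$ with $B_s(u,\phi)+\int_\Omega a u\phi\,dx=\int_\Omega f(x,u)\phi\,dx$ for all $\phi\in\mathcal{X}^{1,2}(\Omega)$ (the fractional Laplacian is normalized so that this is the weak form). "Bounded"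 means $u\in L^\infty(\Omega)$. *)

theory Defs
  imports "HOL-Analysis.Analysis"
begin

section \<open>Classical function spaces\<close>

definition grad :: "('a::euclidean_space \<Rightarrow> real) \<Rightarrow> 'a \<Rightarrow> 'a" where
  "grad g x = (THE D. GDERIV g x :> D)"

text \<open>
  \<open>C_diff k U g\<close>: all partial derivatives of \<open>g\<close> up to order \<open>k\<close> exist and are continuous
  on the open set \<open>U\<close>. In the successor case \<open>G\<close> is the gradient of \<open>g\<close>, and
  \<open>G x \<bullet> b\<close> is its partial derivative in direction \<open>b\<close>.
\<close>
primrec C_diff :: "nat \<Rightarrow> 'a::euclidean_space set \<Rightarrow> ('a \<Rightarrow> real) \<Rightarrow> bool" where
  "C_diff 0 U g \<longleftrightarrow> continuous_on U g"
| "C_diff (Suc k) U g \<longleftrightarrow>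
     continuous_on U g \<and>
     (\<exists>G. (\<forall>x\<in>U. GDERIV g x :> G x) \<and> (\<forall>b\<in>Basis. C_diff k U (\<lambda>x. G x \<bullet> b)))"

definition test_functions :: "'a::euclidean_space set \<Rightarrow> ('a \<Rightarrow> real) set" where
  "test_functions \<Omega> =
     {\<phi>. (\<forall>k. C_diff k UNIV \<phi>) \<and>
         compact (closure {x. \<phi> x \<noteq> 0}) \<and> closure {x. \<phi> x \<noteq> 0} \<subseteq> \<Omega>}"

definition holder_on :: "real \<Rightarrow> 'a::metric_space set \<Rightarrow> ('a \<Rightarrow> real) \<Rightarrow> bool" where
  "holder_on \<alpha> S g \<longleftrightarrow> (\<exists>C. \<forall>x\<in>S. \<forall>y\<in>S. \<bar>g x - g y\<bar> \<le> C * dist x y powr \<alpha>)"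

definition holder_loc :: "real \<Rightarrow> 'a::metric_space set \<Rightarrow> ('a \<Rightarrow> real) \<Rightarrow> bool" where
  "holder_loc \<alpha> S g \<longleftrightarrow> (\<forall>K. compact K \<and> K \<subseteq> S \<longrightarrow> holder_on \<alpha> K g)"

text \<open>
  \<open>holder_closure k \<alpha> V g\<close> is membership in \<open>C\<^sup>k\<^sup>,\<^sup>\<alpha>\<close> of the closure of a bounded open
  set \<open>V\<close>: \<open>g\<close> is continuous on the closure, it is \<open>k\<close> times differentiable in \<open>V\<close>, all
  derivatives of order at most \<open>k\<close> extend continuously to the closure, and those of order
  \<open>k\<close> are Hoelder continuous with exponent \<open>\<alpha>\<close>. In the successor case \<open>G\<close> is the
  continuous extension of the gradient of \<open>g\<close> to the closure; its values outside the
  closure play no role.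
\<close>
primrec holder_closure ::
    "nat \<Rightarrow> real \<Rightarrow> 'a::euclidean_space set \<Rightarrow> ('a \<Rightarrow> real) \<Rightarrow> bool" where
  "holder_closure 0 \<alpha> V g \<longleftrightarrow>
     continuous_on (closure V) g \<and> holder_on \<alpha> (closure V) g"
| "holder_closure (Suc k) \<alpha> V g \<longleftrightarrow>
     continuous_on (closure V) g \<and>
     (\<exists>G. (\<forall>x\<in>V. GDERIV g x :> G x) \<and>
          (\<forall>b\<in>Basis. holder_closure k \<alpha> V (\<lambda>x. G x \<bullet> b)))"

definition Linfty_on :: "'a::euclidean_space set \<Rightarrow> ('a \<Rightarrow> real) \<Rightarrow> bool" where
  "Linfty_on S g \<longleftrightarrow>
     set_borel_measurable lebesgue S g \<and> (\<exists>M. AE x in lebesgue. x \<in> S \<longrightarrow> \<bar>g x\<bar> \<le> M)"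

section \<open>Weak gradients\<close>

definition locally_integrable :: "('a::euclidean_space \<Rightarrow> 'b::euclidean_space) \<Rightarrow> bool" where
  "locally_integrable g \<longleftrightarrow> (\<forall>K. compact K \<longrightarrow> set_integrable lebesgue K g)"

definition has_weak_grad :: "('a::euclidean_space \<Rightarrow> real) \<Rightarrow> ('a \<Rightarrow> 'a) \<Rightarrow> bool" where
  "has_weak_grad u G \<longleftrightarrow>
     locally_integrable u \<and> locally_integrable G \<and>
     (\<forall>\<phi>\<in>test_functions UNIV.
        (LINT x|lebesgue. u x *\<^sub>R grad \<phi> x) = - (LINT x|lebesgue. \<phi> x *\<^sub>R G x))"

text \<open>Unique almost everywhere whenever a weak gradient exists.\<close>
definition weak_grad :: "('a::euclidean_space \<Rightarrow> real) \<Rightarrow> 'a \<Rightarrow> 'a" where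
  "weak_grad u = (SOME G. has_weak_grad u G)"

section \<open>The energy space and weak solutions\<close>

text \<open>
  On the diagonal the integrand is \<open>0 / 0 = 0\<close>; the diagonal is a null set.
\<close>
definition gagliardo_form ::
    "real \<Rightarrow> ('a::euclidean_space \<Rightarrow> real) \<Rightarrow> ('a \<Rightarrow> real) \<Rightarrow> real" where
  "gagliardo_form s u v =
     (LINT (x, y)|(lebesgue \<Otimes>\<^sub>M lebesgue).
        (u x - u y) * (v x - v y) / norm (x - y) powr (real DIM('a) + 2 * s))"

definition X_norm :: "real \<Rightarrow> ('a::euclidean_space \<Rightarrow> real) \<Rightarrow> real" where
  "X_norm s \<phi> = sqrt ((LINT x|lebesgue. (norm (grad \<phi> x))\<^sup>2) + gagliardo_form s \<phi> \<phi>)"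

text \<open>
  The completion of the test functions on \<open>\<Omega>\<close> with respect to \<open>X_norm s\<close>, realized as a
  space of functions on the whole space: for bounded \<open>\<Omega>\<close> a Cauchy sequence converges in
  \<open>L\<^sup>2\<close> by the Poincare inequality, and its class is identified with its \<open>L\<^sup>2\<close> limit.
  Such a limit vanishes almost everywhere outside \<open>\<Omega>\<close>. Functions are not quotiented by
  almost-everywhere equality; the space is closed under it.
\<close>
definition X_space :: "real \<Rightarrow> 'a::euclidean_space set \<Rightarrow> ('a \<Rightarrow> real) set" where
  "X_space s \<Omega> =
     {u. u \<in> borel_measurable lebesgue \<and>
         (\<exists>\<phi> :: nat \<Rightarrow> 'a \<Rightarrow> real.
            (\<forall>k. \<phi> k \<in> test_functions \<Omega>) \<and>
            (\<forall>e>0. \<exists>N. \<forall>j\<ge>N. \<forall>k\<ge>N. X_norm s (\<lambda>x. \<phi> j x - \<phi> k x) < e) \<and>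
            (\<lambda>k. \<integral>\<^sup>+x. ennreal ((\<phi> k x - u x)\<^sup>2) \<partial>lebesgue) \<longlonglongrightarrow> 0)}"

definition energy_form ::
    "real \<Rightarrow> ('a::euclidean_space \<Rightarrow> real) \<Rightarrow> ('a \<Rightarrow> real) \<Rightarrow> real" where
  "energy_form s u v =
     (LINT x|lebesgue. weak_grad u x \<bullet> weak_grad v x) + gagliardo_form s u v"

text \<open>
  The growth of \<open>f\<close> in its second argument is not restricted, so the integral on the
  right-hand side need not exist for a general \<open>u\<close>; its existence is part of the notion of
  weak solution. The other integrals exist for \<open>u\<close> and \<open>\<phi>\<close> in the energy space and
  bounded \<open>a\<close>.
\<close>
definition weak_solution ::
    "real \<Rightarrow> 'a::euclidean_space set \<Rightarrow> ('a \<Rightarrow> real) \<Rightarrow> ('a \<Rightarrow> real \<Rightarrow> real) \<Rightarrow>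
      ('a \<Rightarrow> real) \<Rightarrow> bool" where
  "weak_solution s \<Omega> a f u \<longleftrightarrow>
     u \<in> X_space s \<Omega> \<and>
     (\<forall>\<phi>\<in>X_space s \<Omega>.
        set_integrable lebesgue \<Omega> (\<lambda>x. f x (u x) * \<phi> x) \<and>
        energy_form s u \<phi> + (LINT x:\<Omega>|lebesgue. a x * u x * \<phi> x) =
          (LINT x:\<Omega>|lebesgue. f x (u x) * \<phi> x))"

end

theory Submission
  imports Defs
begin

text \<open>
  Let \<open>\<rho>\<close> be a radial mollifier and \<open>A \<rho> t v\<close> the average of \<open>v\<close> over the scale \<open>t\<close>. As
  \<open>x \<rho>(x) = - \<nabla>\<Psi>(x)\<close> for a bump \<open>\<Psi>\<close>, one has \<open>d/dt (A \<rho> t v) = t A \<Psi> t (\<Delta>v)\<close>, so \<open>v\<close> and its derivatives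
  are recovered from \<open>\<Delta>v\<close> by integrating over scales at most \<open>t\<close>; this yields Schauder estimates
  without a fundamental solution. Since \<open>|z| powr -(n+2s)\<close> is a superposition of rescaled
  \<open>\<rho>\<close>, the fractional Laplacian is a constant multiple of the integral of \<open>t powr (-1-2s) (v - A \<rho> t v)\<close>, whose
  part over \<open>t \<le> d\<close> is at most \<open>d powr (2-2s)\<close> times the supremum of \<open>|\<Delta>v|\<close> on a ball of radius \<open>d\<close>. It can
  therefore be absorbed: for the mollified solutions, first \<open>\<Delta>v\<close> is locally bounded, hence \<open>v\<close> is
  locally Lipschitz and the right-hand side \<open>f(x,u) - a u\<close> is Hoelder continuous; then the same argument for
  differences bounds the Hoelder seminorm of \<open>\<Delta>v\<close> and finally that of the second derivatives. All bounds are
  uniform in the mollification parameter.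
\<close>

section \<open>Smooth functions\<close>

text \<open>Absorbing a multiple of a supremum requires that supremum to be finite beforehand, which
  is not known for \<open>u\<close>. Hence every estimate is run on \<open>A \<rho> d u0\<close>,
  which is smooth with all derivatives bounded; these qualitative bounds make the suprema finite and
  never enter the constants. Testing the weak equation with the translates of one rescaled
  \<open>\<rho>\<close> gives a pointwise equation for these averages.

  The nonlocal term sees the whole space, while regularity is gained only near
  \<open>closure V\<close>. At scales above \<open>d\<close> it is estimated by the global bound of
  \<open>u0\<close> alone; for a difference \<open>v (x + h) - v x\<close> the shift is moved onto
  the smooth kernel, so that a factor \<open>norm h\<close> appears although nothing is known about
  \<open>v\<close> far away. This costs a power of \<open>d\<close>, which the cubic weight in the
  absorption pays for.

  A Bochner integral of a non-integrable function is 0, so the value of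
  \<open>gagliardo_form\<close> carries no information until finiteness is proved; hence the
  extended seminorm \<open>gn\<close>, and hence the integrability clause in
  \<open>eqn_at\<close>.\<close>

definition pd :: "'a::euclidean_space \<Rightarrow> ('a \<Rightarrow> real) \<Rightarrow> 'a \<Rightarrow> real" where
  "pd b v x = grad v x \<bullet> b"

section \<open>Gradients and the closure properties of \<open>C_diff\<close>\<close>

lemma grad_eqI: "GDERIV g x :> D \<Longrightarrow> grad g x = D"
proof -
  assume D: "GDERIV g x :> D"
  have "E = D" if "GDERIV g x :> E" for E
  proof -
    have "(\<lambda>h. h \<bullet> E) = (\<lambda>h. h \<bullet> D)"
      using D that has_derivative_unique unfolding gderiv_def by blast
    then have "(E - D) \<bullet> E = (E - D) \<bullet> D" by meson
    then have "(E - D) \<bullet> (E - D) = 0" by (simp add: inner_diff_right)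
    then show ?thesis by simp
  qed
  then show ?thesis unfolding grad_def using D by (metis the_equality)
qed

lemma GDERIV_continuous: "GDERIV g x :> D \<Longrightarrow> isCont g x"
  unfolding gderiv_def using has_derivative_continuous by blast

lemma C_diff_Suc_grad:
  "C_diff (Suc k) U g \<Longrightarrow> x \<in> U \<Longrightarrow> GDERIV g x :> grad g x"
  using grad_eqI by fastforce

lemma C_diff_Suc_pd:
  assumes "C_diff (Suc k) UNIV g" "b \<in> Basis"
  shows "C_diff k UNIV (pd b g)"
proof -
  obtain G where G: "\<And>x. GDERIV g x :> G x" "\<forall>b\<in>Basis. C_diff k UNIV (\<lambda>x. G x \<bullet> b)"
    using assms by auto
  have "pd b g = (\<lambda>x. G x \<bullet> b)" using grad_eqI[OF G(1)] by (auto simp: pd_def)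
  then show ?thesis using G assms by simp
qed

lemma C_diff_Suc_D: "C_diff (Suc k) U g \<Longrightarrow> C_diff k U g"
proof (induction k arbitrary: g)
  case (Suc k)
  then obtain G where "\<forall>x\<in>U. GDERIV g x :> G x" "\<forall>b\<in>Basis. C_diff (Suc k) U (\<lambda>x. G x \<bullet> b)"
    and "continuous_on U g" by auto
  then show ?case using Suc.IH by (auto simp del: C_diff.simps(2) simp add: C_diff.simps(2)[of k U g])
qed simp

lemma C_diff_continuous: "C_diff k U g \<Longrightarrow> continuous_on U g"
  by (cases k) auto

lemma C_diff_const: "C_diff k U (\<lambda>x. c)"
proof (induction k arbitrary: c)
  case (Suc k)
  have "\<forall>x\<in>U. GDERIV (\<lambda>x. c) x :> 0" by (simp add: GDERIV_const)
  with Suc show ?case by (auto intro!: exI[of _ "\<lambda>x. 0"])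
qed simp

lemma C_diff_inner: "C_diff k U (\<lambda>x. x \<bullet> c)"
proof (cases k)
  case 0
  then show ?thesis by (auto intro!: continuous_intros)
next
  case (Suc m)
  have "\<forall>x\<in>U. GDERIV (\<lambda>x. x \<bullet> c) x :> c"
    unfolding gderiv_def by (auto intro!: derivative_eq_intros)
  then show ?thesis unfolding Suc using C_diff_const
    by (auto intro!: continuous_intros exI[of _ "\<lambda>x. c"])
qed

lemma C_diff_add: "C_diff k U f \<Longrightarrow> C_diff k U g \<Longrightarrow> C_diff k U (\<lambda>x. f x + g x)"
proof (induction k arbitrary: f g)
  case 0
  then show ?case by (auto intro!: continuous_intros)
next
  case (Suc k)
  obtain F G where "\<forall>x\<in>U. GDERIV f x :> F x" "\<forall>b\<in>Basis. C_diff k U (\<lambda>x. F x \<bullet> b)"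
    and "\<forall>x\<in>U. GDERIV g x :> G x" "\<forall>b\<in>Basis. C_diff k U (\<lambda>x. G x \<bullet> b)"
    using Suc.prems by auto
  with Suc show ?case
    by (auto intro!: continuous_intros exI[of _ "\<lambda>x. F x + G x"] GDERIV_add simp: inner_add_left)
qed

lemma C_diff_mult: "C_diff k U f \<Longrightarrow> C_diff k U g \<Longrightarrow> C_diff k U (\<lambda>x. f x * g x)"
proof (induction k arbitrary: f g)
  case 0
  then show ?case by (auto intro!: continuous_intros)
next
  case (Suc k)
  obtain F G where FG: "\<forall>x\<in>U. GDERIV f x :> F x" "\<forall>b\<in>Basis. C_diff k U (\<lambda>x. F x \<bullet> b)"
    "\<forall>x\<in>U. GDERIV g x :> G x" "\<forall>b\<in>Basis. C_diff k U (\<lambda>x. G x \<bullet> b)"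
    using Suc.prems by auto
  have "C_diff k U f" "C_diff k U g" using Suc.prems C_diff_Suc_D by blast+
  then have "\<forall>b\<in>Basis. C_diff k U (\<lambda>x. (f x *\<^sub>R G x + g x *\<^sub>R F x) \<bullet> b)"
    using Suc.IH FG by (auto simp: inner_add_left intro!: C_diff_add)
  moreover have "\<forall>x\<in>U. GDERIV (\<lambda>x. f x * g x) x :> f x *\<^sub>R G x + g x *\<^sub>R F x"
    using FG by (auto intro!: GDERIV_mult)
  ultimately show ?case using Suc.prems
    by (auto intro!: continuous_intros exI[of _ "\<lambda>x. f x *\<^sub>R G x + g x *\<^sub>R F x"])
qed

lemma C_diff_prod:
  "finite I \<Longrightarrow> (\<And>i. i \<in> I \<Longrightarrow> C_diff k U (f i)) \<Longrightarrow> C_diff k U (\<lambda>x. \<Prod>i\<in>I. f i x)"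
  by (induction I rule: finite_induct) (auto intro: C_diff_const C_diff_mult)

lemma C_diff_affine:
  "C_diff k UNIV f \<Longrightarrow> C_diff k UNIV (\<lambda>x. f (c *\<^sub>R x + d))"
proof (induction k arbitrary: f)
  case 0
  then show ?case by (auto intro!: continuous_on_compose2[of UNIV f] continuous_intros)
next
  case (Suc k)
  obtain F where F: "\<forall>x. GDERIV f x :> F x" "\<forall>b\<in>Basis. C_diff k UNIV (\<lambda>x. F x \<bullet> b)"
    using Suc.prems by auto
  have "GDERIV (\<lambda>x. f (c *\<^sub>R x + d)) x :> c *\<^sub>R F (c *\<^sub>R x + d)" for x
  proof -
    have "(f has_derivative (\<lambda>h. h \<bullet> F (c *\<^sub>R x + d))) (at (c *\<^sub>R x + d))"
      using F unfolding gderiv_def by blast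
    moreover have "((\<lambda>x. c *\<^sub>R x + d) has_derivative (\<lambda>h. c *\<^sub>R h)) (at x)"
      by (auto intro!: derivative_eq_intros)
    ultimately have "((\<lambda>x. f (c *\<^sub>R x + d)) has_derivative (\<lambda>h. (c *\<^sub>R h) \<bullet> F (c *\<^sub>R x + d))) (at x)"
      using has_derivative_compose by blast
    then show ?thesis unfolding gderiv_def by (simp add: mult.commute)
  qed
  moreover have "\<forall>b\<in>Basis. C_diff k UNIV (\<lambda>x. (c *\<^sub>R F (c *\<^sub>R x + d)) \<bullet> b)"
    using F(2) by (auto intro!: C_diff_mult C_diff_const Suc.IH[where f = "\<lambda>x. F x \<bullet> _"])
  moreover have "continuous_on UNIV (\<lambda>x. f (c *\<^sub>R x + d))"
    using Suc.prems by (auto intro!: continuous_on_compose2[of UNIV f] continuous_intros)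
  ultimately show ?case by (auto intro!: exI[of _ "\<lambda>x. c *\<^sub>R F (c *\<^sub>R x + d)"])
qed

text \<open>The chain rule produces the factor \<open>H (Suc j) (q x)\<close>, so the induction on
  \<open>k\<close> closes only for all members of a sequence of successive derivatives at
  once.\<close>

lemma C_diff_compose:
  fixes H :: "nat \<Rightarrow> real \<Rightarrow> real"
  assumes H: "\<And>j t. DERIV (H j) t :> H (Suc j) t"
    and q: "\<And>k. C_diff k U q"
  shows "C_diff k U (\<lambda>x. H j (q x))"
proof (induction k arbitrary: j)
  case 0
  have "continuous_on UNIV (H j)" using H DERIV_isCont continuous_at_imp_continuous_on by blast
  then show ?case using q[of 0] continuous_on_compose2[of UNIV "H j" U q] by simp
next
  case (Suc k)
  obtain G where G: "\<forall>x\<in>U. GDERIV q x :> G x" "\<forall>b\<in>Basis. C_diff k U (\<lambda>x. G x \<bullet> b)"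
    using q[of "Suc k"] by auto
  have "\<forall>x\<in>U. GDERIV (\<lambda>x. H j (q x)) x :> H (Suc j) (q x) *\<^sub>R G x"
    using G GDERIV_DERIV_compose[OF _ H] by blast
  moreover have "\<forall>b\<in>Basis. C_diff k U (\<lambda>x. (H (Suc j) (q x) *\<^sub>R G x) \<bullet> b)"
    using G(2) Suc by (auto intro!: C_diff_mult)
  moreover have "continuous_on U (\<lambda>x. H j (q x))" using C_diff_continuous[OF Suc.IH] .
  ultimately show ?case
    by (auto intro!: exI[of _ "\<lambda>x. H (Suc j) (q x) *\<^sub>R G x"])
qed

subsection \<open>A smooth bump\<close>

text \<open>The polynomials in 1/t that accompany \<open>exp (- (1 / t))\<close> in its derivatives:
  with y = 1/t, differentiating p(y) exp(-y) in t gives y^2 (p(y) - p'(y)) exp(-y).\<close>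

fun hpoly :: "nat \<Rightarrow> real poly" where
  "hpoly 0 = 1"
| "hpoly (Suc j) = [:0, 0, 1:] * (hpoly j - pderiv (hpoly j))"

definition hfun :: "nat \<Rightarrow> real \<Rightarrow> real" where
  "hfun j t = (if t > 0 then poly (hpoly j) (1 / t) * exp (- (1 / t)) else 0)"

lemma poly_exp_decay: "((\<lambda>y. poly p y * exp (- y)) \<longlongrightarrow> (0::real)) at_top"
proof -
  have 1: "((\<lambda>y. y ^ i * exp (- y)) \<longlongrightarrow> (0::real)) at_top" for i
    using tendsto_power_div_exp_0[of i] by (simp add: exp_minus divide_inverse)
  have "((\<lambda>y. \<Sum>i\<le>degree p. coeff p i * (y ^ i * exp (- y))) \<longlongrightarrow> (\<Sum>i\<le>degree p. coeff p i * (0::real))) at_top"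
    by (intro tendsto_intros 1)
  then show ?thesis by (simp add: poly_altdef sum_distrib_right mult.assoc)
qed

text \<open>Away from 0 this is the recursion of \<open>hpoly\<close>. At 0 the difference quotient
  from the right is again a polynomial in 1/h times exp(-1/h), and the exponential wins; from the
  left it vanishes.\<close>

lemma hfun_DERIV: "DERIV (hfun j) t :> hfun (Suc j) t"
proof -
  consider "t > 0" | "t < 0" | "t = 0" by linarith
  then show ?thesis
  proof cases
    case 1
    have "((\<lambda>t. poly (hpoly j) (1 / t) * exp (- (1 / t))) has_real_derivative hfun (Suc j) t) (at t)"
      using 1 by (auto intro!: derivative_eq_intros poly_DERIV[THEN DERIV_chain2]
          simp: hfun_def field_simps power2_eq_square)
    then show ?thesis
      by (rule DERIV_cong_ev[THEN iffD1, rotated -1])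
         (use 1 in \<open>auto simp: hfun_def intro!: eventually_nhds_in_open[of "{0<..}", THEN eventually_mono]\<close>)
  next
    case 2
    have "((\<lambda>t. 0) has_real_derivative hfun (Suc j) t) (at t)"
      using 2 by (auto simp: hfun_def)
    then show ?thesis
      by (rule DERIV_cong_ev[THEN iffD1, rotated -1])
         (use 2 in \<open>auto simp: hfun_def intro!: eventually_nhds_in_open[of "{..<0}", THEN eventually_mono]\<close>)
  next
    case 3
    have "((\<lambda>h. poly ([:0,1:] * hpoly j) (1/h) * exp (- (1/h))) \<longlongrightarrow> 0) (at_right (0::real))"
      using filterlim_compose[OF poly_exp_decay[of "[:0,1:] * hpoly j"] filterlim_inverse_at_top_right]
      by (simp add: divide_inverse)
    then have "((\<lambda>h. hfun j h / h) \<longlongrightarrow> 0) (at_right 0)"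
      by (rule tendsto_cong[THEN iffD1, rotated])
         (auto simp: eventually_at hfun_def divide_simps intro!: exI[of _ 1])
    moreover have "((\<lambda>h. hfun j h / h) \<longlongrightarrow> 0) (at_left 0)"
      by (rule tendsto_eventually) (auto simp: eventually_at hfun_def intro!: exI[of _ 1])
    ultimately have "((\<lambda>h. hfun j h / h) \<longlongrightarrow> 0) (at 0)"
      using filterlim_split_at by blast
    then show ?thesis unfolding 3 DERIV_def by (simp add: hfun_def)
  qed
qed

lemma C_diff_hfun: "(\<And>k. C_diff k U q) \<Longrightarrow> C_diff k U (\<lambda>x. hfun j (q x))"
  by (rule C_diff_compose) (auto intro: hfun_DERIV)

lemma hfun_0_bounds: "0 \<le> hfun 0 t" "hfun 0 t \<le> 1"
  by (auto simp: hfun_def)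

lemma hfun_1: "hfun (Suc 0) t = (if t > 0 then (1/t)^2 * exp (- (1/t)) else 0)"
  by (auto simp: hfun_def power2_eq_square)

lemma C_diff_norm_sq: "C_diff k U (\<lambda>x::'a::euclidean_space. 1 - x \<bullet> x)"
proof (cases k)
  case 0
  then show ?thesis by (auto intro!: continuous_intros)
next
  case (Suc m)
  have "\<forall>x\<in>U. GDERIV (\<lambda>x. 1 - x \<bullet> x) x :> (- 2) *\<^sub>R x"
    unfolding gderiv_def by (auto intro!: derivative_eq_intros simp: inner_commute)
  moreover have "C_diff m U (\<lambda>x. ((- 2) *\<^sub>R x) \<bullet> b)" for b
    using C_diff_mult[OF C_diff_const[of m U "-2"] C_diff_inner[of m U b]] by simp
  ultimately show ?thesis unfolding Suc
    by (auto intro!: continuous_intros exI[of _ "\<lambda>x. (- 2) *\<^sub>R x"])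
qed

subsection \<open>Smooth functions with bounded derivatives\<close>

text \<open>Coinduction expresses bounded derivatives of every order without an order index: closure
  under \<open>pd\<close> is built in, and for convolutions and translation differences it suffices
  that the derivative has the same shape as the function.\<close>

coinductive smb :: "('a::euclidean_space \<Rightarrow> real) \<Rightarrow> bool" where
  "bounded (range v) \<Longrightarrow> (\<And>x. GDERIV v x :> G x) \<Longrightarrow>
   (\<And>b. b \<in> Basis \<Longrightarrow> smb (\<lambda>x. G x \<bullet> b)) \<Longrightarrow> smb v"

lemma smb_GDERIV: "smb v \<Longrightarrow> GDERIV v x :> grad v x"
  by (erule smb.cases) (metis grad_eqI)

lemma smb_pd: "smb v \<Longrightarrow> b \<in> Basis \<Longrightarrow> smb (pd b v)"
proof (erule smb.cases)
  fix w G assume *: "b \<in> Basis" "v = w" "\<And>x. GDERIV w x :> G x" "\<And>b. b \<in> Basis \<Longrightarrow> smb (\<lambda>x. G x \<bullet> b)"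
  then have "pd b v = (\<lambda>x. G x \<bullet> b)" using grad_eqI[OF *(3)] by (auto simp: pd_def)
  then show ?thesis using * by simp
qed

lemma smb_bdd: assumes "smb v" obtains B where "0 \<le> B" "\<And>x. \<bar>v x\<bar> \<le> B"
proof -
  have "bounded (range v)" using assms by (rule smb.cases) auto
  then obtain B where "\<And>x. \<bar>v x\<bar> \<le> B" by (auto simp: bounded_iff)
  then show thesis using that[of "\<bar>B\<bar>"] by (meson abs_ge_self abs_ge_zero order_trans)
qed

lemma smb_isCont: "smb v \<Longrightarrow> isCont v x"
  using smb_GDERIV GDERIV_continuous by blast

lemma smb_continuous: "smb v \<Longrightarrow> continuous_on S v"
  using smb_isCont continuous_at_imp_continuous_on by blast

lemma grad_conv_pd: "grad v x = (\<Sum>b\<in>Basis. pd b v x *\<^sub>R b)"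
  by (simp add: pd_def euclidean_representation)

lemma smb_lip:
  assumes "smb v" obtains L where "0 \<le> L" "\<And>x y. \<bar>v x - v y\<bar> \<le> L * norm (x - y)"
proof -
  have "\<exists>B. \<forall>x. \<bar>pd b v x\<bar> \<le> B" if "b \<in> Basis" for b
    using smb_bdd[OF smb_pd[OF assms that]] by metis
  then obtain B where B: "\<And>b x. b \<in> Basis \<Longrightarrow> \<bar>pd b v x\<bar> \<le> B b" by metis
  define L where "L = (\<Sum>b\<in>Basis. B b)"
  have nb: "norm (grad v x) \<le> L" for x
    unfolding L_def using norm_le_l1[of "grad v x"] sum_mono[of Basis "\<lambda>b. \<bar>pd b v x\<bar>" B] B
    by (force simp: pd_def)
  have "\<bar>v x - v y\<bar> \<le> L * norm (x - y)" for x y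
  proof -
    have "norm (v x - v y) \<le> L * norm (x - y)"
    proof (rule differentiable_bound[OF convex_UNIV])
      fix z show "(v has_derivative (\<lambda>h. h \<bullet> grad v z)) (at z)"
        using smb_GDERIV[OF assms] unfolding gderiv_def .
      show "onorm (\<lambda>h. h \<bullet> grad v z) \<le> L"
        using nb[of z] Cauchy_Schwarz_ineq2[of _ "grad v z"]
        by (intro onorm_le) (smt (verit) mult.commute mult_right_mono norm_ge_zero real_norm_def)
    qed auto
    then show ?thesis by simp
  qed
  moreover have "0 \<le> L" using nb norm_ge_zero order_trans by blast
  ultimately show thesis using that by blast
qed

lemma smb_grad_lip:
  assumes "smb v" obtains L where "0 \<le> L" "\<And>x y. norm (grad v x - grad v y) \<le> L * norm (x - y)"
proof -
  have "\<exists>L\<ge>0. \<forall>x y. \<bar>pd b v x - pd b v y\<bar> \<le> L * norm (x - y)" if "b \<in> Basis" for b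
    using smb_lip[OF smb_pd[OF assms that]] by metis
  then obtain L where L: "\<And>b x y. b \<in> Basis \<Longrightarrow> \<bar>pd b v x - pd b v y\<bar> \<le> L b * norm (x - y)"
    "\<And>b. b \<in> Basis \<Longrightarrow> 0 \<le> L b" by metis
  have "norm (grad v x - grad v y) \<le> (\<Sum>b\<in>Basis. L b) * norm (x - y)" for x y
    using norm_le_l1[of "grad v x - grad v y"]
      sum_mono[of Basis "\<lambda>b. \<bar>pd b v x - pd b v y\<bar>" "\<lambda>b. L b * norm (x - y)"] L(1)
    by (force simp: pd_def inner_diff_left sum_distrib_right)
  then show thesis using that[of "\<Sum>b\<in>Basis. L b"] L(2) by (meson sum_nonneg)
qed

text \<open>The mean value inequality for \<open>v z - z \<bullet> grad v x\<close>, whose gradient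
  on the segment is at most \<open>L * norm h\<close>. The remainder is uniform in \<open>x\<close>,
  so it can be integrated against a kernel; this replaces theorems on differentiation under the
  integral sign.\<close>

lemma smb_quad:
  assumes "smb v"
  obtains L where "0 \<le> L" "\<And>x h. \<bar>v (x + h) - v x - h \<bullet> grad v x\<bar> \<le> L * (norm h)\<^sup>2"
proof -
  obtain L where L: "0 \<le> L" "\<And>x y. norm (grad v x - grad v y) \<le> L * norm (x - y)"
    by (metis smb_grad_lip[OF assms])
  have "\<bar>v (x + h) - v x - h \<bullet> grad v x\<bar> \<le> L * (norm h)\<^sup>2" for x h
  proof -
    define f where "f z = v z - z \<bullet> grad v x" for z
    have "norm (f (x + h) - f x) \<le> (L * norm h) * norm (x + h - x)"
    proof (rule differentiable_bound[of "closed_segment x (x + h)"])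
      fix z assume z: "z \<in> closed_segment x (x + h)"
      show "(f has_derivative (\<lambda>k. k \<bullet> grad v z - k \<bullet> grad v x)) (at z within closed_segment x (x + h))"
        using smb_GDERIV[OF assms, of z] unfolding gderiv_def f_def
        by (intro has_derivative_diff has_derivative_inner_left has_derivative_ident)
          (auto intro: has_derivative_at_withinI)
      have "norm (z - x) \<le> norm h" using z segment_bound1 by fastforce
      then have "norm (grad v z - grad v x) \<le> L * norm h"
        using L by (meson mult_left_mono order_trans)
      then show "onorm (\<lambda>k. k \<bullet> grad v z - k \<bullet> grad v x) \<le> L * norm h"
        using Cauchy_Schwarz_ineq2[of _ "grad v z - grad v x"]
        by (intro onorm_le) (smt (verit) inner_diff_right mult.commute mult_right_mono norm_ge_zero real_norm_def)
    qed auto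
    then show ?thesis by (simp add: f_def inner_add_left power2_eq_square algebra_simps)
  qed
  then show thesis using that L by blast
qed

subsection \<open>Test functions\<close>

lemma test_functionsI:
  assumes "\<And>k. C_diff k UNIV \<phi>" "compact K" "K \<subseteq> \<Omega>" "\<And>x. x \<notin> K \<Longrightarrow> \<phi> x = 0"
  shows "\<phi> \<in> test_functions \<Omega>"
proof -
  have "{x. \<phi> x \<noteq> 0} \<subseteq> K" using assms(4) by blast
  then have "closure {x. \<phi> x \<noteq> 0} \<subseteq> K" using assms(2) by (simp add: closure_minimal compact_imp_closed)
  moreover have "compact (closure {x. \<phi> x \<noteq> 0})"
    using assms(2) calculation by (meson bounded_subset closed_closure compact_eq_bounded_closed)
  ultimately show ?thesis using assms unfolding test_functions_def by blast
qed

lemma test_functionsE: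
  assumes "\<phi> \<in> test_functions \<Omega>"
  obtains K where "compact K" "K \<subseteq> \<Omega>" "\<And>x. x \<notin> K \<Longrightarrow> \<phi> x = 0" "\<And>k. C_diff k UNIV \<phi>"
proof (rule that[of "closure {x. \<phi> x \<noteq> 0}"])
  show "x \<notin> closure {x. \<phi> x \<noteq> 0} \<Longrightarrow> \<phi> x = 0" for x using closure_subset[of "{x. \<phi> x \<noteq> 0}"] by blast
qed (use assms in \<open>auto simp: test_functions_def\<close>)

lemma test_functions_mono: "\<Omega> \<subseteq> \<Omega>' \<Longrightarrow> \<phi> \<in> test_functions \<Omega> \<Longrightarrow> \<phi> \<in> test_functions \<Omega>'"
  unfolding test_functions_def by blast

lemma grad_zero_outside:
  assumes "closed K" "\<And>x. x \<notin> K \<Longrightarrow> \<phi> x = 0" "x \<notin> K"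
  shows "grad \<phi> x = 0"
proof (rule grad_eqI)
  have "((\<lambda>x. 0) has_derivative (\<lambda>h. h \<bullet> 0)) (at x)" by simp
  then show "GDERIV \<phi> x :> 0"
    unfolding gderiv_def
    by (rule has_derivative_transform_within_open[of _ _ _ _ "- K"]) (use assms in \<open>auto simp: open_Compl\<close>)
qed

lemma test_functions_pd:
  assumes "\<phi> \<in> test_functions \<Omega>" "b \<in> Basis" shows "pd b \<phi> \<in> test_functions \<Omega>"
proof -
  obtain K where K: "compact K" "K \<subseteq> \<Omega>" "\<And>x. x \<notin> K \<Longrightarrow> \<phi> x = 0" "\<And>k. C_diff k UNIV \<phi>"
    by (metis test_functionsE[OF assms(1)])
  show ?thesis
  proof (rule test_functionsI[OF _ K(1,2)])
    show "C_diff k UNIV (pd b \<phi>)" for k using C_diff_Suc_pd K(4) assms(2) by blast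
    show "pd b \<phi> x = 0" if "x \<notin> K" for x
      using grad_zero_outside[of K \<phi> x] K that by (simp add: pd_def compact_imp_closed)
  qed
qed

lemma test_functions_diff:
  assumes "\<phi> \<in> test_functions \<Omega>" "\<psi> \<in> test_functions \<Omega>"
  shows "(\<lambda>x. \<phi> x - \<psi> x) \<in> test_functions \<Omega>"
proof -
  obtain K where K: "compact K" "K \<subseteq> \<Omega>" "\<And>x. x \<notin> K \<Longrightarrow> \<phi> x = 0" "\<And>k. C_diff k UNIV \<phi>"
    by (metis test_functionsE[OF assms(1)])
  obtain K' where K': "compact K'" "K' \<subseteq> \<Omega>" "\<And>x. x \<notin> K' \<Longrightarrow> \<psi> x = 0" "\<And>k. C_diff k UNIV \<psi>"
    by (metis test_functionsE[OF assms(2)])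
  have "C_diff k UNIV (\<lambda>x. \<phi> x + (-1) * \<psi> x)" for k
    by (intro C_diff_add C_diff_mult C_diff_const K K')
  then show ?thesis using K K' by (intro test_functionsI[of _ "K \<union> K'"]) auto
qed

text \<open>Coinduction: a continuous function with compact support is bounded, and partial
  derivatives of test functions are test functions.\<close>

lemma test_smb: assumes "\<phi> \<in> test_functions \<Omega>" shows "smb \<phi>"
  using assms
proof (coinduction arbitrary: \<phi>)
  case smb
  obtain K where K: "compact K" "K \<subseteq> \<Omega>" "\<And>x. x \<notin> K \<Longrightarrow> \<phi> x = 0" "\<And>k. C_diff k UNIV \<phi>"
    by (metis test_functionsE[OF smb])
  have "compact (\<phi> ` K)" using K C_diff_continuous
    by (meson compact_continuous_image continuous_on_subset subset_UNIV)
  then have "bounded (insert 0 (\<phi> ` K))" using compact_imp_bounded by auto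
  moreover have "range \<phi> \<subseteq> insert 0 (\<phi> ` K)" using K by auto
  ultimately have "bounded (range \<phi>)" using bounded_subset by blast
  moreover have "GDERIV \<phi> x :> grad \<phi> x" for x using C_diff_Suc_grad[OF K(4)] by blast
  ultimately show ?case using test_functions_pd[OF smb]
    by (auto intro!: exI[of _ "grad \<phi>"] simp: pd_def[abs_def])
qed

section \<open>Kernels\<close>

lemma lborel_integral_affine:
  fixes f :: "'a::euclidean_space \<Rightarrow> real"
  assumes "c \<noteq> 0" "f \<in> borel_measurable borel"
  shows "(LINT x|lborel. f x) = \<bar>c\<bar>^DIM('a) * (LINT x|lborel. f (t + c *\<^sub>R x))"
    and "integrable lborel f \<longleftrightarrow> integrable lborel (\<lambda>x. f (t + c *\<^sub>R x))"
proof -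
  note eq = lborel_affine[OF assms(1), of t]
  have "(LINT x|lborel. f x) = (LINT x|density (distr lborel borel (\<lambda>x. t + c *\<^sub>R x)) (\<lambda>_. \<bar>c\<bar>^DIM('a)). f x)"
    using eq by metis
  also have "\<dots> = (LINT x|distr lborel borel (\<lambda>x. t + c *\<^sub>R x). \<bar>c\<bar>^DIM('a) * f x)"
    using assms by (subst integral_density) auto
  also have "\<dots> = (LINT x|lborel. \<bar>c\<bar>^DIM('a) * f (t + c *\<^sub>R x))"
    using assms by (subst integral_distr) auto
  finally show "(LINT x|lborel. f x) = \<bar>c\<bar>^DIM('a) * (LINT x|lborel. f (t + c *\<^sub>R x))" by simp
  have "integrable lborel f \<longleftrightarrow> integrable (density (distr lborel borel (\<lambda>x. t + c *\<^sub>R x)) (\<lambda>_. \<bar>c\<bar>^DIM('a))) f"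
    using eq by metis
  also have "\<dots> \<longleftrightarrow> integrable (distr lborel borel (\<lambda>x. t + c *\<^sub>R x)) (\<lambda>x. \<bar>c\<bar>^DIM('a) * f x)"
    using assms by (subst integrable_density) auto
  also have "\<dots> \<longleftrightarrow> integrable lborel (\<lambda>x. \<bar>c\<bar>^DIM('a) * f (t + c *\<^sub>R x))"
    using assms by (subst integrable_distr_eq) auto
  finally show "integrable lborel f \<longleftrightarrow> integrable lborel (\<lambda>x. f (t + c *\<^sub>R x))"
    using assms(1) by simp
qed

lemma lborel_integral_translate:
  fixes f :: "'a::euclidean_space \<Rightarrow> real"
  assumes "f \<in> borel_measurable borel"
  shows "(LINT x|lborel. f (x + t)) = (LINT x|lborel. f x)"
    and "integrable lborel (\<lambda>x. f (x + t)) \<longleftrightarrow> integrable lborel f"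
  using lborel_integral_affine[OF one_neq_zero assms, of t] by (simp_all add: add.commute)

lemma lborel_integral_reflect:
  fixes f :: "'a::euclidean_space \<Rightarrow> real"
  assumes "f \<in> borel_measurable borel"
  shows "(LINT x|lborel. f (t - x)) = (LINT x|lborel. f x)"
    and "integrable lborel (\<lambda>x. f (t - x)) \<longleftrightarrow> integrable lborel f"
  using lborel_integral_affine[of "-1" f t] assms by simp_all

section \<open>Kernels on the unit ball and bounded Borel functions\<close>

text \<open>Neither the sign nor the integral is fixed, because the derivatives of a mollifier have
  to qualify, and these have mean zero.\<close>

definition kern :: "('a::euclidean_space \<Rightarrow> real) \<Rightarrow> bool" where
  "kern k \<longleftrightarrow> k \<in> test_functions UNIV \<and> (\<forall>x. norm x > 1 \<longrightarrow> k x = 0)"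

lemma kern_pd: "kern k \<Longrightarrow> b \<in> Basis \<Longrightarrow> kern (pd b k)"
  using test_functions_pd[of k UNIV b] grad_zero_outside[of "cball 0 1" k]
  by (auto simp: kern_def pd_def[of b k])

lemma kern_smb: "kern k \<Longrightarrow> smb k"
  using test_smb by (auto simp: kern_def)

lemma kern_zero: "kern k \<Longrightarrow> norm x > 1 \<Longrightarrow> k x = 0"
  by (simp add: kern_def)

lemma smb_measurable [measurable (raw)]: "smb v \<Longrightarrow> v \<in> borel_measurable borel"
  using smb_continuous borel_measurable_continuous_onI by blast

text \<open>Boundedness is asked everywhere rather than almost everywhere, so that averages exist at
  every point and can be estimated by values on one ball.\<close>

definition bbor :: "('a::euclidean_space \<Rightarrow> real) \<Rightarrow> bool" where
  "bbor v \<longleftrightarrow> v \<in> borel_measurable borel \<and> (\<exists>M. \<forall>x. \<bar>v x\<bar> \<le> M)"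

lemma bborI: "v \<in> borel_measurable borel \<Longrightarrow> (\<And>x. \<bar>v x\<bar> \<le> M) \<Longrightarrow> bbor v"
  by (auto simp: bbor_def)

lemma bbor_measurable: "bbor v \<Longrightarrow> v \<in> borel_measurable borel"
  by (simp add: bbor_def)

lemma smb_bbor: "smb v \<Longrightarrow> bbor v"
  by (metis bbor_def smb_bdd smb_measurable)

lemma bbor_const: "bbor (\<lambda>x. c)" by (auto simp: bbor_def)

lemma bbor_diff: "bbor v \<Longrightarrow> bbor w \<Longrightarrow> bbor (\<lambda>x. v x - w x)"
proof -
  assume "bbor v" "bbor w"
  then obtain M N where "\<And>x. \<bar>v x\<bar> \<le> M" "\<And>x. \<bar>w x\<bar> \<le> N"
    "v \<in> borel_measurable borel" "w \<in> borel_measurable borel" by (auto simp: bbor_def)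
  then show ?thesis by (intro bborI[of _ "M + N"]) (auto intro: abs_triangle_ineq4[THEN order_trans] add_mono)
qed

lemma bbor_cmult: "bbor v \<Longrightarrow> bbor (\<lambda>x. c * v x)"
proof -
  assume "bbor v"
  then obtain M where "\<And>x. \<bar>v x\<bar> \<le> M" "v \<in> borel_measurable borel" by (auto simp: bbor_def)
  then show ?thesis by (intro bborI[of _ "\<bar>c\<bar> * M"]) (auto simp: abs_mult intro: mult_left_mono)
qed

lemma bbor_add: "bbor v \<Longrightarrow> bbor w \<Longrightarrow> bbor (\<lambda>x. v x + w x)"
  using bbor_diff[of v "\<lambda>x. (-1) * w x"] bbor_cmult[of w "-1"] by simp

lemma bbor_sum: "finite I \<Longrightarrow> (\<And>i. i \<in> I \<Longrightarrow> bbor (v i)) \<Longrightarrow> bbor (\<lambda>x. \<Sum>i\<in>I. v i x)"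
  by (induction I rule: finite_induct) (auto intro: bbor_add bbor_const)

lemma bbor_affine: "bbor v \<Longrightarrow> bbor (\<lambda>z. v (x + t *\<^sub>R z))"
  unfolding bbor_def by (auto intro!: measurable_compose[of _ borel borel v])

lemma bbor_shift: "bbor v \<Longrightarrow> bbor (\<lambda>z. v (z + h))"
  using bbor_affine[of v h 1] by (simp add: add.commute)

lemma bbor_refl: "bbor v \<Longrightarrow> bbor (\<lambda>z. v (x - t *\<^sub>R z))"
  using bbor_affine[of v x "-t"] by simp

lemma indicator_cball_integrable: "integrable lborel (\<lambda>x. (c::real) * indicator (cball (0::'a::euclidean_space) r) x)"
  using emeasure_bounded_finite[of "cball (0::'a) r"]
  by (intro integrable_mult_right integrable_real_indicator) auto

lemma cball_integrable:
  assumes "f \<in> borel_measurable borel" "\<And>x. \<bar>f x\<bar> \<le> (B::real)" "\<And>x. norm x > r \<Longrightarrow> f (x::'a::euclidean_space) = 0"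
  shows "integrable lborel f"
proof -
  have "integrable lborel (\<lambda>x::'a. indicator (cball 0 r) x * B)"
    using indicator_cball_integrable[of B r] by (simp add: mult.commute)
  then show ?thesis
  proof (rule Bochner_Integration.integrable_bound)
    show "AE x in lborel. norm (f x) \<le> norm (indicator (cball 0 r) x * B)"
    proof (rule AE_I2)
      show "norm (f x) \<le> norm (indicator (cball 0 r) x * B)" for x
        using assms(2)[of x] assms(3)[of x] by (cases "norm x > r") auto
    qed
  qed (use assms in simp)
qed

lemma kern_integrable:
  assumes "kern k" "bbor v" shows "integrable lborel (\<lambda>z. k z * v z)"
proof -
  obtain B where B: "0 \<le> B" "\<And>x. \<bar>k x\<bar> \<le> B" using smb_bdd kern_smb assms by metis
  obtain M where M: "\<And>x. \<bar>v x\<bar> \<le> M" using assms by (auto simp: bbor_def)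
  show ?thesis
  proof (rule cball_integrable[where r = 1 and B = "B * M"])
    show "(\<lambda>z. k z * v z) \<in> borel_measurable borel"
      using smb_measurable[OF kern_smb[OF assms(1)]] assms by (auto simp: bbor_def)
    show "\<bar>k x * v x\<bar> \<le> B * M" for x
      using B M[of x] by (simp add: abs_mult mult_mono)
  qed (use kern_zero[OF assms(1)] in auto)
qed

lemma kern_integrable': "kern k \<Longrightarrow> integrable lborel k"
  using kern_integrable[OF _ bbor_const[of 1], of k] by simp

definition kint :: "('a::euclidean_space \<Rightarrow> real) \<Rightarrow> real" where
  "kint k = (LINT z|lborel. \<bar>k z\<bar>)"

lemma kint_nonneg: "0 \<le> kint k" by (simp add: kint_def)

section \<open>Averages at a scale\<close>

text \<open>Convolution with the kernel rescaled to size \<open>t\<close>, written with the scale in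
  the argument of \<open>v\<close>. In this form it makes sense at \<open>t = 0\<close>, where it is
  the integral of \<open>k\<close> times \<open>v x\<close>, and for smooth \<open>v\<close> it is
  differentiable in \<open>t\<close> there too.\<close>

definition A :: "('a::euclidean_space \<Rightarrow> real) \<Rightarrow> real \<Rightarrow> ('a \<Rightarrow> real) \<Rightarrow> 'a \<Rightarrow> real" where
  "A k t v x = (LINT z|lborel. k z * v (x - t *\<^sub>R z))"

lemma A_integrable: "kern k \<Longrightarrow> bbor v \<Longrightarrow> integrable lborel (\<lambda>z. k z * v (x - t *\<^sub>R z))"
  by (intro kern_integrable bbor_refl)

lemma A_bound:
  assumes k: "kern k" and v: "bbor v" and S: "\<And>y. y \<in> cball x t \<Longrightarrow> \<bar>v y\<bar> \<le> S" and t: "0 \<le> t"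
  shows "\<bar>A k t v x\<bar> \<le> kint k * S"
proof -
  have "\<bar>A k t v x\<bar> \<le> (LINT z|lborel. \<bar>k z * v (x - t *\<^sub>R z)\<bar>)"
    unfolding A_def using integral_norm_bound[of lborel "\<lambda>z. k z * v (x - t *\<^sub>R z)"] by simp
  also have "\<dots> \<le> (LINT z|lborel. \<bar>k z\<bar> * S)"
  proof (rule integral_mono)
    show "integrable lborel (\<lambda>z. \<bar>k z * v (x - t *\<^sub>R z)\<bar>)" using A_integrable[OF k v] by (rule integrable_abs)
    show "integrable lborel (\<lambda>z. \<bar>k z\<bar> * S)" using kern_integrable'[OF k] by (intro integrable_mult_left integrable_abs)
    show "\<bar>k z * v (x - t *\<^sub>R z)\<bar> \<le> \<bar>k z\<bar> * S" for z
    proof (cases "norm z > 1")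
      case False
      then have "x - t *\<^sub>R z \<in> cball x t" using t by (simp add: dist_norm mult_left_le)
      then show ?thesis using S by (simp add: abs_mult mult_left_mono)
    qed (use kern_zero[OF k] in auto)
  qed
  finally show ?thesis by (simp add: kint_def)
qed

lemma A_diff: "kern k \<Longrightarrow> bbor v \<Longrightarrow> bbor w \<Longrightarrow> A k t (\<lambda>x. v x - w x) x = A k t v x - A k t w x"
  unfolding A_def by (simp add: right_diff_distrib A_integrable)

lemma A_sum: "kern k \<Longrightarrow> finite I \<Longrightarrow> (\<And>i. i \<in> I \<Longrightarrow> bbor (v i)) \<Longrightarrow> A k t (\<lambda>x. \<Sum>i\<in>I. v i x) x = (\<Sum>i\<in>I. A k t (v i) x)"
  unfolding A_def by (simp add: sum_distrib_left A_integrable)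

lemma A_const: "A k t (\<lambda>x. c) x = (LINT z|lborel. k z) * c"
  unfolding A_def by simp

lemma A_shift_eq: "A k t v (x + h) = A k t (\<lambda>y. v (y + h)) x"
  unfolding A_def by (simp add: algebra_simps)

text \<open>Translating \<open>v\<close> by \<open>h\<close> at scale \<open>t\<close> is the same
  as translating the kernel by \<open>h / t\<close>, so the Lipschitz constant of \<open>k\<close>
  yields the factor \<open>norm h / t\<close> with no regularity of \<open>v\<close>. When
  \<open>norm h > t\<close> this factor exceeds 1 and \<open>A_bound\<close> is enough.\<close>

lemma A_shift:
  assumes k: "kern k"
  obtains C where "0 \<le> C" "\<And>v x h t S. \<lbrakk>bbor v; 0 < t; \<And>y. y \<in> cball x (t + norm h) \<Longrightarrow> \<bar>v y\<bar> \<le> S\<rbrakk>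
    \<Longrightarrow> \<bar>A k t v (x + h) - A k t v x\<bar> \<le> C * (norm h / t) * S"
proof -
  obtain L where L: "0 \<le> L" "\<And>x y. \<bar>k x - k y\<bar> \<le> L * norm (x - y)" using smb_lip[OF kern_smb[OF k]] by metis
  \<comment> \<open>The ball of radius 2 contains the supports of \<open>k\<close> and of its
    translates by at most 1; the second entry serves shifts longer than \<open>t\<close>.\<close>
  define C where "C = max (L * measure lborel (cball (0::'a) 2)) (2 * kint k)"
  have C0: "0 \<le> C" by (simp add: C_def kint_nonneg le_max_iff_disj)
  have "\<bar>A k t v (x + h) - A k t v x\<bar> \<le> C * (norm h / t) * S"
    if v: "bbor v" and t: "0 < t" and S: "\<And>y. y \<in> cball x (t + norm h) \<Longrightarrow> \<bar>v y\<bar> \<le> S" for v x h t S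
  proof -
    have S0: "0 \<le> S" using S[of x] t by (smt (verit) centre_in_cball norm_ge_zero)
    show ?thesis
    proof (cases "norm h \<le> t")
      case True
      define d where "d = h /\<^sub>R t"
      have d: "norm d = norm h / t" "norm d \<le> 1" using t True by (auto simp: d_def divide_simps)
      let ?f = "\<lambda>z. k z * v (x + h - t *\<^sub>R z)"
      have fm: "?f \<in> borel_measurable borel"
        using borel_measurable_integrable[OF A_integrable[OF k v, of "x+h" t]] by simp
      have e: "?f (z + d) = k (z + d) * v (x - t *\<^sub>R z)" for z
        using t by (simp add: d_def algebra_simps)
      have i1: "integrable lborel (\<lambda>z. k (z + d) * v (x - t *\<^sub>R z))"
        using lborel_integral_translate(2)[OF fm, of d] A_integrable[OF k v, of "x+h" t] e by simp
      have "A k t v (x + h) = (LINT z|lborel. k (z + d) * v (x - t *\<^sub>R z))"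
        using lborel_integral_translate(1)[OF fm, of d] e unfolding A_def by simp
      then have "A k t v (x + h) - A k t v x = (LINT z|lborel. (k (z + d) - k z) * v (x - t *\<^sub>R z))"
        using i1 A_integrable[OF k v, of x t] unfolding A_def by (simp add: left_diff_distrib)
      also have "\<bar>\<dots>\<bar> \<le> (LINT z|lborel. \<bar>(k (z + d) - k z) * v (x - t *\<^sub>R z)\<bar>)"
        using integral_norm_bound[of lborel "\<lambda>z. (k (z + d) - k z) * v (x - t *\<^sub>R z)"] by simp
      also have "\<dots> \<le> (LINT z|lborel. (L * (norm h / t) * S) * indicator (cball (0::'a) 2) z)"
      proof (rule integral_mono)
        show "integrable lborel (\<lambda>z. \<bar>(k (z + d) - k z) * v (x - t *\<^sub>R z)\<bar>)"
          using i1 A_integrable[OF k v, of x t] by (intro integrable_abs) (simp add: left_diff_distrib)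
        show "integrable lborel (\<lambda>z. (L * (norm h / t) * S) * indicator (cball (0::'a) 2) z)"
          by (rule indicator_cball_integrable)
        show "\<bar>(k (z + d) - k z) * v (x - t *\<^sub>R z)\<bar> \<le> (L * (norm h / t) * S) * indicator (cball 0 2) z" for z
        proof (cases "norm z > 1 + norm d")
          case True
          then have "norm (z + d) > 1" "norm z > 1"
            using norm_triangle_ineq4[of "z + d" d] norm_ge_zero[of d] by (simp_all del: norm_ge_zero)
          then show ?thesis using k L S0 t by (auto simp: kern_zero)
        next
          case False
          then have "t * norm z \<le> t * (1 + norm d)" using t by simp
          also have "\<dots> = t + norm h" using t d by (simp add: field_simps)
          finally have "\<bar>v (x - t *\<^sub>R z)\<bar> \<le> S" using t by (intro S) (simp add: dist_norm)
          moreover have "\<bar>k (z + d) - k z\<bar> \<le> L * (norm h / t)" using L(2)[of "z + d" z] d by simp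
          ultimately have "\<bar>(k (z + d) - k z) * v (x - t *\<^sub>R z)\<bar> \<le> L * (norm h / t) * S"
            unfolding abs_mult using L t by (intro mult_mono) auto
          then show ?thesis using False d by simp
        qed
      qed
      also have "\<dots> = (L * measure lborel (cball (0::'a) 2)) * (norm h / t) * S" by simp
      also have "\<dots> \<le> C * (norm h / t) * S" unfolding C_def using t S0 by (intro mult_right_mono) auto
      finally show ?thesis .
    next
      case False
      have "\<bar>A k t v (x + h)\<bar> \<le> kint k * S" "\<bar>A k t v x\<bar> \<le> kint k * S"
      proof -
        show "\<bar>A k t v x\<bar> \<le> kint k * S" using t by (intro A_bound k v S) (auto intro: order_trans)
        have "y \<in> cball x (t + norm h)" if "y \<in> cball (x + h) t" for y
          using that norm_triangle_ineq[of "x + h - y" "- h"] by (auto simp: dist_norm)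
        then show "\<bar>A k t v (x + h)\<bar> \<le> kint k * S" using t by (intro A_bound k v S) auto
      qed
      then have "\<bar>A k t v (x + h) - A k t v x\<bar> \<le> 2 * kint k * S" by linarith
      also have "\<dots> \<le> C * S" unfolding C_def using S0 by (intro mult_right_mono) auto
      also have "\<dots> \<le> C * (norm h / t) * S"
        using False t C0 S0 by (intro mult_right_mono) (auto simp: field_simps mult_left_mono)
      finally show ?thesis .
    qed
  qed
  then show thesis using that C0 by blast
qed

text \<open>Both difference quotients, of the kernel and of \<open>v\<close>, differ from the derivative by \<open>O(h\<^sup>2)\<close>.\<close>
lemma A_pd:
  assumes k: "kern k" and v: "smb v" and b: "b \<in> Basis"
  shows "A (pd b k) t v x = t * A k t (pd b v) x"
proof -
  obtain L where L: "0 \<le> L" "\<And>x h. \<bar>k (x + h) - k x - h \<bullet> grad k x\<bar> \<le> L * (norm h)\<^sup>2"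
    using smb_quad[OF kern_smb[OF k]] by metis
  obtain M where M: "0 \<le> M" "\<And>x h. \<bar>v (x + h) - v x - h \<bullet> grad v x\<bar> \<le> M * (norm h)\<^sup>2"
    using smb_quad[OF v] by metis
  obtain N where N: "0 \<le> N" "\<And>x. \<bar>v x\<bar> \<le> N" using smb_bdd[OF v] by metis
  note vb = smb_bbor[OF v] and pvb = smb_bbor[OF smb_pd[OF v b]]
  define E where "E = A (pd b k) t v x - t * A k t (pd b v) x"
  define C where "C = L * N * measure lborel (cball (0::'a) 2) + kint k * M * t\<^sup>2"
  have key: "\<bar>h * E\<bar> \<le> C * h\<^sup>2" if h: "\<bar>h\<bar> \<le> 1" for h :: real
  proof -
    let ?f = "\<lambda>z. k z * v (x + (t * h) *\<^sub>R b - t *\<^sub>R z)"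
    have fm: "?f \<in> borel_measurable borel"
      using borel_measurable_integrable[OF A_integrable[OF k vb, of "x + (t * h) *\<^sub>R b" t]] by simp
    have e: "?f (z + h *\<^sub>R b) = k (z + h *\<^sub>R b) * v (x - t *\<^sub>R z)" for z
      by (simp add: algebra_simps)
    have i1: "integrable lborel (\<lambda>z. k (z + h *\<^sub>R b) * v (x - t *\<^sub>R z))"
      using lborel_integral_translate(2)[OF fm, of "h *\<^sub>R b"] A_integrable[OF k vb, of _ t] e by simp
    note i2 = A_integrable[OF k vb, of x t] and i3 = A_integrable[OF kern_pd[OF k b] vb, of x t]
      and i4 = A_integrable[OF k vb, of "x + (t * h) *\<^sub>R b" t] and i5 = A_integrable[OF k pvb, of x t]
    have eq: "(LINT z|lborel. ?f z) = (LINT z|lborel. k (z + h *\<^sub>R b) * v (x - t *\<^sub>R z))"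
      using lborel_integral_translate(1)[OF fm, of "h *\<^sub>R b"] e by simp
    have "(LINT z|lborel. (k (z + h *\<^sub>R b) - k z - h * pd b k z) * v (x - t *\<^sub>R z))
       = (LINT z|lborel. k (z + h *\<^sub>R b) * v (x - t *\<^sub>R z)) - A k t v x - h * A (pd b k) t v x"
      using i1 i2 i3 unfolding A_def by (simp add: left_diff_distrib mult.assoc)
    moreover have "(LINT z|lborel. k z * (v (x - t *\<^sub>R z + (t * h) *\<^sub>R b) - v (x - t *\<^sub>R z) - (t * h) * pd b v (x - t *\<^sub>R z)))
       = (LINT z|lborel. ?f z) - A k t v x - t * h * A k t (pd b v) x"
      using i4 i2 i5 unfolding A_def
      by (simp add: right_diff_distrib mult.left_commute[of _ "t * h"] algebra_simps(1-3) add_diff_eq diff_add_eq)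
    ultimately have "h * E = (LINT z|lborel. k z * (v (x - t *\<^sub>R z + (t * h) *\<^sub>R b) - v (x - t *\<^sub>R z) - (t * h) * pd b v (x - t *\<^sub>R z)))
       - (LINT z|lborel. (k (z + h *\<^sub>R b) - k z - h * pd b k z) * v (x - t *\<^sub>R z))" (is "_ = ?I1 - ?I2")
      using eq by (simp add: E_def algebra_simps)
    moreover have "\<bar>?I1\<bar> \<le> kint k * M * t\<^sup>2 * h\<^sup>2"
    proof -
      have "\<bar>?I1\<bar> \<le> (LINT z|lborel. \<bar>k z\<bar> * (M * t\<^sup>2 * h\<^sup>2))"
        unfolding real_norm_def[symmetric]
      proof (rule Bochner_Integration.integral_norm_bound_integral)
        show "integrable lborel (\<lambda>z. k z * (v (x - t *\<^sub>R z + (t * h) *\<^sub>R b) - v (x - t *\<^sub>R z) - (t * h) * pd b v (x - t *\<^sub>R z)))"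
          by (intro kern_integrable[OF k] bbor_diff bbor_cmult bbor_refl[OF vb] bbor_refl[OF pvb])
             (use bbor_refl[OF vb, of "x + (t*h) *\<^sub>R b" t] in \<open>simp add: algebra_simps\<close>)
        show "integrable lborel (\<lambda>z. norm (k z) * (M * t\<^sup>2 * h\<^sup>2))"
          using kern_integrable'[OF k] by (intro integrable_mult_left integrable_norm)
        show "norm (k z * (v (x - t *\<^sub>R z + (t * h) *\<^sub>R b) - v (x - t *\<^sub>R z) - (t * h) * pd b v (x - t *\<^sub>R z)))
           \<le> norm (k z) * (M * t\<^sup>2 * h\<^sup>2)" for z
          using M(2)[of "x - t *\<^sub>R z" "(t * h) *\<^sub>R b"] b
          by (simp add: abs_mult pd_def inner_commute power_mult_distrib mult.assoc mult_left_mono)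
      qed
      then show ?thesis by (simp add: kint_def)
    qed
    moreover have "\<bar>?I2\<bar> \<le> L * N * measure lborel (cball (0::'a) 2) * h\<^sup>2"
    proof -
      have "\<bar>?I2\<bar> \<le> (LINT z|lborel. (L * N * h\<^sup>2) * indicator (cball (0::'a) 2) z)"
        unfolding real_norm_def[symmetric]
      proof (rule Bochner_Integration.integral_norm_bound_integral)
        show "integrable lborel (\<lambda>z. (k (z + h *\<^sub>R b) - k z - h * pd b k z) * v (x - t *\<^sub>R z))"
          using i1 i2 i3 by (simp add: left_diff_distrib mult.assoc)
        show "integrable lborel (\<lambda>z. (L * N * h\<^sup>2) * indicator (cball (0::'a) 2) z)"
          by (rule indicator_cball_integrable)
        show "norm ((k (z + h *\<^sub>R b) - k z - h * pd b k z) * v (x - t *\<^sub>R z)) \<le> (L * N * h\<^sup>2) * indicator (cball 0 2) z" for z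
        proof (cases "norm z > 2")
          case True
          then have "norm (z + h *\<^sub>R b) > 1" "norm z > 1"
            using norm_triangle_ineq4[of "z + h *\<^sub>R b" "h *\<^sub>R b"] h b by auto
          then show ?thesis using k kern_pd[OF k b] L N by (auto simp: kern_zero)
        next
          case False
          have "\<bar>k (z + h *\<^sub>R b) - k z - h * pd b k z\<bar> \<le> L * h\<^sup>2"
            using L(2)[of z "h *\<^sub>R b"] b by (simp add: pd_def inner_commute)
          then have "\<bar>k (z + h *\<^sub>R b) - k z - h * pd b k z\<bar> * \<bar>v (x - t *\<^sub>R z)\<bar> \<le> (L * h\<^sup>2) * N"
            using N L by (intro mult_mono) auto
          then show ?thesis using False by (simp add: abs_mult mult.commute mult.left_commute)
        qed
      qed
      then show ?thesis by (simp add: algebra_simps)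
    qed
    ultimately show ?thesis unfolding C_def by (simp add: distrib_right)
  qed
  \<comment> \<open>\<open>E\<close> does not depend on \<open>h\<close>, so a bound of order
    \<open>h\<^sup>2\<close> for \<open>h * E\<close> at all small \<open>h\<close> forces it to
    vanish.\<close>
  have "E = 0"
  proof (rule ccontr)
    assume E: "E \<noteq> 0"
    define h where "h = min 1 (\<bar>E\<bar> / (2 * (\<bar>C\<bar> + 1)))"
    have h: "0 < h" "\<bar>h\<bar> \<le> 1" "h \<le> \<bar>E\<bar> / (2 * (\<bar>C\<bar> + 1))" using E by (auto simp: h_def)
    have "h * \<bar>E\<bar> \<le> C * h\<^sup>2" using key[OF h(2)] h(1) by (simp add: abs_mult)
    then have "\<bar>E\<bar> \<le> C * h" using h(1) by (simp add: power2_eq_square)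
    also have "\<dots> \<le> (\<bar>C\<bar> + 1) * h" using h(1) by (intro mult_right_mono) auto
    also have "\<dots> \<le> \<bar>E\<bar> / 2" using h(3) by (simp add: field_simps)
    finally show False using E by simp
  qed
  then show ?thesis by (simp add: E_def)
qed

section \<open>The mollifier identity\<close>

lemma GDERIV_quad:
  assumes "\<And>h. \<bar>f (x + h) - f x - h \<bullet> G\<bar> \<le> C * (norm h)\<^sup>2"
  shows "GDERIV f x :> (G::'a::euclidean_space)"
  unfolding gderiv_def has_derivative_at
proof
  show "bounded_linear (\<lambda>h. h \<bullet> G)" by (rule bounded_linear_inner_left)
  have "((\<lambda>h::'a. C * norm h) \<longlongrightarrow> C * norm (0::'a)) (at 0)"
    by (intro tendsto_mult tendsto_const tendsto_norm tendsto_ident_at)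
  then have 0: "((\<lambda>h::'a. C * norm h) \<longlongrightarrow> 0) (at 0)" by simp
  show "(\<lambda>h. norm (f (x + h) - f x - h \<bullet> G) / norm h) \<midarrow>0\<rightarrow> 0"
  proof (rule tendsto_sandwich[OF _ _ tendsto_const 0])
    show "\<forall>\<^sub>F h in at 0. norm (f (x + h) - f x - h \<bullet> G) / norm h \<le> C * norm h"
    proof (rule eventually_at_topological[THEN iffD2], intro exI[of _ UNIV] conjI ballI impI)
      fix h :: 'a assume "h \<noteq> 0"
      then show "norm (f (x + h) - f x - h \<bullet> G) / norm h \<le> C * norm h"
        using assms[of h] by (simp add: divide_le_eq power2_eq_square mult.assoc)
    qed auto
  qed auto
qed

lemma DERIV_quad:
  assumes "\<And>h. \<bar>f (x + h) - f x - h * D\<bar> \<le> C * h\<^sup>2"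
  shows "DERIV f x :> (D::real)"
  using GDERIV_quad[of f x D C] assms by simp

text \<open>Differentiating \<open>v (x - t *\<^sub>R z)\<close> in \<open>t\<close> brings down
  \<open>- (z \<bullet> grad v)\<close>, and the coordinates of \<open>- z\<close> are attached to
  the kernel. That these products are kernels again is supplied through \<open>k'\<close>: for
  \<open>\<rho>\<close> they are the partial derivatives of \<open>\<Psi>\<close>.\<close>

lemma DERIV_A:
  assumes k: "kern k" and k': "\<And>b. b \<in> Basis \<Longrightarrow> kern (k' b)"
    and kk': "\<And>b z. b \<in> Basis \<Longrightarrow> k' b z = - (z \<bullet> b) * k z"
    and v: "smb v"
  shows "((\<lambda>t. A k t v x) has_real_derivative (\<Sum>b\<in>Basis. A (k' b) t (pd b v) x)) (at t)"
proof -
  obtain M where M: "0 \<le> M" "\<And>x h. \<bar>v (x + h) - v x - h \<bullet> grad v x\<bar> \<le> M * (norm h)\<^sup>2"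
    using smb_quad[OF v] by metis
  note vb = smb_bbor[OF v]
  show ?thesis
  proof (rule DERIV_quad[where C = "kint k * M"])
    fix h :: real
    have i: "integrable lborel (\<lambda>z. k' b z * pd b v (x - t *\<^sub>R z))" if "b \<in> Basis" for b
      using A_integrable[OF k'[OF that] smb_bbor[OF smb_pd[OF v that]]] .
    have "k z * (z \<bullet> grad v (x - t *\<^sub>R z)) = - (\<Sum>b\<in>Basis. k' b z * pd b v (x - t *\<^sub>R z))" for z
      by (simp add: euclidean_inner[of z "grad v _"] pd_def kk' sum_distrib_left sum_negf[symmetric] mult_ac)
    then have e: "(\<lambda>z. h * (\<Sum>b\<in>Basis. k' b z * pd b v (x - t *\<^sub>R z))) = (\<lambda>z. k z * (- h * (z \<bullet> grad v (x - t *\<^sub>R z))))"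
      by (auto simp: algebra_simps)
    have "(LINT z|lborel. h * (\<Sum>b\<in>Basis. k' b z * pd b v (x - t *\<^sub>R z))) = h * (\<Sum>b\<in>Basis. A (k' b) t (pd b v) x)"
      unfolding A_def using i by (simp add: sum_distrib_left)
    moreover have i2: "integrable lborel (\<lambda>z. k z * (- h * (z \<bullet> grad v (x - t *\<^sub>R z))))"
      unfolding e[symmetric] using i by simp
    ultimately have "A k (t + h) v x - A k t v x - h * (\<Sum>b\<in>Basis. A (k' b) t (pd b v) x)
      = (LINT z|lborel. k z * v (x - (t + h) *\<^sub>R z) - k z * v (x - t *\<^sub>R z) - k z * (- h * (z \<bullet> grad v (x - t *\<^sub>R z))))"
      using A_integrable[OF k vb, of x "t + h"] A_integrable[OF k vb, of x t]
      by (simp add: A_def e)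
    also have "\<bar>\<dots>\<bar> \<le> (LINT z|lborel. norm (k z) * (M * h\<^sup>2))"
      unfolding real_norm_def[symmetric]
    proof (rule Bochner_Integration.integral_norm_bound_integral)
      show "integrable lborel (\<lambda>z. k z * v (x - (t + h) *\<^sub>R z) - k z * v (x - t *\<^sub>R z) - k z * (- h * (z \<bullet> grad v (x - t *\<^sub>R z))))"
        using A_integrable[OF k vb, of x "t + h"] A_integrable[OF k vb, of x t] i2 by simp
      show "integrable lborel (\<lambda>z. norm (k z) * (M * h\<^sup>2))"
        using kern_integrable'[OF k] by (intro integrable_mult_left integrable_norm)
      fix z
      show "norm (k z * v (x - (t + h) *\<^sub>R z) - k z * v (x - t *\<^sub>R z) - k z * (- h * (z \<bullet> grad v (x - t *\<^sub>R z)))) \<le> norm (k z) * (M * h\<^sup>2)"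
      proof (cases "norm z > 1")
        case False
        have "\<bar>v (x - (t + h) *\<^sub>R z) - v (x - t *\<^sub>R z) - (- h * (z \<bullet> grad v (x - t *\<^sub>R z)))\<bar> \<le> M * (norm (h *\<^sub>R z))\<^sup>2"
          using M(2)[of "x - t *\<^sub>R z" "- h *\<^sub>R z"] by (simp add: algebra_simps)
        also have "\<dots> \<le> M * h\<^sup>2"
        proof -
          have "(norm z)\<^sup>2 \<le> 1" using False power_mono[of "norm z" 1 2] by simp
          then have "h\<^sup>2 * (norm z)\<^sup>2 \<le> h\<^sup>2 * 1" by (intro mult_left_mono) auto
          then show ?thesis using M(1) by (simp add: power_mult_distrib mult_left_mono)
        qed
        finally have "\<bar>k z\<bar> * \<bar>v (x - (t + h) *\<^sub>R z) - v (x - t *\<^sub>R z) - (- h * (z \<bullet> grad v (x - t *\<^sub>R z)))\<bar> \<le> \<bar>k z\<bar> * (M * h\<^sup>2)"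
          by (intro mult_left_mono) auto
        then show ?thesis by (simp add: abs_mult[symmetric] right_diff_distrib distrib_left)
      qed (use kern_zero[OF k] in auto)
    qed
    also have "\<dots> = kint k * M * h\<^sup>2" by (simp add: kint_def)
    finally show "\<bar>A k (t + h) v x - A k t v x - h * (\<Sum>b\<in>Basis. A (k' b) t (pd b v) x)\<bar> \<le> kint k * M * h\<^sup>2" .
  qed
qed

section \<open>The mollifier and its companion bump\<close>

definition nrm :: "'a::euclidean_space itself \<Rightarrow> real" where
  "nrm _ = inverse (LINT z|lborel. 2 * hfun (Suc 0) (1 - z \<bullet> (z::'a)))"

definition \<Psi> :: "'a::euclidean_space \<Rightarrow> real" where
  "\<Psi> z = nrm TYPE('a) * hfun 0 (1 - z \<bullet> z)"

text \<open>The gradient of \<open>hfun 0 (1 - z \<bullet> z)\<close> is -2z times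
  \<open>hfun (Suc 0) (1 - z \<bullet> z)\<close>. Taking \<open>\<rho>\<close> to be twice this
  second factor, normalized, makes it radial, nonnegative and smooth, with \<open>- z\<close> times
  \<open>\<rho>\<close> the gradient of the compactly supported \<open>\<Psi>\<close>.\<close>

definition \<rho> :: "'a::euclidean_space \<Rightarrow> real" where
  "\<rho> z = nrm TYPE('a) * (2 * hfun (Suc 0) (1 - z \<bullet> z))"

lemma kern_bump: "kern (\<lambda>z::'a::euclidean_space. c * hfun j (1 - z \<bullet> z))"
proof -
  have z: "hfun j (1 - z \<bullet> z) = 0" if "norm z > 1" for z :: 'a
  proof -
    have "1 < norm z * norm z" using that less_1_mult by blast
    then show ?thesis by (simp add: hfun_def dot_square_norm power2_eq_square)
  qed
  have "(\<lambda>z::'a. c * hfun j (1 - z \<bullet> z)) \<in> test_functions UNIV"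
    by (rule test_functionsI[of _ "cball 0 1"]) (auto intro!: C_diff_mult C_diff_const C_diff_hfun C_diff_norm_sq z)
  then show ?thesis using z by (auto simp: kern_def)
qed

lemma kern_\<Psi>: "kern \<Psi>"
  using kern_bump[of "nrm TYPE('a)" 0] by (simp add: \<Psi>_def[abs_def])

lemma kern_\<rho>: "kern (\<rho> :: 'a::euclidean_space \<Rightarrow> real)"
  using kern_bump[of "nrm TYPE('a) * 2" "Suc 0"] by (simp add: \<rho>_def[abs_def] mult.assoc)

text \<open>A nonnegative integrable function with integral 0 vanishes almost everywhere, but this
  one is positive on the open unit ball.\<close>

lemma bump_integral_pos: "0 < (LINT z|lborel. 2 * hfun (Suc 0) (1 - z \<bullet> (z::'a::euclidean_space)))"
proof -
  let ?f = "\<lambda>z::'a. 2 * hfun (Suc 0) (1 - z \<bullet> z)"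
  have i: "integrable lborel ?f" using kern_integrable'[OF kern_bump[of 2 "Suc 0"]] .
  have nn: "0 \<le> ?f z" for z by (simp add: hfun_1)
  have "(LINT z|lborel. ?f z) \<noteq> 0"
  proof
    assume "(LINT z|lborel. ?f z) = 0"
    then have "AE z in lborel. ?f z = 0"
      using integral_nonneg_eq_0_iff_AE[OF i] nn by auto
    then have "AE z in lborel. z \<notin> ball (0::'a) 1"
    proof (rule eventually_mono, intro notI)
      fix z :: 'a assume "?f z = 0" "z \<in> ball 0 1"
      moreover have "z \<bullet> z < 1" using \<open>z \<in> ball 0 1\<close> by (simp add: dot_square_norm abs_square_less_1)
      ultimately show False by (simp add: hfun_1)
    qed
    then have "ball (0::'a) 1 \<in> null_sets lborel"
      by (subst AE_iff_null_sets) auto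
    then have "negligible (ball (0::'a) 1)"
      using negligible_iff_null_sets null_sets_completionI by blast
    then show False using open_not_negligible[of "ball (0::'a) 1"] by simp
  qed
  moreover have "0 \<le> (LINT z|lborel. ?f z)" using nn by (intro Bochner_Integration.integral_nonneg) auto
  ultimately show ?thesis by simp
qed

lemma \<rho>_nonneg: "0 \<le> \<rho> z"
  using bump_integral_pos by (simp add: \<rho>_def nrm_def hfun_1 less_imp_le)

lemma \<rho>_integral: "(LINT z|lborel. \<rho> (z::'a::euclidean_space)) = 1"
  using bump_integral_pos[where 'a='a] unfolding \<rho>_def[abs_def] nrm_def by (simp del: integral_mult_right_zero add: integral_mult_right_zero[of lborel "inverse _"])

lemma \<rho>_kint: "kint (\<rho> :: 'a::euclidean_space \<Rightarrow> real) = 1"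
  using \<rho>_integral[where 'a='a] by (simp add: kint_def \<rho>_nonneg)

lemma \<rho>_cong: "norm x = norm y \<Longrightarrow> \<rho> x = \<rho> y" for x y :: "'a::euclidean_space"
  by (simp add: \<rho>_def dot_square_norm)

lemma \<rho>_minus: "\<rho> (- z) = \<rho> z"
  by (rule \<rho>_cong) simp

lemma \<rho>_pos: "norm z < 1 \<Longrightarrow> 0 < \<rho> (z::'a::euclidean_space)"
proof -
  assume "norm z < 1"
  then have "0 < 1 - z \<bullet> z" by (simp add: dot_square_norm abs_square_less_1)
  then have "0 < hfun (Suc 0) (1 - z \<bullet> z)" by (simp add: hfun_1)
  moreover have "0 < nrm TYPE('a)" using bump_integral_pos[where 'a='a] by (simp only: nrm_def positive_imp_inverse_positive)
  ultimately show ?thesis by (simp add: \<rho>_def)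
qed

lemma pd_\<Psi>: "pd b (\<Psi> :: 'a::euclidean_space \<Rightarrow> real) z = - (z \<bullet> b) * \<rho> z"
proof -
  have "GDERIV (\<lambda>z::'a. 1 - z \<bullet> z) z :> (- 2) *\<^sub>R z"
    unfolding gderiv_def by (auto intro!: derivative_eq_intros simp: inner_commute)
  then have "GDERIV (\<lambda>z::'a. hfun 0 (1 - z \<bullet> z)) z :> hfun (Suc 0) (1 - z \<bullet> z) *\<^sub>R (- 2) *\<^sub>R z"
    using GDERIV_DERIV_compose hfun_DERIV by blast
  then have "GDERIV \<Psi> z :> nrm TYPE('a) *\<^sub>R (hfun (Suc 0) (1 - z \<bullet> z) *\<^sub>R (- 2) *\<^sub>R z)"
    unfolding gderiv_def \<Psi>_def[abs_def] by (auto intro!: derivative_eq_intros)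
  from grad_eqI[OF this] show ?thesis by (simp add: pd_def \<rho>_def)
qed

definition lap :: "('a::euclidean_space \<Rightarrow> real) \<Rightarrow> 'a \<Rightarrow> real" where
  "lap v x = (\<Sum>b\<in>Basis. pd b (pd b v) x)"

lemma smb_lap_bbor: "smb v \<Longrightarrow> bbor (lap v)"
  unfolding lap_def[abs_def] by (intro bbor_sum) (auto intro: smb_bbor smb_pd)

text \<open>\<open>DERIV_A\<close> yields averages of \<open>pd b v\<close> with the kernels
  \<open>pd b \<Psi>\<close>, and \<open>A_pd\<close> moves that derivative onto \<open>v\<close> at
  the price of a factor \<open>t\<close>; summing over \<open>b\<close> produces the
  Laplacian.\<close>

theorem A_\<rho>_DERIV:
  assumes v: "smb v"
  shows "((\<lambda>t. A \<rho> t v x) has_real_derivative t * A \<Psi> t (lap v) x) (at t)"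
proof -
  have "((\<lambda>t. A \<rho> t v x) has_real_derivative (\<Sum>b\<in>Basis. A (pd b \<Psi>) t (pd b v) x)) (at t)"
    using pd_\<Psi> by (intro DERIV_A kern_\<rho> kern_pd[OF kern_\<Psi>] v) auto
  also have "(\<Sum>b\<in>Basis. A (pd b \<Psi>) t (pd b v) x) = t * A \<Psi> t (lap v) x"
    unfolding lap_def[abs_def]
    using v by (simp add: A_pd[OF kern_\<Psi> smb_pd] sum_distrib_left[symmetric] A_sum[OF kern_\<Psi>] smb_bbor smb_pd)
  finally show ?thesis .
qed

lemma A_zero: "A \<rho> 0 v x = v x"
  using A_const[of \<rho> 0 "v x" x] by (simp add: A_def \<rho>_integral)

text \<open>The second difference of \<open>v\<close> over the parallelogram with sides
  \<open>h *\<^sub>R a\<close> and \<open>h *\<^sub>R b\<close> is symmetric in the two directions,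
  and it equals \<open>h\<^sup>2\<close> times either mixed derivative up to order
  \<open>h ^ 3\<close>.\<close>

lemma pd_commute:
  assumes v: "smb v" and a: "a \<in> Basis" and b: "b \<in> Basis"
  shows "pd a (pd b v) x = pd b (pd a v) x"
proof -
  have main: "\<exists>C\<ge>0. \<forall>h>0. \<bar>(v (x + h *\<^sub>R a + h *\<^sub>R b) - v (x + h *\<^sub>R a)) - (v (x + h *\<^sub>R b) - v x) - h\<^sup>2 * pd b (pd a v) x\<bar> \<le> C * h ^ 3"
    if a: "a \<in> Basis" and b: "b \<in> Basis" for a b
  proof -
    let ?w = "pd a v"
    have w: "smb ?w" using smb_pd v a by blast
    obtain L where L: "0 \<le> L" "\<And>x h. \<bar>?w (x + h) - ?w x - h \<bullet> grad ?w x\<bar> \<le> L * (norm h)\<^sup>2"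
      using smb_quad[OF w] by metis
    obtain M where M: "0 \<le> M" "\<And>x y. \<bar>pd b ?w x - pd b ?w y\<bar> \<le> M * norm (x - y)"
      using smb_lip[OF smb_pd[OF w b]] by metis
    have "\<bar>(v (x + h *\<^sub>R a + h *\<^sub>R b) - v (x + h *\<^sub>R a)) - (v (x + h *\<^sub>R b) - v x) - h\<^sup>2 * pd b ?w x\<bar> \<le> (L + M) * h ^ 3"
      if h: "0 < h" for h
    proof -
      let ?g = "\<lambda>s. v (x + s *\<^sub>R a + h *\<^sub>R b) - v (x + s *\<^sub>R a)"
      have d: "((\<lambda>s. v (y + s *\<^sub>R a)) has_real_derivative ?w (y + s *\<^sub>R a)) (at s)" for y s
      proof -
        have "(v has_derivative (\<lambda>h. h \<bullet> grad v (y + s *\<^sub>R a))) (at (y + s *\<^sub>R a))"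
          using smb_GDERIV[OF v] unfolding gderiv_def .
        moreover have "((\<lambda>s. y + s *\<^sub>R a) has_derivative (\<lambda>h. h *\<^sub>R a)) (at s)"
          by (auto intro!: derivative_eq_intros)
        ultimately have "((\<lambda>s. v (y + s *\<^sub>R a)) has_derivative (\<lambda>h. (h *\<^sub>R a) \<bullet> grad v (y + s *\<^sub>R a))) (at s)"
          using has_derivative_compose by blast
        then show ?thesis
          by (simp add: has_field_derivative_def pd_def inner_commute mult.commute[of _ "_ \<bullet> _"])
      qed
      have "((\<lambda>s. v (x + s *\<^sub>R a + h *\<^sub>R b)) has_real_derivative ?w (x + s *\<^sub>R a + h *\<^sub>R b)) (at s)" for s
        using d[of "x + h *\<^sub>R b" s] by (simp add: add_ac)
      then have "\<And>s. (?g has_real_derivative ?w (x + s *\<^sub>R a + h *\<^sub>R b) - ?w (x + s *\<^sub>R a)) (at s)"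
        using d by (intro DERIV_diff)
      \<comment> \<open>The mean value theorem is used along \<open>a\<close> only; the remaining
        increment along \<open>b\<close> is expanded to second order by \<open>L\<close>, and
        \<open>M\<close> moves the base point back to \<open>x\<close>.\<close>
      then obtain \<xi> where \<xi>: "0 < \<xi>" "\<xi> < h" "?g h - ?g 0 = (h - 0) * (?w (x + \<xi> *\<^sub>R a + h *\<^sub>R b) - ?w (x + \<xi> *\<^sub>R a))"
        using MVT2[OF h, of ?g "\<lambda>s. ?w (x + s *\<^sub>R a + h *\<^sub>R b) - ?w (x + s *\<^sub>R a)"] by metis
      have 1: "\<bar>?w (x + \<xi> *\<^sub>R a + h *\<^sub>R b) - ?w (x + \<xi> *\<^sub>R a) - h * pd b ?w (x + \<xi> *\<^sub>R a)\<bar> \<le> L * h\<^sup>2"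
        using L(2)[of "x + \<xi> *\<^sub>R a" "h *\<^sub>R b"] b by (simp add: pd_def[of b ?w] inner_commute)
      have 2: "\<bar>pd b ?w (x + \<xi> *\<^sub>R a) - pd b ?w x\<bar> \<le> M * h"
        using M(2)[of "x + \<xi> *\<^sub>R a" x] mult_left_mono[OF less_imp_le[OF \<xi>(2)] M(1)] \<xi>(1) a by simp
      let ?X = "?w (x + \<xi> *\<^sub>R a + h *\<^sub>R b) - ?w (x + \<xi> *\<^sub>R a)" and ?P = "pd b ?w (x + \<xi> *\<^sub>R a)" and ?Q = "pd b ?w x"
      have "\<bar>h * ?X - h\<^sup>2 * ?Q\<bar> = \<bar>h * (?X - h * ?P) + h\<^sup>2 * (?P - ?Q)\<bar>"
        by (simp add: algebra_simps power2_eq_square)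
      also have "\<dots> \<le> h * \<bar>?X - h * ?P\<bar> + h\<^sup>2 * \<bar>?P - ?Q\<bar>"
        using h by (intro order_trans[OF abs_triangle_ineq]) (simp add: abs_mult)
      also have "\<dots> \<le> h * (L * h\<^sup>2) + h\<^sup>2 * (M * h)"
        using 1 2 h by (intro add_mono mult_left_mono) auto
      also have "\<dots> = (L + M) * h ^ 3" by (simp add: algebra_simps power2_eq_square power3_eq_cube)
      finally show ?thesis using \<xi>(3) by simp
    qed
    then show ?thesis using L M by (intro exI[of _ "L + M"]) auto
  qed
  obtain C where C: "0 \<le> C" "\<And>h. h > 0 \<Longrightarrow> \<bar>(v (x + h *\<^sub>R a + h *\<^sub>R b) - v (x + h *\<^sub>R a)) - (v (x + h *\<^sub>R b) - v x) - h\<^sup>2 * pd b (pd a v) x\<bar> \<le> C * h ^ 3"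
    using main[OF a b] by metis
  obtain D where D: "0 \<le> D" "\<And>h. h > 0 \<Longrightarrow> \<bar>(v (x + h *\<^sub>R b + h *\<^sub>R a) - v (x + h *\<^sub>R b)) - (v (x + h *\<^sub>R a) - v x) - h\<^sup>2 * pd a (pd b v) x\<bar> \<le> D * h ^ 3"
    using main[OF b a] by metis
  define E where "E = pd a (pd b v) x - pd b (pd a v) x"
  have E: "\<bar>E\<bar> \<le> (C + D) * h" if h: "h > 0" for h
  proof -
    have "\<bar>h\<^sup>2 * E\<bar> \<le> (C + D) * h ^ 3"
      using C(2)[OF h] D(2)[OF h] unfolding E_def by (simp add: add_ac algebra_simps)
    then have "h\<^sup>2 * \<bar>E\<bar> \<le> h\<^sup>2 * ((C + D) * h)" by (simp add: abs_mult power2_eq_square power3_eq_cube mult_ac)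
    then show ?thesis using h by simp
  qed
  have "E = 0"
  proof (rule ccontr)
    assume "E \<noteq> 0"
    have "\<bar>E\<bar> \<le> (C + D) * (\<bar>E\<bar> / (2 * (C + D + 1)))"
      using \<open>E \<noteq> 0\<close> C D by (intro E) auto
    also have "\<dots> \<le> (C + D + 1) * (\<bar>E\<bar> / (2 * (C + D + 1)))"
      using C D by (intro mult_right_mono) auto
    also have "\<dots> = \<bar>E\<bar> / 2" using C D by (simp add: field_simps)
    finally show False using \<open>E \<noteq> 0\<close> by simp
  qed
  then show ?thesis by (simp add: E_def)
qed

text \<open>Since derivatives commute, \<open>pd i\<close> and \<open>pd j\<close> can both be moved
  from under the Laplacian to the kernel. The scale derivative for second derivatives of
  \<open>v\<close> is thus governed by \<open>lap v\<close> alone.\<close>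

lemma A_lap_pd2:
  assumes v: "smb v" and i: "i \<in> Basis" and j: "j \<in> Basis"
  shows "t\<^sup>2 * A \<Psi> t (lap (pd i (pd j v))) x = A (pd j (pd i \<Psi>)) t (lap v) x"
proof -
  have c: "pd b (pd b (pd i (pd j v))) = pd i (pd j (pd b (pd b v)))" if b: "b \<in> Basis" for b
  proof -
    have *: "pd a (pd c w) = pd c (pd a w)" if "smb w" "a \<in> Basis" "c \<in> Basis" for a c and w :: "'a \<Rightarrow> real"
      using pd_commute[OF that] by (rule ext)
    have "pd b (pd b (pd i (pd j v))) = pd b (pd i (pd b (pd j v)))"
      using *[OF smb_pd[OF v j] b i] by simp
    also have "\<dots> = pd i (pd b (pd b (pd j v)))" using *[OF smb_pd[OF smb_pd[OF v j] b] b i] by simp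
    also have "\<dots> = pd i (pd b (pd j (pd b v)))" using *[OF v b j] by simp
    also have "\<dots> = pd i (pd j (pd b (pd b v)))" using *[OF smb_pd[OF v b] b j] by simp
    finally show ?thesis .
  qed
  have "t\<^sup>2 * A \<Psi> t (pd i (pd j (pd b (pd b v)))) x = A (pd j (pd i \<Psi>)) t (pd b (pd b v)) x" if b: "b \<in> Basis" for b
    using smb_pd[OF smb_pd[OF v b] b] i j
    by (simp add: A_pd[OF kern_\<Psi>, symmetric] A_pd[OF kern_pd[OF kern_\<Psi> i]] A_pd[OF kern_\<Psi> smb_pd] power2_eq_square)
  then have "t\<^sup>2 * (\<Sum>b\<in>Basis. A \<Psi> t (pd b (pd b (pd i (pd j v)))) x) = (\<Sum>b\<in>Basis. A (pd j (pd i \<Psi>)) t (pd b (pd b v)) x)"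
    by (simp add: sum_distrib_left c)
  then show ?thesis
    unfolding lap_def[abs_def]
    using v i j by (simp add: A_sum[OF kern_\<Psi>] A_sum[OF kern_pd[OF kern_pd[OF kern_\<Psi> i] j]] smb_bbor smb_pd)
qed

subsection \<open>Convolution with test functions\<close>

definition cv :: "('a::euclidean_space \<Rightarrow> real) \<Rightarrow> ('a \<Rightarrow> real) \<Rightarrow> 'a \<Rightarrow> real" where
  "cv u k x = (LINT y|lborel. u y * k (x - y))"

lemma cv_integrable:
  assumes u: "integrable lborel u" and k: "smb k"
  shows "integrable lborel (\<lambda>y. u y * k (x - y))"
proof -
  obtain B where B: "0 \<le> B" "\<And>x. \<bar>k x\<bar> \<le> B" using smb_bdd[OF k] by metis
  show ?thesis
  proof (rule Bochner_Integration.integrable_bound)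
    show "integrable lborel (\<lambda>y. u y * B)" using u by simp
    show "(\<lambda>y. u y * k (x - y)) \<in> borel_measurable lborel"
      using u smb_measurable[OF k] by measurable
    show "AE y in lborel. norm (u y * k (x - y)) \<le> norm (u y * B)"
      using B by (intro AE_I2) (simp add: abs_mult mult_left_mono)
  qed
qed

text \<open>The quadratic remainder of \<open>k\<close> is uniform in the base point, so integrating
  it against the absolute value of \<open>u\<close> keeps it quadratic.\<close>

lemma cv_GDERIV:
  assumes u: "integrable lborel u" and k: "smb k"
  shows "GDERIV (cv u k) x :> (\<Sum>b\<in>Basis. cv u (pd b k) x *\<^sub>R b)"
proof -
  obtain L where L: "0 \<le> L" "\<And>x h. \<bar>k (x + h) - k x - h \<bullet> grad k x\<bar> \<le> L * (norm h)\<^sup>2"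
    using smb_quad[OF k] by metis
  show ?thesis
  proof (rule GDERIV_quad[where C = "(LINT y|lborel. \<bar>u y\<bar>) * L"])
    fix h :: 'a
    have i: "integrable lborel (\<lambda>y. (h \<bullet> b) * (u y * pd b k (x - y)))" if "b \<in> Basis" for b
      using cv_integrable[OF u smb_pd[OF k that]] by simp
    have e: "(\<Sum>b\<in>Basis. (h \<bullet> b) * (u y * pd b k (x - y))) = u y * (h \<bullet> grad k (x - y))" for y
      by (simp add: euclidean_inner[of h "grad k _"] pd_def sum_distrib_left mult_ac)
    have "h \<bullet> (\<Sum>b\<in>Basis. cv u (pd b k) x *\<^sub>R b) = (\<Sum>b\<in>Basis. (h \<bullet> b) * cv u (pd b k) x)"
      by (simp add: inner_sum_right mult.commute)
    also have "\<dots> = (LINT y|lborel. (\<Sum>b\<in>Basis. (h \<bullet> b) * (u y * pd b k (x - y))))"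
      using i by (subst Bochner_Integration.integral_sum) (auto simp: cv_def)
    also have "\<dots> = (LINT y|lborel. u y * (h \<bullet> grad k (x - y)))" by (simp add: e)
    finally have e1: "h \<bullet> (\<Sum>b\<in>Basis. cv u (pd b k) x *\<^sub>R b) = (LINT y|lborel. u y * (h \<bullet> grad k (x - y)))" .
    have i1: "integrable lborel (\<lambda>y. u y * (h \<bullet> grad k (x - y)))"
      unfolding e[symmetric] using i by simp
    have "cv u k (x + h) - cv u k x - h \<bullet> (\<Sum>b\<in>Basis. cv u (pd b k) x *\<^sub>R b)
      = (LINT y|lborel. u y * k (x + h - y) - u y * k (x - y) - u y * (h \<bullet> grad k (x - y)))"
      unfolding e1 using cv_integrable[OF u k, of "x + h"] cv_integrable[OF u k, of x] i1 by (simp add: cv_def)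
    also have "\<bar>\<dots>\<bar> \<le> (LINT y|lborel. \<bar>u y\<bar> * (L * (norm h)\<^sup>2))"
      unfolding real_norm_def[symmetric]
    proof (rule Bochner_Integration.integral_norm_bound_integral)
      show "integrable lborel (\<lambda>y. u y * k (x + h - y) - u y * k (x - y) - u y * (h \<bullet> grad k (x - y)))"
        using cv_integrable[OF u k, of "x + h"] cv_integrable[OF u k, of x] i1 by simp
      show "integrable lborel (\<lambda>y. norm (u y) * (L * (norm h)\<^sup>2))" using u by simp
      fix y
      have "\<bar>k (x + h - y) - k (x - y) - (h \<bullet> grad k (x - y))\<bar> \<le> L * (norm h)\<^sup>2"
        using L(2)[of "x - y" h] by (simp add: algebra_simps)
      then show "norm (u y * k (x + h - y) - u y * k (x - y) - u y * (h \<bullet> grad k (x - y))) \<le> norm (u y) * (L * (norm h)\<^sup>2)"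
        by (simp add: right_diff_distrib[symmetric] abs_mult mult_left_mono)
    qed
    also have "\<dots> = (LINT y|lborel. \<bar>u y\<bar>) * L * (norm h)\<^sup>2" by simp
    finally show "\<bar>cv u k (x + h) - cv u k x - h \<bullet> (\<Sum>b\<in>Basis. cv u (pd b k) x *\<^sub>R b)\<bar> \<le> (LINT y|lborel. \<bar>u y\<bar>) * L * (norm h)\<^sup>2" .
  qed
qed

lemma cv_pd: "integrable lborel u \<Longrightarrow> smb k \<Longrightarrow> b \<in> Basis \<Longrightarrow> pd b (cv u k) = cv u (pd b k)"
  using grad_eqI[OF cv_GDERIV[of u k]] by (auto simp: pd_def[abs_def] inner_sum_left inner_Basis if_distrib cong: if_cong)

lemma cv_bdd:
  assumes "integrable lborel u" "smb k" shows "bounded (range (cv u k))"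
proof -
  obtain B where B: "0 \<le> B" "\<And>x. \<bar>k x\<bar> \<le> B" using smb_bdd[OF assms(2)] by metis
  have "norm (cv u k x) \<le> (LINT y|lborel. \<bar>u y\<bar> * B)" for x
    unfolding cv_def
  proof (rule Bochner_Integration.integral_norm_bound_integral)
    show "norm (u y * k (x - y)) \<le> \<bar>u y\<bar> * B" for y using B by (simp add: abs_mult mult_left_mono)
  qed (use cv_integrable[OF assms] assms in auto)
  then show ?thesis by (auto simp: bounded_iff)
qed

text \<open>All derivatives of the convolution fall on \<open>k\<close>, so the derivative formula
  reproduces the shape of the function and the coinduction closes. An integrable function becomes
  smooth in this way.\<close>

lemma smb_cv: "integrable lborel u \<Longrightarrow> smb k \<Longrightarrow> smb (cv u k)"
proof (coinduction arbitrary: k)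
  case smb
  define G where "G x = (\<Sum>b\<in>Basis. cv u (pd b k) x *\<^sub>R b)" for x
  have e: "(\<lambda>x. G x \<bullet> b) = cv u (pd b k)" if "b \<in> Basis" for b
    using that by (auto simp: G_def inner_sum_left inner_Basis if_distrib cong: if_cong)
  show ?case
    by (rule exI[of _ "cv u k"], rule exI[of _ G])
       (use smb cv_bdd[OF smb] cv_GDERIV[OF smb] smb_pd[OF smb(2)] e G_def in auto)
qed

definition scl :: "real \<Rightarrow> ('a::euclidean_space \<Rightarrow> real) \<Rightarrow> 'a \<Rightarrow> real" where
  "scl e k x = k (x /\<^sub>R e) / e ^ DIM('a)"

lemma A_eq_cv:
  fixes u :: "'a::euclidean_space \<Rightarrow> real"
  assumes k: "kern k" and u: "u \<in> borel_measurable borel" and e: "0 < e"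
  shows "A k e u x = cv u (scl e k) x"
proof -
  have m: "(\<lambda>y. u y * scl e k (x - y)) \<in> borel_measurable borel"
    using u smb_measurable[OF kern_smb[OF k]] unfolding scl_def[abs_def] by measurable
  show ?thesis
    using lborel_integral_affine(1)[OF _ m, of "- e" x] e
    by (simp add: cv_def A_def scl_def mult.commute)
qed

lemma scl_test:
  assumes k: "kern k" and e: "0 < e" and sub: "cball x e \<subseteq> \<Omega>"
  shows "(\<lambda>y. scl e k (x - y)) \<in> test_functions \<Omega>" "scl e k \<in> test_functions UNIV"
proof -
  have c: "C_diff m UNIV k" for m using k by (auto simp: kern_def test_functions_def)
  have d: "C_diff m UNIV (\<lambda>y. (1 / e ^ DIM('a)) * k (c *\<^sub>R y + d))" for m c d
    by (intro C_diff_mult C_diff_const C_diff_affine c)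
  show "(\<lambda>y. scl e k (x - y)) \<in> test_functions \<Omega>"
  proof (rule test_functionsI[OF _ compact_cball sub])
    show "C_diff m UNIV (\<lambda>y. scl e k (x - y))" for m
      using d[of m "- inverse e" "x /\<^sub>R e"] by (simp add: scl_def scaleR_diff_right)
    show "scl e k (x - y) = 0" if "y \<notin> cball x e" for y
      using that e kern_zero[OF k, of "(x - y) /\<^sub>R e"] by (simp add: scl_def dist_norm divide_simps)
  qed
  show "scl e k \<in> test_functions UNIV"
  proof (rule test_functionsI[OF _ compact_cball[of 0 e]])
    show "C_diff m UNIV (scl e k)" for m
      using d[of m "inverse e" 0] by (simp add: scl_def[abs_def])
    show "scl e k y = 0" if "y \<notin> cball 0 e" for y
      using that e kern_zero[OF k, of "y /\<^sub>R e"] by (simp add: scl_def divide_simps)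
  qed auto
qed

lemma smb_A:
  assumes "kern k" "u \<in> borel_measurable borel" "integrable lborel u" "0 < e"
  shows "smb (A k e u)"
proof -
  have "A k e u = cv u (scl e k)" using A_eq_cv assms by blast
  then show ?thesis using smb_cv[OF assms(3) test_smb[OF scl_test(2)[OF assms(1,4) subset_UNIV]]] by simp
qed

section \<open>Weak gradients\<close>

lemma test_functions_times:
  assumes "\<phi> \<in> test_functions \<Omega>" "\<And>k. C_diff k UNIV g"
  shows "(\<lambda>x. \<phi> x * g x) \<in> test_functions \<Omega>"
proof -
  obtain K where K: "compact K" "K \<subseteq> \<Omega>" "\<And>x. x \<notin> K \<Longrightarrow> \<phi> x = 0" "\<And>k. C_diff k UNIV \<phi>"
    by (metis test_functionsE[OF assms(1)])
  then show ?thesis using assms by (intro test_functionsI[of _ K]) (auto intro: C_diff_mult)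
qed

lemma hfun_tendsto: "(\<lambda>n. hfun 0 (real (Suc n) * t)) \<longlonglongrightarrow> (if t > 0 then 1 else 0)"
proof (cases "t > 0")
  case True
  have "(\<lambda>n. exp (- ((1 / t) * inverse (real (Suc n))))) \<longlonglongrightarrow> exp (- ((1 / t) * 0))"
    by (intro tendsto_intros LIMSEQ_inverse_real_of_nat)
  moreover have "hfun 0 (real (Suc n) * t) = exp (- ((1 / t) * inverse (real (Suc n))))" for n
    using True by (simp add: hfun_def divide_inverse mult.commute del: of_nat_Suc)
  ultimately show ?thesis using True by simp
next
  case False
  then have "hfun 0 (real (Suc n) * t) = 0" for n
    using mult_nonneg_nonpos[of "real (Suc n)" t] by (simp add: hfun_def not_less)
  then show ?thesis using False by simp
qed

text \<open>A product over the coordinates of one-sided cutoffs \<open>hfun 0\<close>, steepened by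
  \<open>Suc n\<close>. The limit is the open box because \<open>hfun 0\<close> vanishes at 0, while
  the support is only known to lie in the closed box.\<close>

lemma box_indicator_approx:
  fixes a b :: "'a::euclidean_space"
  obtains \<eta> :: "nat \<Rightarrow> 'a \<Rightarrow> real" where
    "\<And>n \<Omega>. cbox a b \<subseteq> \<Omega> \<Longrightarrow> \<eta> n \<in> test_functions \<Omega>" "\<And>n x. 0 \<le> \<eta> n x" "\<And>n x. \<eta> n x \<le> indicator (cbox a b) x"
    "\<And>x. (\<lambda>n. \<eta> n x) \<longlonglongrightarrow> indicator (box a b) x"
proof -
  define \<eta> where "\<eta> n x = (\<Prod>i\<in>Basis. hfun 0 (real (Suc n) * (x \<bullet> i - a \<bullet> i)) * hfun 0 (real (Suc n) * (b \<bullet> i - x \<bullet> i)))" for n x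
  have z: "\<eta> n x = 0" if nx: "x \<notin> cbox a b" for n x
  proof -
    obtain i where i: "i \<in> Basis" "x \<bullet> i < a \<bullet> i \<or> b \<bullet> i < x \<bullet> i" using nx by (auto simp: mem_box not_le)
    have "hfun 0 (real (Suc n) * (x \<bullet> i - a \<bullet> i)) * hfun 0 (real (Suc n) * (b \<bullet> i - x \<bullet> i)) = 0"
      using i(2) by (auto simp: hfun_def zero_less_mult_iff)
    then show ?thesis unfolding \<eta>_def using i(1) by (intro prod_zero) auto
  qed
  have q1: "C_diff k UNIV (\<lambda>x. real (Suc n) * (x \<bullet> i - a \<bullet> i))" for k n i
    using C_diff_add[OF C_diff_mult[OF C_diff_const[of k UNIV "real (Suc n)"] C_diff_inner[of k UNIV i]] C_diff_const[of k UNIV "- real (Suc n) * (a \<bullet> i)"]]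
    by (simp add: right_diff_distrib del: of_nat_Suc)
  have q2: "C_diff k UNIV (\<lambda>x. real (Suc n) * (b \<bullet> i - x \<bullet> i))" for k n i
    using C_diff_add[OF C_diff_mult[OF C_diff_const[of k UNIV "- real (Suc n)"] C_diff_inner[of k UNIV i]] C_diff_const[of k UNIV "real (Suc n) * (b \<bullet> i)"]]
    by (simp add: right_diff_distrib add.commute del: of_nat_Suc)
  have c: "C_diff k UNIV (\<eta> n)" for k n
    unfolding \<eta>_def[abs_def] by (rule C_diff_prod[OF finite_Basis], rule C_diff_mult; rule C_diff_hfun; rule q1 q2)
  show thesis
  proof
    show "\<eta> n \<in> test_functions \<Omega>" if "cbox a b \<subseteq> \<Omega>" for n \<Omega>
      using c z that by (intro test_functionsI[of _ "cbox a b"]) (auto intro: compact_cbox)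
    show 0: "0 \<le> \<eta> n x" for n x
      unfolding \<eta>_def by (intro prod_nonneg) (auto simp: hfun_0_bounds)
    show "\<eta> n x \<le> indicator (cbox a b) x" for n x
    proof (cases "x \<in> cbox a b")
      case True
      have "\<eta> n x \<le> 1" unfolding \<eta>_def by (intro prod_le_1) (auto simp: hfun_0_bounds mult_le_one)
      then show ?thesis using True by simp
    qed (simp add: z)
    show "(\<lambda>n. \<eta> n x) \<longlonglongrightarrow> indicator (box a b) x" for x
    proof -
      have "(\<lambda>n. \<eta> n x) \<longlonglongrightarrow> (\<Prod>i\<in>Basis. (if x \<bullet> i - a \<bullet> i > 0 then 1 else 0) * (if b \<bullet> i - x \<bullet> i > 0 then 1 else 0))"
        unfolding \<eta>_def by (intro tendsto_prod tendsto_mult hfun_tendsto)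
      also have "(\<Prod>i\<in>Basis. (if x \<bullet> i - a \<bullet> i > 0 then 1 else 0) * (if b \<bullet> i - x \<bullet> i > 0 then 1 else (0::real))) = indicator (box a b) x"
      proof (cases "x \<in> box a b")
        case True
        then show ?thesis by (auto simp: mem_box)
      next
        case False
        then obtain i where "i \<in> Basis" "\<not> (a \<bullet> i < x \<bullet> i \<and> x \<bullet> i < b \<bullet> i)" by (auto simp: mem_box)
        then show ?thesis using False by (subst prod_zero) (auto intro!: bexI[of _ i])
      qed
      finally show ?thesis .
    qed
  qed
qed

text \<open>Cutoffs converge to boxes, so the box integrals of \<open>H\<close> vanish. Boxes
  generate the Borel sets and are closed under intersection, hence the integral over every Borel
  part of a box vanishes and \<open>H\<close> is 0 there almost everywhere. Countably many boxes
  cover \<open>U\<close>.\<close>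

lemma du_bois_reymond_lborel:
  fixes H :: "'a::euclidean_space \<Rightarrow> real"
  assumes U: "open U" and H: "H \<in> borel_measurable borel"
    and int: "\<And>a b. cbox a b \<subseteq> U \<Longrightarrow> set_integrable lborel (cbox a b) H"
    and zero: "\<And>\<phi>. \<phi> \<in> test_functions U \<Longrightarrow> (LINT x|lborel. H x * \<phi> x) = 0"
  shows "AE x in lborel. x \<in> U \<longrightarrow> H x = 0"
proof -
  have box0: "(LINT x:box a b|lborel. H x) = 0" if ab: "cbox a b \<subseteq> U" for a b
  proof -
    obtain \<eta> :: "nat \<Rightarrow> 'a \<Rightarrow> real" where \<eta>: "\<And>n \<Omega>. cbox a b \<subseteq> \<Omega> \<Longrightarrow> \<eta> n \<in> test_functions \<Omega>" "\<And>n x. 0 \<le> \<eta> n x"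
      "\<And>n x. \<eta> n x \<le> indicator (cbox a b) x" "\<And>x. (\<lambda>n. \<eta> n x) \<longlonglongrightarrow> indicator (box a b) x"
      using box_indicator_approx[of a b] by blast
    have "(\<lambda>n. LINT x|lborel. H x * \<eta> n x) \<longlonglongrightarrow> (LINT x|lborel. H x * indicator (box a b) x)"
    proof (rule integral_dominated_convergence)
      show "integrable lborel (\<lambda>x. \<bar>H x\<bar> * indicator (cbox a b) x)"
        using integrable_norm[OF int[OF ab, unfolded set_integrable_def]] by (simp add: abs_mult mult.commute)
      show "(\<lambda>x. H x * \<eta> n x) \<in> borel_measurable lborel" for n
        using H smb_measurable[OF test_smb[OF \<eta>(1)[OF ab]]] by measurable
      show "AE x in lborel. norm (H x * \<eta> n x) \<le> \<bar>H x\<bar> * indicator (cbox a b) x" for n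
        using \<eta>(2,3) by (intro AE_I2) (simp add: abs_mult mult_left_mono)
      show "AE x in lborel. (\<lambda>n. H x * \<eta> n x) \<longlonglongrightarrow> H x * indicator (box a b) x"
        using \<eta>(4) by (intro AE_I2 tendsto_mult) auto
    qed (use H in measurable)
    then have "(LINT x|lborel. H x * indicator (box a b) x) = 0"
      using zero[OF \<eta>(1)[OF ab]] by (simp add: LIMSEQ_const_iff)
    then show ?thesis by (simp add: set_lebesgue_integral_def mult.commute)
  qed
  have ae: "AE x in lborel. x \<in> box a b \<longrightarrow> H x = 0" if ab: "cbox a b \<subseteq> U" for a b
  proof -
    define h where "h x = indicator (box a b) x * H x" for x
    have hi: "integrable lborel h"
      using set_integrable_subset[OF int[OF ab], of "box a b"] box_subset_cbox[of a b]
      by (simp add: h_def[abs_def] set_integrable_def)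
    have "(LINT x:A|lborel. h x) = 0" if "A \<in> sets borel" for A
    proof -
      have si: "set_integrable lborel A h" if "A \<in> sets borel" for A
        using integrable_mult_indicator[of A lborel h] that hi by (simp add: set_integrable_def)
      have Int_stable: "Int_stable (range (\<lambda>(a, b). box a b :: 'a set))"
        by (auto simp: Int_stable_def box_Int_box)
      have mem: "A \<in> sigma_sets UNIV (range (\<lambda>(a, b). box a b))" using that unfolding borel_eq_box by simp
      have sub: "range (\<lambda>(a, b). box a b :: 'a set) \<subseteq> Pow UNIV" by simp
      show ?thesis using Int_stable sub mem
      proof (induction rule: sigma_sets_induct_disjoint)
        case (basic A)
        then obtain c d where A: "A = box c d" by auto
        \<comment> \<open>The same corners serve the open and the closed boxes, so
          \<open>cbox c' d'\<close> stays inside \<open>U\<close> and \<open>box0\<close> applies to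
          the intersection.\<close>
        obtain c' d' where cd: "box c d \<inter> box a b = box c' d'" "cbox c d \<inter> cbox a b = cbox c' d'"
          by (auto simp: box_Int_box Int_interval)
        have "(LINT x:A|lborel. h x) = (LINT x:box c' d'|lborel. H x)"
          unfolding A cd(1)[symmetric] set_lebesgue_integral_def h_def by (simp add: indicator_inter_arith mult.assoc)
        then show ?case using box0[of c' d'] cd(2) ab by auto
      next
        case (compl A)
        then have A: "A \<in> sets borel" by (simp add: borel_eq_box)
        have "(LINT x|lborel. h x) = 0"
          using box0[OF ab] by (simp add: h_def set_lebesgue_integral_def)
        moreover have "(LINT x:UNIV - A|lborel. h x) = (LINT x|lborel. h x) - (LINT x:A|lborel. h x)"
        proof -
          have "(LINT x:UNIV - A|lborel. h x) = (LINT x|lborel. h x - indicator A x *\<^sub>R h x)"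
            unfolding set_lebesgue_integral_def by (intro Bochner_Integration.integral_cong) (auto simp: indicator_def)
          then show ?thesis using hi si[OF A] by (simp add: set_lebesgue_integral_def set_integrable_def)
        qed
        ultimately show ?case using compl by simp
      next
        case (union F)
        then have F: "\<And>i. F i \<in> sets borel" by (simp add: borel_eq_box subset_eq)
        have "(LINT x:(\<Union>i. F i)|lborel. h x) = (\<Sum>i. (LINT x:(F i)|lborel. h x))"
          using F union(1) by (intro lebesgue_integral_countable_add si) (auto simp: disjoint_family_on_def)
        then show ?case using union by simp
      qed (simp add: set_lebesgue_integral_def)
    qed
    then have "AE x in lborel. h x = 0"
      using hi by (intro density_unique_real) (auto simp: set_lebesgue_integral_def)
    then show ?thesis by (rule eventually_mono) (auto simp: h_def indicator_def split: if_splits)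
  qed
  define F where "F = {box a b |a b. cbox a b \<subseteq> U}"
  obtain F' where F': "F' \<subseteq> F" "countable F'" "\<Union>F' = \<Union>F"
    using Lindelof[of F] by (auto simp: F_def)
  have "U \<subseteq> \<Union>F"
    unfolding F_def using open_contains_cbox[OF U] by (smt (verit) UnionI mem_Collect_eq subsetI)
  then have "U \<subseteq> \<Union>F'" using F' by simp
  moreover have "AE x in lborel. \<forall>B\<in>F'. x \<in> B \<longrightarrow> H x = 0"
    using F' ae by (intro AE_ball_countable[THEN iffD2]) (auto simp: F_def)
  ultimately show ?thesis by (auto elim!: eventually_mono)
qed

lemma AE_lebesgue_iff:
  "AE x in lebesgue. P x \<Longrightarrow> AE x in (lborel :: 'a::euclidean_space measure). P x"
  by (rule AE_completion_iff[THEN iffD1])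

lemma smb_leb_measurable: "smb v \<Longrightarrow> v \<in> borel_measurable lebesgue"
  using smb_measurable by (intro measurable_completion) simp

text \<open>Reduction to a Borel representative: both the tests and the conclusion ignore null
  sets.\<close>

lemma du_bois_reymond:
  fixes H :: "'a::euclidean_space \<Rightarrow> real"
  assumes U: "open U" and H: "H \<in> borel_measurable lebesgue"
    and int: "\<And>a b. cbox a b \<subseteq> U \<Longrightarrow> set_integrable lebesgue (cbox a b) H"
    and zero: "\<And>\<phi>. \<phi> \<in> test_functions U \<Longrightarrow> (LINT x|lebesgue. H x * \<phi> x) = 0"
  shows "AE x in lebesgue. x \<in> U \<longrightarrow> H x = 0"
proof -
  obtain H' where H': "H' \<in> borel_measurable lborel" "AE x in lborel. H x = H' x"
    using completion_ex_borel_measurable_real[OF H] by auto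
  then have ae: "AE x in lebesgue. H x = H' x" by (intro AE_completion)
  have H'L: "H' \<in> borel_measurable lebesgue" using H'(1) by (rule measurable_completion)
  have "AE x in lborel. x \<in> U \<longrightarrow> H' x = 0"
  proof (rule du_bois_reymond_lborel[OF U])
    show "H' \<in> borel_measurable borel" using H'(1) by simp
    fix a b assume ab: "cbox a b \<subseteq> U"
    have "integrable lebesgue (\<lambda>x. indicator (cbox a b) x *\<^sub>R H' x) \<longleftrightarrow> integrable lebesgue (\<lambda>x. indicator (cbox a b) x *\<^sub>R H x)"
      using ae H H'L by (intro integrable_cong_AE borel_measurable_scaleR borel_measurable_indicator) auto
    then have "integrable lebesgue (\<lambda>x. indicator (cbox a b) x *\<^sub>R H' x)"
      using int[OF ab] by (simp add: set_integrable_def)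
    then show "set_integrable lborel (cbox a b) H'"
      unfolding set_integrable_def using H'(1) by (subst (asm) integrable_completion) auto
  next
    fix \<phi> assume \<phi>: "\<phi> \<in> test_functions U"
    have m: "\<phi> \<in> borel_measurable borel" using smb_measurable[OF test_smb[OF \<phi>]] .
    have "(LINT x|lborel. H' x * \<phi> x) = (LINT x|lebesgue. H' x * \<phi> x)"
      using H'(1) m by (intro integral_completion[symmetric]) simp
    also have "\<dots> = (LINT x|lebesgue. H x * \<phi> x)"
      using ae H H'L smb_leb_measurable[OF test_smb[OF \<phi>]] by (intro integral_cong_AE) auto
    finally show "(LINT x|lborel. H' x * \<phi> x) = 0" using zero[OF \<phi>] by simp
  qed
  then have "AE x in lebesgue. x \<in> U \<longrightarrow> H' x = 0" by (intro AE_completion)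
  with ae show ?thesis by eventually_elim auto
qed

section \<open>Integration by parts and the componentwise form of weak gradients\<close>

text \<open>Once the support is rescaled into the unit ball, this is \<open>A_pd\<close> applied to
  the constant function 1, whose derivative vanishes.\<close>

lemma test_integral_pd:
  assumes \<phi>: "\<phi> \<in> test_functions UNIV" and b: "b \<in> Basis"
  shows "(LINT x|lborel. pd b \<phi> x) = 0"
proof -
  obtain K where K: "compact K" "\<And>x. x \<notin> K \<Longrightarrow> \<phi> x = 0" "\<And>k. C_diff k UNIV \<phi>"
    by (metis test_functionsE[OF \<phi>])
  obtain R where R: "0 < R" "\<And>x. x \<in> K \<Longrightarrow> norm x \<le> R"
    using compact_imp_bounded[OF K(1)] bounded_pos by metis
  define k where "k z = \<phi> (R *\<^sub>R z)" for z
  have k0: "k z = 0" if "norm z > 1" for z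
    unfolding k_def using that R by (intro K(2)) (force simp: mult_le_cancel_left2 not_le)
  have "kern k"
    unfolding kern_def using C_diff_affine[OF K(3), of _ R 0] k0
    by (auto simp: k_def[abs_def] intro!: test_functionsI[of _ "cball 0 1"])
  moreover have one: "smb (\<lambda>x::'a. 1)"
    by (coinduction) (auto intro!: exI[of _ "\<lambda>x. 0"] GDERIV_const smb.intros[of "\<lambda>x. 0" "\<lambda>x. 0"] intro: smb.coinduct[of "\<lambda>v. v = (\<lambda>x. 0)"])
  ultimately have "A (pd b k) 1 (\<lambda>x. 1) 0 = 1 * A k 1 (pd b (\<lambda>x. 1)) 0"
    using A_pd b by blast
  moreover have "pd b (\<lambda>x::'a. 1) = (\<lambda>x. 0)"
    by (simp add: pd_def[abs_def] grad_eqI[OF GDERIV_const])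
  ultimately have "(LINT z|lborel. pd b k z) = 0" by (simp add: A_def)
  moreover have "pd b k z = R * pd b \<phi> (R *\<^sub>R z)" for z
  proof -
    have "(\<phi> has_derivative (\<lambda>h. h \<bullet> grad \<phi> (R *\<^sub>R z))) (at (R *\<^sub>R z))"
      using smb_GDERIV[OF test_smb[OF \<phi>]] unfolding gderiv_def .
    moreover have "((\<lambda>z. R *\<^sub>R z) has_derivative (\<lambda>h. R *\<^sub>R h)) (at z)"
      by (auto intro!: derivative_eq_intros)
    ultimately have "(k has_derivative (\<lambda>h. (R *\<^sub>R h) \<bullet> grad \<phi> (R *\<^sub>R z))) (at z)"
      using has_derivative_compose unfolding k_def[abs_def] by blast
    then have "GDERIV k z :> R *\<^sub>R grad \<phi> (R *\<^sub>R z)" unfolding gderiv_def by (simp add: mult.commute)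
    from grad_eqI[OF this] show ?thesis by (simp add: pd_def)
  qed
  ultimately have "(LINT z|lborel. pd b \<phi> (0 + R *\<^sub>R z)) = 0" using R by simp
  moreover have "pd b \<phi> \<in> borel_measurable borel" using smb_measurable smb_pd test_smb \<phi> b by blast
  ultimately show ?thesis using lborel_integral_affine(1)[of R "pd b \<phi>" 0] R by simp
qed

lemma pd_mult:
  assumes "smb f" "smb g" shows "pd b (\<lambda>x. f x * g x) x = f x * pd b g x + pd b f x * g x"
  using grad_eqI[OF GDERIV_mult[OF smb_GDERIV[OF assms(1)] smb_GDERIV[OF assms(2)]], of x]
  by (simp add: pd_def inner_add_left mult.commute)

lemma test_bounded_support:
  assumes "\<phi> \<in> test_functions \<Omega>"
  obtains B K where "0 \<le> B" "\<And>x. \<bar>\<phi> x\<bar> \<le> B * indicator K x" "compact K" "K \<subseteq> \<Omega>"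
proof -
  obtain K where K: "compact K" "K \<subseteq> \<Omega>" "\<And>x. x \<notin> K \<Longrightarrow> \<phi> x = 0" by (metis test_functionsE[OF assms])
  obtain B where B: "0 \<le> B" "\<And>x. \<bar>\<phi> x\<bar> \<le> B" using smb_bdd[OF test_smb[OF assms]] by metis
  show thesis using that[of B K] K B by (auto simp: indicator_def)
qed

lemma test_integrable:
  fixes g :: "'a::euclidean_space \<Rightarrow> 'b::euclidean_space"
  assumes \<phi>: "\<phi> \<in> test_functions \<Omega>" and g: "\<And>K. compact K \<Longrightarrow> K \<subseteq> \<Omega> \<Longrightarrow> set_integrable lebesgue K g"
  shows "integrable lebesgue (\<lambda>x. \<phi> x *\<^sub>R g x)"
proof -
  obtain B K where K: "0 \<le> B" "\<And>x. \<bar>\<phi> x\<bar> \<le> B * indicator K x" "compact K" "K \<subseteq> \<Omega>"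
    by (metis test_bounded_support[OF \<phi>])
  have i: "integrable lebesgue (\<lambda>x. indicator K x *\<^sub>R g x)"
    using g[OF K(3,4)] by (simp add: set_integrable_def)
  have e: "\<phi> x *\<^sub>R g x = \<phi> x *\<^sub>R (indicator K x *\<^sub>R g x)" for x using K(2)[of x] by (cases "x \<in> K") auto
  have "integrable lebesgue (\<lambda>x. \<phi> x *\<^sub>R (indicator K x *\<^sub>R g x))"
  proof (rule Bochner_Integration.integrable_bound)
    show "integrable lebesgue (\<lambda>x. B *\<^sub>R (indicator K x *\<^sub>R g x))" using i by (rule integrable_scaleR_right)
    show "(\<lambda>x. \<phi> x *\<^sub>R (indicator K x *\<^sub>R g x)) \<in> borel_measurable lebesgue"
      by (intro borel_measurable_scaleR[OF smb_leb_measurable[OF test_smb[OF \<phi>]] borel_measurable_integrable[OF i]])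
    show "AE x in lebesgue. norm (\<phi> x *\<^sub>R (indicator K x *\<^sub>R g x)) \<le> norm (B *\<^sub>R (indicator K x *\<^sub>R g x))"
    proof (rule AE_I2)
      fix x
      have "\<bar>\<phi> x\<bar> \<le> B" using K(1) K(2)[of x] by (cases "x \<in> K") auto
      then show "norm (\<phi> x *\<^sub>R (indicator K x *\<^sub>R g x)) \<le> norm (B *\<^sub>R (indicator K x *\<^sub>R g x))"
        using K(1) by (cases "x \<in> K") (auto intro: mult_right_mono)
    qed
  qed
  then show ?thesis by (simp only: e[symmetric])
qed

lemma test_integral_by_parts:
  assumes \<phi>: "\<phi> \<in> test_functions UNIV" and \<psi>: "\<psi> \<in> test_functions UNIV" and b: "b \<in> Basis"
  shows "(LINT x|lebesgue. \<phi> x * pd b \<psi> x) = - (LINT x|lebesgue. \<psi> x * pd b \<phi> x)"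
proof -
  have c: "C_diff k UNIV \<psi>" "C_diff k UNIV \<phi>" for k using \<psi> \<phi> by (auto simp: test_functions_def)
  have p: "(\<lambda>x. \<phi> x * \<psi> x) \<in> test_functions UNIV" using test_functions_times[OF \<phi> c(1)] .
  have i: "integrable lebesgue (\<lambda>x. f x * g x)" if "f \<in> test_functions UNIV" "g \<in> test_functions UNIV" for f g :: "'a \<Rightarrow> real"
  proof -
    have "integrable lebesgue (\<lambda>x. f x *\<^sub>R g x)"
    proof (rule test_integrable[OF that(1)])
      fix K :: "'a set" assume "compact K"
      then have "set_integrable lborel K g"
        using borel_integrable_compact[OF _ smb_continuous[OF test_smb[OF that(2)]], of K] by (simp add: set_integrable_def)
      then show "set_integrable lebesgue K g" unfolding set_integrable_def
        using \<open>compact K\<close> smb_measurable[OF test_smb[OF that(2)]] by (subst integrable_completion) auto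
    qed
    then show ?thesis by simp
  qed
  have "(LINT x|lborel. pd b (\<lambda>x. \<phi> x * \<psi> x) x) = 0" using test_integral_pd[OF p b] .
  also have "(LINT x|lborel. pd b (\<lambda>x. \<phi> x * \<psi> x) x) = (LINT x|lebesgue. pd b (\<lambda>x. \<phi> x * \<psi> x) x)"
    using smb_measurable[OF smb_pd[OF test_smb[OF p] b]] by (intro integral_completion[symmetric]) simp
  also have "\<dots> = (LINT x|lebesgue. \<phi> x * pd b \<psi> x + \<psi> x * pd b \<phi> x)"
    by (simp add: pd_mult[OF test_smb[OF \<phi>] test_smb[OF \<psi>]] mult.commute)
  also have "\<dots> = (LINT x|lebesgue. \<phi> x * pd b \<psi> x) + (LINT x|lebesgue. \<psi> x * pd b \<phi> x)"
    by (intro Bochner_Integration.integral_add i \<phi> \<psi> test_functions_pd b)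
  finally show ?thesis by simp
qed

lemma test_locally_integrable:
  assumes "\<phi> \<in> test_functions UNIV" shows "locally_integrable \<phi>"
  unfolding locally_integrable_def
proof (intro allI impI)
  fix K :: "'a set" assume "compact K"
  then have "set_integrable lborel K \<phi>"
    using borel_integrable_compact[OF _ smb_continuous[OF test_smb[OF assms]], of K] by (simp add: set_integrable_def)
  then show "set_integrable lebesgue K \<phi>" unfolding set_integrable_def
    using \<open>compact K\<close> smb_measurable[OF test_smb[OF assms]] by (subst integrable_completion) auto
qed

lemma locally_integrableI_components:
  fixes g :: "'a::euclidean_space \<Rightarrow> 'b::euclidean_space"
  assumes "\<And>b. b \<in> Basis \<Longrightarrow> locally_integrable (\<lambda>x. g x \<bullet> b)"
  shows "locally_integrable g"
  unfolding locally_integrable_def set_integrable_def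
proof (intro allI impI)
  fix K :: "'a set" assume K: "compact K"
  have "integrable lebesgue (\<lambda>x. \<Sum>b\<in>Basis. (indicator K x *\<^sub>R (g x \<bullet> b)) *\<^sub>R b)"
    using assms K unfolding locally_integrable_def set_integrable_def
    by (intro Bochner_Integration.integrable_sum integrable_scaleR_left) auto
  moreover have "(\<Sum>b\<in>Basis. (indicator K x *\<^sub>R (g x \<bullet> b)) *\<^sub>R b) = indicator K x *\<^sub>R g x" for x
    using euclidean_representation[of "indicator K x *\<^sub>R g x"] by simp
  ultimately show "integrable lebesgue (\<lambda>x. indicator K x *\<^sub>R g x)" by simp
qed

lemma locally_integrable_inner:
  fixes g :: "'a::euclidean_space \<Rightarrow> 'b::euclidean_space"
  shows "locally_integrable g \<Longrightarrow> locally_integrable (\<lambda>x. g x \<bullet> b)"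
proof -
  assume g: "locally_integrable g"
  have "integrable lebesgue (\<lambda>x. indicator K x *\<^sub>R (g x \<bullet> b))" if "compact K" for K
    using integrable_inner_left[of b lebesgue "\<lambda>x. indicator K x *\<^sub>R g x"] g that
    by (simp add: locally_integrable_def set_integrable_def)
  then show ?thesis by (simp add: locally_integrable_def set_integrable_def)
qed

lemma test_grad_locally_integrable:
  "\<phi> \<in> test_functions UNIV \<Longrightarrow> locally_integrable (grad \<phi>)"
proof (rule locally_integrableI_components)
  fix b :: 'a assume "\<phi> \<in> test_functions UNIV" "b \<in> Basis"
  then have "locally_integrable (pd b \<phi>)" using test_locally_integrable test_functions_pd by blast
  then show "locally_integrable (\<lambda>x. grad \<phi> x \<bullet> b)" by (simp only: pd_def[abs_def])
qed

text \<open>The defining identity is between vector-valued Bochner integrals. These exist, so inner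
  products with basis vectors may be taken inside, and scalar integration by parts becomes
  applicable.\<close>

lemma weak_grad_componentwise:
  assumes u: "locally_integrable u" and G: "locally_integrable G"
  shows "has_weak_grad u G \<longleftrightarrow> (\<forall>\<phi>\<in>test_functions UNIV. \<forall>b\<in>Basis.
    (LINT x|lebesgue. u x * pd b \<phi> x) = - (LINT x|lebesgue. \<phi> x * (G x \<bullet> b)))"
proof -
  have "(LINT x|lebesgue. u x *\<^sub>R grad \<phi> x) = - (LINT x|lebesgue. \<phi> x *\<^sub>R G x) \<longleftrightarrow> (\<forall>b\<in>Basis.
    (LINT x|lebesgue. u x * pd b \<phi> x) = - (LINT x|lebesgue. \<phi> x * (G x \<bullet> b)))" if \<phi>: "\<phi> \<in> test_functions UNIV" for \<phi>
  proof -
    have "integrable lebesgue (\<lambda>x. pd b \<phi> x * u x)" if "b \<in> Basis" for b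
      using test_integrable[OF test_functions_pd[OF \<phi> that], of u] u by (simp add: locally_integrable_def)
    then have "integrable lebesgue (\<lambda>x. \<Sum>b\<in>Basis. (u x * pd b \<phi> x) *\<^sub>R b)"
      by (intro Bochner_Integration.integrable_sum integrable_scaleR_left) (simp add: mult.commute)
    moreover have "(\<Sum>b\<in>Basis. (u x * pd b \<phi> x) *\<^sub>R b) = u x *\<^sub>R grad \<phi> x" for x
      by (simp add: grad_conv_pd[of \<phi>] scaleR_sum_right)
    ultimately have i1: "integrable lebesgue (\<lambda>x. u x *\<^sub>R grad \<phi> x)" by simp
    have i2: "integrable lebesgue (\<lambda>x. \<phi> x *\<^sub>R G x)"
      using test_integrable[OF \<phi>, of G] G by (simp add: locally_integrable_def)
    have "(LINT x|lebesgue. u x *\<^sub>R grad \<phi> x) \<bullet> b = (LINT x|lebesgue. u x * pd b \<phi> x)" for b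
      using integral_inner_left[OF i1, of b] by (simp add: pd_def)
    moreover have "(LINT x|lebesgue. \<phi> x *\<^sub>R G x) \<bullet> b = (LINT x|lebesgue. \<phi> x * (G x \<bullet> b))" for b
      using integral_inner_left[OF i2, of b] by simp
    ultimately show ?thesis by (simp add: euclidean_eq_iff[where 'a='a])
  qed
  then show ?thesis using u G unfolding has_weak_grad_def by auto
qed

lemma test_has_weak_grad:
  assumes \<phi>: "\<phi> \<in> test_functions UNIV" shows "has_weak_grad \<phi> (grad \<phi>)"
  using test_integral_by_parts[OF \<phi>]
  by (subst weak_grad_componentwise[OF test_locally_integrable[OF \<phi>] test_grad_locally_integrable[OF \<phi>]])
     (auto simp: pd_def)

lemma locally_integrable_measurable:
  fixes g :: "'a::euclidean_space \<Rightarrow> real"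
  assumes "locally_integrable g" shows "g \<in> borel_measurable lebesgue"
proof (rule borel_measurable_LIMSEQ_real)
  show "(\<lambda>x. indicator (cball 0 (real n)) x *\<^sub>R g x) \<in> borel_measurable lebesgue" for n
    using assms compact_cball[of 0 "real n"] unfolding locally_integrable_def set_integrable_def
    by (blast intro: borel_measurable_integrable)
  show "(\<lambda>n. indicator (cball 0 (real n)) x *\<^sub>R g x) \<longlonglongrightarrow> g x" for x
  proof (rule tendsto_eventually)
    obtain N where "norm x \<le> real N" using real_arch_simple by blast
    then show "\<forall>\<^sub>F n in sequentially. indicator (cball 0 (real n)) x *\<^sub>R g x = g x"
      by (intro eventually_sequentiallyI[of N]) auto
  qed
qed

text \<open>The fundamental lemma for each component of the difference. It pins down
  \<open>weak_grad\<close>, which is an arbitrary choice, almost everywhere.\<close>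

lemma weak_grad_unique:
  assumes G: "has_weak_grad u G" and G': "has_weak_grad u G'"
  shows "AE x in lebesgue. G x = G' x"
proof -
  have u: "locally_integrable u" and li: "locally_integrable G" "locally_integrable G'"
    using G G' by (auto simp: has_weak_grad_def)
  have "AE x in lebesgue. (G x \<bullet> b) - (G' x \<bullet> b) = 0" if b: "b \<in> Basis" for b
  proof -
    define H where "H x = (G x \<bullet> b) - (G' x \<bullet> b)" for x
    note l = locally_integrable_inner[OF li(1), of b] locally_integrable_inner[OF li(2), of b]
    have "AE x in lebesgue. x \<in> UNIV \<longrightarrow> H x = 0"
    proof (rule du_bois_reymond)
      show "H \<in> borel_measurable lebesgue"
        unfolding H_def[abs_def] using l[THEN locally_integrable_measurable] by measurable
      show "set_integrable lebesgue (cbox a c) H" for a c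
        unfolding H_def[abs_def] using l by (intro set_integral_diff) (auto simp: locally_integrable_def)
      fix \<phi> :: "'a \<Rightarrow> real" assume \<phi>: "\<phi> \<in> test_functions UNIV"
      have i: "integrable lebesgue (\<lambda>x. \<phi> x * (G x \<bullet> b))" "integrable lebesgue (\<lambda>x. \<phi> x * (G' x \<bullet> b))"
        using test_integrable[OF \<phi>, of "\<lambda>x. G x \<bullet> b"] test_integrable[OF \<phi>, of "\<lambda>x. G' x \<bullet> b"] l
        by (auto simp: locally_integrable_def)
      have "(LINT x|lebesgue. u x * pd b \<phi> x) = - (LINT x|lebesgue. \<phi> x * (G x \<bullet> b))"
        using G weak_grad_componentwise[OF u li(1)] \<phi> b by blast
      moreover have "(LINT x|lebesgue. u x * pd b \<phi> x) = - (LINT x|lebesgue. \<phi> x * (G' x \<bullet> b))"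
        using G' weak_grad_componentwise[OF u li(2)] \<phi> b by blast
      ultimately have "(LINT x|lebesgue. \<phi> x * (G x \<bullet> b)) = (LINT x|lebesgue. \<phi> x * (G' x \<bullet> b))"
        by simp
      then show "(LINT x|lebesgue. H x * \<phi> x) = 0"
        using i by (simp add: H_def mult.commute[of _ "\<phi> _"] right_diff_distrib)
    qed auto
    then show ?thesis by (simp add: H_def)
  qed
  then have "AE x in lebesgue. \<forall>b\<in>Basis. (G x \<bullet> b) - (G' x \<bullet> b) = 0"
    by (subst AE_finite_all) auto
  then show ?thesis by (rule eventually_mono) (auto simp: euclidean_eq_iff[where 'a='a])
qed

text \<open>Testing the weak gradient of \<open>u\<close> with \<open>pd b \<phi>\<close> for every \<open>b\<close>.\<close>
lemma weak_grad_energy: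
  assumes u: "has_weak_grad u G" and \<phi>: "\<phi> \<in> test_functions UNIV"
  shows "(LINT x|lebesgue. weak_grad u x \<bullet> weak_grad \<phi> x) = - (LINT x|lebesgue. u x * lap \<phi> x)"
proof -
  have wu: "has_weak_grad u (weak_grad u)" unfolding weak_grad_def using u someI_ex by metis
  have "has_weak_grad \<phi> (weak_grad \<phi>)" unfolding weak_grad_def using test_has_weak_grad[OF \<phi>] someI_ex by metis
  then have ae: "AE x in lebesgue. weak_grad \<phi> x = grad \<phi> x" using weak_grad_unique test_has_weak_grad[OF \<phi>] by blast
  have li: "locally_integrable u" "locally_integrable (weak_grad u)" "locally_integrable (weak_grad \<phi>)"
    using wu \<open>has_weak_grad \<phi> (weak_grad \<phi>)\<close> by (auto simp: has_weak_grad_def)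
  have m: "(\<lambda>x. G x \<bullet> H x) \<in> borel_measurable lebesgue" if "locally_integrable G" "locally_integrable H" for G H :: "'a \<Rightarrow> 'a"
    using that[THEN locally_integrable_inner, THEN locally_integrable_measurable]
    by (subst euclidean_inner) (intro borel_measurable_sum borel_measurable_times)
  have i1: "integrable lebesgue (\<lambda>x. pd b \<phi> x * (weak_grad u x \<bullet> b))" if "b \<in> Basis" for b
    using test_integrable[OF test_functions_pd[OF \<phi> that], of "\<lambda>x. weak_grad u x \<bullet> b"] locally_integrable_inner[OF li(2), of b]
    by (simp add: locally_integrable_def)
  have i2: "integrable lebesgue (\<lambda>x. u x * pd b (pd b \<phi>) x)" if "b \<in> Basis" for b
    using test_integrable[OF test_functions_pd[OF test_functions_pd[OF \<phi> that] that], of u] li(1)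
    by (simp add: locally_integrable_def mult.commute)
  have "(LINT x|lebesgue. weak_grad u x \<bullet> weak_grad \<phi> x) = (LINT x|lebesgue. weak_grad u x \<bullet> grad \<phi> x)"
    using ae li(2,3) test_grad_locally_integrable[OF \<phi>] m by (intro integral_cong_AE) auto
  also have "\<dots> = (LINT x|lebesgue. (\<Sum>b\<in>Basis. pd b \<phi> x * (weak_grad u x \<bullet> b)))"
    by (subst euclidean_inner) (simp add: pd_def mult.commute)
  also have "\<dots> = (\<Sum>b\<in>Basis. (LINT x|lebesgue. pd b \<phi> x * (weak_grad u x \<bullet> b)))"
    using i1 by (intro Bochner_Integration.integral_sum)
  also have "\<dots> = (\<Sum>b\<in>Basis. - (LINT x|lebesgue. u x * pd b (pd b \<phi>) x))"
    using wu weak_grad_componentwise[OF li(1,2)] test_functions_pd[OF \<phi>] by (intro sum.cong) auto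
  also have "\<dots> = - (LINT x|lebesgue. u x * lap \<phi> x)"
    using i2 by (simp add: lap_def sum_distrib_left sum_negf)
  finally show ?thesis .
qed

section \<open>The energy space\<close>

text \<open>A subsequence is Cauchy almost everywhere and provides the limit; Fatou's lemma carries
  the Cauchy bound of the whole sequence over to it.\<close>

lemma L1_complete:
  fixes s :: "nat \<Rightarrow> 'a \<Rightarrow> 'b::{banach, second_countable_topology}"
  assumes s: "\<And>n. integrable M (s n)"
    and C: "\<And>e. e > 0 \<Longrightarrow> \<exists>N. \<forall>i\<ge>N. \<forall>j\<ge>N. (LINT x|M. norm (s i x - s j x)) < e"
  obtains G where "integrable M G" "(\<lambda>n. LINT x|M. norm (s n x - G x)) \<longlonglongrightarrow> 0"
proof -
  obtain r where r: "strict_mono r" "AE x in M. Cauchy (\<lambda>i. s (r i) x)"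
    using cauchy_L1_AE_cauchy_subseq[OF s C] by blast
  define G where "G x = lim (\<lambda>i. s (r i) x)" for x
  have sm [measurable]: "s n \<in> borel_measurable M" for n using s by (rule borel_measurable_integrable)
  have G [measurable]: "G \<in> borel_measurable M" unfolding G_def[abs_def] by measurable
  have lim: "AE x in M. (\<lambda>i. s (r i) x) \<longlonglongrightarrow> G x"
    using r(2) by eventually_elim (simp add: G_def Cauchy_convergent_iff convergent_LIMSEQ_iff)
  have fat: "(\<integral>\<^sup>+x. norm (s i x - G x) \<partial>M) \<le> ennreal e"
    if N: "\<forall>i\<ge>N. \<forall>j\<ge>N. (LINT x|M. norm (s i x - s j x)) < e" and i: "i \<ge> N" for e N i
  proof -
    have "(\<integral>\<^sup>+x. norm (s i x - G x) \<partial>M) = (\<integral>\<^sup>+x. liminf (\<lambda>j. ennreal (norm (s i x - s (r j) x))) \<partial>M)"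
    proof (rule nn_integral_cong_AE)
      show "AE x in M. ennreal (norm (s i x - G x)) = liminf (\<lambda>j. ennreal (norm (s i x - s (r j) x)))"
        using lim
      proof eventually_elim
        case (elim x)
        have "(\<lambda>j. ennreal (norm (s i x - s (r j) x))) \<longlonglongrightarrow> ennreal (norm (s i x - G x))"
          by (intro tendsto_intros elim)
        from lim_imp_Liminf[OF _ this] show ?case by simp
      qed
    qed
    also have "\<dots> \<le> liminf (\<lambda>j. \<integral>\<^sup>+x. norm (s i x - s (r j) x) \<partial>M)"
      by (rule nn_integral_liminf) measurable
    also have "\<dots> \<le> liminf (\<lambda>j. ennreal e)"
    proof (rule Liminf_mono)
      have "\<forall>\<^sub>F j in sequentially. r j \<ge> N"
        using seq_suble[OF r(1)] by (intro eventually_sequentiallyI[of N]) (meson order_trans)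
      then show "\<forall>\<^sub>F j in sequentially. (\<integral>\<^sup>+x. norm (s i x - s (r j) x) \<partial>M) \<le> ennreal e"
      proof eventually_elim
        case (elim j)
        have "(\<integral>\<^sup>+x. norm (s i x - s (r j) x) \<partial>M) = ennreal (LINT x|M. norm (s i x - s (r j) x))"
          using s by (intro nn_integral_eq_integral) auto
        then show ?case using N i elim by (simp add: ennreal_leI less_imp_le)
      qed
    qed
    finally show ?thesis by (simp add: Liminf_const)
  qed
  have i1: "integrable M (\<lambda>x. s i x - G x)" if "\<forall>i\<ge>N. \<forall>j\<ge>N. (LINT x|M. norm (s i x - s j x)) < 1" "i \<ge> N" for i N
    using fat[OF that] by (intro integrableI_bounded) (auto intro: le_less_trans simp: ennreal_less_top)
  obtain N1 where N1: "\<forall>i\<ge>N1. \<forall>j\<ge>N1. (LINT x|M. norm (s i x - s j x)) < 1" using C[of 1] by auto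
  have Gi: "integrable M G"
    using Bochner_Integration.integrable_diff[OF s[of N1] i1[OF N1 order_refl]] by simp
  have "(\<lambda>n. LINT x|M. norm (s n x - G x)) \<longlonglongrightarrow> 0"
  proof (rule LIMSEQ_I)
    fix e :: real assume "0 < e"
    then obtain N where N: "\<forall>i\<ge>N. \<forall>j\<ge>N. (LINT x|M. norm (s i x - s j x)) < e / 2" using C[of "e / 2"] by auto
    have "norm ((LINT x|M. norm (s i x - G x)) - 0) < e" if "i \<ge> N" for i
    proof -
      have "ennreal (LINT x|M. norm (s i x - G x)) = (\<integral>\<^sup>+x. norm (s i x - G x) \<partial>M)"
        using s Gi by (intro nn_integral_eq_integral[symmetric]) auto
      then have "ennreal (LINT x|M. norm (s i x - G x)) \<le> ennreal (e / 2)" using fat[OF N that] by simp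
      then have "(LINT x|M. norm (s i x - G x)) \<le> e / 2" using \<open>0 < e\<close> by (simp add: ennreal_le_iff)
      moreover have "0 \<le> (LINT x|M. norm (s i x - G x))" by simp
      ultimately show ?thesis using \<open>0 < e\<close> by (simp del: integral_nonneg_AE)
    qed
    then show "\<exists>N. \<forall>i\<ge>N. norm ((LINT x|M. norm (s i x - G x)) - 0) < e" by blast
  qed
  then show thesis using that Gi by blast
qed

text \<open>A substitute for the Cauchy-Schwarz inequality on a set of finite measure: integrated,
  it bounds an L1 norm by \<open>d\<close> times the measure plus \<open>1 / d\<close> times a
  squared L2 norm, with \<open>d\<close> at choice.\<close>

lemma le_eps_square: "0 < d \<Longrightarrow> 0 \<le> t \<Longrightarrow> t \<le> d + t\<^sup>2 / (d::real)"
proof (cases "t \<le> d")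
  case False
  assume *: "0 < d" "0 \<le> t"
  then have "d * t \<le> t * t" using False by (intro mult_right_mono) auto
  then have "t \<le> t\<^sup>2 / d" using * by (simp add: field_simps power2_eq_square)
  then show ?thesis using * by simp
qed (simp add: add_increasing2)

lemma gagliardo_nonneg: "0 \<le> gagliardo_form s \<phi> \<phi>"
  unfolding gagliardo_form_def by (intro Bochner_Integration.integral_nonneg) auto

lemma X_norm_less:
  assumes "X_norm s \<phi> < e"
  shows "(LINT x|lebesgue. (norm (grad \<phi> x))\<^sup>2) < e\<^sup>2" "gagliardo_form s \<phi> \<phi> < e\<^sup>2"
proof -
  have g: "0 \<le> (LINT x|lebesgue. (norm (grad \<phi> x))\<^sup>2)" by simp
  have "0 \<le> X_norm s \<phi>" using g gagliardo_nonneg[of s \<phi>] by (simp add: X_norm_def del: integral_nonneg_AE)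
  then have "(X_norm s \<phi>)\<^sup>2 < e\<^sup>2" using assms by (intro power_strict_mono) auto
  moreover have "(X_norm s \<phi>)\<^sup>2 = (LINT x|lebesgue. (norm (grad \<phi> x))\<^sup>2) + gagliardo_form s \<phi> \<phi>"
    using g gagliardo_nonneg[of s \<phi>] by (simp add: X_norm_def del: integral_nonneg_AE)
  ultimately show "(LINT x|lebesgue. (norm (grad \<phi> x))\<^sup>2) < e\<^sup>2" "gagliardo_form s \<phi> \<phi> < e\<^sup>2"
    using g gagliardo_nonneg[of s \<phi>] by linarith+
qed

lemma grad_diff:
  "smb f \<Longrightarrow> smb g \<Longrightarrow> grad (\<lambda>x. f x - g x) x = grad f x - grad g x"
  by (intro grad_eqI GDERIV_diff smb_GDERIV)

lemma test_in_X_space: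
  assumes \<phi>: "\<phi> \<in> test_functions \<Omega>" shows "\<phi> \<in> X_space s \<Omega>"
proof -
  have "X_norm s (\<lambda>x::'a. 0) = 0"
    by (simp add: X_norm_def gagliardo_form_def grad_eqI[OF GDERIV_const] split_beta')
  then show ?thesis using \<phi> smb_leb_measurable[OF test_smb[OF \<phi>]]
    unfolding X_space_def by (auto intro!: exI[of _ "\<lambda>_. \<phi>"])
qed

lemma lebesgue_open_finite:
  assumes "open \<Omega>" "bounded (\<Omega>::'a::euclidean_space set)"
  shows "\<Omega> \<in> sets lebesgue" "emeasure lebesgue \<Omega> < \<infinity>"
proof -
  show "\<Omega> \<in> sets lebesgue" using lmeasurable_open[OF assms(2,1)] by (rule fmeasurableD)
  show "emeasure lebesgue \<Omega> < \<infinity>" using emeasure_bounded_finite[OF assms(2)] assms(1) by simp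
qed

lemma test_outside: "\<phi> \<in> test_functions \<Omega> \<Longrightarrow> x \<notin> \<Omega> \<Longrightarrow> \<phi> x = 0"
  by (metis subsetD test_functionsE)

lemma test_integrable':
  assumes "\<phi> \<in> test_functions \<Omega>" shows "integrable lebesgue \<phi>"
proof -
  obtain K where K: "compact K" "\<And>x. x \<notin> K \<Longrightarrow> \<phi> x = 0" by (metis test_functionsE[OF assms])
  have "locally_integrable \<phi>" using test_locally_integrable test_functions_mono[OF subset_UNIV] assms by blast
  then have "integrable lebesgue (\<lambda>x. indicator K x *\<^sub>R \<phi> x)" using K by (simp add: locally_integrable_def set_integrable_def)
  moreover have "(\<lambda>x. indicator K x *\<^sub>R \<phi> x) = \<phi>" using K by (auto simp: fun_eq_iff indicator_def)
  ultimately show ?thesis by simp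
qed

text \<open>Outside \<Omega> all approximants vanish, hence so does their L2 limit; on the bounded
  set \<Omega> convergence in L2 gives convergence in L1 by \<open>le_eps_square\<close>. The L1
  form is what weak gradients and almost everywhere convergent subsequences are drawn from.\<close>

lemma X_space_L1:
  fixes u :: "'a::euclidean_space \<Rightarrow> real"
  assumes u: "u \<in> X_space s \<Omega>" and \<Omega>: "open \<Omega>" "bounded \<Omega>"
  obtains \<phi> where "\<forall>k. \<phi> k \<in> test_functions \<Omega>"
    "\<forall>e>0. \<exists>N. \<forall>j\<ge>N. \<forall>k\<ge>N. X_norm s (\<lambda>x. \<phi> j x - \<phi> k x) < e"
    "integrable lebesgue u" "(\<lambda>k. LINT x|lebesgue. \<bar>\<phi> k x - u x\<bar>) \<longlonglongrightarrow> 0" "AE x in lebesgue. x \<notin> \<Omega> \<longrightarrow> u x = 0"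
proof -
  have um [measurable]: "u \<in> borel_measurable lebesgue" using u by (simp add: X_space_def)
  obtain \<phi> :: "nat \<Rightarrow> 'a \<Rightarrow> real" where \<phi>: "\<And>k. \<phi> k \<in> test_functions \<Omega>"
    "\<And>e. e > 0 \<Longrightarrow> \<exists>N. \<forall>j\<ge>N. \<forall>k\<ge>N. X_norm s (\<lambda>x. \<phi> j x - \<phi> k x) < e"
    and L2: "(\<lambda>k. \<integral>\<^sup>+x. ennreal ((\<phi> k x - u x)\<^sup>2) \<partial>lebesgue) \<longlonglongrightarrow> 0"
    using u unfolding X_space_def by blast
  have pm [measurable]: "\<phi> k \<in> borel_measurable lebesgue" for k using smb_leb_measurable[OF test_smb[OF \<phi>(1)]] .
  note \<Omega>s [measurable] = lebesgue_open_finite(1)[OF \<Omega>]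
  have out: "AE x in lebesgue. x \<notin> \<Omega> \<longrightarrow> u x = 0"
  proof -
    have "(\<integral>\<^sup>+x. ennreal ((u x)\<^sup>2) * indicator (- \<Omega>) x \<partial>lebesgue) \<le> (\<integral>\<^sup>+x. ennreal ((\<phi> k x - u x)\<^sup>2) \<partial>lebesgue)" for k
      using test_outside[OF \<phi>(1)] by (intro nn_integral_mono) (auto simp: indicator_def)
    then have "(\<integral>\<^sup>+x. ennreal ((u x)\<^sup>2) * indicator (- \<Omega>) x \<partial>lebesgue) \<le> 0"
      by (intro LIMSEQ_le_const[OF L2]) auto
    then have "(\<integral>\<^sup>+x. ennreal ((u x)\<^sup>2) * indicator (- \<Omega>) x \<partial>lebesgue) = 0" by simp
    then have "AE x in lebesgue. ennreal ((u x)\<^sup>2) * indicator (- \<Omega>) x = 0"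
      using \<Omega>s by (subst (asm) nn_integral_0_iff_AE) auto
    then show ?thesis by eventually_elim (auto simp: indicator_def split: if_splits)
  qed
  define m where "m = measure lebesgue \<Omega>"
  have m: "emeasure lebesgue \<Omega> = ennreal m" "0 \<le> m"
    using lebesgue_open_finite(2)[OF \<Omega>] by (auto simp: m_def emeasure_eq_ennreal_measure top.not_eq_extremum)
  have bd: "(\<integral>\<^sup>+x. ennreal \<bar>\<phi> k x - u x\<bar> \<partial>lebesgue) \<le> ennreal (d * m) + ennreal (1 / d) * (\<integral>\<^sup>+x. ennreal ((\<phi> k x - u x)\<^sup>2) \<partial>lebesgue)"
    if d: "0 < d" for d k
  proof -
    have "(\<integral>\<^sup>+x. ennreal \<bar>\<phi> k x - u x\<bar> \<partial>lebesgue) \<le> (\<integral>\<^sup>+x. ennreal d * indicator \<Omega> x + ennreal (1 / d) * ennreal ((\<phi> k x - u x)\<^sup>2) \<partial>lebesgue)"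
    proof (rule nn_integral_mono_AE)
      show "AE x in lebesgue. ennreal \<bar>\<phi> k x - u x\<bar> \<le> ennreal d * indicator \<Omega> x + ennreal (1 / d) * ennreal ((\<phi> k x - u x)\<^sup>2)"
        using out
      proof eventually_elim
        case (elim x)
        show ?case
        proof (cases "x \<in> \<Omega>")
          case True
          have "\<bar>\<phi> k x - u x\<bar> \<le> d + \<bar>\<phi> k x - u x\<bar>\<^sup>2 / d" using d by (intro le_eps_square) auto
          then have "ennreal \<bar>\<phi> k x - u x\<bar> \<le> ennreal (d + 1 / d * (\<phi> k x - u x)\<^sup>2)" by (intro ennreal_leI) simp
          also have "\<dots> = ennreal d + ennreal (1 / d) * ennreal ((\<phi> k x - u x)\<^sup>2)"
            using d by (subst ennreal_plus) (auto simp: ennreal_mult[symmetric])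
          finally show ?thesis using True by simp
        next
          case False
          then show ?thesis using elim test_outside[OF \<phi>(1)] by simp
        qed
      qed
    qed
    also have "\<dots> = (\<integral>\<^sup>+x. ennreal d * indicator \<Omega> x \<partial>lebesgue) + (\<integral>\<^sup>+x. ennreal (1 / d) * ennreal ((\<phi> k x - u x)\<^sup>2) \<partial>lebesgue)"
      by (intro nn_integral_add) measurable
    also have "(\<integral>\<^sup>+x. ennreal d * indicator \<Omega> x \<partial>lebesgue) = ennreal (d * m)"
      using d m \<Omega>s by (simp add: nn_integral_cmult_indicator ennreal_mult)
    also have "(\<integral>\<^sup>+x. ennreal (1 / d) * ennreal ((\<phi> k x - u x)\<^sup>2) \<partial>lebesgue) = ennreal (1 / d) * (\<integral>\<^sup>+x. ennreal ((\<phi> k x - u x)\<^sup>2) \<partial>lebesgue)"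
      by (intro nn_integral_cmult) measurable
    finally show ?thesis .
  qed
  have small: "\<forall>\<^sub>F k in sequentially. (\<integral>\<^sup>+x. ennreal \<bar>\<phi> k x - u x\<bar> \<partial>lebesgue) \<le> ennreal e" if e: "0 < e" for e
  proof -
    \<comment> \<open>Each of the two terms of \<open>bd\<close> receives half of \<open>e\<close>;
      the added 1 keeps the denominator positive when \<Omega> has measure 0.\<close>
    define d where "d = e / (2 * (m + 1))"
    have d: "0 < d" "d * m \<le> e / 2" using e m by (auto simp: d_def field_simps)
    have "\<forall>\<^sub>F k in sequentially. (\<integral>\<^sup>+x. ennreal ((\<phi> k x - u x)\<^sup>2) \<partial>lebesgue) < ennreal (d * e / 2)"
      using d e by (intro order_tendstoD(2)[OF L2]) (auto simp: ennreal_less_zero_iff)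
    then show ?thesis
    proof eventually_elim
      case (elim k)
      have "(\<integral>\<^sup>+x. ennreal \<bar>\<phi> k x - u x\<bar> \<partial>lebesgue) \<le> ennreal (d * m) + ennreal (1 / d) * ennreal (d * e / 2)"
        using elim by (intro order_trans[OF bd[OF d(1)]] add_left_mono mult_left_mono) auto
      also have "\<dots> = ennreal (d * m + e / 2)" using d e m by (simp add: ennreal_mult[symmetric] ennreal_plus[symmetric] del: ennreal_plus)
      also have "\<dots> \<le> ennreal e" using d by (intro ennreal_leI) simp
      finally show ?case .
    qed
  qed
  have ui: "integrable lebesgue u"
  proof -
    obtain k where k: "(\<integral>\<^sup>+x. ennreal \<bar>\<phi> k x - u x\<bar> \<partial>lebesgue) \<le> ennreal 1"
      using small[of 1] by (auto simp: eventually_sequentially)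
    have "integrable lebesgue (\<lambda>x. \<phi> k x - u x)"
    proof (rule integrableI_bounded)
      show "(\<integral>\<^sup>+x. ennreal (norm (\<phi> k x - u x)) \<partial>lebesgue) < \<infinity>"
        using le_less_trans[OF k ennreal_less_top] by simp
    qed measurable
    from Bochner_Integration.integrable_diff[OF test_integrable'[OF \<phi>(1)[of k]] this] show ?thesis by simp
  qed
  have "(\<lambda>k. LINT x|lebesgue. \<bar>\<phi> k x - u x\<bar>) \<longlonglongrightarrow> 0"
  proof (rule tendstoI)
    fix e :: real assume e: "0 < e"
    have "\<forall>\<^sub>F k in sequentially. (\<integral>\<^sup>+x. ennreal \<bar>\<phi> k x - u x\<bar> \<partial>lebesgue) \<le> ennreal (e / 2)" using small[of "e / 2"] e by simp
    then show "\<forall>\<^sub>F k in sequentially. dist (LINT x|lebesgue. \<bar>\<phi> k x - u x\<bar>) 0 < e"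
    proof eventually_elim
      case (elim k)
      have i: "integrable lebesgue (\<lambda>x. \<bar>\<phi> k x - u x\<bar>)"
        using test_integrable'[OF \<phi>(1)[of k]] ui by (intro integrable_abs Bochner_Integration.integrable_diff)
      have "ennreal (LINT x|lebesgue. \<bar>\<phi> k x - u x\<bar>) \<le> ennreal (e / 2)"
        using elim nn_integral_eq_integral[OF i] by simp
      then have "(LINT x|lebesgue. \<bar>\<phi> k x - u x\<bar>) \<le> e / 2" using e by (simp add: ennreal_le_iff)
      moreover have "0 \<le> (LINT x|lebesgue. \<bar>\<phi> k x - u x\<bar>)" by simp
      ultimately show ?case using e by (simp del: integral_nonneg_AE add: dist_real_def)
    qed
  qed
  then show thesis using that \<phi> ui out by blast
qed

lemma integrable_locally_integrable:
  fixes g :: "'a::euclidean_space \<Rightarrow> 'b::euclidean_space"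
  assumes "integrable lebesgue g" shows "locally_integrable g"
  unfolding locally_integrable_def set_integrable_def
  using integrable_mult_indicator[OF _ assms] by (auto intro: lmeasurable_compact fmeasurableD)

text \<open>A Cauchy sequence in \<open>X_norm\<close> has gradients that are Cauchy in L2, hence in
  L1 since they vanish outside \<Omega>. Their limit inherits integration by parts, because test
  functions and their derivatives are bounded.\<close>

lemma X_space_weak_grad:
  fixes u :: "'a::euclidean_space \<Rightarrow> real"
  assumes u: "u \<in> X_space s \<Omega>" and \<Omega>: "open \<Omega>" "bounded \<Omega>"
  obtains G where "has_weak_grad u G"
proof -
  obtain \<phi> where \<phi>': "\<forall>k. \<phi> k \<in> test_functions \<Omega>"
    "\<forall>e>0. \<exists>N. \<forall>j\<ge>N. \<forall>k\<ge>N. X_norm s (\<lambda>x. \<phi> j x - \<phi> k x) < e"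
    and ui: "integrable lebesgue u" and L1: "(\<lambda>k. LINT x|lebesgue. \<bar>\<phi> k x - u x\<bar>) \<longlonglongrightarrow> 0"
    and "AE x in lebesgue. x \<notin> \<Omega> \<longrightarrow> u x = 0"
    by (rule X_space_L1[OF u \<Omega>])
  note \<phi> = \<phi>'[rule_format]
  note pU = test_functions_mono[OF subset_UNIV \<phi>(1)]
  have gi: "integrable lebesgue (grad \<psi>)" if "\<psi> \<in> test_functions \<Omega>" for \<psi>
  proof -
    have "integrable lebesgue (\<lambda>x. \<Sum>b\<in>Basis. pd b \<psi> x *\<^sub>R b)"
      by (intro Bochner_Integration.integrable_sum integrable_scaleR_left test_integrable'[OF test_functions_pd[OF that]])
    moreover have "(\<lambda>x. \<Sum>b\<in>Basis. pd b \<psi> x *\<^sub>R b) = grad \<psi>" by (rule ext) (rule grad_conv_pd[symmetric])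
    ultimately show ?thesis by simp
  qed
  have g2: "(LINT x|lebesgue. norm (grad \<psi> x)) \<le> d * measure lebesgue \<Omega> + (1 / d) * (LINT x|lebesgue. (norm (grad \<psi> x))\<^sup>2)"
    if \<psi>: "\<psi> \<in> test_functions \<Omega>" and d: "0 < d" for \<psi> d
  proof -
    have sq: "integrable lebesgue (\<lambda>x. (norm (grad \<psi> x))\<^sup>2)"
    proof -
      have "integrable lebesgue (\<lambda>x. \<Sum>b\<in>Basis. pd b \<psi> x * pd b \<psi> x)"
        by (intro Bochner_Integration.integrable_sum test_integrable'[of _ \<Omega>] test_functions_times[OF test_functions_pd[OF \<psi>]])
           (use test_functions_pd[OF \<psi>] in \<open>auto simp: test_functions_def\<close>)
      moreover have "(\<Sum>b\<in>Basis. pd b \<psi> x * pd b \<psi> x) = (norm (grad \<psi> x))\<^sup>2" for x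
        by (subst power2_norm_eq_inner, subst euclidean_inner) (simp add: pd_def)
      ultimately show ?thesis by simp
    qed
    have io: "integrable lebesgue (\<lambda>x. d * indicator \<Omega> x :: real)"
      using lebesgue_open_finite[OF \<Omega>] by (intro integrable_mult_right integrable_real_indicator) auto
    have "(LINT x|lebesgue. norm (grad \<psi> x)) \<le> (LINT x|lebesgue. d * indicator \<Omega> x + (1 / d) * (norm (grad \<psi> x))\<^sup>2)"
    proof (rule integral_mono)
      fix x
      show "norm (grad \<psi> x) \<le> d * indicator \<Omega> x + (1 / d) * (norm (grad \<psi> x))\<^sup>2"
      proof (cases "x \<in> \<Omega>")
        case True
        then show ?thesis using le_eps_square[OF d, of "norm (grad \<psi> x)"] by simp
      next
        case False
        then have "pd b \<psi> x = 0" if "b \<in> Basis" for b using test_outside[OF test_functions_pd[OF \<psi> that]] by blast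
        then have "grad \<psi> x = 0" by (subst grad_conv_pd) simp
        then show ?thesis using d by simp
      qed
    qed (use gi[OF \<psi>] sq io in auto)
    also have "\<dots> = d * measure lebesgue \<Omega> + (1 / d) * (LINT x|lebesgue. (norm (grad \<psi> x))\<^sup>2)"
      using sq io lebesgue_open_finite(1)[OF \<Omega>] by (subst Bochner_Integration.integral_add) auto
    finally show ?thesis .
  qed
  have "\<exists>N. \<forall>i\<ge>N. \<forall>j\<ge>N. (LINT x|lebesgue. norm (grad (\<phi> i) x - grad (\<phi> j) x)) < e" if e: "0 < e" for e
  proof -
    define m where "m = measure lebesgue \<Omega>"
    have m: "0 \<le> m" by (simp add: m_def)
    define d where "d = e / (2 * (m + 1))"
    have d: "0 < d" "d * m \<le> e / 2" using e m by (auto simp: d_def field_simps)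
    \<comment> \<open>The bound is squared in \<open>X_norm_less\<close> and then divided by
      \<open>d\<close>, which leaves \<open>e / 2\<close> for the quadratic term of
      \<open>g2\<close>.\<close>
    obtain N where N: "\<forall>j\<ge>N. \<forall>k\<ge>N. X_norm s (\<lambda>x. \<phi> j x - \<phi> k x) < sqrt (d * e / 2)"
      using \<phi>(2)[of "sqrt (d * e / 2)"] d e by auto
    have "(LINT x|lebesgue. norm (grad (\<phi> i) x - grad (\<phi> j) x)) < e" if "i \<ge> N" "j \<ge> N" for i j
    proof -
      let ?p = "\<lambda>x. \<phi> i x - \<phi> j x"
      have "(LINT x|lebesgue. (norm (grad ?p x))\<^sup>2) < d * e / 2"
        using X_norm_less(1)[of s ?p "sqrt (d * e / 2)"] N that d e by simp
      then have "(1 / d) * (LINT x|lebesgue. (norm (grad ?p x))\<^sup>2) < (1 / d) * (d * e / 2)"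
        using d by (intro mult_strict_left_mono) auto
      also have "\<dots> = e / 2" using d by simp
      finally have "(LINT x|lebesgue. norm (grad ?p x)) < e"
        using g2[OF test_functions_diff[OF \<phi>(1) \<phi>(1), of i j] d(1)] d(2) unfolding m_def by linarith
      then show ?thesis by (simp add: grad_diff[OF test_smb[OF \<phi>(1)] test_smb[OF \<phi>(1)]])
    qed
    then show ?thesis by blast
  qed
  then obtain G where G: "integrable lebesgue G" "(\<lambda>n. LINT x|lebesgue. norm (grad (\<phi> n) x - G x)) \<longlonglongrightarrow> 0"
    using L1_complete[of lebesgue "\<lambda>n. grad (\<phi> n)", OF gi[OF \<phi>(1)]] by blast
  note li = integrable_locally_integrable
  have conv: "(\<lambda>n. LINT x|lebesgue. \<psi> x * f n x) \<longlonglongrightarrow> (LINT x|lebesgue. \<psi> x * g x)"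
    if \<psi>: "\<psi> \<in> test_functions UNIV" and f: "\<And>n. integrable lebesgue (f n)" and g: "integrable lebesgue g"
      and c: "(\<lambda>n. LINT x|lebesgue. \<bar>f n x - g x\<bar>) \<longlonglongrightarrow> 0" for \<psi> f g
  proof -
    obtain B where B: "0 \<le> B" "\<And>x. \<bar>\<psi> x\<bar> \<le> B" using smb_bdd[OF test_smb[OF \<psi>]] by metis
    have i: "integrable lebesgue (\<lambda>x. \<psi> x * h x)" if "integrable lebesgue h" for h
      using test_integrable[OF \<psi>, of h] li[OF that] by (simp add: locally_integrable_def)
    have "norm ((LINT x|lebesgue. \<psi> x * f n x) - (LINT x|lebesgue. \<psi> x * g x)) \<le> B * (LINT x|lebesgue. \<bar>f n x - g x\<bar>)" for n
    proof -
      have "(LINT x|lebesgue. \<psi> x * f n x) - (LINT x|lebesgue. \<psi> x * g x) = (LINT x|lebesgue. \<psi> x * (f n x - g x))"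
        using i[OF f] i[OF g] by (simp add: right_diff_distrib)
      also have "norm \<dots> \<le> (LINT x|lebesgue. B * \<bar>f n x - g x\<bar>)"
      proof (rule Bochner_Integration.integral_norm_bound_integral)
        show "integrable lebesgue (\<lambda>x. \<psi> x * (f n x - g x))" using f g by (intro i) simp
        show "integrable lebesgue (\<lambda>x. B * \<bar>f n x - g x\<bar>)" using f g by simp
        show "norm (\<psi> x * (f n x - g x)) \<le> B * \<bar>f n x - g x\<bar>" for x using B by (simp add: abs_mult mult_right_mono)
      qed
      finally show ?thesis by simp
    qed
    moreover have "(\<lambda>n. B * (LINT x|lebesgue. \<bar>f n x - g x\<bar>)) \<longlonglongrightarrow> 0" using tendsto_mult_right_zero[OF c] .
    ultimately have "(\<lambda>n. (LINT x|lebesgue. \<psi> x * f n x) - (LINT x|lebesgue. \<psi> x * g x)) \<longlonglongrightarrow> 0"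
      by (rule Lim_null_comparison[OF always_eventually, rule_format])
    then show ?thesis by (simp add: LIM_zero_iff)
  qed
  have "has_weak_grad u G"
    unfolding weak_grad_componentwise[OF li[OF ui] li[OF G(1)]]
  proof (intro ballI)
    fix \<psi> :: "'a \<Rightarrow> real" and b :: 'a assume \<psi>: "\<psi> \<in> test_functions UNIV" and b: "b \<in> Basis"
    have "(\<lambda>n. LINT x|lebesgue. pd b \<psi> x * \<phi> n x) \<longlonglongrightarrow> (LINT x|lebesgue. pd b \<psi> x * u x)"
      using test_integrable'[OF \<phi>(1)] ui L1 by (intro conv test_functions_pd \<psi> b)
    moreover have "(\<lambda>n. LINT x|lebesgue. \<psi> x * pd b (\<phi> n) x) \<longlonglongrightarrow> (LINT x|lebesgue. \<psi> x * (G x \<bullet> b))"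
    proof (rule conv[OF \<psi>])
      show "integrable lebesgue (pd b (\<phi> n))" for n using test_integrable'[OF test_functions_pd[OF \<phi>(1) b]] .
      show "integrable lebesgue (\<lambda>x. G x \<bullet> b)" using G(1) by simp
      show "(\<lambda>n. LINT x|lebesgue. \<bar>pd b (\<phi> n) x - G x \<bullet> b\<bar>) \<longlonglongrightarrow> 0"
      proof (rule tendsto_sandwich[OF _ _ tendsto_const G(2)])
        show "\<forall>\<^sub>F n in sequentially. (LINT x|lebesgue. \<bar>pd b (\<phi> n) x - G x \<bullet> b\<bar>) \<le> (LINT x|lebesgue. norm (grad (\<phi> n) x - G x))"
        proof (intro always_eventually allI integral_mono)
          fix n x
          show "\<bar>pd b (\<phi> n) x - G x \<bullet> b\<bar> \<le> norm (grad (\<phi> n) x - G x)"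
            using Basis_le_norm[OF b, of "grad (\<phi> n) x - G x"] by (simp add: pd_def inner_diff_left)
          show "integrable lebesgue (\<lambda>x. \<bar>pd b (\<phi> n) x - G x \<bullet> b\<bar>)" for n
            using test_integrable'[OF test_functions_pd[OF \<phi>(1) b]] G(1) by simp
          show "integrable lebesgue (\<lambda>x. norm (grad (\<phi> n) x - G x))" for n
            using gi[OF \<phi>(1)] G(1) by simp
        qed
      qed auto
    qed
    moreover have "(LINT x|lebesgue. pd b \<psi> x * \<phi> n x) = - (LINT x|lebesgue. \<psi> x * pd b (\<phi> n) x)" for n
      using test_integral_by_parts[OF pU \<psi> b] by (simp add: mult.commute)
    ultimately have "(\<lambda>n. - (LINT x|lebesgue. \<psi> x * pd b (\<phi> n) x)) \<longlonglongrightarrow> (LINT x|lebesgue. pd b \<psi> x * u x)"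
      "(\<lambda>n. - (LINT x|lebesgue. \<psi> x * pd b (\<phi> n) x)) \<longlonglongrightarrow> - (LINT x|lebesgue. \<psi> x * (G x \<bullet> b))"
      by (simp_all add: tendsto_minus)
    then have "(LINT x|lebesgue. pd b \<psi> x * u x) = - (LINT x|lebesgue. \<psi> x * (G x \<bullet> b))" using LIMSEQ_unique by blast
    then show "(LINT x|lebesgue. u x * pd b \<psi> x) = - (LINT x|lebesgue. \<psi> x * (G x \<bullet> b))" by (simp add: mult.commute)
  qed
  then show thesis using that by blast
qed

section \<open>The fractional kernel as a superposition of mollifiers\<close>

text \<open>The density over scales. The indicator discards nonpositive scales, so that integrals
  can run over the whole line.\<close>

definition wt :: "real \<Rightarrow> real \<Rightarrow> real" where
  "wt s t = indicator {0<..} t * t powr (- 1 - 2 * s)"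

lemma wt_nonneg: "0 \<le> wt s t" by (simp add: wt_def)

lemma wt_measurable [measurable]: "wt s \<in> borel_measurable borel"
  unfolding wt_def[abs_def] by measurable

text \<open>Small scales are integrable after multiplication by t^2 because \<open>s < 1\<close>:
  the antiderivative t^(2 - 2s) / (2 - 2s) vanishes at 0. At large scales, in \<open>wt_far\<close>,
  it is \<open>0 < s\<close> that gives convergence.\<close>

lemma wt_near:
  assumes "s < 1" "0 < d"
  shows "(\<integral>\<^sup>+t. ennreal (wt s t * t\<^sup>2) * indicator {..d} t \<partial>lborel) = ennreal (d powr (2 - 2 * s) / (2 - 2 * s))"
proof -
  have "((\<lambda>t. t powr (1 - 2 * s)) has_integral (d powr (2 - 2 * s) / (2 - 2 * s) - 0 powr (2 - 2 * s) / (2 - 2 * s))) {0..d}"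
  proof (rule fundamental_theorem_of_calculus_interior)
    show "continuous_on {0..d} (\<lambda>t. t powr (2 - 2 * s) / (2 - 2 * s))"
      using assms by (intro continuous_intros continuous_on_powr') auto
    show "((\<lambda>t. t powr (2 - 2 * s) / (2 - 2 * s)) has_vector_derivative t powr (1 - 2 * s)) (at t)" if "t \<in> {0<..<d}" for t
      using that assms
      by (auto intro!: derivative_eq_intros simp: has_real_derivative_iff_has_vector_derivative[symmetric])
  qed (use assms in auto)
  then have "(\<integral>\<^sup>+t. ennreal (t powr (1 - 2 * s)) * indicator {0..d} t \<partial>lborel) = ennreal (d powr (2 - 2 * s) / (2 - 2 * s))"
    by (intro nn_integral_has_integral_lebesgue') auto
  also have "(\<integral>\<^sup>+t. ennreal (t powr (1 - 2 * s)) * indicator {0..d} t \<partial>lborel) = (\<integral>\<^sup>+t. ennreal (wt s t * t\<^sup>2) * indicator {..d} t \<partial>lborel)"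
  proof (intro nn_integral_cong)
    fix t :: real
    have "t powr (1 - 2 * s) = t powr (- 1 - 2 * s) * t\<^sup>2" if "t > 0"
      using that powr_add[of t "- 1 - 2 * s" 2] by simp
    then show "ennreal (t powr (1 - 2 * s)) * indicator {0..d} t = ennreal (wt s t * t\<^sup>2) * indicator {..d} t"
      by (cases "t > 0") (auto simp: wt_def indicator_def)
  qed
  finally show ?thesis .
qed

lemma wt_far:
  assumes "0 < s" "0 < d"
  shows "(\<integral>\<^sup>+t. ennreal (wt s t) * indicator {d..} t \<partial>lborel) = ennreal (d powr (- 2 * s) / (2 * s))"
proof -
  have "((\<lambda>t. t powr (- 2 * s)) \<longlongrightarrow> 0) at_top"
    using assms by (intro tendsto_neg_powr filterlim_ident) auto
  then have "((\<lambda>t. - (t powr (- 2 * s)) / (2 * s)) \<longlongrightarrow> - 0 / (2 * s)) at_top"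
    using assms by (intro tendsto_intros) auto
  then have lim: "((\<lambda>t. - (t powr (- 2 * s)) / (2 * s)) \<longlongrightarrow> 0) at_top" by simp
  have "(\<integral>\<^sup>+t. ennreal (t powr (- 1 - 2 * s)) * indicator {d..} t \<partial>lborel) = ennreal (0 - (- (d powr (- 2 * s)) / (2 * s)))"
  proof (rule nn_integral_FTC_atLeast[OF _ _ _ lim])
    show "((\<lambda>t. - (t powr (- 2 * s)) / (2 * s)) has_real_derivative t powr (- 1 - 2 * s)) (at t)" if "d \<le> t" for t
    proof -
      have "((\<lambda>t. t powr (- 2 * s)) has_real_derivative (- 2 * s) * t powr (- 2 * s - 1)) (at t)"
        using that assms by (intro has_real_derivative_powr) auto
      then have "((\<lambda>t. - (t powr (- 2 * s)) / (2 * s)) has_real_derivative - ((- 2 * s) * t powr (- 2 * s - 1)) / (2 * s)) (at t)"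
        by (intro DERIV_cdivide DERIV_minus)
      moreover have "- ((- 2 * s) * t powr (- 2 * s - 1)) / (2 * s) = t powr (- 1 - 2 * s)"
        using assms by (simp add: minus_diff_commute)
      ultimately show ?thesis by (simp only:)
    qed
  qed auto
  also have "(\<integral>\<^sup>+t. ennreal (t powr (- 1 - 2 * s)) * indicator {d..} t \<partial>lborel) = (\<integral>\<^sup>+t. ennreal (wt s t) * indicator {d..} t \<partial>lborel)"
    using assms by (intro nn_integral_cong) (auto simp: wt_def indicator_def)
  finally show ?thesis by simp
qed

lemma \<rho>_measurable [measurable]: "\<rho> \<in> borel_measurable borel"
  using smb_measurable[OF kern_smb[OF kern_\<rho>]] .

lemma scl_\<rho>_measurable [measurable (raw)]:
  assumes "f \<in> borel_measurable M" "g \<in> borel_measurable M"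
  shows "(\<lambda>x. scl (f x) \<rho> (g x :: 'a::euclidean_space)) \<in> borel_measurable M"
  unfolding scl_def using assms by measurable

lemma scl_\<rho>_nonneg: "0 < t \<Longrightarrow> 0 \<le> scl t \<rho> z"
  by (simp add: scl_def \<rho>_nonneg)

text \<open>For negative \<open>t\<close> in odd dimension the power in \<open>scl\<close> is
  negative; there \<open>wt\<close> is 0.\<close>

lemma wt_scl_nonneg: "0 \<le> wt s t * scl t \<rho> z"
  by (cases "t > 0") (auto simp: scl_\<rho>_nonneg wt_nonneg, simp add: wt_def)

text \<open>The factor left over when t = norm z * r is substituted in the superposition over
  scales. It stays extended-valued until \<open>kernel_constant\<close> shows it to be finite and
  positive.\<close>

definition kcE :: "real \<Rightarrow> 'a::euclidean_space \<Rightarrow> ennreal" where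
  "kcE s e = (\<integral>\<^sup>+r. ennreal (indicator {0<..} r * r powr (- 1 - 2 * s - real DIM('a)) * \<rho> (e /\<^sub>R r)) \<partial>lborel)"

text \<open>The substitution t = norm z * r pulls out the powers of \<open>norm z\<close>. As
  \<open>\<rho>\<close> is radial, only the length of \<open>z\<close> matters, so one unit vector
  \<open>e\<close> serves all \<open>z\<close>.\<close>

lemma kernel_scales:
  fixes z e :: "'a::euclidean_space"
  assumes z: "z \<noteq> 0" and e: "norm e = 1"
  shows "(\<integral>\<^sup>+t. ennreal (wt s t * scl t \<rho> z) \<partial>lborel) = kcE s e * ennreal (norm z powr (- (real DIM('a) + 2 * s)))"
proof -
  let ?n = "norm z" and ?N = "real DIM('a)"
  have n: "0 < ?n" using z by simp
  have "(\<integral>\<^sup>+t. ennreal (wt s t * scl t \<rho> z) \<partial>lborel) = ennreal ?n * (\<integral>\<^sup>+r. ennreal (wt s (0 + ?n * r) * scl (0 + ?n * r) \<rho> z) \<partial>lborel)"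
    using nn_integral_real_affine[of "\<lambda>t. ennreal (wt s t * scl t \<rho> z)" ?n 0] n by simp
  also have "(\<integral>\<^sup>+r. ennreal (wt s (0 + ?n * r) * scl (0 + ?n * r) \<rho> z) \<partial>lborel)
    = (\<integral>\<^sup>+r. ennreal (?n powr (- 1 - 2 * s - ?N)) * ennreal (indicator {0<..} r * r powr (- 1 - 2 * s - ?N) * \<rho> (e /\<^sub>R r)) \<partial>lborel)"
  proof (intro nn_integral_cong)
    fix r :: real
    show "ennreal (wt s (0 + ?n * r) * scl (0 + ?n * r) \<rho> z) = ennreal (?n powr (- 1 - 2 * s - ?N)) * ennreal (indicator {0<..} r * r powr (- 1 - 2 * s - ?N) * \<rho> (e /\<^sub>R r))"
    proof (cases "r > 0")
      case True
      have "\<rho> (z /\<^sub>R (?n * r)) = \<rho> (e /\<^sub>R r)"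
        using True n e by (intro \<rho>_cong) (simp add: field_simps)
      moreover have "(?n * r) powr (- 1 - 2 * s) / (?n * r) ^ DIM('a) = ?n powr (- 1 - 2 * s - ?N) * r powr (- 1 - 2 * s - ?N)"
        using True n by (simp add: powr_mult powr_diff[of _ "- 1 - 2 * s" "?N"] powr_realpow power_mult_distrib)
      ultimately have "wt s (?n * r) * scl (?n * r) \<rho> z = ?n powr (- 1 - 2 * s - ?N) * (r powr (- 1 - 2 * s - ?N) * \<rho> (e /\<^sub>R r))"
        using True n by (simp add: wt_def scl_def divide_inverse mult_ac)
      then show ?thesis using True by (simp add: ennreal_mult'[symmetric])
    next
      case False
      then have "\<not> 0 < ?n * r" using n by (simp add: zero_less_mult_iff)
      then show ?thesis using False by (simp add: wt_def)
    qed
  qed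
  also have "\<dots> = ennreal (?n powr (- 1 - 2 * s - ?N)) * kcE s e"
    unfolding kcE_def by (intro nn_integral_cmult) measurable
  also have "ennreal ?n * (ennreal (?n powr (- 1 - 2 * s - ?N)) * kcE s e) = kcE s e * ennreal (?n * ?n powr (- 1 - 2 * s - ?N))"
    using n by (simp add: ennreal_mult mult_ac)
  also have "?n * ?n powr (- 1 - 2 * s - ?N) = ?n powr (- (?N + 2 * s))"
    using n powr_add[of ?n 1 "- 1 - 2 * s - ?N"] by (simp add: algebra_simps)
  finally show ?thesis .
qed

text \<open>For r < 1 the argument \<open>e /\<^sub>R r\<close> lies outside the support of
  \<open>\<rho>\<close>, which leaves a convergent tail; for r between 1 and 2 it lies in the open
  unit ball, where \<open>\<rho>\<close> is positive.\<close>

lemma kernel_constant: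
  fixes e :: "'a::euclidean_space"
  assumes s: "0 < s" and e: "norm e = 1"
  shows "kcE s e < \<infinity>" "0 < kcE s e"
proof -
  let ?f = "\<lambda>r. indicator {0<..} r * r powr (- 1 - 2 * s - real DIM('a)) * \<rho> (e /\<^sub>R r)"
  obtain B where B: "0 \<le> B" "\<And>z::'a. \<bar>\<rho> z\<bar> \<le> B" using smb_bdd[OF kern_smb[OF kern_\<rho>]] by metis
  have "kcE s e \<le> (\<integral>\<^sup>+r. ennreal B * (ennreal (wt s r) * indicator {1..} r) \<partial>lborel)"
    unfolding kcE_def
  proof (intro nn_integral_mono)
    fix r :: real
    show "ennreal (?f r) \<le> ennreal B * (ennreal (wt s r) * indicator {1..} r)"
    proof (cases "r \<ge> 1")
      case True
      have "r powr (- 1 - 2 * s - real DIM('a)) * \<rho> (e /\<^sub>R r) \<le> r powr (- 1 - 2 * s) * B"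
        using True B(1) abs_le_D1[OF B(2)] by (intro mult_mono powr_mono) (auto simp: \<rho>_nonneg)
      then show ?thesis using True B(1) by (simp add: wt_def ennreal_mult'[symmetric] mult.commute)
    next
      case False
      have "\<rho> (e /\<^sub>R r) = 0" if "r > 0"
        using that False e by (intro kern_zero[OF kern_\<rho>]) (simp add: field_simps)
      then show ?thesis using False by (cases "r > 0") auto
    qed
  qed
  also have "\<dots> = ennreal B * ennreal (1 powr (- 2 * s) / (2 * s))"
    using s wt_far[of s 1] by (subst nn_integral_cmult) auto
  also have "\<dots> < \<infinity>" by (simp add: ennreal_mult_less_top)
  finally show "kcE s e < \<infinity>" .
  show "0 < kcE s e"
  proof (rule ccontr)
    assume "\<not> 0 < kcE s e"
    then have "(\<integral>\<^sup>+r. ennreal (?f r) \<partial>lborel) = 0" by (simp add: kcE_def)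
    then have "AE r in lborel. ennreal (?f r) = 0" by (subst (asm) nn_integral_0_iff_AE) auto
    then have "AE r in lborel. r \<notin> {1<..<2::real}"
    proof (rule eventually_mono, intro notI)
      fix r :: real assume r: "ennreal (?f r) = 0" "r \<in> {1<..<2}"
      then have "0 < \<rho> (e /\<^sub>R r)" using e by (intro \<rho>_pos) (simp add: field_simps)
      then show False using r by (simp add: ennreal_eq_0_iff not_le zero_less_mult_iff mult_le_0_iff)
    qed
    then have "{1<..<2::real} \<in> null_sets lborel" by (subst AE_iff_null_sets) auto
    then show False by (simp add: null_sets_def)
  qed
qed

subsection \<open>Products of Lebesgue measure\<close>

lemma distr_lebesgue: "distr lebesgue lborel (\<lambda>x. x) = (lborel :: 'a::euclidean_space measure)"
  using distr_completion[of "\<lambda>x. x" lborel "lborel :: 'a measure"] by (simp add: distr_id2)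

lemma sigma_finite_lebesgue: "sigma_finite_measure (lebesgue :: 'a::euclidean_space measure)"
proof (rule sigma_finite_measure_distr)
  show "sigma_finite_measure (distr lebesgue lborel (\<lambda>x::'a. x))"
    unfolding distr_lebesgue by (rule sigma_finite_lborel)
qed (simp add: measurable_completion)

text \<open>\<open>gagliardo_form\<close> integrates over a product of completed measures, whose
  measurable sets are more than those of \<open>lborel \<Otimes>\<^sub>M lborel\<close>. Pushing
  forward along the identity identifies the integrals of Borel functions over the two
  products.\<close>

lemma distr_lebesgue_pair:
  "distr (lebesgue \<Otimes>\<^sub>M lebesgue) (lborel \<Otimes>\<^sub>M lborel) (\<lambda>z. z) = (lborel \<Otimes>\<^sub>M lborel :: ('a::euclidean_space \<times> 'a) measure)"
proof -
  have m: "(\<lambda>x. x) \<in> measurable lebesgue (lborel :: 'a measure)" by (simp add: measurable_completion)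
  have "distr lebesgue lborel (\<lambda>x::'a. x) \<Otimes>\<^sub>M distr lebesgue lborel (\<lambda>x::'a. x)
    = distr (lebesgue \<Otimes>\<^sub>M lebesgue) (lborel \<Otimes>\<^sub>M lborel) (\<lambda>(x, y). (x, y))"
    by (rule pair_measure_distr[OF m m]) (simp add: distr_lebesgue sigma_finite_lborel)
  then show ?thesis by (simp add: distr_lebesgue id_def)
qed

lemma measurable_lebesgue_pair:
  "(\<lambda>z. z) \<in> measurable (lebesgue \<Otimes>\<^sub>M lebesgue) (lborel \<Otimes>\<^sub>M (lborel :: 'a::euclidean_space measure))"
proof -
  have "(\<lambda>z. (fst z, snd z)) \<in> measurable (lebesgue \<Otimes>\<^sub>M lebesgue) (lborel \<Otimes>\<^sub>M (lborel :: 'a measure))"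
    by (intro measurable_Pair measurable_compose[OF measurable_fst] measurable_compose[OF measurable_snd])
       (simp_all add: measurable_completion)
  then show ?thesis by simp
qed

lemma lebesgue_pair_integral:
  fixes f :: "'a::euclidean_space \<times> 'a \<Rightarrow> real"
  assumes "f \<in> borel_measurable (lborel \<Otimes>\<^sub>M lborel)"
  shows "(LINT z|(lebesgue \<Otimes>\<^sub>M lebesgue). f z) = (LINT z|(lborel \<Otimes>\<^sub>M lborel). f z)"
  using integral_distr[OF measurable_lebesgue_pair assms] by (simp add: distr_lebesgue_pair)

text \<open>Used to exchange a function for its Borel representative, or for an almost everywhere
  limit, inside double integrals.\<close>

lemma AE_pair_both:
  assumes M: "sigma_finite_measure M" and P: "AE x in M. P x"
  shows "AE z in M \<Otimes>\<^sub>M M. P (fst z) \<and> P (snd z)"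
proof -
  interpret M: sigma_finite_measure M by fact
  interpret pair_sigma_finite M M ..
  obtain N where N: "N \<in> null_sets M" "{x \<in> space M. \<not> P x} \<subseteq> N"
    using P by (auto elim!: AE_E)
  have Ns [measurable]: "N \<in> sets M" using N by auto
  have ae: "AE x in M. x \<notin> N" using AE_not_in N(1) by blast
  have "AE z in M \<Otimes>\<^sub>M M. fst z \<notin> N \<and> snd z \<notin> N"
  proof (rule AE_pair_measure)
    show "{z \<in> space (M \<Otimes>\<^sub>M M). fst z \<notin> N \<and> snd z \<notin> N} \<in> sets (M \<Otimes>\<^sub>M M)" by measurable
    show "AE x in M. AE y in M. fst (x, y) \<notin> N \<and> snd (x, y) \<notin> N"
      using ae by (rule eventually_mono) (use ae in auto)
  qed
  then show ?thesis
  proof (rule AE_mp, intro AE_I2 impI)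
    fix z assume "z \<in> space (M \<Otimes>\<^sub>M M)" "fst z \<notin> N \<and> snd z \<notin> N"
    then show "P (fst z) \<and> P (snd z)" using N(2) by (auto simp: space_pair_measure)
  qed
qed

subsection \<open>Finiteness of the Gagliardo seminorm\<close>

definition JJ :: "real \<Rightarrow> 'a::euclidean_space \<times> 'a \<Rightarrow> real" where
  "JJ s z = norm (fst z - snd z) powr (- (real DIM('a) + 2 * s))"

lemma JJ_measurable [measurable]: "JJ s \<in> borel_measurable (lborel \<Otimes>\<^sub>M (lborel :: 'a::euclidean_space measure))"
  unfolding JJ_def[abs_def] by measurable

lemma JJ_nonneg: "0 \<le> JJ s z" by (simp add: JJ_def)

text \<open>The squared seminorm as an extended value: unlike \<open>gagliardo_form s v v\<close> it
  is infinite, not 0, when the integrand fails to be integrable.\<close>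

definition gn :: "real \<Rightarrow> ('a::euclidean_space \<Rightarrow> real) \<Rightarrow> ennreal" where
  "gn s v = (\<integral>\<^sup>+z. ennreal ((v (fst z) - v (snd z))\<^sup>2 * JJ s z) \<partial>(lborel \<Otimes>\<^sub>M lborel))"

lemma kernel_scales_times:
  fixes z :: "'a::euclidean_space \<times> 'a"
  assumes D: "fst z = snd z \<Longrightarrow> D = 0" "0 \<le> D" and e: "norm (e::'a) = 1"
  shows "(\<integral>\<^sup>+t. ennreal (wt s t * scl t \<rho> (fst z - snd z) * D) \<partial>lborel) = kcE s e * ennreal (D * JJ s z)"
proof (cases "fst z = snd z")
  case False
  have "(\<integral>\<^sup>+t. ennreal (wt s t * scl t \<rho> (fst z - snd z) * D) \<partial>lborel) = (\<integral>\<^sup>+t. ennreal D * ennreal (wt s t * scl t \<rho> (fst z - snd z)) \<partial>lborel)"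
    using D(2) by (intro nn_integral_cong) (simp add: ennreal_mult'[symmetric] mult.commute)
  also have "\<dots> = ennreal D * (\<integral>\<^sup>+t. ennreal (wt s t * scl t \<rho> (fst z - snd z)) \<partial>lborel)"
    by (intro nn_integral_cmult) measurable
  also have "\<dots> = ennreal D * (kcE s e * ennreal (JJ s z))"
    using kernel_scales[OF _ e, of "fst z - snd z" s] False by (simp add: JJ_def)
  finally show ?thesis using D(2) by (simp add: ennreal_mult' mult_ac)
qed (use D in simp)

lemma scl_\<rho>_smb: "0 < t \<Longrightarrow> smb (scl t (\<rho> :: 'a::euclidean_space \<Rightarrow> real))"
  using test_smb[OF scl_test(2)[OF kern_\<rho> _ subset_UNIV]] .

lemma scl_\<rho>_integral:
  fixes x :: "'a::euclidean_space"
  assumes t: "0 < t"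
  shows "integrable lborel (\<lambda>y. scl t \<rho> (x - y))" "(LINT y|lborel. scl t \<rho> (x - y)) = 1"
    "(\<integral>\<^sup>+y. ennreal (scl t \<rho> (x - y)) \<partial>lborel) = 1" "(\<integral>\<^sup>+y. ennreal (scl t \<rho> (y - x)) \<partial>lborel) = 1"
proof -
  have "integrable lebesgue (scl t (\<rho> :: 'a \<Rightarrow> real))" using test_integrable'[OF scl_test(2)[OF kern_\<rho> t subset_UNIV]] .
  then have i: "integrable lborel (scl t (\<rho> :: 'a \<Rightarrow> real))"
    using smb_measurable[OF scl_\<rho>_smb[OF t]] by (subst (asm) integrable_completion) auto
  then show *: "integrable lborel (\<lambda>y. scl t \<rho> (x - y))"
    using lborel_integral_reflect(2)[OF smb_measurable[OF scl_\<rho>_smb[OF t]], of x] by simp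
  have "A \<rho> t (\<lambda>_. 1) x = cv (\<lambda>_. 1) (scl t \<rho>) x" using t by (intro A_eq_cv kern_\<rho>) auto
  then show **: "(LINT y|lborel. scl t \<rho> (x - y)) = 1" by (simp add: A_const \<rho>_integral cv_def)
  show ***: "(\<integral>\<^sup>+y. ennreal (scl t \<rho> (x - y)) \<partial>lborel) = 1"
    by (subst nn_integral_eq_integral[OF *]) (auto simp: ** scl_\<rho>_nonneg[OF t])
  have "scl t \<rho> (y - x) = scl t \<rho> (x - y)" for y
    using \<rho>_minus[of "(x - y) /\<^sub>R t"] by (simp add: scl_def scaleR_diff_right)
  then show "(\<integral>\<^sup>+y. ennreal (scl t \<rho> (y - x)) \<partial>lborel) = 1" using *** by simp
qed

lemma scl_\<rho>_zero: "0 < t \<Longrightarrow> norm z > t \<Longrightarrow> scl t \<rho> z = 0"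
  using kern_zero[OF kern_\<rho>, of "z /\<^sub>R t"] by (simp add: scl_def divide_simps)

text \<open>Writing the singular kernel as a superposition of mollifiers avoids polar coordinates.
  At scale \<open>t\<close> only pairs at distance at most \<open>t\<close> with one of the points
  in \<open>K\<close> contribute, and each of the two possibilities has mass
  \<open>m\<close>.\<close>

lemma test_gn_finite:
  fixes \<phi> :: "'a::euclidean_space \<Rightarrow> real"
  assumes \<phi>: "\<phi> \<in> test_functions \<Omega>" and s: "0 < s" "s < 1"
  shows "gn s \<phi> < \<infinity>"
proof -
  obtain e :: 'a where "e \<in> Basis" using nonempty_Basis by blast
  then have e: "norm e = 1" by simp
  obtain B K where K: "0 \<le> B" "\<And>x. \<bar>\<phi> x\<bar> \<le> B * indicator K x" "compact K" "K \<subseteq> \<Omega>"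
    using test_bounded_support[OF \<phi>] by metis
  have B: "\<bar>\<phi> x\<bar> \<le> B" for x using K(1) K(2)[of x] by (cases "x \<in> K") auto
  obtain L where L: "0 \<le> L" "\<And>x y. \<bar>\<phi> x - \<phi> y\<bar> \<le> L * norm (x - y)" using smb_lip[OF test_smb[OF \<phi>]] by metis
  note [measurable] = smb_measurable[OF test_smb[OF \<phi>]]
  have [measurable]: "K \<in> sets borel" using K(3) by (simp add: compact_imp_closed borel_closed)
  define m where "m = emeasure lborel K"
  have m: "m < \<infinity>" unfolding m_def using emeasure_bounded_finite[OF compact_imp_bounded[OF K(3)]] .
  \<comment> \<open>A bound for the squared increment over distances up to \<open>t\<close>:
    Lipschitz for small \<open>t\<close>, twice the supremum for large \<open>t\<close>. The two
    entries are matched to \<open>wt_near\<close> and \<open>wt_far\<close>.\<close>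
  define q where "q t = min (L\<^sup>2 * t\<^sup>2) (4 * B\<^sup>2)" for t
  have q0: "0 \<le> q t" for t by (simp add: q_def)
  interpret P: pair_sigma_finite "lborel \<Otimes>\<^sub>M lborel :: ('a \<times> 'a) measure" "lborel :: real measure"
    by (simp add: pair_sigma_finite_def lborel.sigma_finite_measure_axioms lborel_pair.sigma_finite_measure_axioms)
  have inner: "(\<integral>\<^sup>+z. ennreal (wt s t * scl t \<rho> (fst z - snd z) * (\<phi> (fst z) - \<phi> (snd z))\<^sup>2) \<partial>(lborel \<Otimes>\<^sub>M lborel))
      \<le> ennreal (wt s t * q t) * (2 * m)" for t
  proof (cases "t > 0")
    case True
    have "(\<integral>\<^sup>+z. ennreal (wt s t * scl t \<rho> (fst z - snd z) * (\<phi> (fst z) - \<phi> (snd z))\<^sup>2) \<partial>(lborel \<Otimes>\<^sub>M lborel))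
      \<le> (\<integral>\<^sup>+z. ennreal (wt s t * q t) * (indicator K (fst z) * ennreal (scl t \<rho> (fst z - snd z)) + indicator K (snd z) * ennreal (scl t \<rho> (fst z - snd z))) \<partial>(lborel \<Otimes>\<^sub>M lborel))"
    proof (rule nn_integral_mono)
      fix z :: "'a \<times> 'a"
      let ?S = "scl t \<rho> (fst z - snd z)" and ?d = "\<phi> (fst z) - \<phi> (snd z)"
      have S0: "0 \<le> ?S" using scl_\<rho>_nonneg[OF True] .
      show "ennreal (wt s t * ?S * ?d\<^sup>2) \<le> ennreal (wt s t * q t) * (indicator K (fst z) * ennreal ?S + indicator K (snd z) * ennreal ?S)"
      proof (cases "norm (fst z - snd z) > t \<or> (fst z \<notin> K \<and> snd z \<notin> K)")
        case True
        then have "?S = 0 \<or> ?d = 0"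
          using scl_\<rho>_zero[OF \<open>t > 0\<close>] K(2)[of "fst z"] K(2)[of "snd z"] by auto
        then show ?thesis by auto
      next
        case False
        have "\<bar>?d\<bar> \<le> L * t" using L(2)[of "fst z" "snd z"] False L(1) by (meson mult_left_mono not_le order_trans)
        then have "\<bar>?d\<bar>\<^sup>2 \<le> (L * t)\<^sup>2" by (intro power_mono) auto
        moreover have "\<bar>?d\<bar> \<le> 2 * B" using B[of "fst z"] B[of "snd z"] by linarith
        then have "\<bar>?d\<bar>\<^sup>2 \<le> (2 * B)\<^sup>2" by (intro power_mono) auto
        ultimately have "?d\<^sup>2 \<le> q t" by (simp add: q_def power_mult_distrib)
        then have "wt s t * ?S * ?d\<^sup>2 \<le> wt s t * q t * ?S"
          using mult_left_mono[of "?d\<^sup>2" "q t" "wt s t * ?S"] wt_nonneg[of s t] S0 by (simp add: mult_ac)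
        then have "ennreal (wt s t * ?S * ?d\<^sup>2) \<le> ennreal (wt s t * q t) * ennreal ?S"
          using q0 wt_nonneg[of s t] S0 by (simp add: ennreal_mult'[symmetric] ennreal_leI)
        also have "\<dots> \<le> ennreal (wt s t * q t) * (indicator K (fst z) * ennreal ?S + indicator K (snd z) * ennreal ?S)"
          using False by (intro mult_left_mono) (auto simp: indicator_def)
        finally show ?thesis .
      qed
    qed
    also have "\<dots> = ennreal (wt s t * q t) * ((\<integral>\<^sup>+z. indicator K (fst z) * ennreal (scl t \<rho> (fst z - snd z)) \<partial>(lborel \<Otimes>\<^sub>M lborel))
       + (\<integral>\<^sup>+z. indicator K (snd z) * ennreal (scl t \<rho> (fst z - snd z)) \<partial>(lborel \<Otimes>\<^sub>M lborel)))"
      by (subst nn_integral_cmult, measurable, subst nn_integral_add) auto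
    also have "(\<integral>\<^sup>+z. indicator K (fst z) * ennreal (scl t \<rho> (fst z - snd z)) \<partial>(lborel \<Otimes>\<^sub>M lborel))
      = (\<integral>\<^sup>+x. indicator K x * (\<integral>\<^sup>+y. ennreal (scl t \<rho> (x - y)) \<partial>lborel) \<partial>lborel)"
      by (subst lborel.nn_integral_fst[symmetric]) (auto simp: nn_integral_cmult)
    also have "\<dots> = m" unfolding scl_\<rho>_integral(3)[OF True] by (simp add: m_def)
    also have "(\<integral>\<^sup>+z. indicator K (snd z) * ennreal (scl t \<rho> (fst z - snd z)) \<partial>(lborel \<Otimes>\<^sub>M lborel))
      = (\<integral>\<^sup>+y. indicator K y * (\<integral>\<^sup>+x. ennreal (scl t \<rho> (x - y)) \<partial>lborel) \<partial>lborel)"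
      by (subst lborel_pair.nn_integral_snd[symmetric]) (auto simp: nn_integral_cmult)
    also have "\<dots> = m" unfolding scl_\<rho>_integral(4)[OF True] by (simp add: m_def)
    finally show ?thesis by (simp add: mult_2)
  qed (simp add: wt_def)
  have "kcE s e * gn s \<phi> = (\<integral>\<^sup>+z. \<integral>\<^sup>+t. ennreal (wt s t * scl t \<rho> (fst z - snd z) * (\<phi> (fst z) - \<phi> (snd z))\<^sup>2) \<partial>lborel \<partial>(lborel \<Otimes>\<^sub>M lborel))"
    unfolding gn_def by (subst kernel_scales_times[OF _ _ e]) (auto simp: nn_integral_cmult)
  also have "\<dots> = (\<integral>\<^sup>+t. \<integral>\<^sup>+z. ennreal (wt s t * scl t \<rho> (fst z - snd z) * (\<phi> (fst z) - \<phi> (snd z))\<^sup>2) \<partial>(lborel \<Otimes>\<^sub>M lborel) \<partial>lborel)"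
    by (subst P.Fubini'[symmetric]) auto
  also have "\<dots> \<le> (\<integral>\<^sup>+t. ennreal (wt s t * q t) * (2 * m) \<partial>lborel)"
    by (intro nn_integral_mono inner)
  also have "\<dots> = (\<integral>\<^sup>+t. ennreal (wt s t * q t) \<partial>lborel) * (2 * m)"
    unfolding q_def by (subst nn_integral_multc) auto
  also have "(\<integral>\<^sup>+t. ennreal (wt s t * q t) \<partial>lborel) \<le> (\<integral>\<^sup>+t. ennreal (L\<^sup>2) * (ennreal (wt s t * t\<^sup>2) * indicator {..1} t) + ennreal (4 * B\<^sup>2) * (ennreal (wt s t) * indicator {1..} t) \<partial>lborel)"
  proof (rule nn_integral_mono)
    fix t :: real
    have 1: "wt s t * q t \<le> L\<^sup>2 * (wt s t * t\<^sup>2)"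
      using mult_left_mono[of "q t" "L\<^sup>2 * t\<^sup>2" "wt s t"] wt_nonneg[of s t] by (simp add: q_def mult_ac)
    have 2: "wt s t * q t \<le> (4 * B\<^sup>2) * wt s t"
      using mult_left_mono[of "q t" "4 * B\<^sup>2" "wt s t"] wt_nonneg[of s t] by (simp add: q_def mult_ac)
    show "ennreal (wt s t * q t) \<le> ennreal (L\<^sup>2) * (ennreal (wt s t * t\<^sup>2) * indicator {..1} t) + ennreal (4 * B\<^sup>2) * (ennreal (wt s t) * indicator {1..} t)"
    proof (cases "t \<le> 1")
      case True
      then have "ennreal (wt s t * q t) \<le> ennreal (L\<^sup>2) * (ennreal (wt s t * t\<^sup>2) * indicator {..1} t)"
        using 1 wt_nonneg[of s t] by (simp add: ennreal_mult'[symmetric] ennreal_leI)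
      then show ?thesis by (rule order_trans) simp
    next
      case False
      then have "ennreal (wt s t * q t) \<le> ennreal (4 * B\<^sup>2) * (ennreal (wt s t) * indicator {1..} t)"
        using 2 wt_nonneg[of s t] by (simp add: ennreal_mult'[symmetric] ennreal_leI)
      then show ?thesis by (rule order_trans) simp
    qed
  qed
  also have "\<dots> = ennreal (L\<^sup>2) * ennreal (1 powr (2 - 2 * s) / (2 - 2 * s)) + ennreal (4 * B\<^sup>2) * ennreal (1 powr (- 2 * s) / (2 * s))"
    using wt_near[of s 1] wt_far[of s 1] s by (subst nn_integral_add) (auto simp: nn_integral_cmult)
  finally have "kcE s e * gn s \<phi> \<le> (ennreal (L\<^sup>2) * ennreal (1 powr (2 - 2 * s) / (2 - 2 * s)) + ennreal (4 * B\<^sup>2) * ennreal (1 powr (- 2 * s) / (2 * s))) * (2 * m)"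
    by (simp add: mult_right_mono)
  also have "\<dots> < \<infinity>" using m by (simp add: ennreal_mult_less_top ennreal_add_eq_top)
  \<comment> \<open>Finiteness of the product gives finiteness of \<open>gn\<close> because the
    factor \<open>kcE s e\<close> is not 0.\<close>
  finally show ?thesis using kernel_constant[OF s(1) e] by (auto simp: ennreal_mult_less_top)
qed

lemma gn_gagliardo:
  assumes v [measurable]: "v \<in> borel_measurable borel" and fin: "gn s v < \<infinity>"
  shows "gn s v = ennreal (gagliardo_form s v v)"
proof -
  have e: "(v x - v y) * (v x - v y) / norm (x - y) powr (real DIM('a) + 2 * s) = (v x - v y)\<^sup>2 * JJ s (x, y)" for x y
    unfolding JJ_def powr_minus by (simp add: divide_inverse power2_eq_square)
  have nn: "0 \<le> (v (fst z) - v (snd z))\<^sup>2 * JJ s z" for z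
    by (intro mult_nonneg_nonneg JJ_nonneg zero_le_power2)
  have i: "integrable (lborel \<Otimes>\<^sub>M lborel) (\<lambda>z. (v (fst z) - v (snd z))\<^sup>2 * JJ s z)"
    using fin unfolding gn_def by (intro integrableI_bounded) (simp_all add: abs_of_nonneg[OF nn] del: abs_mult)
  have "gagliardo_form s v v = (LINT z|(lebesgue \<Otimes>\<^sub>M lebesgue). (v (fst z) - v (snd z))\<^sup>2 * JJ s z)"
    unfolding gagliardo_form_def e by (intro Bochner_Integration.integral_cong) auto
  also have "\<dots> = (LINT z|(lborel \<Otimes>\<^sub>M lborel). (v (fst z) - v (snd z))\<^sup>2 * JJ s z)"
    by (intro lebesgue_pair_integral) measurable
  finally show ?thesis unfolding gn_def by (subst nn_integral_eq_integral[OF i]) (auto intro: AE_I2[OF nn])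
qed

text \<open>The approximating test functions have bounded seminorms, being Cauchy. A subsequence
  converges almost everywhere, hence on almost all pairs, and Fatou's lemma passes the bound to the
  limit.\<close>

lemma X_space_gn_finite:
  fixes u u0 :: "'a::euclidean_space \<Rightarrow> real"
  assumes u: "u \<in> X_space s \<Omega>" and \<Omega>: "open \<Omega>" "bounded \<Omega>" and s: "0 < s" "s < 1"
    and u0 [measurable]: "u0 \<in> borel_measurable borel" and eq: "AE x in lebesgue. u x = u0 x"
  shows "gn s u0 < \<infinity>"
proof -
  obtain \<phi> where \<phi>': "\<forall>k. \<phi> k \<in> test_functions \<Omega>"
    "\<forall>e>0. \<exists>N. \<forall>j\<ge>N. \<forall>k\<ge>N. X_norm s (\<lambda>x. \<phi> j x - \<phi> k x) < e"
    and ui: "integrable lebesgue u" and L1: "(\<lambda>k. LINT x|lebesgue. \<bar>\<phi> k x - u x\<bar>) \<longlonglongrightarrow> 0"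
    and "AE x in lebesgue. x \<notin> \<Omega> \<longrightarrow> u x = 0"
    by (rule X_space_L1[OF u \<Omega>])
  note \<phi> = \<phi>'[rule_format]
  have [measurable]: "\<phi> k \<in> borel_measurable borel" for k using smb_measurable[OF test_smb[OF \<phi>(1)]] .
  obtain N where N: "\<forall>j\<ge>N. \<forall>k\<ge>N. X_norm s (\<lambda>x. \<phi> j x - \<phi> k x) < 1" using \<phi>(2)[of 1] by auto
  define Q where "Q = 2 * gn s (\<phi> N) + 2"
  have bd: "gn s (\<phi> k) \<le> Q" if k: "k \<ge> N" for k
  proof -
    let ?d = "\<lambda>x. \<phi> N x - \<phi> k x"
    have d: "?d \<in> test_functions \<Omega>" using test_functions_diff \<phi>(1) by blast
    have "gagliardo_form s ?d ?d < 1\<^sup>2" using N k by (intro X_norm_less(2)) auto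
    \<comment> \<open>The bound on the Bochner value of \<open>gagliardo_form\<close> is meaningful
      only since \<open>test_gn_finite\<close> excludes an infinite integral.\<close>
    then have "gn s ?d \<le> 1"
      using gn_gagliardo[OF smb_measurable[OF test_smb[OF d]] test_gn_finite[OF d s]] by simp
    then have gd: "2 * gn s ?d \<le> 2" using mult_left_mono[of "gn s ?d" 1 2] by simp
    have "gn s (\<phi> k) \<le> (\<integral>\<^sup>+z. 2 * ennreal ((\<phi> N (fst z) - \<phi> N (snd z))\<^sup>2 * JJ s z) + 2 * ennreal ((?d (fst z) - ?d (snd z))\<^sup>2 * JJ s z) \<partial>(lborel \<Otimes>\<^sub>M lborel))"
      unfolding gn_def
    proof (rule nn_integral_mono)
      fix z :: "'a \<times> 'a"
      let ?a = "\<phi> N (fst z) - \<phi> N (snd z)" and ?b = "?d (fst z) - ?d (snd z)" and ?c = "\<phi> k (fst z) - \<phi> k (snd z)"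
      have "(a - b)\<^sup>2 \<le> 2 * a\<^sup>2 + 2 * b\<^sup>2" for a b :: real
        using zero_le_power2[of "a + b"] by (simp add: power2_eq_square algebra_simps)
      from this[of ?a ?b] have "?c\<^sup>2 \<le> 2 * ?a\<^sup>2 + 2 * ?b\<^sup>2" by simp
      then have "?c\<^sup>2 * JJ s z \<le> (2 * ?a\<^sup>2 + 2 * ?b\<^sup>2) * JJ s z" using JJ_nonneg by (intro mult_right_mono)
      then have "ennreal (?c\<^sup>2 * JJ s z) \<le> ennreal (2 * (?a\<^sup>2 * JJ s z) + 2 * (?b\<^sup>2 * JJ s z))"
        by (intro ennreal_leI) (simp add: algebra_simps)
      also have "\<dots> = 2 * ennreal (?a\<^sup>2 * JJ s z) + 2 * ennreal (?b\<^sup>2 * JJ s z)"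
        using JJ_nonneg[of s z] by (subst ennreal_plus) (auto simp: ennreal_mult')
      finally show "ennreal (?c\<^sup>2 * JJ s z) \<le> 2 * ennreal (?a\<^sup>2 * JJ s z) + 2 * ennreal (?b\<^sup>2 * JJ s z)" .
    qed
    also have "\<dots> = 2 * gn s (\<phi> N) + 2 * gn s ?d"
      unfolding gn_def by (subst nn_integral_add) (auto simp: nn_integral_cmult)
    also have "\<dots> \<le> Q" unfolding Q_def using gd by (intro add_left_mono)
    finally show ?thesis .
  qed
  obtain r where r: "strict_mono r" "AE x in lebesgue. (\<lambda>n. \<phi> (r n) x - u x) \<longlonglongrightarrow> 0"
    using tendsto_L1_AE_subseq[of lebesgue "\<lambda>n x. \<phi> n x - u x"] ui test_integrable'[OF \<phi>(1)] L1 by auto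
  have "AE x in lebesgue. (\<lambda>n. \<phi> (r n) x) \<longlonglongrightarrow> u0 x"
    using r(2) eq by eventually_elim (simp add: LIM_zero_iff)
  then have "AE x in lborel. (\<lambda>n. \<phi> (r n) x) \<longlonglongrightarrow> u0 x" by (rule AE_lebesgue_iff)
  from AE_pair_both[OF sigma_finite_lborel this]
  have ae: "AE z in lborel \<Otimes>\<^sub>M lborel. ennreal ((u0 (fst z) - u0 (snd z))\<^sup>2 * JJ s z) = liminf (\<lambda>n. ennreal ((\<phi> (r n) (fst z) - \<phi> (r n) (snd z))\<^sup>2 * JJ s z))"
  proof eventually_elim
    case (elim z)
    then have "(\<lambda>n. ennreal ((\<phi> (r n) (fst z) - \<phi> (r n) (snd z))\<^sup>2 * JJ s z)) \<longlonglongrightarrow> ennreal ((u0 (fst z) - u0 (snd z))\<^sup>2 * JJ s z)"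
      by (intro tendsto_intros) auto
    from lim_imp_Liminf[OF _ this] show ?case by simp
  qed
  have "gn s u0 = (\<integral>\<^sup>+z. liminf (\<lambda>n. ennreal ((\<phi> (r n) (fst z) - \<phi> (r n) (snd z))\<^sup>2 * JJ s z)) \<partial>(lborel \<Otimes>\<^sub>M lborel))"
    unfolding gn_def using ae by (rule nn_integral_cong_AE)
  also have "\<dots> \<le> liminf (\<lambda>n. gn s (\<phi> (r n)))"
    unfolding gn_def by (rule nn_integral_liminf) measurable
  also have "\<dots> \<le> liminf (\<lambda>n::nat. Q)"
  proof (rule Liminf_mono)
    show "\<forall>\<^sub>F n in sequentially. gn s (\<phi> (r n)) \<le> Q"
      using seq_suble[OF r(1)] by (intro eventually_sequentiallyI[of N] bd) (meson order_trans)
  qed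
  also have "\<dots> = Q" by (simp add: Liminf_const)
  also have "Q < \<infinity>" unfolding Q_def using test_gn_finite[OF \<phi>(1) s, of N] by (simp add: ennreal_mult_less_top)
  finally show ?thesis .
qed

section \<open>The mollified equation\<close>

lemma pd_reflect:
  assumes k: "smb k"
  shows "pd b (\<lambda>y. k (x - y)) y = - pd b k (x - y)"
proof -
  have "(k has_derivative (\<lambda>h. h \<bullet> grad k (x - y))) (at (x - y))"
    using smb_GDERIV[OF k] unfolding gderiv_def .
  moreover have "((\<lambda>y. x - y) has_derivative (\<lambda>h. - h)) (at y)"
    by (auto intro!: derivative_eq_intros)
  ultimately have "((\<lambda>y. k (x - y)) has_derivative (\<lambda>h. (- h) \<bullet> grad k (x - y))) (at y)"
    using has_derivative_compose by blast
  then have "GDERIV (\<lambda>y. k (x - y)) y :> - grad k (x - y)" unfolding gderiv_def by simp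
  from grad_eqI[OF this] show ?thesis by (simp add: pd_def)
qed

text \<open>The sign changes of the two derivatives cancel, so testing with a reflected kernel
  yields the Laplacian of a convolution.\<close>

lemma lap_reflect:
  assumes k: "smb k"
  shows "lap (\<lambda>y. k (x - y)) y = lap k (x - y)"
proof -
  have "pd b (pd b (\<lambda>y. k (x - y))) y = pd b (pd b k) (x - y)" if b: "b \<in> Basis" for b
  proof -
    have 1: "pd b (\<lambda>y. k (x - y)) = (\<lambda>y. - pd b k (x - y))" by (rule ext) (rule pd_reflect[OF k])
    have "GDERIV (\<lambda>y. pd b k (x - y)) y :> - grad (pd b k) (x - y)"
    proof -
      have "(pd b k has_derivative (\<lambda>h. h \<bullet> grad (pd b k) (x - y))) (at (x - y))"
        using smb_GDERIV[OF smb_pd[OF k b]] unfolding gderiv_def .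
      moreover have "((\<lambda>y. x - y) has_derivative (\<lambda>h. - h)) (at y)"
        by (auto intro!: derivative_eq_intros)
      ultimately have "((\<lambda>y. pd b k (x - y)) has_derivative (\<lambda>h. (- h) \<bullet> grad (pd b k) (x - y))) (at y)"
        using has_derivative_compose by blast
      then show ?thesis unfolding gderiv_def by simp
    qed
    from grad_eqI[OF GDERIV_minus[OF this]] show ?thesis unfolding 1 by (simp add: pd_def[of b])
  qed
  then show ?thesis by (simp add: lap_def)
qed

lemma lap_cv:
  assumes u: "integrable lborel u" and k: "smb k"
  shows "lap (cv u k) x = (LINT y|lborel. u y * lap k (x - y))"
proof -
  have "lap (cv u k) x = (\<Sum>b\<in>Basis. cv u (pd b (pd b k)) x)"
    using u k by (simp add: lap_def cv_pd smb_pd)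
  also have "\<dots> = (LINT y|lborel. (\<Sum>b\<in>Basis. u y * pd b (pd b k) (x - y)))"
    using cv_integrable[OF u smb_pd[OF smb_pd[OF k]]] unfolding cv_def
    by (intro Bochner_Integration.integral_sum[symmetric]) auto
  finally show ?thesis by (simp add: lap_def sum_distrib_left)
qed

lemma \<rho>_tensor_integrable: "integrable (lborel \<Otimes>\<^sub>M lborel) (\<lambda>z::'a::euclidean_space \<times> 'a. \<rho> (fst z) * \<rho> (snd z))"
proof (rule integrableI_bounded)
  have 1: "(\<integral>\<^sup>+x. ennreal (\<rho> (x::'a)) \<partial>lborel) = 1"
    using \<rho>_integral[where 'a='a] by (subst nn_integral_eq_integral[OF kern_integrable'[OF kern_\<rho>]]) (auto simp: \<rho>_nonneg)
  have "(\<integral>\<^sup>+z. ennreal (norm (\<rho> (fst z :: 'a) * \<rho> (snd z :: 'a))) \<partial>(lborel \<Otimes>\<^sub>M lborel))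
    = (\<integral>\<^sup>+x. (\<integral>\<^sup>+y. ennreal (\<rho> (x::'a)) * ennreal (\<rho> (y::'a)) \<partial>lborel) \<partial>lborel)"
    by (subst lborel.nn_integral_fst[symmetric]) (auto simp: abs_mult \<rho>_nonneg ennreal_mult')
  also have "\<dots> = 1" by (simp add: nn_integral_cmult 1)
  finally show "(\<integral>\<^sup>+z. ennreal (norm (\<rho> (fst z :: 'a) * \<rho> (snd z :: 'a))) \<partial>(lborel \<Otimes>\<^sub>M lborel)) < \<infinity>" by simp
qed measurable

text \<open>Fubini, with the integrable majorant given by the product of the two kernels. It later
  allows fixing one scale while the other tends to 0.\<close>

lemma A_\<rho>_commute:
  assumes u: "bbor u"
  shows "A \<rho> d (A \<rho> t u) x = A \<rho> t (A \<rho> d u) x"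
proof -
  obtain M where M: "\<And>x. \<bar>u x\<bar> \<le> M" and um [measurable]: "u \<in> borel_measurable borel" using u by (auto simp: bbor_def)
  have i: "integrable (lborel \<Otimes>\<^sub>M lborel) (\<lambda>(z, w). \<rho> z * (\<rho> w * u (x - d *\<^sub>R z - t *\<^sub>R w)))"
  proof (rule Bochner_Integration.integrable_bound)
    show "integrable (lborel \<Otimes>\<^sub>M lborel) (\<lambda>z. M * (\<rho> (fst z :: 'a) * \<rho> (snd z :: 'a)))"
      by (intro integrable_mult_right \<rho>_tensor_integrable)
    show "AE z in lborel \<Otimes>\<^sub>M lborel. norm (case z of (z, w) \<Rightarrow> \<rho> z * (\<rho> w * u (x - d *\<^sub>R z - t *\<^sub>R w))) \<le> norm (M * (\<rho> (fst z :: 'a) * \<rho> (snd z :: 'a)))"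
    proof (intro AE_I2)
      fix z :: "'a \<times> 'a"
      have "\<bar>u (x - d *\<^sub>R fst z - t *\<^sub>R snd z)\<bar> \<le> \<bar>M\<bar>" using M[of "x - d *\<^sub>R fst z - t *\<^sub>R snd z"] by linarith
      then have "\<rho> (fst z) * (\<rho> (snd z) * \<bar>u (x - d *\<^sub>R fst z - t *\<^sub>R snd z)\<bar>) \<le> \<rho> (fst z) * (\<rho> (snd z) * \<bar>M\<bar>)"
        by (intro mult_left_mono \<rho>_nonneg)
      then show "norm (case z of (z, w) \<Rightarrow> \<rho> z * (\<rho> w * u (x - d *\<^sub>R z - t *\<^sub>R w))) \<le> norm (M * (\<rho> (fst z :: 'a) * \<rho> (snd z :: 'a)))"
        by (simp add: split_beta abs_mult \<rho>_nonneg mult_ac)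
    qed
  qed measurable
  have "A \<rho> d (A \<rho> t u) x = (LINT z|lborel. LINT w|lborel. \<rho> z * (\<rho> w * u (x - d *\<^sub>R z - t *\<^sub>R w)))"
    by (simp add: A_def)
  also have "\<dots> = (LINT w|lborel. LINT z|lborel. \<rho> z * (\<rho> w * u (x - d *\<^sub>R z - t *\<^sub>R w)))"
    using lborel_pair.Fubini_integral[OF i] by simp
  also have "\<dots> = (LINT w|lborel. \<rho> w * (LINT z|lborel. \<rho> z * u (x - t *\<^sub>R w - d *\<^sub>R z)))"
  proof (intro Bochner_Integration.integral_cong refl)
    fix w :: 'a
    have "(LINT z|lborel. \<rho> z * (\<rho> w * u (x - d *\<^sub>R z - t *\<^sub>R w))) = (LINT z|lborel. \<rho> w * (\<rho> z * u (x - t *\<^sub>R w - d *\<^sub>R z)))"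
      by (intro Bochner_Integration.integral_cong refl) (simp add: algebra_simps)
    then show "(LINT z|lborel. \<rho> z * (\<rho> w * u (x - d *\<^sub>R z - t *\<^sub>R w))) = \<rho> w * (LINT z|lborel. \<rho> z * u (x - t *\<^sub>R w - d *\<^sub>R z))" by simp
  qed
  finally show ?thesis by (simp add: A_def)
qed

lemma A_borel:
  assumes "kern k" "u \<in> borel_measurable borel" shows "A k t u \<in> borel_measurable borel"
proof -
  have [measurable]: "k \<in> borel_measurable borel" "u \<in> borel_measurable borel"
    using assms smb_measurable kern_smb by blast+
  have "(\<lambda>x. LINT z|lborel. k z * u (x - t *\<^sub>R z)) \<in> borel_measurable borel" by measurable
  then show ?thesis by (simp add: A_def[abs_def])
qed

lemma scl_\<rho>_sym: "scl t \<rho> (x - y) = scl t \<rho> (y - x)"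
  using \<rho>_minus[of "(x - y) /\<^sub>R t"] by (simp add: scl_def scaleR_diff_right)

text \<open>Expanding the product gives four integrals. In the two where \<open>u\<close> and the
  test function share their variable, the kernel contributes its mass 1 and
  \<open>A \<rho> d u x\<close> remains; in the two mixed ones it averages \<open>u\<close> at scale
  \<open>t\<close> as well.\<close>

lemma form_at_scale:
  fixes u :: "'a::euclidean_space \<Rightarrow> real" and x :: 'a
  assumes u: "bbor u" and d: "0 < d" and t: "0 < t"
  defines "\<phi> \<equiv> \<lambda>y. scl d \<rho> (x - y)"
  shows "(LINT z|(lborel \<Otimes>\<^sub>M lborel). scl t \<rho> (fst z - snd z) * ((u (fst z) - u (snd z)) * (\<phi> (fst z) - \<phi> (snd z))))
    = 2 * (A \<rho> d u x - A \<rho> t (A \<rho> d u) x)"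
proof -
  obtain M where M: "\<And>x. \<bar>u x\<bar> \<le> M" and um [measurable]: "u \<in> borel_measurable borel" using u by (auto simp: bbor_def)
  have \<phi>m [measurable]: "\<phi> \<in> borel_measurable borel" unfolding \<phi>_def by measurable
  have \<phi>0: "0 \<le> \<phi> y" for y unfolding \<phi>_def using d by (rule scl_\<rho>_nonneg)
  have t0: "0 \<le> scl t \<rho> z" for z :: 'a using t by (rule scl_\<rho>_nonneg)
  have \<phi>1: "(\<integral>\<^sup>+y. ennreal (\<phi> y) \<partial>lborel) = 1" unfolding \<phi>_def by (rule scl_\<rho>_integral(3)[OF d])
  have s0: "(LINT y|lborel. scl t \<rho> (x - y)) = 1" for x :: 'a by (rule scl_\<rho>_integral(2)[OF t])
  have s1: "(LINT x|lborel. scl t \<rho> (x - y)) = 1" for y :: 'a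
    using scl_\<rho>_integral(2)[OF t, of y] by (simp add: scl_\<rho>_sym[of t y])
  have E1: "integrable (lborel \<Otimes>\<^sub>M lborel) (\<lambda>z. \<phi> (fst z) * scl t \<rho> (fst z - snd z))"
  proof (rule integrableI_bounded)
    have "(\<integral>\<^sup>+z. ennreal (norm (\<phi> (fst z) * scl t \<rho> (fst z - snd z))) \<partial>(lborel \<Otimes>\<^sub>M lborel))
      = (\<integral>\<^sup>+x. ennreal (\<phi> x) * (\<integral>\<^sup>+y. ennreal (scl t \<rho> (x - y)) \<partial>lborel) \<partial>lborel)"
      using \<phi>0 t0 by (subst lborel.nn_integral_fst[symmetric]) (auto simp: abs_mult ennreal_mult' nn_integral_cmult)
    also have "\<dots> = 1" unfolding scl_\<rho>_integral(3)[OF t] using \<phi>1 by simp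
    finally show "(\<integral>\<^sup>+z. ennreal (norm (\<phi> (fst z) * scl t \<rho> (fst z - snd z))) \<partial>(lborel \<Otimes>\<^sub>M lborel)) < \<infinity>" by simp
  qed measurable
  have E2: "integrable (lborel \<Otimes>\<^sub>M lborel) (\<lambda>z. \<phi> (snd z) * scl t \<rho> (fst z - snd z))"
    using lborel_pair.integrable_product_swap[OF E1] by (simp add: split_beta' scl_\<rho>_sym)
  have b: "integrable (lborel \<Otimes>\<^sub>M lborel) (\<lambda>z. w z * E z)"
    if "integrable (lborel \<Otimes>\<^sub>M lborel) E" and wm: "w \<in> borel_measurable (lborel \<Otimes>\<^sub>M lborel)" and w: "\<And>z. \<bar>w z\<bar> \<le> M"
    for w E :: "'a \<times> 'a \<Rightarrow> real"
  proof (rule Bochner_Integration.integrable_bound)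
    show "integrable (lborel \<Otimes>\<^sub>M lborel) (\<lambda>z. M * E z)" using that(1) by simp
    show "(\<lambda>z. w z * E z) \<in> borel_measurable (lborel \<Otimes>\<^sub>M lborel)" using wm that(1) by measurable
    show "AE z in lborel \<Otimes>\<^sub>M lborel. norm (w z * E z) \<le> norm (M * E z)"
      using w by (intro AE_I2) (simp add: abs_mult mult_right_mono order_trans[OF _ abs_ge_self])
  qed
  note T1 = b[OF E1, of "\<lambda>z. u (fst z)"] and T2 = b[OF E2, of "\<lambda>z. u (fst z)"]
    and T3 = b[OF E1, of "\<lambda>z. u (snd z)"] and T4 = b[OF E2, of "\<lambda>z. u (snd z)"]
  have i: "integrable (lborel \<Otimes>\<^sub>M lborel) (\<lambda>z. u (fst z) * (\<phi> (fst z) * scl t \<rho> (fst z - snd z)))"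
    "integrable (lborel \<Otimes>\<^sub>M lborel) (\<lambda>z. u (fst z) * (\<phi> (snd z) * scl t \<rho> (fst z - snd z)))"
    "integrable (lborel \<Otimes>\<^sub>M lborel) (\<lambda>z. u (snd z) * (\<phi> (fst z) * scl t \<rho> (fst z - snd z)))"
    "integrable (lborel \<Otimes>\<^sub>M lborel) (\<lambda>z. u (snd z) * (\<phi> (snd z) * scl t \<rho> (fst z - snd z)))"
    using M by (intro T1 T2 T3 T4; measurable)+
  have Au: "A \<rho> t u y = (LINT x|lborel. u x * scl t \<rho> (y - x))" for y
    using A_eq_cv[OF kern_\<rho> um t, of y] by (simp add: cv_def)
  have v: "A \<rho> d w x = (LINT y|lborel. w y * \<phi> y)" if "w \<in> borel_measurable borel" for w
    using A_eq_cv[OF kern_\<rho> that d, of x] by (simp add: cv_def \<phi>_def)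
  have e1: "(LINT z|(lborel \<Otimes>\<^sub>M lborel). u (fst z) * (\<phi> (fst z) * scl t \<rho> (fst z - snd z))) = A \<rho> d u x"
    by (subst lborel_pair.integral_fst'[OF i(1), symmetric]) (simp add: v s0 mult.assoc[symmetric])
  have e4: "(LINT z|(lborel \<Otimes>\<^sub>M lborel). u (snd z) * (\<phi> (snd z) * scl t \<rho> (fst z - snd z))) = A \<rho> d u x"
    using lborel_pair.integral_snd[of "\<lambda>x y. u y * (\<phi> y * scl t \<rho> (x - y))"] i(4)
    by (simp add: split_beta' v s1 mult.assoc[symmetric])
  have e2: "(LINT z|(lborel \<Otimes>\<^sub>M lborel). u (fst z) * (\<phi> (snd z) * scl t \<rho> (fst z - snd z))) = A \<rho> d (A \<rho> t u) x"
  proof -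
    have "(LINT x|lborel. u x * (\<phi> y * scl t \<rho> (x - y))) = A \<rho> t u y * \<phi> y" for y
      unfolding Au by (subst integral_mult_left_zero[symmetric]) (simp add: scl_\<rho>_sym[of t y] mult_ac)
    then show ?thesis
      using lborel_pair.integral_snd[of "\<lambda>x y. u x * (\<phi> y * scl t \<rho> (x - y))"] i(2)
      by (simp add: split_beta' v A_borel[OF kern_\<rho> um])
  qed
  have e3: "(LINT z|(lborel \<Otimes>\<^sub>M lborel). u (snd z) * (\<phi> (fst z) * scl t \<rho> (fst z - snd z))) = A \<rho> d (A \<rho> t u) x"
  proof -
    have "(LINT y|lborel. u y * (\<phi> x * scl t \<rho> (x - y))) = A \<rho> t u x * \<phi> x" for x
      unfolding Au by (subst integral_mult_left_zero[symmetric]) (simp add: mult_ac)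
    then show ?thesis
      by (subst lborel_pair.integral_fst'[OF i(3), symmetric]) (simp add: v A_borel[OF kern_\<rho> um])
  qed
  have "(LINT z|(lborel \<Otimes>\<^sub>M lborel). scl t \<rho> (fst z - snd z) * ((u (fst z) - u (snd z)) * (\<phi> (fst z) - \<phi> (snd z))))
    = (LINT z|(lborel \<Otimes>\<^sub>M lborel). u (fst z) * (\<phi> (fst z) * scl t \<rho> (fst z - snd z)) - u (fst z) * (\<phi> (snd z) * scl t \<rho> (fst z - snd z))
       - u (snd z) * (\<phi> (fst z) * scl t \<rho> (fst z - snd z)) + u (snd z) * (\<phi> (snd z) * scl t \<rho> (fst z - snd z)))"
    by (intro Bochner_Integration.integral_cong refl) (simp add: algebra_simps)
  also have "\<dots> = 2 * (A \<rho> d u x - A \<rho> d (A \<rho> t u) x)"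
    using i by (simp add: e1 e2 e3 e4)
  finally show ?thesis by (simp only: A_\<rho>_commute[OF u])
qed

text \<open>Fubini over pairs of points and scales. Absolute integrability follows from \<bar>a
  b\<bar> \<le> a^2 + b^2 and the finiteness of \<open>gn\<close> for \<open>u\<close> and for the
  test function; integrating out the scales first gives back the singular kernel, integrating out
  the pairs first gives \<open>form_at_scale\<close>.\<close>

lemma gagliardo_mollified:
  fixes u :: "'a::euclidean_space \<Rightarrow> real" and x :: 'a
  assumes u: "bbor u" and gu: "gn s u < \<infinity>" and s: "0 < s" "s < 1" and d: "0 < d" and e: "norm (e::'a) = 1"
  defines "\<phi> \<equiv> \<lambda>y. scl d \<rho> (x - y)" and "v \<equiv> A \<rho> d u"
  shows "integrable lborel (\<lambda>t. wt s t * (v x - A \<rho> t v x))"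
    and "enn2real (kcE s e) * (LINT z|(lborel \<Otimes>\<^sub>M lborel). (u (fst z) - u (snd z)) * (\<phi> (fst z) - \<phi> (snd z)) * JJ s z)
      = 2 * (LINT t|lborel. wt s t * (v x - A \<rho> t v x))"
proof -
  interpret P: pair_sigma_finite "lborel \<Otimes>\<^sub>M lborel :: ('a \<times> 'a) measure" "lborel :: real measure"
    by (simp add: pair_sigma_finite_def lborel.sigma_finite_measure_axioms lborel_pair.sigma_finite_measure_axioms)
  have [measurable]: "u \<in> borel_measurable borel" using u by (rule bbor_measurable)
  have \<phi>m [measurable]: "\<phi> \<in> borel_measurable borel" unfolding \<phi>_def by measurable
  have \<phi>t: "\<phi> \<in> test_functions UNIV" unfolding \<phi>_def by (rule scl_test(1)[OF kern_\<rho> d subset_UNIV])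
  define D where "D z = (u (fst z) - u (snd z)) * (\<phi> (fst z) - \<phi> (snd z))" for z
  have Dm [measurable]: "D \<in> borel_measurable (lborel \<Otimes>\<^sub>M lborel)" unfolding D_def[abs_def] by measurable
  have D0: "fst z = snd z \<Longrightarrow> D z = 0" for z by (simp add: D_def)
  note kc = kernel_constant[OF s(1) e]
  have DJ: "(\<integral>\<^sup>+z. ennreal (\<bar>D z\<bar> * JJ s z) \<partial>(lborel \<Otimes>\<^sub>M lborel)) < \<infinity>"
  proof -
    have "(\<integral>\<^sup>+z. ennreal (\<bar>D z\<bar> * JJ s z) \<partial>(lborel \<Otimes>\<^sub>M lborel))
      \<le> (\<integral>\<^sup>+z. ennreal ((u (fst z) - u (snd z))\<^sup>2 * JJ s z) + ennreal ((\<phi> (fst z) - \<phi> (snd z))\<^sup>2 * JJ s z) \<partial>(lborel \<Otimes>\<^sub>M lborel))"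
    proof (rule nn_integral_mono)
      fix z :: "'a \<times> 'a"
      have "\<bar>a * b\<bar> \<le> a\<^sup>2 + b\<^sup>2" for a b :: real
      proof -
        have "\<bar>a * b\<bar> \<le> 2 * \<bar>a\<bar> * \<bar>b\<bar>" by (simp add: abs_mult)
        also have "\<dots> \<le> \<bar>a\<bar>\<^sup>2 + \<bar>b\<bar>\<^sup>2" by (rule sum_squares_bound)
        finally show ?thesis by simp
      qed
      then have "\<bar>D z\<bar> * JJ s z \<le> ((u (fst z) - u (snd z))\<^sup>2 + (\<phi> (fst z) - \<phi> (snd z))\<^sup>2) * JJ s z"
        unfolding D_def by (intro mult_right_mono JJ_nonneg)
      then have "ennreal (\<bar>D z\<bar> * JJ s z) \<le> ennreal ((u (fst z) - u (snd z))\<^sup>2 * JJ s z + (\<phi> (fst z) - \<phi> (snd z))\<^sup>2 * JJ s z)"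
        by (intro ennreal_leI) (simp add: distrib_right)
      also have "\<dots> = ennreal ((u (fst z) - u (snd z))\<^sup>2 * JJ s z) + ennreal ((\<phi> (fst z) - \<phi> (snd z))\<^sup>2 * JJ s z)"
        by (intro ennreal_plus mult_nonneg_nonneg JJ_nonneg) auto
      finally show "ennreal (\<bar>D z\<bar> * JJ s z) \<le> \<dots>" .
    qed
    also have "\<dots> = gn s u + gn s \<phi>" unfolding gn_def by (rule nn_integral_add) measurable
    also have "\<dots> < \<infinity>" using gu test_gn_finite[OF \<phi>t s] by (simp add: ennreal_add_eq_top less_top[symmetric])
    finally show ?thesis .
  qed
  define g where "g z t = wt s t * scl t \<rho> (fst z - snd z) * D z" for z t
  have gm: "(\<lambda>(z, t). g z t) \<in> borel_measurable ((lborel \<Otimes>\<^sub>M lborel) \<Otimes>\<^sub>M lborel)"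
    unfolding g_def by measurable
  have gm': "(\<lambda>p. ennreal (norm (case p of (z, t) \<Rightarrow> g z t))) \<in> borel_measurable ((lborel \<Otimes>\<^sub>M lborel) \<Otimes>\<^sub>M lborel)"
    using measurable_compose[OF measurable_compose[OF gm borel_measurable_norm] measurable_ennreal] by simp
  have gi: "integrable ((lborel \<Otimes>\<^sub>M lborel) \<Otimes>\<^sub>M lborel) (\<lambda>(z, t). g z t)"
  proof (rule integrableI_bounded[OF gm])
    have "(\<integral>\<^sup>+p. ennreal (norm (case p of (z, t) \<Rightarrow> g z t)) \<partial>((lborel \<Otimes>\<^sub>M lborel) \<Otimes>\<^sub>M lborel))
      = (\<integral>\<^sup>+z. \<integral>\<^sup>+t. ennreal (wt s t * scl t \<rho> (fst z - snd z) * \<bar>D z\<bar>) \<partial>lborel \<partial>(lborel \<Otimes>\<^sub>M lborel))"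
      by (subst lborel.nn_integral_fst[OF gm', symmetric]) (auto simp: g_def abs_mult[of _ "D _"] abs_of_nonneg[OF wt_scl_nonneg])
    also have "\<dots> = (\<integral>\<^sup>+z. kcE s e * ennreal (\<bar>D z\<bar> * JJ s z) \<partial>(lborel \<Otimes>\<^sub>M lborel))"
      by (intro nn_integral_cong kernel_scales_times[OF _ _ e]) (auto simp: D0)
    also have "\<dots> = kcE s e * (\<integral>\<^sup>+z. ennreal (\<bar>D z\<bar> * JJ s z) \<partial>(lborel \<Otimes>\<^sub>M lborel))"
      by (intro nn_integral_cmult) measurable
    also have "\<dots> < \<infinity>" using DJ kc by (simp add: ennreal_mult_less_top)
    finally show "(\<integral>\<^sup>+p. ennreal (norm (case p of (z, t) \<Rightarrow> g z t)) \<partial>((lborel \<Otimes>\<^sub>M lborel) \<Otimes>\<^sub>M lborel)) < \<infinity>" .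
  qed
  have gt: "(LINT z|(lborel \<Otimes>\<^sub>M lborel). g z t) = 2 * (wt s t * (v x - A \<rho> t v x))" for t
  proof (cases "t > 0")
    case True
    have "(LINT z|(lborel \<Otimes>\<^sub>M lborel). g z t) = wt s t * (LINT z|(lborel \<Otimes>\<^sub>M lborel). scl t \<rho> (fst z - snd z) * D z)"
      unfolding g_def by (simp add: mult.assoc)
    then show ?thesis unfolding D_def \<phi>_def v_def form_at_scale[OF u d True] by simp
  qed (simp add: g_def wt_def)
  have gz: "(LINT t|lborel. g z t) = enn2real (kcE s e) * (D z * JJ s z)" for z
  proof (cases "fst z = snd z")
    case False
    have "(LINT t|lborel. wt s t * scl t \<rho> (fst z - snd z)) = enn2real (\<integral>\<^sup>+t. ennreal (wt s t * scl t \<rho> (fst z - snd z)) \<partial>lborel)"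
      by (intro integral_eq_nn_integral) (auto simp: wt_scl_nonneg)
    also have "\<dots> = enn2real (kcE s e) * JJ s z"
      using kernel_scales[OF _ e, of "fst z - snd z" s] False by (simp add: JJ_def enn2real_mult)
    finally show ?thesis unfolding g_def by (simp add: mult_ac)
  qed (simp add: g_def D0)
  have "integrable lborel (\<lambda>t. LINT z|(lborel \<Otimes>\<^sub>M lborel). g z t)" using P.integrable_snd[OF gi] .
  then have "integrable lborel (\<lambda>t. 2 * (wt s t * (v x - A \<rho> t v x)))" by (simp only: gt)
  then show "integrable lborel (\<lambda>t. wt s t * (v x - A \<rho> t v x))" by simp
  have "(LINT t|lborel. LINT z|(lborel \<Otimes>\<^sub>M lborel). g z t) = (LINT z|(lborel \<Otimes>\<^sub>M lborel). LINT t|lborel. g z t)"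
    using P.Fubini_integral[OF gi] .
  then show "enn2real (kcE s e) * (LINT z|(lborel \<Otimes>\<^sub>M lborel). (u (fst z) - u (snd z)) * (\<phi> (fst z) - \<phi> (snd z)) * JJ s z)
      = 2 * (LINT t|lborel. wt s t * (v x - A \<rho> t v x))"
    unfolding gt gz by (simp add: D_def)
qed

text \<open>The test function is the reflected mollifier centred at \<open>x\<close>, so every term
  of the weak form becomes a value at \<open>x\<close>. The constant is \<open>2 / K\<close>, with 2
  from \<open>form_at_scale\<close> and \<open>K\<close> the kernel constant, and is thus
  independent of \<open>x\<close> and \<open>d\<close>.\<close>

theorem mollified_equation:
  fixes u u0 :: "'a::euclidean_space \<Rightarrow> real"
  assumes s: "0 < s" "s < 1" and \<Omega>: "open \<Omega>" "bounded \<Omega>"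
    and sol: "weak_solution s \<Omega> a f u"
    and u0: "bbor u0" "integrable lborel u0" and eq: "AE x in lebesgue. u x = u0 x"
  obtains C where "0 < C" "\<And>d x. 0 < d \<Longrightarrow> cball x d \<subseteq> \<Omega> \<Longrightarrow>
    integrable lborel (\<lambda>t. wt s t * (A \<rho> d u0 x - A \<rho> t (A \<rho> d u0) x)) \<and>
    - lap (A \<rho> d u0) x + C * (LINT t|lborel. wt s t * (A \<rho> d u0 x - A \<rho> t (A \<rho> d u0) x))
      = (LINT y:\<Omega>|lebesgue. f y (u y) * scl d \<rho> (x - y)) - (LINT y:\<Omega>|lebesgue. a y * u y * scl d \<rho> (x - y))"
proof -
  obtain e :: 'a where "e \<in> Basis" using nonempty_Basis by blast
  then have e: "norm e = 1" by simp
  note kc = kernel_constant[OF s(1) e]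
  define K where "K = enn2real (kcE s e)"
  have K: "0 < K" using kc by (simp add: K_def enn2real_positive_iff)
  have uX: "u \<in> X_space s \<Omega>" using sol by (simp add: weak_solution_def)
  have um: "u \<in> borel_measurable lebesgue" using uX by (simp add: X_space_def)
  have u0m [measurable]: "u0 \<in> borel_measurable borel" using u0(1) by (rule bbor_measurable)
  have u0L: "u0 \<in> borel_measurable lebesgue" by (intro measurable_completion) simp
  have gfin: "gn s u0 < \<infinity>" using X_space_gn_finite[OF uX \<Omega> s u0m eq] .
  obtain G where G: "has_weak_grad u G" using X_space_weak_grad[OF uX \<Omega>] by blast
  have main: "integrable lborel (\<lambda>t. wt s t * (A \<rho> d u0 x - A \<rho> t (A \<rho> d u0) x)) \<and>
    - lap (A \<rho> d u0) x + (2 / K) * (LINT t|lborel. wt s t * (A \<rho> d u0 x - A \<rho> t (A \<rho> d u0) x))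
      = (LINT y:\<Omega>|lebesgue. f y (u y) * scl d \<rho> (x - y)) - (LINT y:\<Omega>|lebesgue. a y * u y * scl d \<rho> (x - y))"
    if d: "0 < d" and sub: "cball x d \<subseteq> \<Omega>" for d x
  proof -
    define \<phi> where "\<phi> y = scl d \<rho> (x - y)" for y
    have \<phi>: "\<phi> \<in> test_functions \<Omega>" "\<phi> \<in> test_functions UNIV"
      unfolding \<phi>_def[abs_def] using scl_test(1)[OF kern_\<rho> d] sub by blast+
    have \<phi>m [measurable]: "\<phi> \<in> borel_measurable borel" using smb_measurable[OF test_smb[OF \<phi>(1)]] .
    have "(LINT x|lebesgue. weak_grad u x \<bullet> weak_grad \<phi> x) = - (LINT y|lebesgue. u y * lap \<phi> y)"
      by (rule weak_grad_energy[OF G \<phi>(2)])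
    \<comment> \<open>The solution is replaced by its Borel representative before the completed
      measure is replaced by \<open>lborel\<close>.\<close>
    also have "(LINT y|lebesgue. u y * lap \<phi> y) = (LINT y|lebesgue. u0 y * lap \<phi> y)"
    proof (rule integral_cong_AE)
      have "lap \<phi> \<in> borel_measurable lebesgue"
        using bbor_measurable[OF smb_lap_bbor[OF test_smb[OF \<phi>(1)]]] by (intro measurable_completion) simp
      then show "(\<lambda>y. u y * lap \<phi> y) \<in> borel_measurable lebesgue" "(\<lambda>y. u0 y * lap \<phi> y) \<in> borel_measurable lebesgue"
        using um u0L by (auto intro: borel_measurable_times)
    qed (use eq in auto)
    also have "\<dots> = (LINT y|lborel. u0 y * lap \<phi> y)"
      using bbor_measurable[OF smb_lap_bbor[OF test_smb[OF \<phi>(1)]]] by (intro integral_completion) simp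
    also have "\<dots> = (LINT y|lborel. u0 y * lap (scl d \<rho>) (x - y))"
      unfolding \<phi>_def[abs_def] by (simp add: lap_reflect[OF scl_\<rho>_smb[OF d]])
    also have "\<dots> = lap (cv u0 (scl d \<rho>)) x" by (rule lap_cv[OF u0(2) scl_\<rho>_smb[OF d], symmetric])
    also have "cv u0 (scl d \<rho>) = A \<rho> d u0" using A_eq_cv[OF kern_\<rho> u0m d] by auto
    finally have en: "(LINT x|lebesgue. weak_grad u x \<bullet> weak_grad \<phi> x) = - lap (A \<rho> d u0) x" .
    have "gagliardo_form s u \<phi> = (LINT z|(lebesgue \<Otimes>\<^sub>M lebesgue). (u (fst z) - u (snd z)) * (\<phi> (fst z) - \<phi> (snd z)) * JJ s z)"
      unfolding gagliardo_form_def JJ_def powr_minus by (intro Bochner_Integration.integral_cong) (auto simp: divide_inverse)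
    also have "\<dots> = (LINT z|(lebesgue \<Otimes>\<^sub>M lebesgue). (u0 (fst z) - u0 (snd z)) * (\<phi> (fst z) - \<phi> (snd z)) * JJ s z)"
    proof (rule integral_cong_AE)
      have "(\<lambda>z. (\<phi> (fst z) - \<phi> (snd z)) * JJ s z) \<in> borel_measurable (lborel \<Otimes>\<^sub>M lborel)" by measurable
      from measurable_compose[OF measurable_lebesgue_pair this]
      have 1: "(\<lambda>z. (\<phi> (fst z) - \<phi> (snd z)) * JJ s z) \<in> borel_measurable (lebesgue \<Otimes>\<^sub>M lebesgue)" .
      have "(\<lambda>z. (w (fst z) - w (snd z)) * ((\<phi> (fst z) - \<phi> (snd z)) * JJ s z)) \<in> borel_measurable (lebesgue \<Otimes>\<^sub>M lebesgue)"
        if "w \<in> borel_measurable lebesgue" for w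
        by (intro borel_measurable_times 1 borel_measurable_diff measurable_compose[OF measurable_fst that] measurable_compose[OF measurable_snd that])
      then show "(\<lambda>z. (u (fst z) - u (snd z)) * (\<phi> (fst z) - \<phi> (snd z)) * JJ s z) \<in> borel_measurable (lebesgue \<Otimes>\<^sub>M lebesgue)"
        "(\<lambda>z. (u0 (fst z) - u0 (snd z)) * (\<phi> (fst z) - \<phi> (snd z)) * JJ s z) \<in> borel_measurable (lebesgue \<Otimes>\<^sub>M lebesgue)"
        using um u0L by (simp_all add: mult.assoc)
      show "AE z in lebesgue \<Otimes>\<^sub>M lebesgue. (u (fst z) - u (snd z)) * (\<phi> (fst z) - \<phi> (snd z)) * JJ s z = (u0 (fst z) - u0 (snd z)) * (\<phi> (fst z) - \<phi> (snd z)) * JJ s z"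
        using AE_pair_both[OF sigma_finite_lebesgue eq] by eventually_elim auto
    qed
    also have "\<dots> = (LINT z|(lborel \<Otimes>\<^sub>M lborel). (u0 (fst z) - u0 (snd z)) * (\<phi> (fst z) - \<phi> (snd z)) * JJ s z)"
      by (intro lebesgue_pair_integral) measurable
    finally have "K * gagliardo_form s u \<phi> = 2 * (LINT t|lborel. wt s t * (A \<rho> d u0 x - A \<rho> t (A \<rho> d u0) x))"
      using gagliardo_mollified(2)[OF u0(1) gfin s d e, of x] by (simp add: K_def \<phi>_def)
    then have ga: "gagliardo_form s u \<phi> = (2 / K) * (LINT t|lborel. wt s t * (A \<rho> d u0 x - A \<rho> t (A \<rho> d u0) x))"
      using K by (simp add: field_simps)
    have "energy_form s u \<phi> + (LINT y:\<Omega>|lebesgue. a y * u y * \<phi> y) = (LINT y:\<Omega>|lebesgue. f y (u y) * \<phi> y)"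
      using sol test_in_X_space[OF \<phi>(1)] unfolding weak_solution_def by blast
    then show ?thesis
      using gagliardo_mollified(1)[OF u0(1) gfin s d e, of x] unfolding energy_form_def en ga by (simp add: \<phi>_def)
  qed
  show thesis using that[of "2 / K"] K main by simp
qed

section \<open>Interior estimates\<close>

lemma smb_shift_diff: "smb v \<Longrightarrow> smb (\<lambda>x. v (x + h) - v x)"
proof (coinduction arbitrary: v)
  case smb
  obtain B where B: "\<And>x. \<bar>v x\<bar> \<le> B" by (metis smb_bdd[OF smb])
  have 1: "bounded (range (\<lambda>x. v (x + h) - v x))"
  proof (rule boundedI)
    fix y assume "y \<in> range (\<lambda>x. v (x + h) - v x)"
    then obtain x where "y = v (x + h) - v x" by auto
    then show "norm y \<le> B + B" using B[of x] B[of "x + h"] by simp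
  qed
  have 2: "GDERIV (\<lambda>x. v (x + h) - v x) x :> grad v (x + h) - grad v x" for x
  proof -
    have "(v has_derivative (\<lambda>k. k \<bullet> grad v (x + h))) (at (x + h))" using smb_GDERIV[OF smb] unfolding gderiv_def .
    moreover have "((\<lambda>x. x + h) has_derivative (\<lambda>k. k)) (at x)" by (auto intro!: derivative_eq_intros)
    ultimately have "((\<lambda>x. v (x + h)) has_derivative (\<lambda>k. k \<bullet> grad v (x + h))) (at x)"
      using has_derivative_compose by blast
    then have "GDERIV (\<lambda>x. v (x + h)) x :> grad v (x + h)" unfolding gderiv_def .
    then show ?thesis by (intro GDERIV_diff smb_GDERIV smb)
  qed
  show ?case
    by (rule exI[of _ "\<lambda>x. v (x + h) - v x"], rule exI[of _ "\<lambda>x. grad v (x + h) - grad v x"])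
       (use 1 2 smb_pd[OF smb] in \<open>auto simp: inner_diff_left pd_def[abs_def]\<close>)
qed

lemma pd_shift_diff:
  assumes v: "smb v" shows "pd b (\<lambda>x. v (x + h) - v x) = (\<lambda>x. pd b v (x + h) - pd b v x)"
proof
  fix x
  have "(v has_derivative (\<lambda>k. k \<bullet> grad v (x + h))) (at (x + h))" using smb_GDERIV[OF v] unfolding gderiv_def .
  moreover have "((\<lambda>x. x + h) has_derivative (\<lambda>k. k)) (at x)" by (auto intro!: derivative_eq_intros)
  ultimately have "((\<lambda>x. v (x + h)) has_derivative (\<lambda>k. k \<bullet> grad v (x + h))) (at x)"
    using has_derivative_compose by blast
  then have "GDERIV (\<lambda>x. v (x + h)) x :> grad v (x + h)" unfolding gderiv_def .
  from grad_eqI[OF GDERIV_diff[OF this smb_GDERIV[OF v]]]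
  show "pd b (\<lambda>x. v (x + h) - v x) x = pd b v (x + h) - pd b v x" by (simp add: pd_def inner_diff_left)
qed

lemma lap_shift_diff: "smb v \<Longrightarrow> lap (\<lambda>x. v (x + h) - v x) x = lap v (x + h) - lap v x"
  by (simp add: lap_def pd_shift_diff smb_pd sum_subtractf)

text \<open>Mean value inequality with a majorant. \<open>B\<close> is asked to be differentiable in
  the open interval and merely continuous at its ends, because majorants such as t powr \<alpha>
  have unbounded derivative at 0.\<close>

lemma increment_bound:
  fixes m B :: "real \<Rightarrow> real"
  assumes "a \<le> b" and m: "\<And>t. (m has_real_derivative m' t) (at t)"
    and B: "continuous_on {a..b} B" "\<And>t. a < t \<Longrightarrow> t < b \<Longrightarrow> (B has_real_derivative B' t) (at t)"
    and le: "\<And>t. a < t \<Longrightarrow> t < b \<Longrightarrow> \<bar>m' t\<bar> \<le> B' t"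
  shows "\<bar>m b - m a\<bar> \<le> B b - B a"
proof (cases "a = b")
  case False
  then have "a < b" using assms(1) by simp
  have "continuous_on {a..b} m"
    using m DERIV_isCont continuous_at_imp_continuous_on by blast
  have "norm (m b - m a) \<le> B b - B a"
    by (rule differentiable_bound_general[OF \<open>a < b\<close> \<open>continuous_on {a..b} m\<close> B(1), of m' B'])
       (use m B(2) le in \<open>auto simp: has_real_derivative_iff_has_vector_derivative[symmetric]\<close>)
  then show ?thesis by simp
qed simp

text \<open>\<open>A_\<rho>_DERIV\<close> is integrated from scale 0, where the average is
  \<open>v x\<close>. All smaller scales stay in the same ball, so only \<open>lap v\<close> near
  \<open>x\<close> enters. A factor 1/2 is given away.\<close>

lemma mollifier_error:
  fixes x :: "'a::euclidean_space"
  assumes v: "smb v" and t: "0 \<le> t" and S: "\<And>y. y \<in> cball x t \<Longrightarrow> \<bar>lap v y\<bar> \<le> S"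
  shows "\<bar>v x - A \<rho> t v x\<bar> \<le> t\<^sup>2 * (kint (\<Psi> :: 'a \<Rightarrow> real) * S)"
proof -
  let ?K = "kint (\<Psi> :: 'a \<Rightarrow> real) * S"
  have S0: "0 \<le> S" using S[of x] t by (smt (verit) centre_in_cball)
  have "\<bar>A \<rho> t v x - A \<rho> 0 v x\<bar> \<le> ?K * t\<^sup>2 - ?K * 0\<^sup>2"
  proof (rule increment_bound[OF t A_\<rho>_DERIV[OF v]])
    show "((\<lambda>t. ?K * t\<^sup>2) has_real_derivative ?K * (2 * r)) (at r)" for r
      by (auto intro!: derivative_eq_intros)
    fix r assume r: "0 < r" "r < t"
    have "\<bar>A \<Psi> r (lap v) x\<bar> \<le> ?K"
      using r by (intro A_bound kern_\<Psi> smb_lap_bbor v S) auto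
    then have "\<bar>r * A \<Psi> r (lap v) x\<bar> \<le> r * ?K" using r by (simp add: abs_mult mult_left_mono)
    also have "\<dots> \<le> ?K * (2 * r)" using r S0 kint_nonneg[of "\<Psi> :: 'a \<Rightarrow> real"] by (simp add: mult.commute)
    finally show "\<bar>r * A \<Psi> r (lap v) x\<bar> \<le> ?K * (2 * r)" .
  qed (intro continuous_intros)
  then show ?thesis by (simp add: A_zero abs_minus_commute mult.commute)
qed

text \<open>The scale integral is split at \<open>d\<close>: quadratic smallness of \<open>g\<close>
  compensates the singular weight below, and boundedness of \<open>g\<close> suffices above.\<close>

lemma form_bound:
  fixes g :: "real \<Rightarrow> real"
  assumes s: "0 < s" "s < 1" and d: "0 < d" and P: "0 \<le> P" and N: "0 \<le> N"
    and i: "integrable lborel (\<lambda>t. wt s t * g t)"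
    and near: "\<And>t. 0 < t \<Longrightarrow> t \<le> d \<Longrightarrow> \<bar>g t\<bar> \<le> t\<^sup>2 * P" and far: "\<And>t. d \<le> t \<Longrightarrow> \<bar>g t\<bar> \<le> N"
  shows "\<bar>LINT t|lborel. wt s t * g t\<bar> \<le> P * (d powr (2 - 2 * s) / (2 - 2 * s)) + N * (d powr (- 2 * s) / (2 * s))"
proof -
  let ?R = "P * (d powr (2 - 2 * s) / (2 - 2 * s)) + N * (d powr (- 2 * s) / (2 * s))"
  have R: "0 \<le> ?R" using s P N by simp
  have "ennreal \<bar>LINT t|lborel. wt s t * g t\<bar> \<le> (\<integral>\<^sup>+t. ennreal \<bar>wt s t * g t\<bar> \<partial>lborel)"
    using integral_norm_bound_ennreal[OF i] by simp
  also have "\<dots> \<le> (\<integral>\<^sup>+t. ennreal P * (ennreal (wt s t * t\<^sup>2) * indicator {..d} t) + ennreal N * (ennreal (wt s t) * indicator {d..} t) \<partial>lborel)"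
  proof (rule nn_integral_mono)
    fix t :: real
    show "ennreal \<bar>wt s t * g t\<bar> \<le> ennreal P * (ennreal (wt s t * t\<^sup>2) * indicator {..d} t) + ennreal N * (ennreal (wt s t) * indicator {d..} t)"
    proof (cases "t \<le> d")
      case True
      have "\<bar>wt s t * g t\<bar> \<le> P * (wt s t * t\<^sup>2)"
      proof (cases "t > 0")
        case t: True
        have "wt s t * \<bar>g t\<bar> \<le> wt s t * (t\<^sup>2 * P)" using near[OF t True] wt_nonneg by (intro mult_left_mono)
        then show ?thesis by (simp add: abs_mult wt_nonneg mult_ac)
      qed (simp add: wt_def)
      then have "ennreal \<bar>wt s t * g t\<bar> \<le> ennreal P * (ennreal (wt s t * t\<^sup>2) * indicator {..d} t)"
        using True P wt_nonneg[of s t] by (simp add: ennreal_mult'[symmetric] ennreal_leI)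
      then show ?thesis by (rule order_trans) simp
    next
      case False
      have "wt s t * \<bar>g t\<bar> \<le> wt s t * N" using far[of t] False wt_nonneg by (intro mult_left_mono) auto
      then have "ennreal \<bar>wt s t * g t\<bar> \<le> ennreal N * (ennreal (wt s t) * indicator {d..} t)"
        using False N wt_nonneg[of s t] by (simp add: ennreal_mult'[symmetric] ennreal_leI abs_mult mult.commute)
      then show ?thesis by (rule order_trans) simp
    qed
  qed
  also have "\<dots> = ennreal P * ennreal (d powr (2 - 2 * s) / (2 - 2 * s)) + ennreal N * ennreal (d powr (- 2 * s) / (2 * s))"
    using wt_near[of s d] wt_far[of s d] s d by (subst nn_integral_add) (auto simp: nn_integral_cmult)
  also have "\<dots> = ennreal ?R"
    using s P N by (subst ennreal_plus) (auto simp: ennreal_mult'[symmetric])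
  finally show ?thesis using R by (simp add: ennreal_le_iff)
qed

text \<open>
  The weight \<open>(R - dist x0 x)\<^sup>3\<close> turns the loss of domain in the hypothesis into a constant
  factor, which is absorbed by taking \<open>d\<close> to be a small multiple of the distance to the boundary.
\<close>
definition absorb_radius :: "real \<Rightarrow> real \<Rightarrow> real" where
  "absorb_radius s \<kappa> = min (1/2) ((1 / (16 * (\<kappa> + 1))) powr (1 / (2 - 2 * s)))"

lemma absorption:
  fixes w :: "'a::metric_space \<Rightarrow> real"
  assumes s: "s < (1::real)" and \<kappa>: "0 \<le> \<kappa>"
    and R: "0 < R" "R \<le> 1" and a: "0 \<le> a" and B: "\<And>x. x \<in> ball x0 R \<Longrightarrow> \<bar>w x\<bar> \<le> B"
    and H: "\<And>x d S. \<lbrakk>x \<in> ball x0 R; 0 < d; cball x d \<subseteq> ball x0 R; d \<le> 1; \<And>y. y \<in> cball x d \<Longrightarrow> \<bar>w y\<bar> \<le> S\<rbrakk>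
       \<Longrightarrow> \<bar>w x\<bar> \<le> a / d ^ 3 + \<kappa> * d powr (2 - 2 * s) * S"
  shows "\<bar>w x0\<bar> \<le> 2 / absorb_radius s \<kappa> ^ 3 * a / R ^ 3"
proof -
  define \<mu> where "\<mu> = absorb_radius s \<kappa>"
  have \<mu>: "0 < \<mu>" "\<mu> \<le> 1/2" using \<kappa> by (auto simp: \<mu>_def absorb_radius_def)
  \<comment> \<open>The radius solves \<mu>^(2 - 2s) = 1 / (16 (\<kappa> + 1)), capped at 1/2, so
    that the coefficient 8 \<kappa> \<mu>^(2 - 2s) of the supremum to be absorbed is at most
    1/2.\<close>
  have "\<mu> powr (2 - 2 * s) \<le> ((1 / (16 * (\<kappa> + 1))) powr (1 / (2 - 2 * s))) powr (2 - 2 * s)"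
    using s \<mu> by (intro powr_mono2) (auto simp: \<mu>_def absorb_radius_def)
  also have "\<dots> = 1 / (16 * (\<kappa> + 1))" using s \<kappa> by (simp add: powr_powr)
  finally have "8 * \<kappa> * \<mu> powr (2 - 2 * s) \<le> 8 * \<kappa> * (1 / (16 * (\<kappa> + 1)))" using \<kappa> by (intro mult_left_mono) auto
  also have "\<dots> \<le> 1 / 2" using \<kappa> by (simp add: field_simps)
  finally have \<kappa>\<mu>: "8 * \<kappa> * \<mu> powr (2 - 2 * s) \<le> 1 / 2" .
  define C where "C = 2 / \<mu> ^ 3"
  have "\<bar>w x0\<bar> \<le> C * a / R ^ 3"
  proof -
    define D where "D x = R - dist x0 x" for x
    have D: "0 < D x" "D x \<le> 1" if "x \<in> ball x0 R" for x using that R by (auto simp: D_def intro: order_trans[of _ R])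
    define \<Phi> where "\<Phi> = (SUP x\<in>ball x0 R. D x ^ 3 * \<bar>w x\<bar>)"
    \<comment> \<open>Here \<open>B\<close> enters: the weighted supremum is finite, so half of it
      may be subtracted. The value of \<open>B\<close> does not reach the final constant.\<close>
    have bdd: "bdd_above ((\<lambda>x. D x ^ 3 * \<bar>w x\<bar>) ` ball x0 R)"
    proof (rule bdd_aboveI2)
      fix x assume x: "x \<in> ball x0 R"
      show "D x ^ 3 * \<bar>w x\<bar> \<le> 1 * B" using D[OF x] B[OF x] by (intro mult_mono) (auto simp: power_le_one)
    qed
    have \<Phi>: "D x ^ 3 * \<bar>w x\<bar> \<le> \<Phi>" if "x \<in> ball x0 R" for x
      unfolding \<Phi>_def using that bdd by (rule cSUP_upper)
    have \<Phi>0: "0 \<le> \<Phi>" using \<Phi>[of x0] R by (smt (verit) centre_in_ball D zero_le_power mult_nonneg_nonneg abs_ge_zero)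
    have "\<Phi> \<le> a / \<mu> ^ 3 + \<Phi> / 2"
      unfolding \<Phi>_def
    proof (rule cSUP_least)
      show "ball x0 R \<noteq> {}" using R by simp
      fix x assume x: "x \<in> ball x0 R"
      define d where "d = \<mu> * D x"
      have d: "0 < d" "d \<le> D x / 2" using D[OF x] \<mu> mult_right_mono[of \<mu> "1/2" "D x"] by (auto simp: d_def)
      then have d1: "d \<le> 1" using D[OF x] by simp
      have Dy: "D x / 2 \<le> D y" if "y \<in> cball x d" for y
        using that d dist_triangle[of x0 y x] by (simp add: D_def dist_commute)
      have sub: "cball x d \<subseteq> ball x0 R"
        using Dy D[OF x] by (force simp: D_def)
      \<comment> \<open>On \<open>cball x d\<close> the distance to the boundary is at least half of
        that at \<open>x\<close>; the cube turns this into the factor 8.\<close>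
      have wy: "\<bar>w y\<bar> \<le> 8 * \<Phi> / D x ^ 3" if y: "y \<in> cball x d" for y
      proof -
        have "(D x / 2) ^ 3 * \<bar>w y\<bar> \<le> D y ^ 3 * \<bar>w y\<bar>"
          using Dy[OF y] D[OF x] by (intro mult_right_mono power_mono) auto
        also have "\<dots> \<le> \<Phi>" using sub y by (intro \<Phi>) auto
        finally show ?thesis using D[OF x] by (simp add: field_simps power_divide)
      qed
      have "\<bar>w x\<bar> \<le> a / d ^ 3 + \<kappa> * d powr (2 - 2 * s) * (8 * \<Phi> / D x ^ 3)"
        using H[OF x d(1) sub d1 wy] .
      then have "D x ^ 3 * \<bar>w x\<bar> \<le> D x ^ 3 * (a / d ^ 3 + \<kappa> * d powr (2 - 2 * s) * (8 * \<Phi> / D x ^ 3))"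
        using D[OF x] by (intro mult_left_mono) auto
      also have "\<dots> = a / \<mu> ^ 3 + 8 * \<kappa> * d powr (2 - 2 * s) * \<Phi>"
        using D[OF x] \<mu> by (simp add: d_def field_simps power_mult_distrib)
      also have "8 * \<kappa> * d powr (2 - 2 * s) * \<Phi> \<le> 8 * \<kappa> * \<mu> powr (2 - 2 * s) * \<Phi>"
        using D[OF x] \<mu> s \<kappa> \<Phi>0 d by (intro mult_right_mono mult_left_mono powr_mono2) (auto simp: d_def mult_left_le)
      also have "\<dots> \<le> 1 / 2 * \<Phi>" using \<kappa>\<mu> \<Phi>0 by (intro mult_right_mono)
      finally show "D x ^ 3 * \<bar>w x\<bar> \<le> a / \<mu> ^ 3 + (SUP x\<in>ball x0 R. D x ^ 3 * \<bar>w x\<bar>) / 2" by (simp add: \<Phi>_def)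
    qed
    then have "\<Phi> \<le> C * a" by (simp add: C_def)
    moreover have "R ^ 3 * \<bar>w x0\<bar> \<le> \<Phi>" using \<Phi>[of x0] R by (simp add: D_def)
    ultimately have "R ^ 3 * \<bar>w x0\<bar> \<le> C * a" by simp
    then show ?thesis using R by (simp add: field_simps)
  qed
  then show ?thesis by (simp add: C_def \<mu>_def)
qed

text \<open>Integrability of the scale integral is part of the equation, since its Bochner value
  would otherwise be 0; subtracting two such equations relies on it.\<close>

definition eqn_at :: "real \<Rightarrow> real \<Rightarrow> ('a::euclidean_space \<Rightarrow> real) \<Rightarrow> real \<Rightarrow> 'a \<Rightarrow> bool" where
  "eqn_at s C v g x \<longleftrightarrow> integrable lborel (\<lambda>t. wt s t * (v x - A \<rho> t v x)) \<and>
     - lap v x + C * (LINT t|lborel. wt s t * (v x - A \<rho> t v x)) = g"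

lemma eqn_at_diff:
  assumes v: "smb v" and 1: "eqn_at s C v g (x + h)" and 2: "eqn_at s C v g' x"
  shows "eqn_at s C (\<lambda>x. v (x + h) - v x) (g - g') x"
proof -
  have e: "wt s t * ((v (x + h) - v x) - A \<rho> t (\<lambda>x. v (x + h) - v x) x)
    = wt s t * (v (x + h) - A \<rho> t v (x + h)) - wt s t * (v x - A \<rho> t v x)" for t
    using A_diff[OF kern_\<rho> bbor_shift[OF smb_bbor[OF v]] smb_bbor[OF v], of t h x] A_shift_eq[of \<rho> t v x h]
    by (simp add: right_diff_distrib)
  have 3: "(LINT t|lborel. wt s t * (v (x + h) - A \<rho> t v (x + h)) - wt s t * (v x - A \<rho> t v x))
     = (LINT t|lborel. wt s t * (v (x + h) - A \<rho> t v (x + h))) - (LINT t|lborel. wt s t * (v x - A \<rho> t v x))"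
    using 1 2 unfolding eqn_at_def by (intro Bochner_Integration.integral_diff) auto
  show ?thesis
    using 1 2 unfolding eqn_at_def e 3
    by (auto simp: lap_shift_diff[OF v] right_diff_distrib intro!: Bochner_Integration.integrable_diff)
qed

text \<open>Near the diagonal the nonlocal term is controlled by the Laplacian itself.\<close>
lemma eqn_at_bound:
  fixes v :: "'a::euclidean_space \<Rightarrow> real"
  assumes s: "0 < s" "s < 1" and C: "0 \<le> C" and v: "smb v" and eq: "eqn_at s C v g x"
    and d: "0 < d" and S: "\<And>y. y \<in> cball x d \<Longrightarrow> \<bar>lap v y\<bar> \<le> S"
    and far: "\<And>t. d \<le> t \<Longrightarrow> \<bar>v x - A \<rho> t v x\<bar> \<le> N"
  shows "\<bar>lap v x\<bar> \<le> \<bar>g\<bar> + C * (N * (d powr (- 2 * s) / (2 * s))) + (C * kint (\<Psi> :: 'a \<Rightarrow> real) / (2 - 2 * s)) * d powr (2 - 2 * s) * S"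
proof -
  have S0: "0 \<le> S" using S[of x] d by (smt (verit) centre_in_cball)
  have N0: "0 \<le> N" using far[of d] by (smt (verit) abs_ge_zero)
  have "\<bar>LINT t|lborel. wt s t * (v x - A \<rho> t v x)\<bar> \<le> (kint (\<Psi> :: 'a \<Rightarrow> real) * S) * (d powr (2 - 2 * s) / (2 - 2 * s)) + N * (d powr (- 2 * s) / (2 * s))"
  proof (rule form_bound[OF s d _ N0 _ _ far])
    show "\<bar>v x - A \<rho> t v x\<bar> \<le> t\<^sup>2 * (kint (\<Psi> :: 'a \<Rightarrow> real) * S)" if "0 < t" "t \<le> d" for t
      using that by (intro mollifier_error v S) auto
  qed (use eq S0 kint_nonneg[of "\<Psi> :: 'a \<Rightarrow> real"] in \<open>auto simp: eqn_at_def\<close>)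
  then have "C * \<bar>LINT t|lborel. wt s t * (v x - A \<rho> t v x)\<bar> \<le> C * ((kint (\<Psi> :: 'a \<Rightarrow> real) * S) * (d powr (2 - 2 * s) / (2 - 2 * s)) + N * (d powr (- 2 * s) / (2 * s)))"
    using C by (intro mult_left_mono)
  moreover have "\<bar>lap v x\<bar> \<le> \<bar>g\<bar> + C * \<bar>LINT t|lborel. wt s t * (v x - A \<rho> t v x)\<bar>"
  proof -
    have "lap v x = C * (LINT t|lborel. wt s t * (v x - A \<rho> t v x)) - g" using eq by (simp add: eqn_at_def)
    then show ?thesis using C by (simp add: abs_mult abs_triangle_ineq4[THEN order_trans])
  qed
  ultimately show ?thesis by (simp add: algebra_simps)
qed

text \<open>This dictates the exponent 3 of the weight in \<open>absorption\<close>: the far scales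
  cost \<open>2 * s\<close> powers of \<open>1 / d\<close> for \<open>v\<close> and
  \<open>1 + 2 * s\<close> for its differences, both below 3.\<close>

lemma powr_le_inverse_cube:
  assumes "0 < d" "d \<le> 1" "p \<le> 3" shows "d powr (- p) \<le> 1 / (d::real) ^ 3"
proof -
  have "d powr (- p) \<le> d powr (- 3)" using assms by (intro powr_mono') auto
  then show ?thesis using assms by (simp add: powr_minus divide_inverse)
qed

section \<open>A priori estimates for the Laplacian and the first increments\<close>

text \<open>\<open>eqn_at_bound\<close> has the form required by \<open>absorption\<close>, where
  the far scales contribute at most \<open>2 * M\<close> because \<open>\<rho>\<close> has mass 1.
  The order of quantifiers makes \<open>K\<close> independent of \<open>v\<close>, hence uniform
  over all mollified solutions.\<close>

theorem lap_bound:
  assumes s: "0 < s" "s < 1" and C: "0 \<le> C"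
  shows "\<exists>K\<ge>0. \<forall>(v :: 'a::euclidean_space \<Rightarrow> real) G x0 R M g. smb v \<longrightarrow> 0 < R \<longrightarrow> R \<le> 1 \<longrightarrow> (\<forall>x. \<bar>v x\<bar> \<le> M) \<longrightarrow>
     (\<forall>x\<in>ball x0 R. eqn_at s C v (G x) x) \<longrightarrow> (\<forall>x\<in>ball x0 R. \<bar>G x\<bar> \<le> g) \<longrightarrow> \<bar>lap v x0\<bar> \<le> K * (g + M) / R ^ 3"
proof -
  define \<kappa> where "\<kappa> = C * kint (\<Psi> :: 'a \<Rightarrow> real) / (2 - 2 * s)"
  have \<kappa>: "0 \<le> \<kappa>" using C s kint_nonneg[of "\<Psi> :: 'a \<Rightarrow> real"] by (simp add: \<kappa>_def)
  define K0 where "K0 = 2 / absorb_radius s \<kappa> ^ 3"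
  have K0: "0 \<le> K0" using \<kappa> by (simp add: K0_def absorb_radius_def)
  define K where "K = K0 * (1 + C / s)"
  have "\<bar>lap v x0\<bar> \<le> K * (g + M) / R ^ 3"
    if v: "smb v" and R: "0 < R" "R \<le> 1" and M: "\<And>x. \<bar>v x\<bar> \<le> M"
      and eq: "\<And>x. x \<in> ball x0 R \<Longrightarrow> eqn_at s C v (G x) x" and g: "\<And>x. x \<in> ball x0 R \<Longrightarrow> \<bar>G x\<bar> \<le> g"
    for v :: "'a \<Rightarrow> real" and G x0 R M g
  proof -
    have g0: "0 \<le> g" using g[of x0] R by (smt (verit) centre_in_ball)
    have M0: "0 \<le> M" using M[of x0] by (smt (verit))
    \<comment> \<open>A purely qualitative bound, which feeds the finiteness hypothesis of
      \<open>absorption\<close> and does not enter \<open>K\<close>.\<close>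
    obtain B where B: "\<And>x. \<bar>lap v x\<bar> \<le> B" using smb_lap_bbor[OF v] by (auto simp: bbor_def)
    have far: "\<bar>v x - A \<rho> t v x\<bar> \<le> 2 * M" if "0 \<le> t" for x t
    proof -
      have "\<bar>A \<rho> t v x\<bar> \<le> kint (\<rho> :: 'a \<Rightarrow> real) * M" using that M by (intro A_bound kern_\<rho> smb_bbor v)
      then show ?thesis using M[of x] by (simp add: \<rho>_kint)
    qed
    have "\<bar>lap v x0\<bar> \<le> K0 * (g + C * M / s) / R ^ 3"
    proof (rule absorption[where w = "lap v" and ?x0.0 = x0, OF s(2) \<kappa> R, folded K0_def])
      show "0 \<le> g + C * M / s" using g0 M0 C s by simp
      show "\<bar>lap v x\<bar> \<le> B" for x by (rule B)
      fix x d S assume x: "x \<in> ball x0 R" and d: "0 < d" "d \<le> 1" and S: "\<And>y. y \<in> cball x d \<Longrightarrow> \<bar>lap v y\<bar> \<le> S"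
      have "\<bar>lap v x\<bar> \<le> \<bar>G x\<bar> + C * (2 * M * (d powr (- 2 * s) / (2 * s))) + \<kappa> * d powr (2 - 2 * s) * S"
        unfolding \<kappa>_def using d by (intro eqn_at_bound[OF s C v eq[OF x] d(1) S] far) auto
      moreover have "\<bar>G x\<bar> \<le> g / d ^ 3"
      proof -
        have "g * 1 \<le> g * (1 / d ^ 3)" using d g0 by (intro mult_left_mono) (auto simp: power_le_one)
        then show ?thesis using g[OF x] by simp
      qed
      moreover have "C * (2 * M * (d powr (- 2 * s) / (2 * s))) \<le> (C * M / s) * (1 / d ^ 3)"
      proof -
        have "C * (2 * M * (d powr (- 2 * s) / (2 * s))) = (C * M / s) * d powr (- (2 * s))" by simp
        also have "\<dots> \<le> (C * M / s) * (1 / d ^ 3)"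
          using powr_le_inverse_cube[of d "2 * s"] d s C M0 by (intro mult_left_mono) auto
        finally show ?thesis .
      qed
      ultimately show "\<bar>lap v x\<bar> \<le> (g + C * M / s) / d ^ 3 + \<kappa> * d powr (2 - 2 * s) * S"
        by (simp add: add_divide_distrib)
    qed
    also have "\<dots> \<le> K * (g + M) / R ^ 3"
    proof -
      have "g + C * M / s \<le> (1 + C / s) * (g + M)"
      proof -
        have "g + c * M \<le> (1 + c) * (g + M)" if "0 \<le> c" for c
          using that g0 M0 by (simp add: algebra_simps)
        from this[of "C / s"] show ?thesis using C s by simp
      qed
      then show ?thesis using K0 R unfolding K_def by (intro divide_right_mono) (auto simp: mult.assoc mult_left_mono)
    qed
    finally show ?thesis .
  qed
  moreover have "0 \<le> K" using K0 C s by (simp add: K_def)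
  ultimately show ?thesis by (intro exI[of _ K]) blast
qed

text \<open>The increment of the averages, viewed as a function of the scale, is the wanted
  increment at scale 0. At scale \<open>r\<close> it is controlled by \<open>A_shift\<close>; in
  between, its derivative carries a factor \<open>t\<close> that cancels the \<open>1 / t\<close> of
  \<open>A_shift\<close>.\<close>

theorem lipschitz_bound:
  shows "\<exists>K\<ge>0. \<forall>(v :: 'a::euclidean_space \<Rightarrow> real) x h r M F. smb v \<longrightarrow> 0 < r \<longrightarrow> norm h \<le> r \<longrightarrow> (\<forall>x. \<bar>v x\<bar> \<le> M) \<longrightarrow>
     (\<forall>y\<in>cball x (2 * r). \<bar>lap v y\<bar> \<le> F) \<longrightarrow> \<bar>v (x + h) - v x\<bar> \<le> K * (M / r + r * F) * norm h"
proof -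
  obtain C1 where C1: "0 \<le> C1" "\<And>v x (h::'a) t S. \<lbrakk>bbor v; 0 < t; \<And>y. y \<in> cball x (t + norm h) \<Longrightarrow> \<bar>v y\<bar> \<le> S\<rbrakk>
    \<Longrightarrow> \<bar>A \<rho> t v (x + h) - A \<rho> t v x\<bar> \<le> C1 * (norm h / t) * S"
    using A_shift[OF kern_\<rho>] by blast
  obtain C2 where C2: "0 \<le> C2" "\<And>v x (h::'a) t S. \<lbrakk>bbor v; 0 < t; \<And>y. y \<in> cball x (t + norm h) \<Longrightarrow> \<bar>v y\<bar> \<le> S\<rbrakk>
    \<Longrightarrow> \<bar>A \<Psi> t v (x + h) - A \<Psi> t v x\<bar> \<le> C2 * (norm h / t) * S"
    using A_shift[OF kern_\<Psi>] by blast
  have "\<bar>v (x + h) - v x\<bar> \<le> (C1 + C2) * (M / r + r * F) * norm h"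
    if v: "smb v" and r: "0 < r" "norm h \<le> r" and M: "\<And>x. \<bar>v x\<bar> \<le> M" and F: "\<And>y. y \<in> cball x (2 * r) \<Longrightarrow> \<bar>lap v y\<bar> \<le> F"
    for v :: "'a \<Rightarrow> real" and x h r M F
  proof -
    have M0: "0 \<le> M" using M[of x] by (smt (verit))
    have F0: "0 \<le> F" using F[of x] r by (smt (verit) centre_in_cball)
    define m where "m t = A \<rho> t v (x + h) - A \<rho> t v x" for t
    have "\<bar>m r - m 0\<bar> \<le> (C2 * norm h * F) * r - (C2 * norm h * F) * 0"
    proof (rule increment_bound)
      show "(m has_real_derivative (t * A \<Psi> t (lap v) (x + h) - t * A \<Psi> t (lap v) x)) (at t)" for t
        unfolding m_def[abs_def] by (intro DERIV_diff A_\<rho>_DERIV v)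
      show "((\<lambda>t. (C2 * norm h * F) * t) has_real_derivative C2 * norm h * F) (at t)" for t
        by (auto intro!: derivative_eq_intros)
      fix t assume t: "0 < t" "t < r"
      have "\<bar>A \<Psi> t (lap v) (x + h) - A \<Psi> t (lap v) x\<bar> \<le> C2 * (norm h / t) * F"
        using t r by (intro C2(2) smb_lap_bbor v F) auto
      then have "t * \<bar>A \<Psi> t (lap v) (x + h) - A \<Psi> t (lap v) x\<bar> \<le> t * (C2 * (norm h / t) * F)" using t by (intro mult_left_mono) auto
      also have "\<dots> = C2 * norm h * F" using t by simp
      finally show "\<bar>t * A \<Psi> t (lap v) (x + h) - t * A \<Psi> t (lap v) x\<bar> \<le> C2 * norm h * F"
        using t by (simp add: right_diff_distrib[symmetric] abs_mult)
    qed (use r in \<open>auto intro!: continuous_intros\<close>)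
    moreover have "\<bar>m r\<bar> \<le> C1 * (norm h / r) * M"
      unfolding m_def using r M by (intro C1(2) smb_bbor v) auto
    moreover have "m 0 = v (x + h) - v x" by (simp add: m_def A_zero)
    ultimately have "\<bar>v (x + h) - v x\<bar> \<le> C1 * (norm h / r) * M + C2 * norm h * F * r" by simp
    also have "\<dots> = (C1 * (M / r) + C2 * (r * F)) * norm h" by (simp add: algebra_simps)
    also have "\<dots> \<le> (C1 + C2) * (M / r + r * F) * norm h"
    proof -
      have "C1 * p + C2 * q \<le> (C1 + C2) * (p + q)" if "0 \<le> p" "0 \<le> q" for p q
        using that C1(1) C2(1) by (simp add: algebra_simps)
      from this[of "M / r" "r * F"] show ?thesis using M0 F0 r by (intro mult_right_mono) auto
    qed
    finally show ?thesis .
  qed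
  then show ?thesis using C1(1) C2(1) by (intro exI[of _ "C1 + C2"]) simp
qed

text \<open>The equation is linear in \<open>v\<close>, so the translation difference solves it with
  the differenced right-hand side, and \<open>absorption\<close> applies to its Laplacian. Terms
  linear in \<open>norm h\<close> are weakened to norm h powr \<alpha>, using
  \<open>norm h \<le> 1\<close>.\<close>

theorem lap_holder:
  assumes s: "0 < s" "s < 1" and C: "0 \<le> C" and \<alpha>: "0 < \<alpha>" "\<alpha> < 1"
  shows "\<exists>K\<ge>0. \<forall>(v :: 'a::euclidean_space \<Rightarrow> real) G x0 R M \<Lambda> H h. smb v \<longrightarrow> 0 < R \<longrightarrow> R \<le> 1 \<longrightarrow> norm h \<le> 1 \<longrightarrow> (\<forall>x. \<bar>v x\<bar> \<le> M) \<longrightarrow>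
     (\<forall>x\<in>ball x0 R. eqn_at s C v (G x) x \<and> eqn_at s C v (G (x + h)) (x + h)) \<longrightarrow>
     (\<forall>x\<in>ball x0 R. \<bar>v (x + h) - v x\<bar> \<le> \<Lambda> * norm h) \<longrightarrow>
     (\<forall>x\<in>ball x0 R. \<bar>G (x + h) - G x\<bar> \<le> H * norm h powr \<alpha>) \<longrightarrow>
     \<bar>lap v (x0 + h) - lap v x0\<bar> \<le> K * (H + \<Lambda> + M) / R ^ 3 * norm h powr \<alpha>"
proof -
  define \<kappa> where "\<kappa> = C * kint (\<Psi> :: 'a \<Rightarrow> real) / (2 - 2 * s)"
  have \<kappa>: "0 \<le> \<kappa>" using C s kint_nonneg[of "\<Psi> :: 'a \<Rightarrow> real"] by (simp add: \<kappa>_def)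
  define K0 where "K0 = 2 / absorb_radius s \<kappa> ^ 3"
  have K0: "0 \<le> K0" using \<kappa> by (simp add: K0_def absorb_radius_def)
  obtain C1 where C1: "0 \<le> C1" "\<And>v x (h::'a) t S. \<lbrakk>bbor v; 0 < t; \<And>y. y \<in> cball x (t + norm h) \<Longrightarrow> \<bar>v y\<bar> \<le> S\<rbrakk>
    \<Longrightarrow> \<bar>A \<rho> t v (x + h) - A \<rho> t v x\<bar> \<le> C1 * (norm h / t) * S"
    using A_shift[OF kern_\<rho>] by blast
  define C2 where "C2 = C * (1 + C1) / (2 * s)"
  have C2: "0 \<le> C2" using C C1 s by (simp add: C2_def)
  have "\<bar>lap v (x0 + h) - lap v x0\<bar> \<le> K0 * (1 + C2) * (H + \<Lambda> + M) / R ^ 3 * norm h powr \<alpha>"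
    if v: "smb v" and R: "0 < R" "R \<le> 1" and h: "norm h \<le> 1" and M: "\<And>x. \<bar>v x\<bar> \<le> M"
      and eq: "\<And>x. x \<in> ball x0 R \<Longrightarrow> eqn_at s C v (G x) x \<and> eqn_at s C v (G (x + h)) (x + h)"
      and L: "\<And>x. x \<in> ball x0 R \<Longrightarrow> \<bar>v (x + h) - v x\<bar> \<le> \<Lambda> * norm h"
      and H: "\<And>x. x \<in> ball x0 R \<Longrightarrow> \<bar>G (x + h) - G x\<bar> \<le> H * norm h powr \<alpha>"
    for v :: "'a \<Rightarrow> real" and G x0 R M \<Lambda> H h
  proof (cases "h = 0")
    case False
    define n where "n = norm h"
    have n: "0 < n" "n \<le> 1" using False h by (auto simp: n_def)
    have x0: "x0 \<in> ball x0 R" using R by simp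
    have M0: "0 \<le> M" using M[of x0] by (smt (verit))
    have H0: "0 \<le> H" using order_trans[OF abs_ge_zero H[OF x0]] n by (simp add: n_def zero_le_mult_iff)
    have L0: "0 \<le> \<Lambda>" using order_trans[OF abs_ge_zero L[OF x0]] n by (simp add: n_def zero_le_mult_iff)
    have n\<alpha>: "n \<le> n powr \<alpha>" using powr_mono'[of \<alpha> 1 n] n \<alpha> by simp
    define w where "w x = v (x + h) - v x" for x
    have w: "smb w" unfolding w_def[abs_def] by (rule smb_shift_diff[OF v])
    have weq: "eqn_at s C w (G (x + h) - G x) x" if "x \<in> ball x0 R" for x
      unfolding w_def[abs_def] using eq[OF that] by (intro eqn_at_diff[OF v]) auto
    obtain B where B: "\<And>x. \<bar>lap w x\<bar> \<le> B" using smb_lap_bbor[OF w] by (auto simp: bbor_def)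
    \<comment> \<open>No Lipschitz bound for \<open>v\<close> is available at distance
      \<open>t\<close>, so the average of \<open>w\<close> is written as an increment of the average
      of \<open>v\<close> and \<open>A_shift\<close> supplies the factor \<open>n / t\<close>. This
      costs one power of \<open>1 / d\<close> more than in \<open>lap_bound\<close>.\<close>
    have far: "\<bar>w x - A \<rho> t w x\<bar> \<le> n * (1 + C1) * (\<Lambda> + M) / d" if x: "x \<in> ball x0 R" and d: "0 < d" "d \<le> 1" "d \<le> t" for x t d
    proof -
      have "A \<rho> t w x = A \<rho> t v (x + h) - A \<rho> t v x"
        unfolding w_def[abs_def] A_shift_eq by (intro A_diff kern_\<rho> bbor_shift smb_bbor v)
      moreover have "\<bar>A \<rho> t v (x + h) - A \<rho> t v x\<bar> \<le> C1 * (n / t) * M"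
        unfolding n_def using d M by (intro C1(2) smb_bbor v) auto
      moreover have "C1 * (n / t) * M \<le> C1 * (n / d) * M"
        using d n C1 M0 by (intro mult_right_mono mult_left_mono divide_left_mono) auto
      moreover have "\<bar>w x\<bar> \<le> \<Lambda> * n" using L[OF x] by (simp add: w_def n_def)
      moreover have "\<Lambda> * n \<le> \<Lambda> * n / d" using d L0 n mult_left_le[of d "\<Lambda> * n"] by (simp add: pos_le_divide_eq)
      ultimately have "\<bar>w x - A \<rho> t w x\<bar> \<le> \<Lambda> * n / d + C1 * (n / d) * M" by linarith
      also have "\<dots> = (n / d) * (\<Lambda> + C1 * M)" by (simp add: algebra_simps)
      also have "\<dots> \<le> (n / d) * ((1 + C1) * (\<Lambda> + M))"
        using C1 M0 L0 n d by (intro mult_left_mono) (auto simp: algebra_simps)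
      finally show ?thesis by simp
    qed
    have "\<bar>lap w x0\<bar> \<le> K0 * ((1 + C2) * (H + \<Lambda> + M) * n powr \<alpha>) / R ^ 3"
    proof (rule absorption[where w = "lap w" and ?x0.0 = x0, OF s(2) \<kappa> R, folded K0_def])
      show "0 \<le> (1 + C2) * (H + \<Lambda> + M) * n powr \<alpha>" using C2 H0 L0 M0 by simp
      show "\<bar>lap w x\<bar> \<le> B" for x by (rule B)
      fix x d S assume x: "x \<in> ball x0 R" and d: "0 < d" "d \<le> 1" and S: "\<And>y. y \<in> cball x d \<Longrightarrow> \<bar>lap w y\<bar> \<le> S"
      let ?N = "n * (1 + C1) * (\<Lambda> + M) / d"
      have "\<bar>lap w x\<bar> \<le> \<bar>G (x + h) - G x\<bar> + C * (?N * (d powr (- 2 * s) / (2 * s))) + \<kappa> * d powr (2 - 2 * s) * S"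
        unfolding \<kappa>_def using d by (intro eqn_at_bound[OF s C w weq[OF x] d(1) S] far x) auto
      moreover have "\<bar>G (x + h) - G x\<bar> \<le> H * n powr \<alpha> * (1 / d ^ 3)"
      proof -
        have "H * n powr \<alpha> * 1 \<le> H * n powr \<alpha> * (1 / d ^ 3)" using d H0 by (intro mult_left_mono) (auto simp: power_le_one)
        then show ?thesis using H[OF x] by (simp add: n_def)
      qed
      moreover have "C * (?N * (d powr (- 2 * s) / (2 * s))) \<le> C2 * (\<Lambda> + M) * n powr \<alpha> * (1 / d ^ 3)"
      proof -
        have "d powr (- 2 * s) / d = d powr (- (1 + 2 * s))"
        proof -
          have e: "- (1 + 2 * s) = - 2 * s - 1" by simp
          show ?thesis unfolding e powr_diff using d by simp
        qed
        then have pe: "d powr (- 2 * s) / d = d powr (- (1 + 2 * s))" .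
        have "C * (n * c * m / d * (q / (2 * s))) = C * c / (2 * s) * m * n * (q / d)" for c m q :: real
          by (simp only: divide_inverse mult_ac)
        from this[of "1 + C1" "\<Lambda> + M" "d powr (- 2 * s)"]
        have "C * (?N * (d powr (- 2 * s) / (2 * s))) = C * (1 + C1) / (2 * s) * (\<Lambda> + M) * n * (d powr (- 2 * s) / d)" .
        also have "\<dots> = C2 * (\<Lambda> + M) * n * d powr (- (1 + 2 * s))" unfolding pe C2_def ..
        also have "\<dots> \<le> C2 * (\<Lambda> + M) * n powr \<alpha> * (1 / d ^ 3)"
          using powr_le_inverse_cube[of d "1 + 2 * s"] d s C2 M0 L0 n n\<alpha> by (intro mult_mono) auto
        finally show ?thesis .
      qed
      moreover have "H * n powr \<alpha> * (1 / d ^ 3) + C2 * (\<Lambda> + M) * n powr \<alpha> * (1 / d ^ 3) \<le> ((1 + C2) * (H + \<Lambda> + M) * n powr \<alpha>) / d ^ 3"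
      proof -
        have "H * n powr \<alpha> * (1 / d ^ 3) + C2 * (\<Lambda> + M) * n powr \<alpha> * (1 / d ^ 3) = (H + C2 * (\<Lambda> + M)) * (n powr \<alpha> * (1 / d ^ 3))"
          by (simp only: distrib_right mult.assoc)
        also have "\<dots> \<le> ((1 + C2) * (H + \<Lambda> + M)) * (n powr \<alpha> * (1 / d ^ 3))"
          using C2 H0 L0 M0 d by (intro mult_right_mono) (auto simp: algebra_simps)
        finally show ?thesis by simp
      qed
      ultimately show "\<bar>lap w x\<bar> \<le> ((1 + C2) * (H + \<Lambda> + M) * n powr \<alpha>) / d ^ 3 + \<kappa> * d powr (2 - 2 * s) * S"
        by linarith
    qed
    then show ?thesis by (simp add: w_def[abs_def] lap_shift_diff[OF v] n_def mult_ac)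
  qed simp
  moreover have "0 \<le> K0 * (1 + C2)" using K0 C2 by simp
  ultimately show ?thesis by (intro exI[of _ "K0 * (1 + C2)"]) blast
qed

section \<open>Estimates for first and second derivatives\<close>

lemma A_lap_pd1:
  assumes v: "smb v" and j: "j \<in> Basis"
  shows "t * A \<Psi> t (lap (pd j v)) x = A (pd j \<Psi>) t (lap v) x"
proof -
  have c: "pd b (pd b (pd j v)) = pd j (pd b (pd b v))" if b: "b \<in> Basis" for b
  proof -
    have *: "pd a (pd c w) = pd c (pd a w)" if "smb w" "a \<in> Basis" "c \<in> Basis" for a c and w :: "'a \<Rightarrow> real"
      using pd_commute[OF that] by (rule ext)
    show ?thesis using *[OF v b j] *[OF smb_pd[OF v b] b j] by simp
  qed
  have "t * A \<Psi> t (pd j (pd b (pd b v))) x = A (pd j \<Psi>) t (pd b (pd b v)) x" if b: "b \<in> Basis" for b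
    using A_pd[OF kern_\<Psi> smb_pd[OF smb_pd[OF v b] b] j] by simp
  then have "t * (\<Sum>b\<in>Basis. A \<Psi> t (pd b (pd b (pd j v))) x) = (\<Sum>b\<in>Basis. A (pd j \<Psi>) t (pd b (pd b v)) x)"
    by (simp add: sum_distrib_left c)
  then show ?thesis
    unfolding lap_def[abs_def]
    using v j by (simp add: A_sum[OF kern_\<Psi>] A_sum[OF kern_pd[OF kern_\<Psi> j]] smb_bbor smb_pd)
qed

text \<open>Moving one derivative to the kernel uses up the factor \<open>t\<close> of the scale
  derivative, which leaves a bounded integrand over the scales.\<close>

lemma first_derivative_error:
  assumes v: "smb v" and j: "j \<in> Basis" and t: "0 \<le> t" and F: "\<And>y. y \<in> cball x t \<Longrightarrow> \<bar>lap v y\<bar> \<le> F"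
  shows "\<bar>pd j v x - A \<rho> t (pd j v) x\<bar> \<le> kint (pd j \<Psi>) * F * t"
proof -
  have "\<bar>A \<rho> t (pd j v) x - A \<rho> 0 (pd j v) x\<bar> \<le> kint (pd j \<Psi>) * F * t - kint (pd j \<Psi>) * F * 0"
  proof (rule increment_bound[OF t A_\<rho>_DERIV[OF smb_pd[OF v j]]])
    show "((\<lambda>t. kint (pd j \<Psi>) * F * t) has_real_derivative kint (pd j \<Psi>) * F) (at r)" for r
      by (auto intro!: derivative_eq_intros)
    fix r assume r: "0 < r" "r < t"
    show "\<bar>r * A \<Psi> r (lap (pd j v)) x\<bar> \<le> kint (pd j \<Psi>) * F"
      unfolding A_lap_pd1[OF v j] using r by (intro A_bound kern_pd kern_\<Psi> j smb_lap_bbor v F) auto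
  qed (intro continuous_intros)
  then show ?thesis by (simp add: A_zero abs_minus_commute)
qed

text \<open>With both derivatives on the kernel the scale derivative is
  \<open>A k t (lap v) y / t\<close>, which boundedness of \<open>lap v\<close> would not make
  integrable at 0. But \<open>k\<close> has mean zero, so only the oscillation of
  \<open>lap v\<close> counts and t powr (\<alpha> - 1) remains. Between the scales
  \<open>norm h\<close> and \<open>r\<close> the increment gains norm h / t from
  \<open>A_shift\<close>, and at scale \<open>r\<close> the bound \<open>M\<close> suffices. The
  mollification error is recorded for the passage to the limit.\<close>

theorem second_derivative_bounds:
  fixes i j :: "'a::euclidean_space"
  assumes i: "i \<in> Basis" and j: "j \<in> Basis" and \<alpha>: "0 < \<alpha>" "\<alpha> < 1"
  shows "\<exists>K\<ge>0. \<forall>v x r M H. smb v \<longrightarrow> 0 < r \<longrightarrow> r \<le> 1 \<longrightarrow> 0 \<le> H \<longrightarrow> (\<forall>x. \<bar>v x\<bar> \<le> M) \<longrightarrow>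
    (\<forall>y\<in>cball x (2 * r). \<forall>z\<in>cball x (2 * r). \<bar>lap v y - lap v z\<bar> \<le> H * dist y z powr \<alpha>) \<longrightarrow>
    (\<forall>t. 0 \<le> t \<longrightarrow> t \<le> r \<longrightarrow> \<bar>pd i (pd j v) x - A \<rho> t (pd i (pd j v)) x\<bar> \<le> K * H * t powr \<alpha>) \<and>
    (\<forall>h. norm h \<le> r \<longrightarrow> \<bar>pd i (pd j v) (x + h) - pd i (pd j v) x\<bar> \<le> K * (H + M / r ^ 3) * norm h powr \<alpha>) \<and>
    \<bar>pd i (pd j v) x\<bar> \<le> K * (H + M / r ^ 3)"
proof -
  define k where "k = pd j (pd i (\<Psi> :: 'a \<Rightarrow> real))"
  define l where "l = pd j (pd i (\<rho> :: 'a \<Rightarrow> real))"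
  have k: "kern k" unfolding k_def by (intro kern_pd kern_\<Psi> i j)
  have l: "kern l" unfolding l_def by (intro kern_pd kern_\<rho> i j)
  have k0: "(LINT z|lborel. k z) = 0"
    unfolding k_def using kern_pd[OF kern_\<Psi> i] by (intro test_integral_pd j) (simp add: kern_def)
  obtain Ck where Ck: "0 \<le> Ck" "\<And>v x (h::'a) t S. \<lbrakk>bbor v; 0 < t; \<And>y. y \<in> cball x (t + norm h) \<Longrightarrow> \<bar>v y\<bar> \<le> S\<rbrakk>
    \<Longrightarrow> \<bar>A k t v (x + h) - A k t v x\<bar> \<le> Ck * (norm h / t) * S"
    using A_shift[OF k] by blast
  obtain Cl where Cl: "0 \<le> Cl" "\<And>v x (h::'a) t S. \<lbrakk>bbor v; 0 < t; \<And>y. y \<in> cball x (t + norm h) \<Longrightarrow> \<bar>v y\<bar> \<le> S\<rbrakk>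
    \<Longrightarrow> \<bar>A l t v (x + h) - A l t v x\<bar> \<le> Cl * (norm h / t) * S"
    using A_shift[OF l] by blast
  \<comment> \<open>The factor 1/\<alpha> comes from integrating t powr (\<alpha> - 1) near 0, the
    factor 1/(1 - \<alpha>) in \<open>K2\<close> from integrating t powr (\<alpha> - 2) at larger
    scales; the 2 there bounds 2 powr \<alpha>.\<close>
  define K1 where "K1 = kint k / \<alpha>"
  have K1: "0 \<le> K1" using \<alpha> kint_nonneg[of k] by (simp add: K1_def)
  define K2 where "K2 = 2 * Ck / (1 - \<alpha>)"
  have K2: "0 \<le> K2" using \<alpha> Ck(1) by (simp add: K2_def)
  define K where "K = 2 * K1 + K2 + Cl + kint l"
  have K: "0 \<le> K" using K1 K2 Cl(1) kint_nonneg[of l] by (simp add: K_def)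
  have powr_cont: "continuous_on {0..b} (\<lambda>t. c * t powr \<alpha>)" for b c
    using \<alpha> by (intro continuous_intros continuous_on_powr') auto
  have main: "(\<forall>t. 0 \<le> t \<longrightarrow> t \<le> r \<longrightarrow> \<bar>pd i (pd j v) x - A \<rho> t (pd i (pd j v)) x\<bar> \<le> K * H * t powr \<alpha>) \<and>
    (\<forall>h. norm h \<le> r \<longrightarrow> \<bar>pd i (pd j v) (x + h) - pd i (pd j v) x\<bar> \<le> K * (H + M / r ^ 3) * norm h powr \<alpha>) \<and>
    \<bar>pd i (pd j v) x\<bar> \<le> K * (H + M / r ^ 3)"
    if v: "smb v" and r: "0 < r" "r \<le> 1" and H0: "0 \<le> H" and M: "\<forall>x. \<bar>v x\<bar> \<le> M"
      and H: "\<forall>y\<in>cball x (2 * r). \<forall>z\<in>cball x (2 * r). \<bar>lap v y - lap v z\<bar> \<le> H * dist y z powr \<alpha>"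
    for v x r M H
  proof -
    define p where "p = pd i (pd j v)"
    have p: "smb p" unfolding p_def by (intro smb_pd v i j)
    have M0: "0 \<le> M" using M abs_ge_zero order_trans by blast
    note lb = smb_lap_bbor[OF v]
    have der: "((\<lambda>t. A \<rho> t p y) has_real_derivative t * A \<Psi> t (lap p) y) (at t)" for t y
      by (rule A_\<rho>_DERIV[OF p])
    have der_eq: "t * A \<Psi> t (lap p) y = A k t (lap v) y / t" if "0 < t" for t y
      using A_lap_pd2[OF v i j, of t y] that by (simp add: p_def k_def field_simps power2_eq_square)
    have osc: "A k t (lap v) y = A k t (\<lambda>z. lap v z - c) y" for t y c
      using A_diff[OF k lb bbor_const, of t c y] by (simp add: A_const k0)
    have kb: "\<bar>A k t (lap v) y\<bar> \<le> kint k * (H * t powr \<alpha>)" if t: "0 < t" and y: "cball y t \<subseteq> cball x (2 * r)" for t y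
      unfolding osc[of t y "lap v y"]
    proof (rule A_bound[OF k bbor_diff[OF lb bbor_const]])
      fix z assume z: "z \<in> cball y t"
      have "\<bar>lap v z - lap v y\<bar> \<le> H * dist z y powr \<alpha>" using H z y t by (metis centre_in_cball less_imp_le subsetD)
      also have "\<dots> \<le> H * t powr \<alpha>" using z H0 \<alpha> by (intro mult_left_mono powr_mono2) (auto simp: dist_commute)
      finally show "\<bar>lap v z - lap v y\<bar> \<le> H * t powr \<alpha>" .
    qed (use t in simp)
    have sm: "\<bar>t * A \<Psi> t (lap p) y\<bar> \<le> K1 * H * (\<alpha> * t powr (\<alpha> - 1))" if t: "0 < t" and y: "cball y t \<subseteq> cball x (2 * r)" for t y
    proof -
      have "\<bar>t * A \<Psi> t (lap p) y\<bar> \<le> kint k * (H * t powr \<alpha>) / t"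
        unfolding der_eq[OF t] using kb[OF t y] t by (simp add: divide_right_mono)
      also have "\<dots> = K1 * H * (\<alpha> * t powr (\<alpha> - 1))"
        using t \<alpha> by (simp add: K1_def powr_diff)
      finally show ?thesis .
    qed
    have powr_der: "((\<lambda>t. c * t powr q) has_real_derivative c * (q * t powr (q - 1))) (at t)" if "0 < t" for c t q
      using that by (auto intro!: derivative_eq_intros)
    have err: "\<bar>p x - A \<rho> t p x\<bar> \<le> K1 * H * t powr \<alpha>" if t: "0 \<le> t" "t \<le> r" for t
    proof -
      have "\<bar>A \<rho> t p x - A \<rho> 0 p x\<bar> \<le> K1 * H * t powr \<alpha> - K1 * H * 0 powr \<alpha>"
        using t by (intro increment_bound[OF t(1) der powr_cont powr_der sm]) auto
      then show ?thesis using \<alpha> by (simp add: A_zero abs_minus_commute)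
    qed
    \<comment> \<open>At the fixed scale \<open>r\<close> both derivatives are moved to the
      mollifier, at the cost of \<open>1 / r\<^sup>2\<close>.\<close>
    have Ar: "A \<rho> r p y = A l r v y / r\<^sup>2" for y
    proof -
      have "A l r v y = r * (r * A \<rho> r p y)"
        unfolding l_def p_def using A_pd[OF kern_pd[OF kern_\<rho> i] v j, of r y] A_pd[OF kern_\<rho> smb_pd[OF v j] i, of r y] by simp
      then show ?thesis using r by (simp add: power2_eq_square)
    qed
    have r3: "1 / r\<^sup>2 \<le> 1 / r ^ 3"
      using r power_decreasing[of 2 3 r] by (intro divide_left_mono) auto
    have sup: "\<bar>p x\<bar> \<le> K * (H + M / r ^ 3)"
    proof -
      have "\<bar>A l r v x\<bar> \<le> kint l * M" using M r by (intro A_bound l smb_bbor v) auto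
      then have "\<bar>A l r v x\<bar> * (1 / r\<^sup>2) \<le> (kint l * M) * (1 / r ^ 3)"
        using r3 r M0 kint_nonneg[of l] by (intro mult_mono) auto
      then have "\<bar>A \<rho> r p x\<bar> \<le> kint l * (M / r ^ 3)" by (simp add: Ar)
      moreover have "K1 * H * r powr \<alpha> \<le> K1 * H * 1" using r \<alpha> K1 H0 by (intro mult_left_mono powr_le1) auto
      ultimately have "\<bar>p x\<bar> \<le> K1 * H + kint l * (M / r ^ 3)" using err[of r] r by simp
      also have "\<dots> \<le> K * H + K * (M / r ^ 3)"
        using K1 K2 Cl(1) kint_nonneg[of l] H0 M0 r by (intro add_mono mult_right_mono) (auto simp: K_def)
      finally show ?thesis by (simp add: distrib_left)
    qed
    have hol: "\<bar>p (x + h) - p x\<bar> \<le> K * (H + M / r ^ 3) * norm h powr \<alpha>" if h: "norm h \<le> r" for h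
    proof (cases "h = 0")
      case False
      define n where "n = norm h"
      have n: "0 < n" "n \<le> r" "n \<le> 1" using False h r by (auto simp: n_def)
      define D where "D t = A \<rho> t p (x + h) - A \<rho> t p x" for t
      have D: "(D has_real_derivative (t * A \<Psi> t (lap p) (x + h) - t * A \<Psi> t (lap p) x)) (at t)" for t
        unfolding D_def[abs_def] by (intro DERIV_diff der)
      have D0: "D 0 = p (x + h) - p x" by (simp add: D_def A_zero)
      \<comment> \<open>Scales below the step length: the two points are estimated separately, with
        no cancellation between them.\<close>
      have "\<bar>D n - D 0\<bar> \<le> (2 * K1 * H) * n powr \<alpha> - (2 * K1 * H) * 0 powr \<alpha>"
      proof (rule increment_bound[OF _ D powr_cont powr_der])
        fix t assume t: "0 < t" "t < n"
        have "cball (x + h) t \<subseteq> cball x (2 * r)"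
        proof
          fix y assume "y \<in> cball (x + h) t"
          then show "y \<in> cball x (2 * r)"
            using t n norm_triangle_ineq[of "x + h - y" "- h"] by (simp add: dist_norm n_def)
        qed
        moreover have "cball x t \<subseteq> cball x (2 * r)" using t n r by (intro subset_cball) simp
        ultimately
        have "\<bar>t * A \<Psi> t (lap p) (x + h)\<bar> + \<bar>t * A \<Psi> t (lap p) x\<bar> \<le> 2 * (K1 * H * (\<alpha> * t powr (\<alpha> - 1)))"
          using sm[OF t(1), of "x + h"] sm[OF t(1), of x] by linarith
        then show "\<bar>t * A \<Psi> t (lap p) (x + h) - t * A \<Psi> t (lap p) x\<bar> \<le> 2 * K1 * H * (\<alpha> * t powr (\<alpha> - 1))"
          by (simp add: mult.assoc)
      qed (use n in auto)
      then have 1: "\<bar>D n - D 0\<bar> \<le> (2 * K1 * H) * n powr \<alpha>" using \<alpha> by simp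
      \<comment> \<open>The sign is negative so that \<open>c * t powr (\<alpha> - 1)\<close>
        increases: its derivative is the positive bound of order t powr (\<alpha> - 2) needed as a
        majorant.\<close>
      define c where "c = - (K2 * H * n)"
      have "\<bar>D r - D n\<bar> \<le> c * r powr (\<alpha> - 1) - c * n powr (\<alpha> - 1)"
      proof (rule increment_bound[OF n(2) D _ powr_der])
        show "continuous_on {n..r} (\<lambda>t. c * t powr (\<alpha> - 1))" using n by (intro continuous_intros) auto
        fix t assume t: "n < t" "t < r"
        then have t0: "0 < t" using n by simp
        have "\<bar>A k t (lap v) (x + h) - A k t (lap v) x\<bar> = \<bar>A k t (\<lambda>z. lap v z - lap v x) (x + h) - A k t (\<lambda>z. lap v z - lap v x) x\<bar>"
          using osc[of t "x + h" "lap v x"] osc[of t x "lap v x"] by simp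
        also have "\<dots> \<le> Ck * (norm h / t) * (H * (2 * t powr \<alpha>))"
        proof (rule Ck(2)[OF bbor_diff[OF lb bbor_const] t0])
          fix y assume y: "y \<in> cball x (t + norm h)"
          have "\<bar>lap v y - lap v x\<bar> \<le> H * dist y x powr \<alpha>"
            using H y t r by (auto simp: n_def)
          also have "\<dots> \<le> H * (2 * t) powr \<alpha>"
            using y t H0 \<alpha> by (intro mult_left_mono powr_mono2) (auto simp: n_def dist_commute)
          also have "(2 * t) powr \<alpha> \<le> 2 * t powr \<alpha>"
            using t0 \<alpha> powr_mono[of \<alpha> 1 2] by (simp add: powr_mult mult_right_mono)
          finally show "\<bar>lap v y - lap v x\<bar> \<le> H * (2 * t powr \<alpha>)" using H0 by (simp add: mult_left_mono)
        qed
        finally have "\<bar>A k t (lap v) (x + h) - A k t (lap v) x\<bar> \<le> Ck * (norm h / t) * (H * (2 * t powr \<alpha>))" .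
        then have "\<bar>A k t (lap v) (x + h) - A k t (lap v) x\<bar> / t \<le> Ck * (n / t) * (H * (2 * t powr \<alpha>)) / t"
          unfolding n_def using t0 by (intro divide_right_mono) auto
        also have "\<dots> = c * ((\<alpha> - 1) * t powr (\<alpha> - 1 - 1))"
          using t0 \<alpha> by (simp add: c_def K2_def powr_diff field_simps power2_eq_square)
        finally show "\<bar>t * A \<Psi> t (lap p) (x + h) - t * A \<Psi> t (lap p) x\<bar> \<le> c * ((\<alpha> - 1) * t powr (\<alpha> - 1 - 1))"
          using t0 by (simp add: der_eq diff_divide_distrib[symmetric])
      qed (use n in auto)
      also have "\<dots> \<le> - c * n powr (\<alpha> - 1)" using K2 H0 n by (simp add: c_def mult_nonneg_nonneg)
      also have "\<dots> = K2 * H * n powr \<alpha>" using n by (simp add: c_def powr_diff)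
      finally have 2: "\<bar>D r - D n\<bar> \<le> K2 * H * n powr \<alpha>" .
      \<comment> \<open>The top scale: only the supremum of \<open>v\<close> is used, and
        \<open>n \<le> 1\<close> turns the linear factor into n powr \<alpha>.\<close>
      have "\<bar>A l r v (x + h) - A l r v x\<bar> \<le> Cl * (norm h / r) * M" using M r by (intro Cl(2) smb_bbor v) auto
      then have "\<bar>A l r v (x + h) - A l r v x\<bar> / r\<^sup>2 \<le> Cl * (n / r) * M / r\<^sup>2"
        unfolding n_def by (intro divide_right_mono) auto
      also have "\<dots> = Cl * (M / r ^ 3) * n" by (simp add: power2_eq_square power3_eq_cube mult_ac)
      also have "\<dots> \<le> Cl * (M / r ^ 3) * n powr \<alpha>"
        using n \<alpha> Cl(1) M0 r powr_mono'[of \<alpha> 1 n] by (intro mult_left_mono) auto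
      finally have 3: "\<bar>D r\<bar> \<le> Cl * (M / r ^ 3) * n powr \<alpha>" by (simp add: D_def Ar diff_divide_distrib[symmetric])
      have "\<bar>p (x + h) - p x\<bar> \<le> (2 * K1 * H) * n powr \<alpha> + K2 * H * n powr \<alpha> + Cl * (M / r ^ 3) * n powr \<alpha>"
        using 1 2 3 unfolding D0 by linarith
      also have "\<dots> = ((2 * K1 + K2) * H + Cl * (M / r ^ 3)) * n powr \<alpha>" by (simp add: algebra_simps)
      also have "\<dots> \<le> (K * H + K * (M / r ^ 3)) * n powr \<alpha>"
        using K1 K2 Cl(1) kint_nonneg[of l] H0 M0 r by (intro mult_right_mono add_mono) (auto simp: K_def)
      finally show ?thesis by (simp add: distrib_left n_def)
    qed (simp add: \<open>0 < r\<close>)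
    have "K1 * H * t powr \<alpha> \<le> K * H * t powr \<alpha>" for t
      using K1 K2 Cl(1) kint_nonneg[of l] H0 by (intro mult_right_mono) (auto simp: K_def)
    then show ?thesis using err hol sup unfolding p_def by (meson order_trans)
  qed
  show ?thesis by (rule exI[of _ K]) (use K main in blast)
qed

section \<open>Passing to the limit\<close>

text \<open>Neighbourhoods indexed by their radius, so that successive losses of domain become
  arithmetic on radii.\<close>

definition nbd :: "'a::metric_space set \<Rightarrow> real \<Rightarrow> 'a set" where
  "nbd K r = {x. \<exists>y\<in>K. dist y x \<le> r}"

lemma nbd_mono: "r \<le> r' \<Longrightarrow> nbd K r \<subseteq> nbd K r'"
  by (force simp: nbd_def)

lemma nbd_cball: "x \<in> nbd K r \<Longrightarrow> r + t \<le> r' \<Longrightarrow> cball x t \<subseteq> nbd K r'"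
proof
  fix z assume "x \<in> nbd K r" "r + t \<le> r'" "z \<in> cball x t"
  then obtain y where "y \<in> K" "dist y x \<le> r" "dist x z \<le> t" by (auto simp: nbd_def)
  then show "z \<in> nbd K r'" using dist_triangle[of y z x] \<open>r + t \<le> r'\<close> by (force simp: nbd_def)
qed

lemma nbd_add: "x \<in> nbd K r \<Longrightarrow> r + norm h \<le> r' \<Longrightarrow> x + h \<in> nbd K r'" for h :: "'a::real_normed_vector"
  using nbd_cball[of x K r "norm h" r'] by (auto simp: dist_norm)

lemma subset_nbd: "0 \<le> r \<Longrightarrow> K \<subseteq> nbd K r"
  by (force simp: nbd_def)

lemma compact_nbd:
  fixes K :: "'a::euclidean_space set"
  assumes "compact K" shows "compact (nbd K r)"
proof -
  have "nbd K r = {x + y |x y. x \<in> K \<and> y \<in> cball 0 r}"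
  proof safe
    fix x assume "x \<in> nbd K r"
    then obtain y where "y \<in> K" "dist y x \<le> r" by (auto simp: nbd_def)
    then show "\<exists>a b. x = a + b \<and> a \<in> K \<and> b \<in> cball 0 r"
      by (intro exI[of _ y] exI[of _ "x - y"]) (auto simp: dist_norm norm_minus_commute)
  qed (force simp: nbd_def dist_norm)
  then show ?thesis using compact_sums[OF assms compact_cball[of 0 r]] by (simp only:)
qed

lemma mollified_bounded:
  assumes "bbor u" "\<And>x. \<bar>u x\<bar> \<le> M" "0 \<le> d" shows "\<bar>A \<rho> d u x\<bar> \<le> M"
  using A_bound[OF kern_\<rho> assms(1), of x d M] assms by (simp add: \<rho>_kint)

text \<open>Each estimate shrinks the domain: \<open>lap_bound\<close> consumes a ball of radius
  \<open>R\<close>, \<open>lipschitz_bound\<close> one of radius \<open>2 * R\<close>. The resulting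
  constants do not involve the mollification parameter.\<close>

theorem mollified_lipschitz:
  fixes u :: "'a::euclidean_space \<Rightarrow> real"
  assumes s: "0 < s" "s < 1" and C: "0 \<le> C" and R: "0 < R" "R \<le> 1"
    and u: "bbor u" "integrable lborel u" "\<And>x. \<bar>u x\<bar> \<le> M"
    and eq: "\<And>d x. 0 < d \<Longrightarrow> d \<le> R \<Longrightarrow> x \<in> nbd K (9 * R) \<Longrightarrow> eqn_at s C (A \<rho> d u) (G d x) x \<and> \<bar>G d x\<bar> \<le> g"
  shows "\<exists>F \<Lambda>. \<forall>d. 0 < d \<longrightarrow> d \<le> R \<longrightarrow> (\<forall>x\<in>nbd K (8 * R). \<bar>lap (A \<rho> d u) x\<bar> \<le> F) \<and>
    (\<forall>x\<in>nbd K (6 * R). \<forall>h. norm h \<le> R \<longrightarrow> \<bar>A \<rho> d u (x + h) - A \<rho> d u x\<bar> \<le> \<Lambda> * norm h)"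
proof -
  obtain K1 where K1: "\<forall>(v :: 'a \<Rightarrow> real) G x0 R M g. smb v \<longrightarrow> 0 < R \<longrightarrow> R \<le> 1 \<longrightarrow> (\<forall>x. \<bar>v x\<bar> \<le> M) \<longrightarrow>
     (\<forall>x\<in>ball x0 R. eqn_at s C v (G x) x) \<longrightarrow> (\<forall>x\<in>ball x0 R. \<bar>G x\<bar> \<le> g) \<longrightarrow> \<bar>lap v x0\<bar> \<le> K1 * (g + M) / R ^ 3"
    using lap_bound[OF s C, where 'a='a] by blast
  obtain K2 where K2: "\<forall>(v :: 'a \<Rightarrow> real) x h r M F. smb v \<longrightarrow> 0 < r \<longrightarrow> norm h \<le> r \<longrightarrow> (\<forall>x. \<bar>v x\<bar> \<le> M) \<longrightarrow>
     (\<forall>y\<in>cball x (2 * r). \<bar>lap v y\<bar> \<le> F) \<longrightarrow> \<bar>v (x + h) - v x\<bar> \<le> K2 * (M / r + r * F) * norm h"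
    using lipschitz_bound[where 'a='a] by blast
  define F where "F = K1 * (g + M) / R ^ 3"
  have "(\<forall>x\<in>nbd K (8 * R). \<bar>lap (A \<rho> d u) x\<bar> \<le> F) \<and>
    (\<forall>x\<in>nbd K (6 * R). \<forall>h. norm h \<le> R \<longrightarrow> \<bar>A \<rho> d u (x + h) - A \<rho> d u x\<bar> \<le> (K2 * (M / R + R * F)) * norm h)"
    if d: "0 < d" "d \<le> R" for d
  proof -
    have v: "smb (A \<rho> d u)" by (rule smb_A[OF kern_\<rho> bbor_measurable[OF u(1)] u(2) d(1)])
    have M: "\<forall>x. \<bar>A \<rho> d u x\<bar> \<le> M" using mollified_bounded[OF u(1) u(3)] d by auto
    have F: "\<bar>lap (A \<rho> d u) x0\<bar> \<le> F" if "x0 \<in> nbd K (8 * R)" for x0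
    proof -
      have "ball x0 R \<subseteq> nbd K (9 * R)" using nbd_cball[OF that, of R "9 * R"] by auto
      then have "\<forall>x\<in>ball x0 R. eqn_at s C (A \<rho> d u) (G d x) x" "\<forall>x\<in>ball x0 R. \<bar>G d x\<bar> \<le> g" using eq[OF d] by blast+
      then show ?thesis unfolding F_def using K1 v R M by blast
    qed
    moreover have "\<bar>A \<rho> d u (x + h) - A \<rho> d u x\<bar> \<le> (K2 * (M / R + R * F)) * norm h" if x: "x \<in> nbd K (6 * R)" and h: "norm h \<le> R" for x h
    proof -
      have "cball x (2 * R) \<subseteq> nbd K (8 * R)" using nbd_cball[OF x, of "2 * R" "8 * R"] by simp
      then have "\<forall>y\<in>cball x (2 * R). \<bar>lap (A \<rho> d u) y\<bar> \<le> F" using F by blast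
      then show ?thesis using K2 v R(1) M h by blast
    qed
    ultimately show ?thesis by blast
  qed
  then show ?thesis by blast
qed

section \<open>Uniform convergence of the mollified solutions\<close>

text \<open>Three-epsilon argument: \<open>f n\<close> is within \<open>E e\<close> of a comparison
  sequence, uniformly in \<open>n\<close>, and for fixed \<open>e\<close> the comparison sequence is
  Cauchy.\<close>

lemma uniformly_Cauchy_approx:
  fixes f :: "nat \<Rightarrow> 'a \<Rightarrow> real" and E :: "real \<Rightarrow> real"
  assumes r: "0 < r" and err: "\<And>e n x. 0 < e \<Longrightarrow> e \<le> r \<Longrightarrow> x \<in> X \<Longrightarrow> \<bar>f n x - B e n x\<bar> \<le> E e"
    and E: "(E \<longlongrightarrow> 0) (at_right 0)" and B: "\<And>e. 0 < e \<Longrightarrow> e \<le> r \<Longrightarrow> uniformly_Cauchy_on X (B e)"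
  shows "uniformly_Cauchy_on X f"
  unfolding uniformly_Cauchy_on_def
proof (intro allI impI)
  fix c :: real assume c: "0 < c"
  have "\<forall>\<^sub>F e in at_right 0. E e < c / 3" using order_tendstoD(2)[OF E, of "c / 3"] c by simp
  then obtain b where b: "0 < b" "\<forall>y>0. y < b \<longrightarrow> E y < c / 3" unfolding eventually_at_right_field by blast
  define e where "e = min (b / 2) r"
  have e: "E e < c / 3" "0 < e" "e \<le> r" using b r by (auto simp: e_def)
  obtain N where N: "\<forall>x\<in>X. \<forall>m\<ge>N. \<forall>n\<ge>N. dist (B e m x) (B e n x) < c / 3"
    using B[OF e(2,3)] c unfolding uniformly_Cauchy_on_def by (meson divide_pos_pos zero_less_numeral)
  have "dist (f m x) (f n x) < c" if "x \<in> X" "m \<ge> N" "n \<ge> N" for x m n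
  proof -
    have "dist (B e m x) (B e n x) < c / 3" using N that by blast
    then show ?thesis using err[OF e(2,3) that(1), of m] err[OF e(2,3) that(1), of n] e(1)
      unfolding dist_real_def by linarith
  qed
  then show "\<exists>M. \<forall>x\<in>X. \<forall>m\<ge>M. \<forall>n\<ge>M. dist (f m x) (f n x) < c" by blast
qed

lemma A_uniformly_Cauchy:
  assumes k: "kern k" and v: "\<And>n. bbor (v n)" and Y: "uniformly_Cauchy_on Y v"
    and X: "\<And>x. x \<in> X \<Longrightarrow> cball x e \<subseteq> Y" and e: "0 \<le> e"
  shows "uniformly_Cauchy_on X (\<lambda>n x. c * A k e (v n) x)"
  unfolding uniformly_Cauchy_on_def
proof (intro allI impI)
  fix d :: real assume d: "0 < d"
  define b where "b = d / (\<bar>c\<bar> * kint k + 1)"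
  have den: "0 < \<bar>c\<bar> * kint k + 1" using kint_nonneg[of k] by (simp add: add_nonneg_pos)
  have b: "0 < b" using d den by (simp add: b_def)
  obtain N where N: "\<forall>x\<in>Y. \<forall>m\<ge>N. \<forall>n\<ge>N. dist (v m x) (v n x) < b"
    using Y b unfolding uniformly_Cauchy_on_def by meson
  have "dist (c * A k e (v m) x) (c * A k e (v n) x) < d" if x: "x \<in> X" and mn: "m \<ge> N" "n \<ge> N" for x m n
  proof -
    have "\<bar>A k e (\<lambda>y. v m y - v n y) x\<bar> \<le> kint k * b"
    proof (rule A_bound[OF k bbor_diff[OF v v] _ e])
      fix y assume "y \<in> cball x e"
      then have "y \<in> Y" using X[OF x] by blast
      then have "dist (v m y) (v n y) < b" using N mn by blast
      then show "\<bar>v m y - v n y\<bar> \<le> b" by (simp add: dist_real_def)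
    qed
    then have "\<bar>c\<bar> * \<bar>A k e (\<lambda>y. v m y - v n y) x\<bar> \<le> \<bar>c\<bar> * (kint k * b)" by (intro mult_left_mono) auto
    also have "\<dots> < (\<bar>c\<bar> * kint k + 1) * b" using b by (simp add: algebra_simps)
    also have "\<dots> = d" using den by (simp add: b_def)
    finally show ?thesis by (simp add: dist_real_def A_diff[OF k v v] right_diff_distrib[symmetric] abs_mult)
  qed
  then show "\<exists>M. \<forall>x\<in>X. \<forall>m\<ge>M. \<forall>n\<ge>M. dist (c * A k e (v m) x) (c * A k e (v n) x) < d" by blast
qed

lemma mollifier_lip:
  fixes y :: "'a::euclidean_space \<Rightarrow> real"
  assumes y: "bbor y" and L: "\<And>x z. \<bar>y x - y z\<bar> \<le> L * norm (x - z)" and d: "0 \<le> d" and L0: "0 \<le> L"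
  shows "\<bar>A \<rho> d y x - y x\<bar> \<le> L * d"
proof -
  have "A \<rho> d y x - y x = A \<rho> d (\<lambda>z. y z - y x) x"
    using A_diff[OF kern_\<rho> y bbor_const, of d "y x" x] by (simp add: A_const \<rho>_integral)
  moreover have "\<bar>A \<rho> d (\<lambda>z. y z - y x) x\<bar> \<le> kint (\<rho> :: 'a \<Rightarrow> real) * (L * d)"
  proof (rule A_bound[OF kern_\<rho> bbor_diff[OF y bbor_const] _ d])
    fix z assume z: "z \<in> cball x d"
    have "\<bar>y z - y x\<bar> \<le> L * norm (z - x)" by (rule L)
    also have "\<dots> \<le> L * d" using z L0 by (intro mult_left_mono) (auto simp: dist_norm norm_minus_commute)
    finally show "\<bar>y z - y x\<bar> \<le> L * d" .
  qed
  ultimately show ?thesis using \<rho>_kint[where 'a='a] by simp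
qed

text \<open>Averaging once more at a fixed scale \<open>e\<close> gives the comparison. The error is
  of order \<open>e\<^sup>2\<close> by the Laplacian bound; and after exchanging the two averages,
  \<open>A \<rho> e u\<close> is Lipschitz, so its mollifications converge to it uniformly.\<close>

lemma mollified_Cauchy:
  fixes u :: "'a::euclidean_space \<Rightarrow> real"
  assumes u: "bbor u" "integrable lborel u" and d: "\<And>n. 0 < d n" "d \<longlonglongrightarrow> 0" and r: "0 < r"
    and bd: "\<And>n x y. x \<in> X \<Longrightarrow> y \<in> cball x r \<Longrightarrow> \<bar>lap (A \<rho> (d n) u) y\<bar> \<le> F"
  shows "uniformly_Cauchy_on X (\<lambda>n. A \<rho> (d n) u)"
proof (rule uniformly_Cauchy_approx[OF r])
  have v: "smb (A \<rho> e u)" if "0 < e" for e using smb_A[OF kern_\<rho> bbor_measurable[OF u(1)] u(2) that] .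
  show "\<bar>A \<rho> (d n) u x - A \<rho> (d n) (A \<rho> e u) x\<bar> \<le> e\<^sup>2 * (kint (\<Psi> :: 'a \<Rightarrow> real) * F)" if "0 < e" "e \<le> r" "x \<in> X" for e n x
    unfolding A_\<rho>_commute[OF u(1), of "d n" e]
    using that by (intro mollifier_error v d bd) auto
  have "((\<lambda>e. e\<^sup>2 * (kint (\<Psi> :: 'a \<Rightarrow> real) * F)) \<longlongrightarrow> 0\<^sup>2 * (kint (\<Psi> :: 'a \<Rightarrow> real) * F)) (at_right 0)"
    by (intro tendsto_intros)
  then show "((\<lambda>e. e\<^sup>2 * (kint (\<Psi> :: 'a \<Rightarrow> real) * F)) \<longlongrightarrow> 0) (at_right 0)" by simp
  fix e :: real assume e: "0 < e"
  obtain L where L: "0 \<le> L" "\<And>x y. \<bar>A \<rho> e u x - A \<rho> e u y\<bar> \<le> L * norm (x - y)" using smb_lip[OF v[OF e]] by metis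
  show "uniformly_Cauchy_on X (\<lambda>n. A \<rho> (d n) (A \<rho> e u))"
    unfolding uniformly_Cauchy_on_def
  proof (intro allI impI)
    fix c :: real assume c: "0 < c"
    have "(\<lambda>n. L * d n) \<longlonglongrightarrow> L * 0" by (intro tendsto_intros d)
    then have "\<forall>\<^sub>F n in sequentially. L * d n < c / 2" using c by (intro order_tendstoD) auto
    then obtain N where N: "\<And>n. n \<ge> N \<Longrightarrow> L * d n < c / 2" by (auto simp: eventually_sequentially)
    have "dist (A \<rho> (d m) (A \<rho> e u) x) (A \<rho> (d n) (A \<rho> e u) x) < c" if "m \<ge> N" "n \<ge> N" for m n x
      using mollifier_lip[OF smb_bbor[OF v[OF e]] L(2) less_imp_le[OF d(1)] L(1), of m x] N[OF that(1)]
        mollifier_lip[OF smb_bbor[OF v[OF e]] L(2) less_imp_le[OF d(1)] L(1), of n x] N[OF that(2)]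
      unfolding dist_real_def by linarith
    then show "\<exists>M. \<forall>x\<in>X. \<forall>m\<ge>M. \<forall>n\<ge>M. dist (A \<rho> (d m) (A \<rho> e u) x) (A \<rho> (d n) (A \<rho> e u) x) < c" by blast
  qed
qed

lemma uniformly_Cauchy_uniform_limit:
  fixes f :: "nat \<Rightarrow> 'a \<Rightarrow> real"
  assumes "uniformly_Cauchy_on X f"
  shows "uniform_limit X f (\<lambda>x. lim (\<lambda>n. f n x)) sequentially"
  using Cauchy_uniformly_convergent[OF assms] uniformly_convergent_uniform_limit_iff by blast

section \<open>Identification of the limit\<close>

lemma mollifier_adjoint:
  fixes u :: "'a::euclidean_space \<Rightarrow> real"
  assumes u: "bbor u" "integrable lborel u" and \<phi>: "smb \<phi>" "integrable lborel \<phi>" and d: "0 < d"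
  shows "(LINT x|lborel. A \<rho> d u x * \<phi> x) = (LINT y|lborel. u y * A \<rho> d \<phi> y)"
proof -
  note [measurable] = bbor_measurable[OF u(1)] smb_measurable[OF \<phi>(1)]
  obtain B where B: "0 \<le> B" "\<And>z::'a. \<bar>scl d \<rho> z\<bar> \<le> B" using smb_bdd[OF scl_\<rho>_smb[OF d]] by metis
  have "integrable (lborel \<Otimes>\<^sub>M lborel) (\<lambda>(x, y). u y * scl d \<rho> (x - y) * \<phi> x)"
  proof (rule integrableI_bounded)
    have "(\<integral>\<^sup>+z. ennreal (norm (case z of (x, y) \<Rightarrow> u y * scl d \<rho> (x - y) * \<phi> x)) \<partial>(lborel \<Otimes>\<^sub>M lborel))
      \<le> (\<integral>\<^sup>+z. ennreal (B * norm (\<phi> (fst z))) * ennreal (norm (u (snd z))) \<partial>(lborel \<Otimes>\<^sub>M lborel))"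
    proof (rule nn_integral_mono)
      fix z :: "'a \<times> 'a"
      have "\<bar>u (snd z)\<bar> * \<bar>scl d \<rho> (fst z - snd z)\<bar> * \<bar>\<phi> (fst z)\<bar> \<le> \<bar>u (snd z)\<bar> * B * \<bar>\<phi> (fst z)\<bar>"
        using B(2) by (intro mult_right_mono mult_left_mono) auto
      then show "ennreal (norm (case z of (x, y) \<Rightarrow> u y * scl d \<rho> (x - y) * \<phi> x)) \<le> ennreal (B * norm (\<phi> (fst z))) * ennreal (norm (u (snd z)))"
        using B(1) by (simp add: split_beta abs_mult ennreal_mult'[symmetric] ennreal_leI mult_ac)
    qed
    also have "\<dots> = (\<integral>\<^sup>+x. ennreal (B * norm (\<phi> x)) * (\<integral>\<^sup>+y. ennreal (norm (u y)) \<partial>lborel) \<partial>lborel)"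
      by (subst lborel.nn_integral_fst[symmetric]) (auto simp: nn_integral_cmult)
    also have "\<dots> = (\<integral>\<^sup>+x. ennreal (B * norm (\<phi> x)) \<partial>lborel) * (\<integral>\<^sup>+y. ennreal (norm (u y)) \<partial>lborel)"
      by (intro nn_integral_multc) measurable
    also have "\<dots> < \<infinity>"
    proof -
      have "(\<integral>\<^sup>+y. ennreal (norm (u y)) \<partial>lborel) < \<infinity>" using u(2) by (simp add: integrable_iff_bounded)
      moreover have "integrable lborel (\<lambda>x. B * norm (\<phi> x))" using \<phi>(2) by simp
      then have "(\<integral>\<^sup>+x. ennreal (norm (B * norm (\<phi> x))) \<partial>lborel) < \<infinity>" by (simp only: integrable_iff_bounded)
      then have "(\<integral>\<^sup>+x. ennreal (B * norm (\<phi> x)) \<partial>lborel) < \<infinity>" using B(1) by (simp add: abs_mult)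
      ultimately show ?thesis by (simp add: ennreal_mult_less_top)
    qed
    finally show "(\<integral>\<^sup>+z. ennreal (norm (case z of (x, y) \<Rightarrow> u y * scl d \<rho> (x - y) * \<phi> x)) \<partial>(lborel \<Otimes>\<^sub>M lborel)) < \<infinity>" .
  qed measurable
  from lborel_pair.Fubini_integral[OF this]
  have "(LINT x|lborel. LINT y|lborel. u y * scl d \<rho> (x - y) * \<phi> x) = (LINT y|lborel. LINT x|lborel. u y * scl d \<rho> (x - y) * \<phi> x)" ..
  moreover have "(LINT x|lborel. u y * scl d \<rho> (x - y) * \<phi> x) = u y * A \<rho> d \<phi> y" for y
    using A_eq_cv[OF kern_\<rho> smb_measurable[OF \<phi>(1)] d, of y]
    by (simp add: cv_def mult.assoc scl_\<rho>_sym[of d y] mult.commute[of "\<phi> _"])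
  moreover have "(LINT y|lborel. u y * scl d \<rho> (x - y) * \<phi> x) = A \<rho> d u x * \<phi> x" for x
    using A_eq_cv[OF kern_\<rho> bbor_measurable[OF u(1)] d, of x] by (simp add: cv_def)
  ultimately show ?thesis by (simp only:)
qed

text \<open>Integrals of the averages against a test function have two limits: one with
  \<open>w\<close>, by uniform convergence, and one with \<open>u\<close>, by moving the average
  onto the Lipschitz test function. The fundamental lemma then applies on \<open>U\<close>.\<close>

theorem mollified_limit_AE:
  fixes u :: "'a::euclidean_space \<Rightarrow> real"
  assumes u: "bbor u" "integrable lborel u" and d: "\<And>n. 0 < d n" "d \<longlonglongrightarrow> 0" and U: "open U"
    and lim: "uniform_limit U (\<lambda>n. A \<rho> (d n) u) w sequentially"
  shows "AE x in lborel. x \<in> U \<longrightarrow> u x = w x"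
proof -
  note um [measurable] = bbor_measurable[OF u(1)]
  have v: "smb (A \<rho> (d n) u)" for n using smb_A[OF kern_\<rho> um u(2) d(1)] .
  have wc: "continuous_on U w"
    using uniform_limit_theorem[OF _ lim] smb_continuous[OF v] by (simp add: always_eventually)
  \<comment> \<open>\<open>w\<close> is known to be continuous on \<open>U\<close> only; cutting it
    off outside makes the difference Borel on the whole space.\<close>
  define H where "H x = u x - indicator U x * w x" for x
  have wm [measurable]: "(\<lambda>x. indicator U x * w x) \<in> borel_measurable borel"
    using borel_measurable_continuous_on_indicator[OF _ wc] U by (simp add: borel_open)
  have "AE x in lborel. x \<in> U \<longrightarrow> H x = 0"
  proof (rule du_bois_reymond_lborel[OF U])
    show "H \<in> borel_measurable borel" unfolding H_def[abs_def] by measurable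
    fix a b assume ab: "cbox a b \<subseteq> U"
    have "set_integrable lborel (cbox a b) w"
      using borel_integrable_compact[OF compact_cbox continuous_on_subset[OF wc ab]] by (simp add: set_integrable_def)
    then have "set_integrable lborel (cbox a b) (\<lambda>x. indicator U x * w x)"
      by (rule set_integrable_cong[THEN iffD1, rotated -1]) (use ab in auto)
    moreover have "set_integrable lborel (cbox a b) u"
      unfolding set_integrable_def using u(2) by (intro integrable_mult_indicator) auto
    ultimately show "set_integrable lborel (cbox a b) H" unfolding H_def[abs_def] by (intro set_integral_diff)
  next
    fix \<phi> assume \<phi>: "\<phi> \<in> test_functions U"
    note s\<phi> = test_smb[OF \<phi>] and [measurable] = smb_measurable[OF test_smb[OF \<phi>]]
    have i\<phi>: "integrable lborel \<phi>" using test_integrable'[OF \<phi>] by (subst (asm) integrable_completion) auto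
    obtain L where L: "0 \<le> L" "\<And>x y. \<bar>\<phi> x - \<phi> y\<bar> \<le> L * norm (x - y)" using smb_lip[OF s\<phi>] by metis
    obtain B K where K: "0 \<le> B" "\<And>x. \<bar>\<phi> x\<bar> \<le> B * indicator K x" "compact K" "K \<subseteq> U"
      using test_bounded_support[OF \<phi>] by metis
    have mult_smb: "integrable lborel (\<lambda>x. f x * g x)" if f: "integrable lborel f" and g: "bbor g" for f g :: "'a \<Rightarrow> real"
    proof -
      obtain B where B: "\<And>x. \<bar>g x\<bar> \<le> B" and [measurable]: "g \<in> borel_measurable borel" using g by (auto simp: bbor_def)
      show ?thesis
      proof (rule Bochner_Integration.integrable_bound)
        show "integrable lborel (\<lambda>x. f x * B)" using f by simp
        show "AE x in lborel. norm (f x * g x) \<le> norm (f x * B)"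
          using B by (intro AE_I2) (simp add: abs_mult mult_left_mono order_trans[OF _ abs_ge_self])
      qed (use f in measurable)
    qed
    have wK: "integrable lborel (\<lambda>x. indicator U x * w x * \<phi> x)"
    proof -
      have "integrable lborel (\<lambda>x. indicator K x *\<^sub>R w x)"
        using borel_integrable_compact[OF K(3) continuous_on_subset[OF wc K(4)]] .
      from mult_smb[OF this smb_bbor[OF s\<phi>]] show ?thesis
      proof (rule Bochner_Integration.integrable_cong[THEN iffD1, rotated -1, OF _ refl])
        fix x
        show "indicator K x *\<^sub>R w x * \<phi> x = indicator U x * w x * \<phi> x"
          using K(2)[of x] K(4) by (cases "x \<in> K") auto
      qed
    qed
    have "(\<lambda>n. LINT x|lborel. A \<rho> (d n) u x * \<phi> x) \<longlonglongrightarrow> (LINT x|lborel. indicator U x * w x * \<phi> x)"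
    proof (rule tendstoI)
      fix e :: real assume e: "0 < e"
      define I where "I = (LINT x|lborel. \<bar>\<phi> x\<bar>)"
      have I: "0 \<le> I" by (simp add: I_def)
      have "\<forall>\<^sub>F n in sequentially. \<forall>x\<in>U. dist (A \<rho> (d n) u x) (w x) < e / (I + 1)"
        using lim e I unfolding uniform_limit_iff by simp
      then show "\<forall>\<^sub>F n in sequentially. dist (LINT x|lborel. A \<rho> (d n) u x * \<phi> x) (LINT x|lborel. indicator U x * w x * \<phi> x) < e"
      proof eventually_elim
        case (elim n)
        have i1: "integrable lborel (\<lambda>x. A \<rho> (d n) u x * \<phi> x)" using mult_smb[OF i\<phi> smb_bbor[OF v]] by (simp add: mult.commute)
        have "(LINT x|lborel. A \<rho> (d n) u x * \<phi> x) - (LINT x|lborel. indicator U x * w x * \<phi> x)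
          = (LINT x|lborel. A \<rho> (d n) u x * \<phi> x - indicator U x * w x * \<phi> x)"
          using i1 wK by simp
        also have "norm \<dots> \<le> (LINT x|lborel. e / (I + 1) * \<bar>\<phi> x\<bar>)"
        proof (rule Bochner_Integration.integral_norm_bound_integral)
          show "integrable lborel (\<lambda>x. A \<rho> (d n) u x * \<phi> x - indicator U x * w x * \<phi> x)" using i1 wK by simp
          show "integrable lborel (\<lambda>x. e / (I + 1) * \<bar>\<phi> x\<bar>)" using i\<phi> by simp
          fix x
          show "norm (A \<rho> (d n) u x * \<phi> x - indicator U x * w x * \<phi> x) \<le> e / (I + 1) * \<bar>\<phi> x\<bar>"
          proof (cases "x \<in> U")
            case True
            then have "\<bar>A \<rho> (d n) u x - w x\<bar> \<le> e / (I + 1)" using elim by (force simp: dist_real_def)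
            then have "\<bar>A \<rho> (d n) u x - w x\<bar> * \<bar>\<phi> x\<bar> \<le> e / (I + 1) * \<bar>\<phi> x\<bar>" by (intro mult_right_mono) auto
            then show ?thesis using True by (simp add: left_diff_distrib[symmetric] abs_mult)
          next
            case False
            then show ?thesis using test_outside[OF \<phi> False] by simp
          qed
        qed
        also have "\<dots> = e / (I + 1) * I" by (simp add: I_def)
        also have "\<dots> < e" using e I by (simp add: field_simps)
        finally show ?case by (simp add: dist_real_def)
      qed
    qed
    moreover have "(\<lambda>n. LINT x|lborel. A \<rho> (d n) u x * \<phi> x) \<longlonglongrightarrow> (LINT x|lborel. u x * \<phi> x)"
    proof (rule LIM_zero_cancel, rule Lim_null_comparison[OF always_eventually, rule_format])
      fix n
      have b: "bbor (A \<rho> (d n) \<phi>)" "integrable lborel (\<lambda>x. u x * A \<rho> (d n) \<phi> x)"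
      proof -
        show "bbor (A \<rho> (d n) \<phi>)"
          using smb_bbor[OF smb_A[OF kern_\<rho> _ i\<phi> d(1)]] by simp
        then show "integrable lborel (\<lambda>x. u x * A \<rho> (d n) \<phi> x)" by (rule mult_smb[OF u(2)])
      qed
      have "(LINT x|lborel. A \<rho> (d n) u x * \<phi> x) - (LINT x|lborel. u x * \<phi> x) = (LINT x|lborel. u x * A \<rho> (d n) \<phi> x - u x * \<phi> x)"
        using b(2) mult_smb[OF u(2) smb_bbor[OF s\<phi>]] mollifier_adjoint[OF u s\<phi> i\<phi> d(1), of n] by simp
      also have "norm \<dots> \<le> (LINT x|lborel. \<bar>u x\<bar> * (L * d n))"
      proof (rule Bochner_Integration.integral_norm_bound_integral)
        show "integrable lborel (\<lambda>x. u x * A \<rho> (d n) \<phi> x - u x * \<phi> x)"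
          using b(2) mult_smb[OF u(2) smb_bbor[OF s\<phi>]] by simp
        show "integrable lborel (\<lambda>x. \<bar>u x\<bar> * (L * d n))" using u(2) by simp
        fix x
        have "\<bar>A \<rho> (d n) \<phi> x - \<phi> x\<bar> \<le> L * d n"
          using d(1)[of n] by (intro mollifier_lip smb_bbor s\<phi> L) auto
        then show "norm (u x * A \<rho> (d n) \<phi> x - u x * \<phi> x) \<le> \<bar>u x\<bar> * (L * d n)"
          by (simp add: right_diff_distrib[symmetric] abs_mult mult_left_mono)
      qed
      finally show "norm ((LINT x|lborel. A \<rho> (d n) u x * \<phi> x) - (LINT x|lborel. u x * \<phi> x)) \<le> (LINT x|lborel. \<bar>u x\<bar>) * (L * d n)" by simp
    next
      have "(\<lambda>n. (LINT x|lborel. \<bar>u x\<bar>) * (L * d n)) \<longlonglongrightarrow> (LINT x|lborel. \<bar>u x\<bar>) * (L * 0)"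
        by (intro tendsto_intros d)
      then show "(\<lambda>n. (LINT x|lborel. \<bar>u x\<bar>) * (L * d n)) \<longlonglongrightarrow> 0" by simp
    qed
    ultimately have "(LINT x|lborel. indicator U x * w x * \<phi> x) = (LINT x|lborel. u x * \<phi> x)" using LIMSEQ_unique by blast
    then show "(LINT x|lborel. H x * \<phi> x) = 0"
      using wK mult_smb[OF u(2) smb_bbor[OF s\<phi>]] by (simp add: H_def left_diff_distrib)
  qed
  then show ?thesis by eventually_elim (simp add: H_def)
qed

section \<open>Differentiability and Hoelder continuity of the limit\<close>

lemma GDERIV_uniform_limit:
  fixes v :: "nat \<Rightarrow> 'a::euclidean_space \<Rightarrow> real"
  assumes X: "open X" and v: "\<And>n. smb (v n)" and lim: "\<And>x. x \<in> X \<Longrightarrow> (\<lambda>n. v n x) \<longlonglongrightarrow> w x"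
    and q: "\<And>b. b \<in> Basis \<Longrightarrow> uniform_limit X (\<lambda>n. pd b (v n)) (q b) sequentially" and x: "x \<in> X"
  shows "GDERIV w x :> (\<Sum>b\<in>Basis. q b x *\<^sub>R b)"
proof -
  obtain e where e: "0 < e" "ball x e \<subseteq> X" using X x open_contains_ball by blast
  have "\<exists>g. \<forall>y\<in>ball x e. (\<lambda>n. v n y) \<longlonglongrightarrow> g y \<and> (g has_derivative (\<lambda>h. \<Sum>b\<in>Basis. (h \<bullet> b) * q b y)) (at y within ball x e)"
  proof (rule has_derivative_sequence[where f = v and f' = "\<lambda>n y h. \<Sum>b\<in>Basis. (h \<bullet> b) * pd b (v n) y" and ?x0.0 = x and l = "w x"])
    show "convex (ball x e)" "(\<lambda>n. v n x) \<longlonglongrightarrow> w x" using lim[OF x] by auto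
    show "(v n has_derivative (\<lambda>h. \<Sum>b\<in>Basis. (h \<bullet> b) * pd b (v n) y)) (at y within ball x e)" for n y
    proof -
      have "(v n has_derivative (\<lambda>h. h \<bullet> grad (v n) y)) (at y)" using smb_GDERIV[OF v] unfolding gderiv_def .
      moreover have "h \<bullet> grad (v n) y = (\<Sum>b\<in>Basis. (h \<bullet> b) * pd b (v n) y)" for h
        by (subst euclidean_inner) (simp add: pd_def)
      ultimately show ?thesis by (simp add: has_derivative_at_withinI)
    qed
    show "x \<in> ball x e" using e by simp
    fix c :: real assume c: "0 < c"
    \<comment> \<open>The tolerance is distributed evenly over the partial derivatives.\<close>
    define k where "k = c / real DIM('a)"
    have k: "0 < k" using c by (simp add: k_def)
    have "\<forall>\<^sub>F n in sequentially. \<forall>b\<in>Basis. \<forall>y\<in>X. dist (pd b (v n) y) (q b y) < k"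
      using q k unfolding uniform_limit_iff by (intro eventually_ball_finite) auto
    then show "\<forall>\<^sub>F n in sequentially. \<forall>y\<in>ball x e. \<forall>h. norm ((\<Sum>b\<in>Basis. (h \<bullet> b) * pd b (v n) y) - (\<Sum>b\<in>Basis. (h \<bullet> b) * q b y)) \<le> c * norm h"
    proof eventually_elim
      case (elim n)
      show ?case
      proof (intro ballI allI)
        fix y h assume y: "y \<in> ball x e"
        have "norm ((\<Sum>b\<in>Basis. (h \<bullet> b) * pd b (v n) y) - (\<Sum>b\<in>Basis. (h \<bullet> b) * q b y)) = \<bar>\<Sum>b\<in>Basis. (h \<bullet> b) * (pd b (v n) y - q b y)\<bar>"
          by (simp add: sum_subtractf[symmetric] right_diff_distrib)
        also have "\<dots> \<le> (\<Sum>b::'a\<in>Basis. norm h * k)"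
        proof (rule order_trans[OF sum_abs], rule sum_mono)
          fix b :: 'a assume b: "b \<in> Basis"
          have "\<bar>pd b (v n) y - q b y\<bar> \<le> k" using elim b y e by (force simp: dist_real_def)
          then show "\<bar>(h \<bullet> b) * (pd b (v n) y - q b y)\<bar> \<le> norm h * k"
            unfolding abs_mult using Basis_le_norm[OF b] k by (intro mult_mono) auto
        qed
        also have "\<dots> = c * norm h" by (simp add: k_def)
        finally show "norm ((\<Sum>b\<in>Basis. (h \<bullet> b) * pd b (v n) y) - (\<Sum>b\<in>Basis. (h \<bullet> b) * q b y)) \<le> c * norm h" .
      qed
    qed
  qed
  then obtain g where g: "\<And>y. y \<in> ball x e \<Longrightarrow> (\<lambda>n. v n y) \<longlonglongrightarrow> g y"
    "\<And>y. y \<in> ball x e \<Longrightarrow> (g has_derivative (\<lambda>h. \<Sum>b\<in>Basis. (h \<bullet> b) * q b y)) (at y within ball x e)" by blast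
  have "g y = w y" if "y \<in> ball x e" for y using g(1)[OF that] lim e that LIMSEQ_unique by blast
  moreover have "(g has_derivative (\<lambda>h. \<Sum>b\<in>Basis. (h \<bullet> b) * q b x)) (at x)"
    using g(2)[of x] e(1) at_within_open[of x "ball x e"] by simp
  ultimately have "(w has_derivative (\<lambda>h. \<Sum>b\<in>Basis. (h \<bullet> b) * q b x)) (at x)"
    using has_derivative_transform_within_open[of g _ x UNIV "ball x e" w] e(1) by simp
  then show ?thesis unfolding gderiv_def by (simp add: inner_sum_right mult.commute)
qed

lemma holder_closureI:
  fixes V :: "'a::euclidean_space set"
  assumes X: "closure V \<subseteq> X" and w: "\<And>x. x \<in> X \<Longrightarrow> GDERIV w x :> (\<Sum>b\<in>Basis. q b x *\<^sub>R b)"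
    and q: "\<And>b x. b \<in> Basis \<Longrightarrow> x \<in> X \<Longrightarrow> GDERIV (q b) x :> (\<Sum>i\<in>Basis. P i b x *\<^sub>R i)"
    and Pc: "\<And>i b. i \<in> Basis \<Longrightarrow> b \<in> Basis \<Longrightarrow> continuous_on X (P i b)"
    and Ph: "\<And>i b. i \<in> Basis \<Longrightarrow> b \<in> Basis \<Longrightarrow> holder_on \<alpha> (closure V) (P i b)"
  shows "holder_closure 2 \<alpha> V w"
proof -
  have V: "V \<subseteq> X" using X closure_subset by blast
  have cont: "continuous_on (closure V) f" if "\<And>x. x \<in> X \<Longrightarrow> GDERIV f x :> D x" for f D
    using that X GDERIV_continuous by (intro continuous_at_imp_continuous_on) blast
  have comp: "(\<Sum>c\<in>Basis. f c *\<^sub>R c) \<bullet> b = f b" if "b \<in> Basis" for f and b :: 'a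
    using that by (simp add: inner_sum_left inner_Basis if_distrib cong: if_cong)
  have "holder_closure (Suc 0) \<alpha> V (\<lambda>x. (\<Sum>c\<in>Basis. q c x *\<^sub>R c) \<bullet> b)" if b: "b \<in> Basis" for b
  proof -
    have "holder_closure 0 \<alpha> V (\<lambda>x. (\<Sum>i\<in>Basis. P i b x *\<^sub>R i) \<bullet> i)" if i: "i \<in> Basis" for i
      using Pc[OF i b] Ph[OF i b] X by (auto simp: comp[OF i] intro: continuous_on_subset)
    then show ?thesis
      using q[OF b] V cont[of "q b", OF q[OF b]] by (auto simp: comp[OF b] intro!: exI[of _ "\<lambda>x. \<Sum>i\<in>Basis. P i b x *\<^sub>R i"])
  qed
  then have "holder_closure (Suc (Suc 0)) \<alpha> V w"
    using w V cont[of w, OF w] unfolding holder_closure.simps(2)[of "Suc 0"]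
    by (intro conjI exI[of _ "\<lambda>x. \<Sum>b\<in>Basis. q b x *\<^sub>R b"]) blast+
  then show ?thesis by (simp add: numeral_2_eq_2)
qed

text \<open>At a fixed scale, averages of derivatives of \<open>v n\<close> are averages of
  \<open>v n\<close> with differentiated kernels, so they are Cauchy together with
  \<open>v n\<close>. The averaging errors are uniform in \<open>n\<close>, by the Laplacian bound
  for first derivatives and by its Hoelder bound for second ones, and
  \<open>uniformly_Cauchy_approx\<close> gives uniform convergence of both orders.\<close>

theorem limit_regularity:
  fixes v :: "nat \<Rightarrow> 'a::euclidean_space \<Rightarrow> real"
  assumes \<alpha>: "0 < \<alpha>" "\<alpha> < 1" and R: "0 < R" "R \<le> 1" and v: "\<And>n. smb (v n)" and M: "\<And>n x. \<bar>v n x\<bar> \<le> M"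
    and lim: "uniformly_Cauchy_on (nbd (closure V) (2 * R)) v"
    and F: "\<And>n x. x \<in> nbd (closure V) (2 * R) \<Longrightarrow> \<bar>lap (v n) x\<bar> \<le> F"
    and H0: "0 \<le> H" and H: "\<And>n x h. x \<in> nbd (closure V) R \<Longrightarrow> norm h \<le> R \<Longrightarrow> \<bar>lap (v n) (x + h) - lap (v n) x\<bar> \<le> H * norm h powr \<alpha>"
  shows "holder_closure 2 \<alpha> V (\<lambda>x. lim (\<lambda>n. v n x))"
proof -
  let ?N = "nbd (closure V)"
  note vb = smb_bbor[OF v]
  define w where "w x = lim (\<lambda>n. v n x)" for x
  define q where "q b x = lim (\<lambda>n. pd b (v n) x)" for b x
  define P where "P i b x = lim (\<lambda>n. pd i (pd b (v n)) x)" for i b x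
  \<comment> \<open>An open neighbourhood of \<open>closure V\<close>: the limit is differentiated
    there, so the continuous extension to the closure comes for free.\<close>
  define X where "X = (\<Union>y\<in>closure V. ball y (R / 2))"
  have X: "open X" "closure V \<subseteq> X" using R by (auto simp: X_def)
  have X3: "X \<subseteq> ?N (R / 2)"
  proof
    fix x assume "x \<in> X"
    then obtain y where "y \<in> closure V" "dist y x < R / 2" by (auto simp: X_def)
    then show "x \<in> ?N (R / 2)" unfolding nbd_def by (intro CollectI bexI[of _ y] less_imp_le)
  qed
  have wl: "uniform_limit (?N (2 * R)) v w sequentially"
    using uniformly_Cauchy_uniform_limit[OF lim] by (simp add: w_def[abs_def])
  have qC: "uniformly_Cauchy_on (?N R) (\<lambda>n. pd b (v n))" if b: "b \<in> Basis" for b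
  proof (rule uniformly_Cauchy_approx[OF R(1)])
    fix e n x assume e: "0 < e" "e \<le> R" and x: "x \<in> ?N R"
    have "cball x e \<subseteq> ?N (2 * R)" using nbd_cball[OF x, of e "2 * R"] e by simp
    then show "\<bar>pd b (v n) x - A \<rho> e (pd b (v n)) x\<bar> \<le> kint (pd b \<Psi>) * F * e"
      using e F by (intro first_derivative_error v b) auto
  next
    have "((\<lambda>e. kint (pd b \<Psi>) * F * e) \<longlongrightarrow> kint (pd b \<Psi>) * F * 0) (at_right 0)" by (intro tendsto_intros)
    then show "((\<lambda>e. kint (pd b \<Psi>) * F * e) \<longlongrightarrow> 0) (at_right 0)" by simp
    fix e assume e: "0 < e" "e \<le> R"
    have "(\<lambda>n. A \<rho> e (pd b (v n))) = (\<lambda>n x. (1 / e) * A (pd b \<rho>) e (v n) x)"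
      using A_pd[OF kern_\<rho> v b, of e] e by (simp add: fun_eq_iff)
    moreover have "uniformly_Cauchy_on (?N R) (\<lambda>n x. (1 / e) * A (pd b \<rho>) e (v n) x)"
      using e nbd_cball[of _ _ R e "2 * R"] by (intro A_uniformly_Cauchy[OF kern_pd[OF kern_\<rho> b] vb lim]) auto
    ultimately show "uniformly_Cauchy_on (?N R) (\<lambda>n. A \<rho> e (pd b (v n)))" by (simp only:)
  qed
  have main: "uniformly_Cauchy_on (?N (R / 2)) (\<lambda>n. pd i (pd b (v n))) \<and> holder_on \<alpha> (closure V) (P i b)"
    if i: "i \<in> Basis" and b: "b \<in> Basis" for i b
  proof -
    \<comment> \<open>For \<open>x\<close> within \<open>R / 2\<close> of the closure,
      \<open>cball x (2 * r)\<close> stays within distance \<open>R\<close>, and its points are at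
      most \<open>4 * r = R / 2\<close> apart, so \<open>H\<close> applies to any two of
      them.\<close>
    define r where "r = R / 8"
    have r: "0 < r" "r \<le> 1" using R by (auto simp: r_def)
    obtain K where K: "0 \<le> K" "\<forall>v x r M H. smb v \<longrightarrow> 0 < r \<longrightarrow> r \<le> 1 \<longrightarrow> 0 \<le> H \<longrightarrow> (\<forall>x. \<bar>v x\<bar> \<le> M) \<longrightarrow>
      (\<forall>y\<in>cball x (2 * r). \<forall>z\<in>cball x (2 * r). \<bar>lap v y - lap v z\<bar> \<le> H * dist y z powr \<alpha>) \<longrightarrow>
      (\<forall>t. 0 \<le> t \<longrightarrow> t \<le> r \<longrightarrow> \<bar>pd i (pd b v) x - A \<rho> t (pd i (pd b v)) x\<bar> \<le> K * H * t powr \<alpha>) \<and>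
      (\<forall>h. norm h \<le> r \<longrightarrow> \<bar>pd i (pd b v) (x + h) - pd i (pd b v) x\<bar> \<le> K * (H + M / r ^ 3) * norm h powr \<alpha>) \<and>
      \<bar>pd i (pd b v) x\<bar> \<le> K * (H + M / r ^ 3)"
      using second_derivative_bounds[OF i b \<alpha>] by blast
    have est: "(\<forall>t. 0 \<le> t \<longrightarrow> t \<le> r \<longrightarrow> \<bar>pd i (pd b (v n)) x - A \<rho> t (pd i (pd b (v n))) x\<bar> \<le> K * H * t powr \<alpha>) \<and>
      (\<forall>h. norm h \<le> r \<longrightarrow> \<bar>pd i (pd b (v n)) (x + h) - pd i (pd b (v n)) x\<bar> \<le> K * (H + M / r ^ 3) * norm h powr \<alpha>) \<and>
      \<bar>pd i (pd b (v n)) x\<bar> \<le> K * (H + M / r ^ 3)" if x: "x \<in> ?N (R / 2)" for x n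
    proof (rule K(2)[rule_format, OF v r H0 M])
      fix y z assume y: "y \<in> cball x (2 * r)" and z: "z \<in> cball x (2 * r)"
      have zN: "z \<in> ?N R" using nbd_cball[OF x, of "2 * r" R] z R by (auto simp: r_def)
      have "norm (y - z) \<le> R" using y z R dist_triangle[of y z x] by (simp add: r_def dist_norm norm_minus_commute)
      then show "\<bar>lap (v n) y - lap (v n) z\<bar> \<le> H * dist y z powr \<alpha>" using H[OF zN, of "y - z" n] by (simp add: dist_norm)
    qed
    have pC: "uniformly_Cauchy_on (?N (R / 2)) (\<lambda>n. pd i (pd b (v n)))"
    proof (rule uniformly_Cauchy_approx[OF r(1)])
      show "\<bar>pd i (pd b (v n)) x - A \<rho> e (pd i (pd b (v n))) x\<bar> \<le> K * H * e powr \<alpha>" if "0 < e" "e \<le> r" "x \<in> ?N (R / 2)" for e n x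
        using est[OF that(3)] that by simp
      have "((\<lambda>e::real. e powr \<alpha>) \<longlongrightarrow> 0) (at_right 0)"
        using \<alpha> by (intro tendsto_zero_powrI[where b = \<alpha>] tendsto_intros) (auto simp: eventually_at_filter)
      from tendsto_mult_right_zero[OF this] show "((\<lambda>e. K * H * e powr \<alpha>) \<longlongrightarrow> 0) (at_right 0)" .
      fix e assume e: "0 < e" "e \<le> r"
      have "(\<lambda>n. A \<rho> e (pd i (pd b (v n)))) = (\<lambda>n x. (1 / e\<^sup>2) * A (pd b (pd i \<rho>)) e (v n) x)"
        using A_pd[OF kern_pd[OF kern_\<rho> i] v b, of e] A_pd[OF kern_\<rho> smb_pd[OF v b] i, of e] e
        by (simp add: fun_eq_iff power2_eq_square)
      moreover have "uniformly_Cauchy_on (?N (R / 2)) (\<lambda>n x. (1 / e\<^sup>2) * A (pd b (pd i \<rho>)) e (v n) x)"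
        using e r R nbd_cball[of _ _ "R / 2" e "2 * R"]
        by (intro A_uniformly_Cauchy[OF kern_pd[OF kern_pd[OF kern_\<rho> i] b] vb lim]) (auto simp: r_def)
      ultimately show "uniformly_Cauchy_on (?N (R / 2)) (\<lambda>n. A \<rho> e (pd i (pd b (v n))))" by (simp only:)
    qed
    have pl: "(\<lambda>n. pd i (pd b (v n)) x) \<longlonglongrightarrow> P i b x" if "x \<in> ?N (R / 2)" for x
      using tendsto_uniform_limitI[OF uniformly_Cauchy_uniform_limit[OF pC] that] by (simp add: P_def)
    define B where "B = K * (H + M / r ^ 3)"
    have M0: "0 \<le> M" using M abs_ge_zero order_trans by blast
    have B: "0 \<le> B" using K(1) H0 M0 r by (simp add: B_def)
    have sub: "x \<in> closure V \<Longrightarrow> x \<in> ?N (R / 2)" for x using X X3 by blast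
    have near: "\<bar>P i b (x + h) - P i b x\<bar> \<le> B * norm h powr \<alpha>" if x: "x \<in> closure V" "x + h \<in> closure V" and h: "norm h \<le> r" for x h
    proof (rule LIMSEQ_le_const2)
      show "(\<lambda>n. \<bar>pd i (pd b (v n)) (x + h) - pd i (pd b (v n)) x\<bar>) \<longlonglongrightarrow> \<bar>P i b (x + h) - P i b x\<bar>"
        by (intro tendsto_intros pl sub x)
      show "\<exists>N. \<forall>n\<ge>N. \<bar>pd i (pd b (v n)) (x + h) - pd i (pd b (v n)) x\<bar> \<le> B * norm h powr \<alpha>"
        using est[OF sub[OF x(1)]] h unfolding B_def by blast
    qed
    have Pb: "\<bar>P i b x\<bar> \<le> B" if x: "x \<in> closure V" for x
    proof (rule LIMSEQ_le_const2)
      show "(\<lambda>n. \<bar>pd i (pd b (v n)) x\<bar>) \<longlonglongrightarrow> \<bar>P i b x\<bar>" by (intro tendsto_intros pl sub x)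
      show "\<exists>N. \<forall>n\<ge>N. \<bar>pd i (pd b (v n)) x\<bar> \<le> B" using est[OF sub[OF x]] unfolding B_def by blast
    qed
    \<comment> \<open>The term \<open>B\<close> serves pairs at distance at most \<open>r\<close>;
      for more distant pairs the supremum bound \<open>2 * B\<close> is divided by
      \<open>r powr \<alpha>\<close>.\<close>
    define C where "C = B + 2 * B / r powr \<alpha>"
    have "\<bar>P i b x - P i b y\<bar> \<le> C * dist x y powr \<alpha>" if x: "x \<in> closure V" and y: "y \<in> closure V" for x y
    proof (cases "dist x y \<le> r")
      case True
      have "\<bar>P i b x - P i b y\<bar> \<le> B * dist x y powr \<alpha>"
        using near[of y "x - y"] x y True by (simp add: dist_norm)
      also have "\<dots> \<le> C * dist x y powr \<alpha>" using B r by (intro mult_right_mono) (auto simp: C_def)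
      finally show ?thesis .
    next
      case False
      have "\<bar>P i b x - P i b y\<bar> \<le> 2 * B" using Pb[OF x] Pb[OF y] by linarith
      also have "\<dots> = 2 * B / r powr \<alpha> * r powr \<alpha>" using r by simp
      also have "\<dots> \<le> C * dist x y powr \<alpha>"
        using B r False \<alpha> by (intro mult_mono powr_mono2) (auto simp: C_def)
      finally show ?thesis .
    qed
    then show ?thesis using pC unfolding holder_on_def by blast
  qed
  show ?thesis unfolding w_def[abs_def, symmetric]
  proof (rule holder_closureI[where X = X and q = q and P = P])
    show "closure V \<subseteq> X" by (rule X)
    have sub: "X \<subseteq> ?N R" "X \<subseteq> ?N (2 * R)"
      using X3 nbd_mono[of "R / 2" R] nbd_mono[of "R / 2" "2 * R"] R by force+
    have ql: "uniform_limit X (\<lambda>n. pd b (v n)) (q b) sequentially" if "b \<in> Basis" for b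
      using uniform_limit_on_subset[OF uniformly_Cauchy_uniform_limit[OF qC[OF that]] sub(1)] by (simp add: q_def[abs_def])
    have Pl: "uniform_limit X (\<lambda>n. pd i (pd b (v n))) (P i b) sequentially" if "i \<in> Basis" "b \<in> Basis" for i b
      using uniform_limit_on_subset[OF uniformly_Cauchy_uniform_limit X3] main[OF that] by (simp add: P_def[abs_def])
    show "GDERIV w x :> (\<Sum>b\<in>Basis. q b x *\<^sub>R b)" if "x \<in> X" for x
      using tendsto_uniform_limitI[OF wl] sub by (intro GDERIV_uniform_limit[OF X(1) v _ ql that]) auto
    show "GDERIV (q b) x :> (\<Sum>i\<in>Basis. P i b x *\<^sub>R i)" if "b \<in> Basis" "x \<in> X" for b x
      using tendsto_uniform_limitI[OF ql[OF that(1)]]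
      by (intro GDERIV_uniform_limit[OF X(1) smb_pd[OF v that(1)] _ Pl that(2)]) (auto simp: that)
    show "continuous_on X (P i b)" if "i \<in> Basis" "b \<in> Basis" for i b
      using uniform_limit_theorem[OF always_eventually Pl[OF that]] smb_continuous[OF smb_pd[OF smb_pd[OF v that(2)] that(1)]] by simp
    show "holder_on \<alpha> (closure V) (P i b)" if "i \<in> Basis" "b \<in> Basis" for i b
      using main[OF that] by blast
  qed
qed

section \<open>Regularity of weak solutions\<close>

lemma holder_on_bounded:
  assumes "holder_on \<alpha> S g" "bounded S" "0 \<le> \<alpha>"
  obtains B where "0 \<le> B" "\<And>x. x \<in> S \<Longrightarrow> \<bar>g x\<bar> \<le> B"
proof (cases "S = {}")
  case False
  then obtain z where z: "z \<in> S" by blast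
  obtain C where C: "\<And>x y. x \<in> S \<Longrightarrow> y \<in> S \<Longrightarrow> \<bar>g x - g y\<bar> \<le> C * dist x y powr \<alpha>"
    using assms(1) unfolding holder_on_def by blast
  obtain e where e: "\<And>x. x \<in> S \<Longrightarrow> dist z x \<le> e" using assms(2) bounded_any_center[of S z] by blast
  have "\<bar>g x\<bar> \<le> \<bar>g z\<bar> + \<bar>C\<bar> * \<bar>e\<bar> powr \<alpha>" if x: "x \<in> S" for x
  proof -
    have "\<bar>g x - g z\<bar> \<le> C * dist x z powr \<alpha>" by (rule C[OF x z])
    also have "\<dots> \<le> \<bar>C\<bar> * \<bar>e\<bar> powr \<alpha>"
      using e[OF x] assms(3) by (intro mult_mono powr_mono2) (auto simp: dist_commute)
    finally show ?thesis by linarith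
  qed
  then show thesis using that[of "\<bar>g z\<bar> + \<bar>C\<bar> * \<bar>e\<bar> powr \<alpha>"] by simp
qed (use that[of 0] in auto)

text \<open>Only pairs at distance at most \<open>R\<close> are controlled, which is what a
  right-hand side composed with a locally Lipschitz function provides.\<close>

lemma local_holder_continuous:
  fixes g :: "'a::metric_space \<Rightarrow> real"
  assumes \<alpha>: "0 < \<alpha>" and R: "0 < R" and H: "\<And>x y. x \<in> S \<Longrightarrow> y \<in> S \<Longrightarrow> dist x y \<le> R \<Longrightarrow> \<bar>g x - g y\<bar> \<le> H * dist x y powr \<alpha>"
  shows "continuous_on S g"
  unfolding continuous_on
proof
  fix x assume x: "x \<in> S"
  have "((\<lambda>y. dist x y) \<longlongrightarrow> dist x x) (at x within S)" by (intro tendsto_intros)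
  then have "((\<lambda>y. dist x y powr \<alpha>) \<longlongrightarrow> 0 powr \<alpha>) (at x within S)"
    using \<alpha> by (intro tendsto_powr2) (auto intro!: tendsto_intros)
  then have 0: "((\<lambda>y. H * dist x y powr \<alpha>) \<longlongrightarrow> 0) (at x within S)"
    using \<alpha> by (auto intro: tendsto_mult_right_zero)
  have "((\<lambda>y. g y - g x) \<longlongrightarrow> 0) (at x within S)"
  proof (rule Lim_null_comparison[OF _ 0])
    show "\<forall>\<^sub>F y in at x within S. norm (g y - g x) \<le> H * dist x y powr \<alpha>"
      using R H[OF x] by (auto simp: eventually_at dist_commute abs_minus_commute intro!: exI[of _ R])
  qed
  then show "(g \<longlongrightarrow> g x) (at x within S)" by (rule LIM_zero_cancel)
qed

text \<open>A weighted mean with nonnegative weights of total mass 1. If the product is not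
  integrable, its Bochner integral is 0 and the bound holds as well, so an almost everywhere bound
  of \<open>h\<close> on the support suffices.\<close>

lemma averaged_bound:
  assumes \<phi>: "integrable M \<phi>" "\<And>y. 0 \<le> \<phi> y" "(LINT y|M. \<phi> y) = (1::real)" and B: "0 \<le> B"
    and h: "AE y in M. \<phi> y \<noteq> 0 \<longrightarrow> \<bar>h y\<bar> \<le> B"
  shows "\<bar>LINT y:S|M. h y * \<phi> y\<bar> \<le> B"
proof -
  have "\<bar>LINT y:S|M. h y * \<phi> y\<bar> \<le> (LINT y|M. \<bar>indicator S y *\<^sub>R (h y * \<phi> y)\<bar>)"
    unfolding set_lebesgue_integral_def using integral_norm_bound[of M "\<lambda>y. indicator S y *\<^sub>R (h y * \<phi> y)"] by simp
  also have "\<dots> \<le> (LINT y|M. B * \<phi> y)"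
  proof (rule integral_mono_AE')
    show "integrable M (\<lambda>y. B * \<phi> y)" using \<phi>(1) by simp
    show "AE y in M. \<bar>indicator S y *\<^sub>R (h y * \<phi> y)\<bar> \<le> B * \<phi> y"
      using h by eventually_elim (use \<phi>(2) B in \<open>auto simp: indicator_def abs_mult mult_right_mono\<close>)
    show "AE y in M. 0 \<le> B * \<phi> y" using \<phi>(2) B by simp
  qed
  also have "\<dots> = B" using \<phi>(3) by simp
  finally show ?thesis .
qed

text \<open>The mollifier vanishes outside \<open>cball x d\<close>, so the integrand can be altered
  away from \<open>N\<close> at will. This exchanges a function known only locally for a globally
  defined Borel one, to which the estimates for \<open>A\<close> apply.\<close>

lemma average_eq_A:
  fixes h g :: "'a::euclidean_space \<Rightarrow> real"
  assumes d: "0 < d" and N: "cball x d \<subseteq> N" "N \<subseteq> S" and g: "g \<in> borel_measurable borel"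
    and hm: "(\<lambda>y. indicator S y *\<^sub>R (h y * scl d \<rho> (x - y))) \<in> borel_measurable lebesgue"
    and eq: "AE y in lebesgue. y \<in> N \<longrightarrow> h y = g y"
  shows "(LINT y:S|lebesgue. h y * scl d \<rho> (x - y)) = A \<rho> d g x"
proof -
  have bm: "(\<lambda>y. g y * scl d \<rho> (x - y)) \<in> borel_measurable borel" using g by measurable
  have "(LINT y:S|lebesgue. h y * scl d \<rho> (x - y)) = (LINT y|lebesgue. g y * scl d \<rho> (x - y))"
    unfolding set_lebesgue_integral_def
  proof (rule integral_cong_AE[OF hm])
    show "(\<lambda>y. g y * scl d \<rho> (x - y)) \<in> borel_measurable lebesgue" using bm by (intro measurable_completion) simp
    show "AE y in lebesgue. indicator S y *\<^sub>R (h y * scl d \<rho> (x - y)) = g y * scl d \<rho> (x - y)"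
      using eq
    proof eventually_elim
      case (elim y)
      show ?case
      proof (cases "y \<in> N")
        case True
        then show ?thesis using elim N by auto
      next
        case False
        then have "y \<notin> cball x d" using N(1) by blast
        then have "norm (x - y) > d" by (simp add: dist_norm)
        then show ?thesis using scl_\<rho>_zero[OF d, of "x - y"] by simp
      qed
    qed
  qed
  also have "\<dots> = (LINT y|lborel. g y * scl d \<rho> (x - y))" using bm by (intro integral_completion) simp
  finally show ?thesis using A_eq_cv[OF kern_\<rho> g d, of x] by (simp add: cv_def)
qed

text \<open>A Borel representative is truncated to [-M, M] and set to 0 outside \<Omega>; by
  \<open>bd\<close> and \<open>out\<close> both changes affect a null set only. The bound then holds
  everywhere, as \<open>bbor\<close> requires.\<close>

lemma bounded_representative:
  fixes u :: "'a::euclidean_space \<Rightarrow> real"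
  assumes u: "u \<in> borel_measurable lebesgue" and out: "AE x in lebesgue. x \<notin> \<Omega> \<longrightarrow> u x = 0"
    and bd: "AE x in lebesgue. x \<in> \<Omega> \<longrightarrow> \<bar>u x\<bar> \<le> M" and \<Omega>: "open \<Omega>" "bounded \<Omega>" and M: "0 \<le> M"
  obtains u0 where "bbor u0" "integrable lborel u0" "\<And>x. \<bar>u0 x\<bar> \<le> M" "AE x in lebesgue. u x = u0 x"
proof -
  obtain u' where u': "u' \<in> borel_measurable lborel" "AE x in lborel. u x = u' x"
    using completion_ex_borel_measurable_real[OF u] by auto
  have [measurable]: "u' \<in> borel_measurable borel" using u'(1) by simp
  have [measurable]: "\<Omega> \<in> sets borel" using \<Omega> by (simp add: borel_open)
  define u0 where "u0 x = indicator \<Omega> x * max (- M) (min M (u' x))" for x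
  have m: "u0 \<in> borel_measurable borel" unfolding u0_def[abs_def] by measurable
  have b: "\<bar>u0 x\<bar> \<le> M" for x using M by (auto simp: u0_def indicator_def)
  obtain r where r: "\<And>x. x \<in> \<Omega> \<Longrightarrow> norm x \<le> r" using \<Omega>(2) bounded_iff by metis
  have "integrable lborel u0"
  proof (rule cball_integrable[OF m b])
    show "u0 x = 0" if "norm x > r" for x using r[of x] that by (auto simp: u0_def indicator_def)
  qed
  moreover have "AE x in lebesgue. u x = u0 x"
    using AE_completion[OF u'(2)] out bd
  proof eventually_elim
    case (elim x)
    then show ?case by (cases "x \<in> \<Omega>") (auto simp: u0_def)
  qed
  ultimately show thesis using that bborI[OF m b] b by blast
qed

lemma uniformly_Cauchy_on_subset:
  "uniformly_Cauchy_on X f \<Longrightarrow> Y \<subseteq> X \<Longrightarrow> uniformly_Cauchy_on Y f"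
  unfolding uniformly_Cauchy_on_def by (meson subsetD)

text \<open>Elements of \<open>X_space\<close> are given up to null sets, so regularity is asserted
  of a representative: the locally uniform limit of the mollified solutions, which agrees with
  \<open>u\<close> almost everywhere near \<open>closure V\<close>.\<close>

theorem theorem1p5:
  fixes s \<alpha> :: real
    and \<Omega> V :: "'a::euclidean_space set"
    and a u :: "'a \<Rightarrow> real"
    and f :: "'a \<Rightarrow> real \<Rightarrow> real"
  assumes "0 < s" "s < 1"
    and "0 < \<alpha>" "\<alpha> < 1"
    and "open \<Omega>" "connected \<Omega>" "\<Omega> \<noteq> {}" "bounded \<Omega>"
    and "Linfty_on \<Omega> a" "holder_loc \<alpha> \<Omega> a"
    and "holder_loc \<alpha> (\<Omega> \<times> UNIV) (\<lambda>(x, t). f x t)"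
    and "weak_solution s \<Omega> a f u"
    and "Linfty_on \<Omega> u"
    and "open V" "connected V" "V \<noteq> {}"
    and "compact (closure V)" "closure V \<subseteq> \<Omega>"
  shows "\<exists>w. holder_closure 2 \<alpha> V w \<and> (AE x in lebesgue. x \<in> closure V \<longrightarrow> u x = w x)"
proof -
  note s = assms(1,2) and \<alpha> = assms(3,4) and \<Omega> = \<open>open \<Omega>\<close> \<open>bounded \<Omega>\<close>
  let ?N = "nbd (closure V)"
  obtain e0 where e0: "0 < e0" "(\<Union>x\<in>closure V. cball x e0) \<subseteq> \<Omega>"
    using compact_subset_open_imp_cball_epsilon_subset[OF assms(17) \<Omega>(1) assms(18)] by blast
  \<comment> \<open>Room for ten shrinkings inside \<Omega>. At distance \<open>9 * R\<close> the
    equation has a bounded right-hand side, at \<open>8 * R\<close> the Laplacian is bounded, at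
    \<open>6 * R\<close> the averages are Lipschitz and converge, at \<open>5 * R\<close> the limit
    is \<open>u\<close>, at \<open>4 * R\<close> the right-hand side is Hoelder continuous, at
    \<open>3 * R\<close> its averages are those of \<open>g1\<close>, at \<open>2 * R\<close> these
    are Hoelder continuous, and at \<open>R\<close> so is the Laplacian. The cap 1 is required by
    the estimates.\<close>
  define R where "R = min 1 (e0 / 10)"
  have R: "0 < R" "R \<le> 1" "10 * R \<le> e0" using e0(1) by (auto simp: R_def)
  have N10: "?N (10 * R) \<subseteq> \<Omega>" using e0(2) R(3) by (force simp: nbd_def)
  have Ncpt: "compact (?N r)" for r by (rule compact_nbd[OF assms(17)])

  have uX: "u \<in> X_space s \<Omega>" using assms(12) by (simp add: weak_solution_def)
  have um: "u \<in> borel_measurable lebesgue" using uX by (simp add: X_space_def)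
  have out: "AE x in lebesgue. x \<notin> \<Omega> \<longrightarrow> u x = 0" by (rule X_space_L1[OF uX \<Omega>])
  obtain M' where M': "AE x in lebesgue. x \<in> \<Omega> \<longrightarrow> \<bar>u x\<bar> \<le> M'" using assms(13) by (auto simp: Linfty_on_def)
  define M where "M = max 0 M'"
  have M: "0 \<le> M" "AE x in lebesgue. x \<in> \<Omega> \<longrightarrow> \<bar>u x\<bar> \<le> M"
    using M' by (auto simp: M_def elim!: eventually_mono)
  obtain u0 where u0: "bbor u0" "integrable lborel u0" "\<And>x. \<bar>u0 x\<bar> \<le> M" "AE x in lebesgue. u x = u0 x"
    using bounded_representative[OF um out M(2) \<Omega> M(1)] by blast

  obtain C where C: "0 < C" "\<And>d x. 0 < d \<Longrightarrow> cball x d \<subseteq> \<Omega> \<Longrightarrow>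
    integrable lborel (\<lambda>t. wt s t * (A \<rho> d u0 x - A \<rho> t (A \<rho> d u0) x)) \<and>
    - lap (A \<rho> d u0) x + C * (LINT t|lborel. wt s t * (A \<rho> d u0 x - A \<rho> t (A \<rho> d u0) x))
      = (LINT y:\<Omega>|lebesgue. f y (u y) * scl d \<rho> (x - y)) - (LINT y:\<Omega>|lebesgue. a y * u y * scl d \<rho> (x - y))"
    using mollified_equation[OF s \<Omega> assms(12) u0(1,2,4)] by blast
  have C0: "0 \<le> C" using C(1) by simp
  \<comment> \<open>The averaged right-hand side, still formed with \<open>u\<close>. Its Hoelder
    bound has to wait until \<open>u\<close> can be replaced by the Lipschitz function
    \<open>w\<close>.\<close>
  define G where "G d x = (LINT y:\<Omega>|lebesgue. f y (u y) * scl d \<rho> (x - y)) - (LINT y:\<Omega>|lebesgue. a y * u y * scl d \<rho> (x - y))" for d x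
  have eqn: "eqn_at s C (A \<rho> d u0) (G d x) x" if "0 < d" "cball x d \<subseteq> \<Omega>" for d x
    using C(2)[OF that] unfolding eqn_at_def G_def by blast

  \<comment> \<open>Boundedness of \<open>u\<close> enters here: it confines the second argument of
    \<open>f\<close> to a compact interval, on which the local Hoelder condition is uniform.\<close>
  have fh: "holder_on \<alpha> (?N (10 * R) \<times> {- M..M}) (\<lambda>(x, t). f x t)"
    using assms(11) N10 Ncpt unfolding holder_loc_def by (auto intro!: compact_Times)
  have ah: "holder_on \<alpha> (?N (10 * R)) a"
    using assms(10) N10 Ncpt unfolding holder_loc_def by auto
  obtain Bf where Bf: "0 \<le> Bf" "\<And>x t. x \<in> ?N (10 * R) \<Longrightarrow> \<bar>t\<bar> \<le> M \<Longrightarrow> \<bar>f x t\<bar> \<le> Bf"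
  proof (rule holder_on_bounded[OF fh])
    show "bounded (?N (10 * R) \<times> {- M..M})" using Ncpt by (intro bounded_Times) (auto simp: compact_imp_bounded)
    fix B assume "0 \<le> B" and B: "\<And>p. p \<in> ?N (10 * R) \<times> {- M..M} \<Longrightarrow> \<bar>case p of (x, t) \<Rightarrow> f x t\<bar> \<le> B"
    show thesis
    proof (rule that[OF \<open>0 \<le> B\<close>])
      show "\<bar>f x t\<bar> \<le> B" if "x \<in> ?N (10 * R)" "\<bar>t\<bar> \<le> M" for x t
        using B[of "(x, t)"] that by (simp add: abs_le_iff)
    qed
  qed (use \<alpha> in simp)
  obtain Ba where Ba: "0 \<le> Ba" "\<And>x. x \<in> ?N (10 * R) \<Longrightarrow> \<bar>a x\<bar> \<le> Ba"
    using holder_on_bounded[OF ah compact_imp_bounded[OF Ncpt]] \<alpha> by (metis less_imp_le)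
  have Gb: "\<bar>G d x\<bar> \<le> Bf + Ba * M" if d: "0 < d" "d \<le> R" and x: "x \<in> ?N (9 * R)" for d x
  proof -
    define \<phi> where "\<phi> y = scl d \<rho> (x - y)" for y
    have sub: "cball x d \<subseteq> ?N (10 * R)" using nbd_cball[OF x, of d "10 * R"] d by simp
    have \<phi>m: "\<phi> \<in> borel_measurable borel" unfolding \<phi>_def[abs_def] by measurable
    have \<phi>i: "integrable lebesgue \<phi>"
      using scl_\<rho>_integral(1)[OF d(1), of x] \<phi>m by (subst integrable_completion) (auto simp: \<phi>_def[abs_def])
    have \<phi>1: "(LINT y|lebesgue. \<phi> y) = 1"
      using scl_\<rho>_integral(2)[OF d(1), of x] \<phi>m by (subst integral_completion) (auto simp: \<phi>_def[abs_def])
    have \<phi>0: "0 \<le> \<phi> y" for y unfolding \<phi>_def using d(1) by (rule scl_\<rho>_nonneg)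
    have supp: "y \<in> ?N (10 * R)" if "\<phi> y \<noteq> 0" for y
    proof -
      have "\<not> norm (x - y) > d" using scl_\<rho>_zero[OF d(1), of "x - y"] that by (auto simp: \<phi>_def)
      then show ?thesis using sub by (auto simp: dist_norm)
    qed
    have "\<bar>LINT y:\<Omega>|lebesgue. f y (u y) * \<phi> y\<bar> \<le> Bf"
    proof (rule averaged_bound[OF \<phi>i \<phi>0 \<phi>1 Bf(1)])
      show "AE y in lebesgue. \<phi> y \<noteq> 0 \<longrightarrow> \<bar>f y (u y)\<bar> \<le> Bf"
        using M(2) by eventually_elim (use supp N10 Bf(2) in blast)
    qed
    moreover have "\<bar>LINT y:\<Omega>|lebesgue. a y * u y * \<phi> y\<bar> \<le> Ba * M"
    proof (rule averaged_bound[OF \<phi>i \<phi>0 \<phi>1])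
      show "AE y in lebesgue. \<phi> y \<noteq> 0 \<longrightarrow> \<bar>a y * u y\<bar> \<le> Ba * M"
        using M(2)
      proof eventually_elim
        case (elim y)
        then show ?case using supp[of y] N10 Ba by (auto simp: abs_mult intro!: mult_mono)
      qed
    qed (use Ba M in simp)
    ultimately show ?thesis unfolding G_def \<phi>_def by linarith
  qed
  have ball\<Omega>: "cball x d \<subseteq> \<Omega>" if "d \<le> R" "x \<in> ?N (9 * R)" for x d
    using nbd_cball[OF that(2), of d "10 * R"] that N10 by auto

  obtain F \<Lambda>' where F\<Lambda>: "\<forall>d. 0 < d \<longrightarrow> d \<le> R \<longrightarrow> (\<forall>x\<in>?N (8 * R). \<bar>lap (A \<rho> d u0) x\<bar> \<le> F) \<and>
    (\<forall>x\<in>?N (6 * R). \<forall>h. norm h \<le> R \<longrightarrow> \<bar>A \<rho> d u0 (x + h) - A \<rho> d u0 x\<bar> \<le> \<Lambda>' * norm h)"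
    using mollified_lipschitz[OF s C0 R(1,2) u0(1,2,3), of "closure V" G "Bf + Ba * M"] eqn Gb ball\<Omega> by blast
  define \<Lambda> where "\<Lambda> = max 0 \<Lambda>'"
  have \<Lambda>0: "0 \<le> \<Lambda>" by (simp add: \<Lambda>_def)
  have lip: "\<bar>A \<rho> d u0 (x + h) - A \<rho> d u0 x\<bar> \<le> \<Lambda> * norm h"
    if "0 < d" "d \<le> R" "x \<in> ?N (6 * R)" "norm h \<le> R" for d x h
  proof -
    have "\<bar>A \<rho> d u0 (x + h) - A \<rho> d u0 x\<bar> \<le> \<Lambda>' * norm h" using F\<Lambda> that by blast
    also have "\<dots> \<le> \<Lambda> * norm h" by (intro mult_right_mono) (auto simp: \<Lambda>_def)
    finally show ?thesis .
  qed

  define d where "d n = R / real (Suc n)" for n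
  have d: "0 < d n" "d n \<le> R" for n using R by (auto simp: d_def divide_le_eq)
  have d0: "d \<longlonglongrightarrow> 0" unfolding d_def[abs_def] using lim_const_over_n[of R] LIMSEQ_Suc by fastforce
  define v where "v n = A \<rho> (d n) u0" for n
  have v: "smb (v n)" for n unfolding v_def by (rule smb_A[OF kern_\<rho> bbor_measurable[OF u0(1)] u0(2) d(1)])
  have vM: "\<bar>v n x\<bar> \<le> M" for n x
    unfolding v_def using mollified_bounded[OF u0(1,3)] d(1)[of n] by simp
  have vC: "uniformly_Cauchy_on (?N (6 * R)) v"
  proof -
    have "uniformly_Cauchy_on (?N (6 * R)) (\<lambda>n. A \<rho> (d n) u0)"
    proof (rule mollified_Cauchy[OF u0(1,2) d(1) d0 R(1)])
      fix n x y assume "x \<in> ?N (6 * R)" "y \<in> cball x R"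
      then have "y \<in> ?N (8 * R)" using nbd_cball[of x "closure V" "6 * R" R "8 * R"] R by auto
      then show "\<bar>lap (A \<rho> (d n) u0) y\<bar> \<le> F" using F\<Lambda> d by blast
    qed
    then show ?thesis by (simp add: v_def[abs_def])
  qed
  define w where "w x = lim (\<lambda>n. v n x)" for x
  have wl: "uniform_limit (?N (6 * R)) v w sequentially"
    using uniformly_Cauchy_uniform_limit[OF vC] by (simp add: w_def[abs_def])
  note wlim = tendsto_uniform_limitI[OF wl]
  have wM: "\<bar>w x\<bar> \<le> M" if "x \<in> ?N (6 * R)" for x
  proof (rule LIMSEQ_le_const2)
    show "(\<lambda>n. \<bar>v n x\<bar>) \<longlonglongrightarrow> \<bar>w x\<bar>" by (intro tendsto_intros wlim that)
  qed (use vM in blast)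
  have wL: "\<bar>w (x + h) - w x\<bar> \<le> \<Lambda> * norm h" if x: "x \<in> ?N (5 * R)" and h: "norm h \<le> R" for x h
  proof (rule LIMSEQ_le_const2)
    have "x \<in> ?N (6 * R)" "x + h \<in> ?N (6 * R)"
      using nbd_mono[of "5 * R" "6 * R"] nbd_add[OF x, of h "6 * R"] x h R by auto
    then show "(\<lambda>n. \<bar>v n (x + h) - v n x\<bar>) \<longlonglongrightarrow> \<bar>w (x + h) - w x\<bar>" by (intro tendsto_intros wlim)
    show "\<exists>N. \<forall>n\<ge>N. \<bar>v n (x + h) - v n x\<bar> \<le> \<Lambda> * norm h"
      using lip[OF d(1,2) \<open>x \<in> ?N (6 * R)\<close> h] unfolding v_def by blast
  qed
  have uw: "AE x in lebesgue. x \<in> ?N (5 * R) \<longrightarrow> u x = w x"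
  proof -
    \<comment> \<open>The fundamental lemma asks for an open set; this one lies between the
      neighbourhoods of radius \<open>5 * R\<close> and \<open>6 * R\<close>.\<close>
    define U where "U = (\<Union>y\<in>closure V. ball y (6 * R))"
    have "open U" by (auto simp: U_def)
    have "U \<subseteq> ?N (6 * R)"
    proof
      fix x assume "x \<in> U"
      then obtain y where "y \<in> closure V" "dist y x < 6 * R" by (auto simp: U_def)
      then show "x \<in> ?N (6 * R)" unfolding nbd_def by (intro CollectI bexI[of _ y] less_imp_le)
    qed
    then have "uniform_limit U (\<lambda>n. A \<rho> (d n) u0) w sequentially"
      using uniform_limit_on_subset[OF wl] by (simp add: v_def[abs_def])
    from mollified_limit_AE[OF u0(1,2) d(1) d0 \<open>open U\<close> this]
    have "AE x in lebesgue. x \<in> U \<longrightarrow> u0 x = w x" by (rule AE_completion)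
    with u0(4) show ?thesis
    proof eventually_elim
      case (elim x)
      have "x \<in> U" if x: "x \<in> ?N (5 * R)"
      proof -
        obtain y where "y \<in> closure V" "dist y x \<le> 5 * R" using x by (auto simp: nbd_def)
        moreover have "5 * R < 6 * R" using R by simp
        ultimately show ?thesis unfolding U_def by (auto intro!: bexI[of _ y])
      qed
      then show ?case using elim by simp
    qed
  qed

  let ?S = "?N (4 * R)"
  define ff where "ff y = f y (w y)" for y
  define aa where "aa y = a y * w y" for y
  have S5: "x \<in> ?N (5 * R)" and S6: "x \<in> ?N (6 * R)" and S10: "x \<in> ?N (10 * R)" if "x \<in> ?S" for x
    using that nbd_mono[of "4 * R" "5 * R" "closure V"] nbd_mono[of "4 * R" "6 * R" "closure V"]
      nbd_mono[of "4 * R" "10 * R" "closure V"] R by (simp_all add: subset_iff)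
  obtain Cf where Cf: "\<And>p q. p \<in> ?N (10 * R) \<times> {- M..M} \<Longrightarrow> q \<in> ?N (10 * R) \<times> {- M..M} \<Longrightarrow>
     \<bar>(case p of (x, t) \<Rightarrow> f x t) - (case q of (x, t) \<Rightarrow> f x t)\<bar> \<le> Cf * dist p q powr \<alpha>"
    using fh unfolding holder_on_def by blast
  obtain Ca where Ca: "\<And>x y. x \<in> ?N (10 * R) \<Longrightarrow> y \<in> ?N (10 * R) \<Longrightarrow> \<bar>a x - a y\<bar> \<le> Ca * dist x y powr \<alpha>"
    using ah unfolding holder_on_def by blast
  have wLd: "\<bar>w x - w y\<bar> \<le> \<Lambda> * dist x y" if "y \<in> ?S" "dist x y \<le> R" for x y
    using wL[OF S5[OF that(1)], of "x - y"] that(2) by (simp add: dist_norm)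
  \<comment> \<open>\<open>f\<close> is composed with the map from \<open>x\<close> to
    \<open>(x, w x)\<close>, which has Lipschitz constant \<open>1 + \<Lambda>\<close> at distances
    up to \<open>R\<close>.\<close>
  define Hf where "Hf = \<bar>Cf\<bar> * (1 + \<Lambda>) powr \<alpha>"
  have Hf: "\<bar>ff x - ff y\<bar> \<le> Hf * dist x y powr \<alpha>" if x: "x \<in> ?S" and y: "y \<in> ?S" and xy: "dist x y \<le> R" for x y
  proof -
    have p: "(z, w z) \<in> ?N (10 * R) \<times> {- M..M}" if "z \<in> ?S" for z
      using S10[OF that] wM[OF S6[OF that]] by (auto simp: abs_le_iff)
    have "dist (x, w x) (y, w y) \<le> dist x y + dist (w x) (w y)"
      unfolding dist_Pair_Pair by (rule sqrt_sum_squares_le_sum) auto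
    also have "\<dots> \<le> (1 + \<Lambda>) * dist x y" using wLd[OF y xy] by (simp add: dist_real_def distrib_right)
    finally have dd: "dist (x, w x) (y, w y) \<le> (1 + \<Lambda>) * dist x y" .
    have "\<bar>ff x - ff y\<bar> \<le> Cf * dist (x, w x) (y, w y) powr \<alpha>" using Cf[OF p[OF x] p[OF y]] by (simp add: ff_def)
    also have "\<dots> \<le> \<bar>Cf\<bar> * ((1 + \<Lambda>) * dist x y) powr \<alpha>" using dd \<alpha> by (intro mult_mono powr_mono2) auto
    also have "\<dots> = Hf * dist x y powr \<alpha>" using \<Lambda>0 by (simp add: Hf_def powr_mult)
    finally show ?thesis .
  qed
  \<comment> \<open>Product rule for increments: the bound of \<open>a\<close> with the Lipschitz
    constant of \<open>w\<close>, and the Hoelder constant of \<open>a\<close> with the bound of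
    \<open>w\<close>. Distances are at most 1, so the Lipschitz term is dominated by the power
    \<alpha>.\<close>
  define Ha where "Ha = Ba * \<Lambda> + \<bar>Ca\<bar> * M"
  have Ha: "\<bar>aa x - aa y\<bar> \<le> Ha * dist x y powr \<alpha>" if x: "x \<in> ?S" and y: "y \<in> ?S" and xy: "dist x y \<le> R" for x y
  proof -
    have "aa x - aa y = a x * (w x - w y) + (a x - a y) * w y" by (simp add: aa_def algebra_simps)
    then have "\<bar>aa x - aa y\<bar> \<le> \<bar>a x\<bar> * \<bar>w x - w y\<bar> + \<bar>a x - a y\<bar> * \<bar>w y\<bar>"
      by (simp add: abs_mult[symmetric] abs_triangle_ineq)
    also have "\<dots> \<le> Ba * (\<Lambda> * dist x y powr \<alpha>) + \<bar>Ca\<bar> * dist x y powr \<alpha> * M"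
    proof (intro add_mono mult_mono)
      show "\<bar>a x\<bar> \<le> Ba" using Ba(2)[OF S10[OF x]] .
      have "dist x y \<le> dist x y powr \<alpha>"
        using powr_mono'[of \<alpha> 1 "dist x y"] \<alpha> xy R by (cases "x = y") auto
      then show "\<bar>w x - w y\<bar> \<le> \<Lambda> * dist x y powr \<alpha>" using wLd[OF y xy] \<Lambda>0 by (meson mult_left_mono order_trans)
      have "\<bar>a x - a y\<bar> \<le> Ca * dist x y powr \<alpha>" using Ca[OF S10[OF x] S10[OF y]] .
      also have "\<dots> \<le> \<bar>Ca\<bar> * dist x y powr \<alpha>" by (intro mult_right_mono) auto
      finally show "\<bar>a x - a y\<bar> \<le> \<bar>Ca\<bar> * dist x y powr \<alpha>" .
      show "\<bar>w y\<bar> \<le> M" using wM[OF S6[OF y]] .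
    qed (use Ba in auto)
    also have "\<dots> = Ha * dist x y powr \<alpha>" by (simp add: Ha_def algebra_simps)
    finally show ?thesis .
  qed
  have Scl: "?S \<in> sets borel" using Ncpt by (simp add: compact_imp_closed borel_closed)
  \<comment> \<open>Cutting off to the compact set \<open>?S\<close> makes a function controlled
    only there Borel and bounded on the whole space. Averages at points whose ball lies in
    \<open>?S\<close> do not see the cut.\<close>
  have loc: "bbor (\<lambda>y. indicator ?S y * g y)"
    if g: "\<And>x y. x \<in> ?S \<Longrightarrow> y \<in> ?S \<Longrightarrow> dist x y \<le> R \<Longrightarrow> \<bar>g x - g y\<bar> \<le> H * dist x y powr \<alpha>" and B: "0 \<le> B" "\<And>x. x \<in> ?S \<Longrightarrow> \<bar>g x\<bar> \<le> B"
    for g :: "'a \<Rightarrow> real" and H B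
  proof (rule bborI[of _ B])
    show "(\<lambda>y. indicator ?S y * g y) \<in> borel_measurable borel"
      using borel_measurable_continuous_on_indicator[OF Scl local_holder_continuous[OF \<alpha>(1) R(1) g]] by simp
  qed (use B in \<open>auto simp: indicator_def\<close>)
  define f1 where "f1 y = indicator ?S y * ff y" for y
  define a1 where "a1 y = indicator ?S y * aa y" for y
  have f1: "bbor f1" unfolding f1_def[abs_def]
    by (rule loc[OF Hf Bf(1)]) (use Bf(2) S10 wM S6 in \<open>auto simp: ff_def\<close>)
  have a1: "bbor a1" unfolding a1_def[abs_def]
  proof (rule loc[OF Ha])
    show "0 \<le> Ba * M" using Ba M by simp
    show "\<bar>aa x\<bar> \<le> Ba * M" if "x \<in> ?S" for x
      unfolding aa_def abs_mult using Ba S10[OF that] wM[OF S6[OF that]] by (intro mult_mono) auto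
  qed
  define g1 where "g1 y = f1 y - a1 y" for y
  have g1: "bbor g1" unfolding g1_def[abs_def] by (rule bbor_diff[OF f1 a1])
  define Hg where "Hg = Hf + Ha"
  have Hg: "\<bar>g1 x - g1 y\<bar> \<le> Hg * dist x y powr \<alpha>" if "x \<in> ?S" "y \<in> ?S" "dist x y \<le> R" for x y
    using Hf[OF that] Ha[OF that] that by (simp add: g1_def f1_def a1_def Hg_def distrib_right)

  have GA: "G e x = A \<rho> e g1 x" if e: "0 < e" "e \<le> R" and x: "x \<in> ?N (3 * R)" for e x
  proof -
    have sub: "cball x e \<subseteq> ?S" using nbd_cball[OF x, of e "4 * R"] e by simp
    have S\<Omega>: "?S \<subseteq> \<Omega>" using N10 S10 by blast
    define \<phi> where "\<phi> y = scl e \<rho> (x - y)" for y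
    have \<phi>: "\<phi> \<in> test_functions \<Omega>"
      unfolding \<phi>_def[abs_def] using sub S\<Omega> by (intro scl_test(1) kern_\<rho> e) auto
    have "(LINT y:\<Omega>|lebesgue. f y (u y) * scl e \<rho> (x - y)) = A \<rho> e f1 x"
    proof (rule average_eq_A[OF e(1) sub S\<Omega> bbor_measurable[OF f1]])
      \<comment> \<open>The measurability asked by \<open>average_eq_A\<close> is taken from the
        integrability clause of \<open>weak_solution\<close>.\<close>
      have "set_integrable lebesgue \<Omega> (\<lambda>y. f y (u y) * \<phi> y)"
        using assms(12) test_in_X_space[OF \<phi>] unfolding weak_solution_def by blast
      then show "(\<lambda>y. indicator \<Omega> y *\<^sub>R (f y (u y) * scl e \<rho> (x - y))) \<in> borel_measurable lebesgue"
        unfolding set_integrable_def \<phi>_def by (rule borel_measurable_integrable)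
      show "AE y in lebesgue. y \<in> ?S \<longrightarrow> f y (u y) = f1 y"
        using uw by eventually_elim (auto simp: f1_def ff_def dest: S5)
    qed
    moreover have "(LINT y:\<Omega>|lebesgue. a y * u y * scl e \<rho> (x - y)) = A \<rho> e a1 x"
    proof (rule average_eq_A[OF e(1) sub S\<Omega> bbor_measurable[OF a1]])
      have "(\<lambda>y. indicator \<Omega> y *\<^sub>R a y) \<in> borel_measurable lebesgue"
        using assms(9) by (simp add: Linfty_on_def set_borel_measurable_def)
      then have "(\<lambda>y. (indicator \<Omega> y *\<^sub>R a y) * u y * \<phi> y) \<in> borel_measurable lebesgue"
        by (intro borel_measurable_times um smb_leb_measurable[OF test_smb[OF \<phi>]])
      then show "(\<lambda>y. indicator \<Omega> y *\<^sub>R (a y * u y * scl e \<rho> (x - y))) \<in> borel_measurable lebesgue"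
        by (simp add: \<phi>_def mult.assoc)
      show "AE y in lebesgue. y \<in> ?S \<longrightarrow> a y * u y = a1 y"
        using uw by eventually_elim (auto simp: a1_def aa_def dest: S5)
    qed
    ultimately show ?thesis
      unfolding G_def g1_def[abs_def] A_diff[OF kern_\<rho> f1 a1] by simp
  qed
  \<comment> \<open>Translation commutes with averaging, so the increment of \<open>G e\<close> is
    the average of an increment of \<open>g1\<close> taken inside \<open>?S\<close>; as
    \<open>\<rho>\<close> has mass 1, the constant is the same at all scales.\<close>
  have GH: "\<bar>G e (x + h) - G e x\<bar> \<le> Hg * norm h powr \<alpha>"
    if e: "0 < e" "e \<le> R" and x: "x \<in> ?N (2 * R)" and h: "norm h \<le> R" for e x h
  proof -
    have "x \<in> ?N (3 * R)" "x + h \<in> ?N (3 * R)"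
      using nbd_mono[of "2 * R" "3 * R"] nbd_add[OF x, of h "3 * R"] x h R by auto
    then have "G e (x + h) - G e x = A \<rho> e (\<lambda>y. g1 (y + h) - g1 y) x"
      using A_diff[OF kern_\<rho> bbor_shift[OF g1] g1] by (simp add: GA[OF e] A_shift_eq)
    also have "\<bar>\<dots>\<bar> \<le> kint (\<rho> :: 'a \<Rightarrow> real) * (Hg * norm h powr \<alpha>)"
    proof (rule A_bound[OF kern_\<rho> bbor_diff[OF bbor_shift[OF g1] g1]])
      fix y assume y: "y \<in> cball x e"
      have y3: "y \<in> ?N (3 * R)" using nbd_cball[OF x, of e "3 * R"] e y by auto
      then have "y \<in> ?S" "y + h \<in> ?S"
        using nbd_mono[of "3 * R" "4 * R"] nbd_add[OF y3, of h "4 * R"] h R by auto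
      then show "\<bar>g1 (y + h) - g1 y\<bar> \<le> Hg * norm h powr \<alpha>" using Hg[of "y + h" y] h by (simp add: dist_norm)
    qed (use e in simp)
    finally show ?thesis by (simp add: \<rho>_kint)
  qed

  obtain K where K: "0 \<le> K" "\<forall>(v :: 'a \<Rightarrow> real) G x0 R M \<Lambda> H h. smb v \<longrightarrow> 0 < R \<longrightarrow> R \<le> 1 \<longrightarrow> norm h \<le> 1 \<longrightarrow> (\<forall>x. \<bar>v x\<bar> \<le> M) \<longrightarrow>
     (\<forall>x\<in>ball x0 R. eqn_at s C v (G x) x \<and> eqn_at s C v (G (x + h)) (x + h)) \<longrightarrow>
     (\<forall>x\<in>ball x0 R. \<bar>v (x + h) - v x\<bar> \<le> \<Lambda> * norm h) \<longrightarrow>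
     (\<forall>x\<in>ball x0 R. \<bar>G (x + h) - G x\<bar> \<le> H * norm h powr \<alpha>) \<longrightarrow>
     \<bar>lap v (x0 + h) - lap v x0\<bar> \<le> K * (H + \<Lambda> + M) / R ^ 3 * norm h powr \<alpha>"
    using lap_holder[OF s C0 \<alpha>, where 'a='a] by blast
  \<comment> \<open>The absolute value provides the nonnegativity that
    \<open>limit_regularity\<close> asks for.\<close>
  define H where "H = \<bar>K * (Hg + \<Lambda> + M) / R ^ 3\<bar>"
  have lapH: "\<bar>lap (v n) (x + h) - lap (v n) x\<bar> \<le> H * norm h powr \<alpha>" if x: "x \<in> ?N R" and h: "norm h \<le> R" for n x h
  proof -
    have b2: "z \<in> ?N (2 * R)" if "z \<in> ball x R" for z using nbd_cball[OF x, of R "2 * R"] that by auto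
    have "eqn_at s C (v n) (G (d n) z) z \<and> eqn_at s C (v n) (G (d n) (z + h)) (z + h)" if "z \<in> ball x R" for z
    proof -
      have "z \<in> ?N (9 * R)" "z + h \<in> ?N (9 * R)"
        using b2[OF that] nbd_mono[of "2 * R" "9 * R"] nbd_add[OF b2[OF that], of h "9 * R"] h R by auto
      then show ?thesis unfolding v_def using eqn[OF d(1)] ball\<Omega>[OF d(2)] by blast
    qed
    moreover have "\<bar>v n (z + h) - v n z\<bar> \<le> \<Lambda> * norm h" if "z \<in> ball x R" for z
      using lip[OF d, of z h n] b2[OF that] nbd_mono[of "2 * R" "6 * R"] h R by (auto simp: v_def)
    moreover have "\<bar>G (d n) (z + h) - G (d n) z\<bar> \<le> Hg * norm h powr \<alpha>" if "z \<in> ball x R" for z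
      by (rule GH[OF d b2[OF that] h])
    ultimately have "\<bar>lap (v n) (x + h) - lap (v n) x\<bar> \<le> K * (Hg + \<Lambda> + M) / R ^ 3 * norm h powr \<alpha>"
      using K(2)[rule_format, OF v[of n] R(1,2) _ vM, of h x "G (d n)" \<Lambda> Hg] h R(2) by simp
    also have "\<dots> \<le> H * norm h powr \<alpha>" unfolding H_def by (intro mult_right_mono abs_ge_self) auto
    finally show ?thesis .
  qed
  have "holder_closure 2 \<alpha> V (\<lambda>x. lim (\<lambda>n. v n x))"
  proof (rule limit_regularity[OF \<alpha> R(1,2) v vM _ _ _ lapH])
    show "uniformly_Cauchy_on (?N (2 * R)) v"
      using vC nbd_mono[of "2 * R" "6 * R"] R by (auto intro: uniformly_Cauchy_on_subset)
    show "\<bar>lap (v n) x\<bar> \<le> F" if "x \<in> ?N (2 * R)" for n x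
      using F\<Lambda> d that nbd_mono[of "2 * R" "8 * R"] R by (force simp: v_def)
  qed (simp add: H_def)
  then have "holder_closure 2 \<alpha> V w" by (simp add: w_def[abs_def])
  moreover have "AE x in lebesgue. x \<in> closure V \<longrightarrow> u x = w x"
    using uw by eventually_elim (use subset_nbd[of "5 * R" "closure V"] R in auto)
  ultimately show ?thesis by blast
qed

end
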